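(* Let $N\in\mathbb N$ and $\gamma\in[-1,0)$. Then $\dot H^{1,1}(\mathbb R^N)\hookrightarrow\dot W^{1,1}(\gamma)$ and $\dot H^{1,1}(\mathbb R^N)\hookrightarrow\dot{BV}(\gamma)$; that is, $\dot H^{1,1}(\mathbb R^N)$ is contained in both spaces and there exists a positive constant $C$ such that, for any $u\in\dot H^{1,1}(\mathbb R^N)$, $$\|u\|_{\dot W^{1,1}(\gamma)}\le C\|u\|_{\dot H^{1,1}(\mathbb R^N)}\quad\text{and}\quad \|u\|_{\dot{BV}(\gamma)}\le C\|u\|_{\dot H^{1,1}(\mathbb R^N)}.$$ Here $\dot W^{1,1}(\gamma)=\dot W^{1,1}_N(\gamma)$ and $\dot{BV}(\gamma)=\dot{BV}_N(\gamma)$ are the spaces on $\mathbb R^N$ defined in the context.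
   Context: $\mathbb N=\{1,2,\ldots\}$. For $\gamma\in\mathbb R$, a measurable function $u$ on $\mathbb R^N$ and $\lambda\in(0,\infty)$, let $$E^{(N)}_{\lambda,\gamma}[u]:=\Big\{(x,y)\in\mathbb R^N\times\mathbb R^N: x\ne y,\ \frac{|u(x)-u(y)|}{|x-y|^{1+\gamma}}>\lambda\Big\},$$ for measurable $E\subset\mathbb R^N\times\mathbb R^N$ let $\nu_{N,\gamma}(E):=\iint_E|x-y|^{\gamma-N}\,dx\,dy$, and let $$[u]_{\dot W_{N,\gamma}}:=\sup_{\lambda\in(0,\infty)}\lambda\,\nu_{N,\gamma}(E^{(N)}_{\lambda,\gamma}[u]).$$ $\dot W^{1,1}(\mathbb R^N)$ is the set of all $u\in L^1_{\rm loc}(\mathbb R^N)$ with distributional gradient $\nabla u\in L^1(\mathbb R^N)$. $\dot{BV}(\mathbb R^N)$ is the set of all $u\in L^1_{\rm loc}(\mathbb R^N)$ whose distributional gradient is a bounded $\mathbb R^N$-valued Borel measure, with $\|\nabla u\|_{\mathcal M}:=|\nabla u|(\mathbb R^N)$. Set $$\dot W^{1,1}_N(\gamma):=\{u\in\dot W^{1,1}(\mathbb R^N):[u]_{\dot W_{N,\gamma}}<\infty\},\quad \|u\|_{\dot W^{1,1}_N(\gamma)}:=\|\nabla u\|_{L^1(\mathbb R^N)}+[u]_{\dot W_{N,\gamma}},$$ $$\dot{BV}_N(\gamma):=\{u\in\dot{BV}(\mathbb R^N):[u]_{\dot W_{N,\gamma}}<\infty\},\quad \|u\|_{\dot{BV}_N(\gamma)}:=\|\nabla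 u\|_{\mathcal M}+[u]_{\dot W_{N,\gamma}}.$$ Hardy space: fix $\varphi\in C_{\mathrm c}^\infty(\mathbb R^N)$ with $\int_{\mathbb R^N}\varphi=1$ and let $\varphi_t:=t^{-N}\varphi(\cdot/t)$. $H^1(\mathbb R^N)$ is the set of all $f\in\mathcal S'(\mathbb R^N)$ such that $\|f\|_{H^1(\mathbb R^N)}:=\big\|\sup_{t\in(0,\infty)}|f*\varphi_t|\big\|_{L^1(\mathbb R^N)}<\infty$. $\dot H^{1,1}(\mathbb R^N)$ is the set of all $u\in\mathcal S'(\mathbb R^N)$ with $\|u\|_{\dot H^{1,1}(\mathbb R^N)}:=\sum_{j=1}^N\|\partial_ju\|_{H^1(\mathbb R^N)}<\infty$ (distributional derivatives). *)

theory Defs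
  imports "HOL-Analysis.Analysis"
begin

text \<open>All function spaces are real-valued, as the gradient of a \<open>BV\<close> function is required to be
  an \<open>\<real>\<^sup>N\<close>-valued measure. The dimension \<open>N\<close> is \<^term>\<open>CARD('n)\<close>.\<close>

definition pdiff :: "'n::finite \<Rightarrow> (real^'n \<Rightarrow> real) \<Rightarrow> real^'n \<Rightarrow> real" where
  "pdiff j f x = frechet_derivative f (at x) (axis j 1)"

text \<open>Multi-indices are lists of coordinate directions, so that every partial derivative of
  order \<open>k\<close> is indexed by a list of length \<open>k\<close>.\<close>

definition pdiffs :: "'n::finite list \<Rightarrow> (real^'n \<Rightarrow> real) \<Rightarrow> real^'n \<Rightarrow> real" where
  "pdiffs js f = foldr pdiff js f"

definition smooth :: "(real^'n::finite \<Rightarrow> real) \<Rightarrow> bool" where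
  "smooth f \<longleftrightarrow> (\<forall>js. \<forall>x. pdiffs js f differentiable (at x))"

definition test_functions :: "(real^'n::finite \<Rightarrow> real) set" where
  "test_functions = {\<psi>. smooth \<psi> \<and> compact (closure {x. \<psi> x \<noteq> 0})}"

definition schwartz_functions :: "(real^'n::finite \<Rightarrow> real) set" where
  "schwartz_functions = {\<psi>. smooth \<psi> \<and>
     (\<forall>k js. bdd_above (range (\<lambda>x. (1 + norm x) ^ k * \<bar>pdiffs js \<psi> x\<bar>)))}"

definition schwartz_seminorm :: "nat \<Rightarrow> 'n::finite list \<Rightarrow> (real^'n \<Rightarrow> real) \<Rightarrow> real" where
  "schwartz_seminorm k js \<psi> = (SUP x. (1 + norm x) ^ k * \<bar>pdiffs js \<psi> x\<bar>)"

definition schwartz_topology :: "(real^'n::finite \<Rightarrow> real) topology" where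
  "schwartz_topology = topology_generated_by
     {{\<psi> \<in> schwartz_functions. schwartz_seminorm k js (\<lambda>x. \<psi> x - \<psi>\<^sub>0 x) < e} | k js \<psi>\<^sub>0 e.
        \<psi>\<^sub>0 \<in> schwartz_functions \<and> e > 0}"

text \<open>A tempered distribution is represented by a function on all of \<open>\<real>\<^sup>N \<Rightarrow> \<real>\<close>, of which only the
  values on Schwartz functions are relevant.\<close>

definition tempered_distributions :: "((real^'n::finite \<Rightarrow> real) \<Rightarrow> real) set" where
  "tempered_distributions = {T.
     (\<forall>\<psi>\<in>schwartz_functions. \<forall>\<eta>\<in>schwartz_functions. \<forall>a b.
        T (\<lambda>x. a * \<psi> x + b * \<eta> x) = a * T \<psi> + b * T \<eta>) \<and>
     continuous_map schwartz_topology euclidean T}"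

definition distr_pdiff ::
    "'n::finite \<Rightarrow> ((real^'n \<Rightarrow> real) \<Rightarrow> real) \<Rightarrow> (real^'n \<Rightarrow> real) \<Rightarrow> real" where
  "distr_pdiff j T \<psi> = - T (pdiff j \<psi>)"

definition L1_loc :: "(real^'n::finite \<Rightarrow> real) set" where
  "L1_loc = {u. \<forall>K. compact K \<longrightarrow> set_integrable lebesgue K u}"

text \<open>The identification of a distribution with a locally integrable function.\<close>

definition distr_is_function ::
    "((real^'n::finite \<Rightarrow> real) \<Rightarrow> real) \<Rightarrow> (real^'n \<Rightarrow> real) \<Rightarrow> bool" where
  "distr_is_function T u \<longleftrightarrow> u \<in> L1_loc \<and>
     (\<forall>\<psi>\<in>test_functions. T \<psi> = integral\<^sup>L lebesgue (\<lambda>x. u x * \<psi> x))"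

definition dilate :: "(real^'n::finite \<Rightarrow> real) \<Rightarrow> real \<Rightarrow> real^'n \<Rightarrow> real" where
  "dilate \<phi> t x = \<phi> (x /\<^sub>R t) / t ^ CARD('n)"

definition distr_conv ::
    "((real^'n::finite \<Rightarrow> real) \<Rightarrow> real) \<Rightarrow> (real^'n \<Rightarrow> real) \<Rightarrow> real^'n \<Rightarrow> real" where
  "distr_conv T \<psi> x = T (\<lambda>y. \<psi> (x - y))"

definition H1_norm ::
    "(real^'n::finite \<Rightarrow> real) \<Rightarrow> ((real^'n \<Rightarrow> real) \<Rightarrow> real) \<Rightarrow> ennreal" where
  "H1_norm \<phi> T =
     (\<integral>\<^sup>+x. (SUP t\<in>{0<..}. ennreal \<bar>distr_conv T (dilate \<phi> t) x\<bar>) \<partial>lebesgue)"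

definition H11_norm ::
    "(real^'n::finite \<Rightarrow> real) \<Rightarrow> ((real^'n \<Rightarrow> real) \<Rightarrow> real) \<Rightarrow> ennreal" where
  "H11_norm \<phi> T = (\<Sum>j\<in>UNIV. H1_norm \<phi> (distr_pdiff j T))"

definition H11 :: "(real^'n::finite \<Rightarrow> real) \<Rightarrow> ((real^'n \<Rightarrow> real) \<Rightarrow> real) set" where
  "H11 \<phi> = {T \<in> tempered_distributions. H11_norm \<phi> T < \<infinity>}"

definition E_set ::
    "real \<Rightarrow> real \<Rightarrow> (real^'n::finite \<Rightarrow> real) \<Rightarrow> ((real^'n) \<times> (real^'n)) set" where
  "E_set l \<gamma> u = {(x, y). x \<noteq> y \<and> \<bar>u x - u y\<bar> / norm (x - y) powr (1 + \<gamma>) > l}"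

definition nu :: "real \<Rightarrow> ((real^'n::finite) \<times> (real^'n)) set \<Rightarrow> ennreal" where
  "nu \<gamma> E = (\<integral>\<^sup>+p\<in>E. ennreal (norm (fst p - snd p) powr (\<gamma> - real CARD('n))) \<partial>lebesgue)"

definition weak_seminorm :: "real \<Rightarrow> (real^'n::finite \<Rightarrow> real) \<Rightarrow> ennreal" where
  "weak_seminorm \<gamma> u = (SUP l\<in>{0<..}. ennreal l * nu \<gamma> (E_set l \<gamma> u))"

definition has_L1_gradient :: "(real^'n::finite \<Rightarrow> real) \<Rightarrow> (real^'n \<Rightarrow> real^'n) \<Rightarrow> bool" where
  "has_L1_gradient u G \<longleftrightarrow> integrable lebesgue G \<and>
     (\<forall>\<psi>\<in>test_functions. \<forall>j.
        integral\<^sup>L lebesgue (\<lambda>x. u x * pdiff j \<psi> x) = - integral\<^sup>L lebesgue (\<lambda>x. G x $ j * \<psi> x))"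

definition W11 :: "(real^'n::finite \<Rightarrow> real) set" where
  "W11 = {u \<in> L1_loc. \<exists>G. has_L1_gradient u G}"

text \<open>The gradient is unique up to null sets, so its \<open>L\<^sup>1\<close> norm does not depend on the choice.\<close>

definition grad_L1_norm :: "(real^'n::finite \<Rightarrow> real) \<Rightarrow> ennreal" where
  "grad_L1_norm u = (\<integral>\<^sup>+x. ennreal (norm ((SOME G. has_L1_gradient u G) x)) \<partial>lebesgue)"

definition W11_gamma :: "real \<Rightarrow> (real^'n::finite \<Rightarrow> real) set" where
  "W11_gamma \<gamma> = {u \<in> W11. weak_seminorm \<gamma> u < \<infinity>}"

definition W11_gamma_norm :: "real \<Rightarrow> (real^'n::finite \<Rightarrow> real) \<Rightarrow> ennreal" where
  "W11_gamma_norm \<gamma> u = grad_L1_norm u + weak_seminorm \<gamma> u"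

definition vector_borel_measure :: "((real^'n::finite) set \<Rightarrow> real^'n) \<Rightarrow> bool" where
  "vector_borel_measure \<mu> \<longleftrightarrow>
     (\<forall>A. range A \<subseteq> sets borel \<longrightarrow> disjoint_family A \<longrightarrow>
        (\<lambda>i::nat. \<mu> (A i)) sums \<mu> (\<Union>i. A i))"

definition total_variation ::
    "((real^'n::finite) set \<Rightarrow> real^'n) \<Rightarrow> (real^'n) set \<Rightarrow> ennreal" where
  "total_variation \<mu> S =
     (SUP A\<in>{A :: nat \<Rightarrow> (real^'n) set. range A \<subseteq> sets borel \<and> disjoint_family A \<and> (\<Union>i. A i) = S}.
        \<Sum>i. ennreal (norm (\<mu> (A i))))"

text \<open>The Jordan decomposition of a real (signed) Borel measure \<open>\<nu>\<close>: its positive part is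
  \<open>S \<mapsto> sup {\<nu> B | B \<subseteq> S Borel}\<close>, and its negative part is the positive part of \<open>-\<nu>\<close>. The
  supremum ranges over \<open>B = {}\<close> as well, so truncating negative values by \<^const>\<open>ennreal\<close> is
  harmless.\<close>

definition pos_part_measure :: "((real^'n::finite) set \<Rightarrow> real) \<Rightarrow> (real^'n) measure" where
  "pos_part_measure \<nu> =
     measure_of UNIV (sets borel) (\<lambda>S. SUP B\<in>{B \<in> sets borel. B \<subseteq> S}. ennreal (\<nu> B))"

definition signed_integral ::
    "((real^'n::finite) set \<Rightarrow> real) \<Rightarrow> (real^'n \<Rightarrow> real) \<Rightarrow> real" where
  "signed_integral \<nu> f =
     integral\<^sup>L (pos_part_measure \<nu>) f - integral\<^sup>L (pos_part_measure (\<lambda>S. - \<nu> S)) f"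

definition has_measure_gradient ::
    "(real^'n::finite \<Rightarrow> real) \<Rightarrow> ((real^'n) set \<Rightarrow> real^'n) \<Rightarrow> bool" where
  "has_measure_gradient u \<mu> \<longleftrightarrow>
     vector_borel_measure \<mu> \<and> total_variation \<mu> UNIV < \<infinity> \<and>
     (\<forall>\<psi>\<in>test_functions. \<forall>j.
        integral\<^sup>L lebesgue (\<lambda>x. u x * pdiff j \<psi> x) = - signed_integral (\<lambda>S. \<mu> S $ j) \<psi>)"

definition BV :: "(real^'n::finite \<Rightarrow> real) set" where
  "BV = {u \<in> L1_loc. \<exists>\<mu>. has_measure_gradient u \<mu>}"

text \<open>The gradient measure is unique on Borel sets, so its total variation does not depend on
  the choice.\<close>

definition grad_M_norm :: "(real^'n::finite \<Rightarrow> real) \<Rightarrow> ennreal" where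
  "grad_M_norm u = total_variation (SOME \<mu>. has_measure_gradient u \<mu>) UNIV"

definition BV_gamma :: "real \<Rightarrow> (real^'n::finite \<Rightarrow> real) set" where
  "BV_gamma \<gamma> = {u \<in> BV. weak_seminorm \<gamma> u < \<infinity>}"

definition BV_gamma_norm :: "real \<Rightarrow> (real^'n::finite \<Rightarrow> real) \<Rightarrow> ennreal" where
  "BV_gamma_norm \<gamma> u = grad_M_norm u + weak_seminorm \<gamma> u"

end

theory Submission
  imports Defs
begin

text \<open>
  Everything is deduced from the pointwise estimate \<open>\<bar>u x - u y\<bar> \<le> \<bar>x - y\<bar> (G x + G y)\<close> with an integrable \<open>G\<close>.
  It gives the weak-type bound at once: on \<open>E\<close> one of \<open>G x\<close>, \<open>G y\<close> exceeds a multiple of \<open>\<lambda> \<bar>x - y\<bar>\<^sup>\<gamma>\<close>, and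
  integrating \<open>\<bar>x - y\<bar>\<^sup>\<gamma>\<^sup>-\<^sup>N\<close> over the set of all \<open>y\<close> with \<open>\<bar>x - y\<bar>\<^sup>\<gamma> < s\<close> yields a multiple of \<open>s\<close>, because \<open>\<gamma> < 0\<close>.

  To construct \<open>G\<close> from the radial maximal functions of \<open>\<partial>\<^sub>j u\<close>, let \<open>A\<^sub>i\<close> be convolution with \<open>\<phi>\<close> dilated by
  \<open>2\<^sup>-\<^sup>i\<close>. Telescoping the products \<open>(I - A\<^sub>0) \<dots> (I - A\<^sub>i)\<close> writes every test function \<open>\<Phi>\<close> as \<open>\<Sum> A\<^sub>i \<eta>\<^sub>i\<close>
  with \<open>\<eta>\<^sub>i\<close> supported in a fixed ball and decaying like \<open>2\<^sup>-\<^sup>L\<^sup>i\<close> for any \<open>L\<close>; no Fourier transform is needed. Hence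
  \<open>f * \<Phi>\<^sub>t\<close> is controlled by the radial means \<open>f * \<phi>\<^sub>s\<close> with \<open>s \<le> t\<close>. The tangential maximal function of \<open>f\<close> is then
  dominated by the square of the Hardy--Littlewood maximal function of \<open>sup\<^sub>s \<bar>f * \<phi>\<^sub>s\<bar>\<^sup>1\<^sup>/\<^sup>2\<close>, which is
  integrable by the \<open>L\<^sup>2\<close> maximal inequality. With \<open>f = \<partial>\<^sub>j u\<close> this bounds the oscillation of \<open>u * \<phi>\<^sub>t\<close> at scale \<open>t\<close>.

  The functions \<open>\<partial>\<^sub>j u * \<phi>\<^sub>t\<close> are dominated by one integrable function, so by Radon--Nikodym their distributional
  limit \<open>\<partial>\<^sub>j u\<close> is an integrable function.
\<close>

section \<open>Calculus of iterated partial derivatives\<close>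

text \<open>The obstacle: membership in \<open>H11\<close> controls the regularisations of
  \<open>f = \<partial>\<^sub>j u\<close> over a point \<open>x\<close> by a function of that same
  \<open>x\<close>, and says nothing about the size of \<open>u\<close>, whereas the pointwise
  estimate compares \<open>u\<close> at two points. The reproducing formula passes from values over
  nearby points to values over \<open>x\<close>, at the price of powers of \<open>2\<^sup>i\<close>,
  which the free decay exponent \<open>L\<close> pays. That the size of \<open>u\<close> never
  enters is possible because the step from scale \<open>t\<close> to \<open>t/2\<close> is
  convolution with a kernel of integral zero: constants may be subtracted, and only the gradient of
  \<open>u * \<phi>\<^sub>t\<close> remains. The statement speaks about every function representing
  the distribution, and the gradient norms are defined by choosing some gradient. Uniqueness is
  therefore needed three times: for the representing function up to a null set, for the integrable
  gradient, and for the gradient measure on Borel sets. The last goes through the Jordan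
  decomposition, by which integrals against a signed measure are defined.\<close>

lemma pdiff_eqI:
  fixes f :: "real^'n::finite \<Rightarrow> real"
  assumes "(f has_derivative f') (at x)"
  shows "pdiff j f x = f' (axis j 1)"
  unfolding pdiff_def using frechet_derivative_at[OF assms] by simp

lemma has_derivative_pdiff:
  fixes f :: "real^'n::finite \<Rightarrow> real"
  assumes "f differentiable (at x)"
  shows "(f has_derivative (\<lambda>v. \<Sum>j\<in>UNIV. v $ j * pdiff j f x)) (at x)"
proof -
  let ?D = "frechet_derivative f (at x)"
  have D: "(f has_derivative ?D) (at x)"
    using assms frechet_derivative_works by blast
  then have lin: "linear ?D"
    by (rule has_derivative_linear)
  have "?D v = (\<Sum>j\<in>UNIV. v $ j * pdiff j f x)" for v
  proof -
    have "?D v = ?D (\<Sum>j\<in>UNIV. v $ j *\<^sub>R axis j 1)"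
      using basis_expansion[of v] by (simp add: scalar_mult_eq_scaleR)
    also have "\<dots> = (\<Sum>j\<in>UNIV. v $ j * pdiff j f x)"
      by (simp add: linear_sum[OF lin] linear_cmul[OF lin] pdiff_def)
    finally show ?thesis .
  qed
  then have "?D = (\<lambda>v. \<Sum>j\<in>UNIV. v $ j * pdiff j f x)" by blast
  with D show ?thesis by simp
qed

lemma pdiffs_Nil [simp]: "pdiffs [] f = f"
  by (simp add: pdiffs_def)

lemma pdiffs_Cons [simp]: "pdiffs (j # js) f = pdiff j (pdiffs js f)"
  by (simp add: pdiffs_def)

lemma pdiffs_append: "pdiffs (is @ js) f = pdiffs is (pdiffs js f)"
  by (simp add: pdiffs_def)

lemma smoothD: "smooth f \<Longrightarrow> pdiffs js f differentiable (at x)"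
  by (simp add: smooth_def)

lemma smooth_differentiable: "smooth f \<Longrightarrow> f differentiable (at x)"
  using smoothD[of f "[]"] by simp

lemma smooth_pdiffs: "smooth f \<Longrightarrow> smooth (pdiffs js f)"
  by (simp add: smooth_def flip: pdiffs_append)

lemma smooth_pdiff: "smooth f \<Longrightarrow> smooth (pdiff j f)"
  using smooth_pdiffs[of f "[j]"] by simp

lemma smooth_continuous: "smooth f \<Longrightarrow> continuous_on S f"
  by (simp add: continuous_at_imp_continuous_on differentiable_imp_continuous_within smooth_differentiable)

lemma pdiff_lincomb:
  assumes "f differentiable (at x)" "g differentiable (at x)"
  shows "pdiff j (\<lambda>x. a * f x + b * g x) x = a * pdiff j f x + b * pdiff j g x"
proof -
  have "((\<lambda>x. a * f x + b * g x) has_derivative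
     (\<lambda>v. a * frechet_derivative f (at x) v + b * frechet_derivative g (at x) v)) (at x)"
    using assms unfolding frechet_derivative_works by (auto intro!: derivative_eq_intros)
  then show ?thesis by (simp add: pdiff_eqI) (simp add: pdiff_def)
qed

lemma pdiffs_lincomb:
  assumes "smooth f" "smooth g"
  shows "pdiffs js (\<lambda>x. a * f x + b * g x) = (\<lambda>x. a * pdiffs js f x + b * pdiffs js g x)"
proof (induction js)
  case (Cons j js)
  show ?case unfolding pdiffs_Cons Cons using assms by (auto simp: pdiff_lincomb smoothD)
qed simp

lemma smooth_lincomb:
  assumes "smooth f" "smooth g"
  shows "smooth (\<lambda>x. a * f x + b * g x)"
  using assms unfolding smooth_def pdiffs_lincomb[OF assms] by (intro allI) (auto intro!: derivative_intros)

text \<open>Translations, dilations and the reflection \<open>y \<mapsto> x - y\<close> are all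
  substitutions of this form, so one chain rule serves them all.\<close>

lemma pdiff_affine:
  fixes f :: "real^'n::finite \<Rightarrow> real"
  assumes "f differentiable (at (a + s *\<^sub>R x))"
  shows "(\<lambda>y. c * f (a + s *\<^sub>R y)) differentiable (at x)"
    and "pdiff j (\<lambda>y. c * f (a + s *\<^sub>R y)) x = c * s * pdiff j f (a + s *\<^sub>R x)"
proof -
  let ?D = "frechet_derivative f (at (a + s *\<^sub>R x))"
  have D: "(f has_derivative ?D) (at (a + s *\<^sub>R x))"
    using assms frechet_derivative_works by blast
  have A: "((\<lambda>y. a + s *\<^sub>R y) has_derivative (\<lambda>v. s *\<^sub>R v)) (at x)"
    by (auto intro!: derivative_eq_intros)
  have *: "((\<lambda>y. c * f (a + s *\<^sub>R y)) has_derivative (\<lambda>v. c * ?D (s *\<^sub>R v))) (at x)"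
    using has_derivative_compose[OF A D] by (auto intro!: derivative_eq_intros)
  show "(\<lambda>y. c * f (a + s *\<^sub>R y)) differentiable (at x)"
    using * differentiable_def by blast
  have "?D (s *\<^sub>R v) = s * ?D v" for v
    using linear_cmul[OF has_derivative_linear[OF D]] by simp
  then show "pdiff j (\<lambda>y. c * f (a + s *\<^sub>R y)) x = c * s * pdiff j f (a + s *\<^sub>R x)"
    unfolding pdiff_eqI[OF *] by (simp add: pdiff_def)
qed

lemma pdiffs_affine:
  fixes f :: "real^'n::finite \<Rightarrow> real"
  assumes "smooth f"
  shows "pdiffs js (\<lambda>y. c * f (a + s *\<^sub>R y)) = (\<lambda>y. c * s ^ length js * pdiffs js f (a + s *\<^sub>R y))"
proof (induction js)
  case (Cons j js)
  then show ?case
    using pdiff_affine(2)[OF smoothD[OF assms], where c = "c * s ^ length js" and j = j, of js]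
    unfolding pdiffs_Cons Cons by (simp add: fun_eq_iff mult_ac)
qed simp

lemma smooth_affine:
  assumes "smooth f"
  shows "smooth (\<lambda>y. c * f (a + s *\<^sub>R y))"
  unfolding smooth_def pdiffs_affine[OF assms]
  using pdiff_affine(1)[OF smoothD[OF assms]] by blast

lemma smooth_reflect: "smooth f \<Longrightarrow> smooth (\<lambda>y. f (x - y))"
  using smooth_affine[of f 1 x "-1"] by simp

lemma pdiffs_reflect: "smooth f \<Longrightarrow> pdiffs js (\<lambda>y. f (x - y)) = (\<lambda>y. (-1) ^ length js * pdiffs js f (x - y))"
  using pdiffs_affine[of f js 1 x "-1"] by simp

text \<open>Smoothness and the derivative formula are proved in one induction, because the two-term
  rule used in the insertion step presupposes that the partial sum is already smooth.\<close>

lemma smooth_sum: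
  fixes f :: "'i \<Rightarrow> real^'n::finite \<Rightarrow> real"
  assumes "finite I" "\<And>i. i \<in> I \<Longrightarrow> smooth (f i)"
  shows "smooth (\<lambda>x. \<Sum>i\<in>I. c i * f i x) \<and>
    pdiffs js (\<lambda>x. \<Sum>i\<in>I. c i * f i x) = (\<lambda>x. \<Sum>i\<in>I. c i * pdiffs js (f i) x)"
  using assms
proof (induction I arbitrary: js)
  case empty
  have *: "pdiffs js (\<lambda>x. 0) = (\<lambda>x. 0)" for js :: "'n list"
    by (induction js) (auto simp: pdiff_def)
  show ?case by (simp add: * smooth_def)
next
  case (insert i I)
  then have s: "smooth (f i)" "smooth (\<lambda>x. \<Sum>i\<in>I. c i * f i x)" by simp_all
  from insert show ?case
    using smooth_lincomb[OF s, of "c i" 1] pdiffs_lincomb[OF s, of js "c i" 1] by simp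
qed

section \<open>Mean value theorems: symmetry of mixed derivatives and a second-order Taylor
  bound\<close>

lemma pdiff_directional:
  fixes f :: "real^'n::finite \<Rightarrow> real"
  assumes "f differentiable (at (x + s *\<^sub>R axis j 1))"
  shows "((\<lambda>s. f (x + s *\<^sub>R axis j 1)) has_real_derivative pdiff j f (x + s *\<^sub>R axis j 1)) (at s)"
proof -
  let ?D = "frechet_derivative f (at (x + s *\<^sub>R axis j 1))"
  have D: "(f has_derivative ?D) (at (x + s *\<^sub>R axis j 1))"
    using assms frechet_derivative_works by blast
  have A: "((\<lambda>s. x + s *\<^sub>R axis j 1) has_derivative (\<lambda>h. h *\<^sub>R axis j 1)) (at s)"
    by (auto intro!: derivative_eq_intros)
  have "((\<lambda>s. f (x + s *\<^sub>R axis j 1)) has_derivative (\<lambda>h. ?D (h *\<^sub>R axis j 1))) (at s)"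
    using has_derivative_compose[OF A D] by simp
  moreover have "?D (h *\<^sub>R axis j 1) = pdiff j f (x + s *\<^sub>R axis j 1) * h" for h
    using linear_cmul[OF has_derivative_linear[OF D]] by (simp add: pdiff_def)
  ultimately show ?thesis by (simp add: has_field_derivative_def)
qed

text \<open>The second difference is the increment over \<open>[0, h]\<close> of a first difference.
  The mean value theorem along \<open>i\<close> and then once more along \<open>j\<close> makes it a
  single mixed derivative at an intermediate point; the order of the two applications fixes the
  order of differentiation.\<close>

lemma second_difference_mean_value:
  fixes f :: "real^'n::finite \<Rightarrow> real"
  assumes "smooth f" "0 < h"
  shows "\<exists>s t. 0 < s \<and> s < h \<and> 0 < t \<and> t < h \<and>
     f (x + h *\<^sub>R axis i 1 + h *\<^sub>R axis j 1) - f (x + h *\<^sub>R axis i 1) - f (x + h *\<^sub>R axis j 1) + f x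
      = h * h * pdiff j (pdiff i f) (x + s *\<^sub>R axis i 1 + t *\<^sub>R axis j 1)"
proof -
  let ?g = "\<lambda>s. f ((x + h *\<^sub>R axis j 1) + s *\<^sub>R axis i 1) - f (x + s *\<^sub>R axis i 1)"
  have "\<exists>s. 0 < s \<and> s < h \<and> ?g h - ?g 0 = (h - 0) * (pdiff i f ((x + h *\<^sub>R axis j 1) + s *\<^sub>R axis i 1) - pdiff i f (x + s *\<^sub>R axis i 1))"
    by (intro MVT2 \<open>0 < h\<close> DERIV_diff pdiff_directional smooth_differentiable assms)
  then obtain s where s: "0 < s" "s < h" "?g h - ?g 0 = h * (pdiff i f ((x + h *\<^sub>R axis j 1) + s *\<^sub>R axis i 1) - pdiff i f (x + s *\<^sub>R axis i 1))"
    by auto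
  let ?k = "\<lambda>t. pdiff i f ((x + s *\<^sub>R axis i 1) + t *\<^sub>R axis j 1)"
  have "\<exists>t. 0 < t \<and> t < h \<and> ?k h - ?k 0 = (h - 0) * pdiff j (pdiff i f) ((x + s *\<^sub>R axis i 1) + t *\<^sub>R axis j 1)"
    by (intro MVT2 \<open>0 < h\<close> pdiff_directional smooth_differentiable smooth_pdiff assms)
  then obtain t where t: "0 < t" "t < h" "?k h - ?k 0 = h * pdiff j (pdiff i f) ((x + s *\<^sub>R axis i 1) + t *\<^sub>R axis j 1)"
    by auto
  have "?g h - ?g 0 = h * (?k h - ?k 0)"
    using s(3) by (simp add: algebra_simps)
  then show ?thesis
    using s t by (intro exI[of _ s] exI[of _ t]) (simp add: algebra_simps)
qed

text \<open>The second difference is symmetric in \<open>i\<close> and \<open>j\<close>, so both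
  orders of applying the mean value theorem represent the same number. Dividing by
  \<open>h n * h n\<close> and letting \<open>h n\<close> tend to \<open>0\<close> gives the two
  mixed derivatives by continuity.\<close>

lemma pdiff_commute:
  fixes f :: "real^'n::finite \<Rightarrow> real"
  assumes "smooth f"
  shows "pdiff i (pdiff j f) = pdiff j (pdiff i f)"
proof
  fix x
  define h :: "nat \<Rightarrow> real" where "h n = 1 / (Suc n)" for n
  have h: "h n > 0" for n by (simp add: h_def)
  have h0: "h \<longlonglongrightarrow> 0"
    unfolding h_def using LIMSEQ_inverse_real_of_nat by (simp add: inverse_eq_divide)
  have lim: "\<exists>X. (X \<longlonglongrightarrow> pdiff j (pdiff i f) x) \<and> (\<forall>n.
     f (x + h n *\<^sub>R axis i 1 + h n *\<^sub>R axis j 1) - f (x + h n *\<^sub>R axis i 1) - f (x + h n *\<^sub>R axis j 1) + f x = h n * h n * X n)" for i j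
  proof -
    let ?P = "\<lambda>n s t. 0 < s \<and> s < h n \<and> 0 < t \<and> t < h n \<and>
     f (x + h n *\<^sub>R axis i 1 + h n *\<^sub>R axis j 1) - f (x + h n *\<^sub>R axis i 1) - f (x + h n *\<^sub>R axis j 1) + f x
      = h n * h n * pdiff j (pdiff i f) (x + s *\<^sub>R axis i 1 + t *\<^sub>R axis j 1)"
    have "\<forall>n. \<exists>s t. ?P n s t"
      using second_difference_mean_value[OF assms h] by blast
    then obtain s where "\<forall>n. \<exists>t. ?P n (s n) t"
      by (rule choice[THEN exE])
    then obtain t where st: "\<And>n. ?P n (s n) (t n)"
      using choice[of "\<lambda>n t. ?P n (s n) t"] by blast
    have s0: "s \<longlonglongrightarrow> 0" and t0: "t \<longlonglongrightarrow> 0"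
      using st by (auto intro!: tendsto_sandwich[OF _ _ tendsto_const h0] eventuallyI less_imp_le)
    have "(\<lambda>n. x + s n *\<^sub>R axis i 1 + t n *\<^sub>R axis j 1) \<longlonglongrightarrow> x + 0 *\<^sub>R axis i 1 + 0 *\<^sub>R axis j 1"
      by (intro tendsto_intros s0 t0)
    then have "(\<lambda>n. x + s n *\<^sub>R axis i 1 + t n *\<^sub>R axis j 1) \<longlonglongrightarrow> x" by simp
    moreover have "isCont (pdiff j (pdiff i f)) x"
      using assms by (intro differentiable_imp_continuous_within smooth_differentiable smooth_pdiff)
    ultimately have "(\<lambda>n. pdiff j (pdiff i f) (x + s n *\<^sub>R axis i 1 + t n *\<^sub>R axis j 1)) \<longlonglongrightarrow> pdiff j (pdiff i f) x"
      using isCont_tendsto_compose by blast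
    then show ?thesis using st by blast
  qed
  define D where "D i j n = f (x + h n *\<^sub>R axis i 1 + h n *\<^sub>R axis j 1) - f (x + h n *\<^sub>R axis i 1) - f (x + h n *\<^sub>R axis j 1) + f x" for i j n
  obtain X where X: "X \<longlonglongrightarrow> pdiff j (pdiff i f) x" "\<And>n. D i j n = h n * h n * X n"
    using lim[of j i] unfolding D_def by blast
  obtain Y where Y: "Y \<longlonglongrightarrow> pdiff i (pdiff j f) x" "\<And>n. D j i n = h n * h n * Y n"
    using lim[of i j] unfolding D_def by blast
  have "D i j n = D j i n" for n
    by (simp add: D_def add_ac)
  then have "X n = Y n" for n
    using X(2)[of n] Y(2)[of n] h[of n] by simp
  then have "X = Y" by blast
  then show "pdiff i (pdiff j f) x = pdiff j (pdiff i f) x"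
    using X(1) Y(1) LIMSEQ_unique by blast
qed

lemma pdiffs_pdiff_commute:
  "smooth f \<Longrightarrow> pdiffs js (pdiff j f) = pdiff j (pdiffs js f)"
  by (induction js) (simp_all add: pdiff_commute smooth_pdiffs)

text \<open>The bound is stated for the \<open>l1\<close> norm of the gradient, the form in which
  the maximal function estimates deliver it.\<close>

lemma mean_value_pdiff:
  fixes f :: "real^'n::finite \<Rightarrow> real"
  assumes "convex S" "x \<in> S" "y \<in> S"
    and "\<And>z. z \<in> S \<Longrightarrow> f differentiable (at z)"
    and "\<And>z. z \<in> S \<Longrightarrow> (\<Sum>j\<in>UNIV. \<bar>pdiff j f z\<bar>) \<le> B"
  shows "\<bar>f x - f y\<bar> \<le> B * norm (x - y)"
proof -
  have "norm (f x - f y) \<le> B * norm (x - y)"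
  proof (rule differentiable_bound[OF assms(1)])
    fix z assume z: "z \<in> S"
    show "(f has_derivative (\<lambda>v. \<Sum>j\<in>UNIV. v $ j * pdiff j f z)) (at z within S)"
      using has_derivative_pdiff[OF assms(4)[OF z]] has_derivative_at_withinI by blast
    show "onorm (\<lambda>v. \<Sum>j\<in>UNIV. v $ j * pdiff j f z) \<le> B"
    proof (rule onorm_le)
      fix v :: "real^'n"
      have "norm (\<Sum>j\<in>UNIV. v $ j * pdiff j f z) \<le> (\<Sum>j\<in>UNIV. norm v * \<bar>pdiff j f z\<bar>)"
        by (intro sum_norm_le) (simp add: abs_mult component_le_norm_cart mult_right_mono)
      also have "\<dots> \<le> B * norm v"
        using mult_right_mono[OF assms(5)[OF z] norm_ge_zero[of v]] by (simp add: sum_distrib_left[symmetric] mult.commute)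
      finally show "norm (\<Sum>j\<in>UNIV. v $ j * pdiff j f z) \<le> B * norm v" .
    qed
  qed (use assms in auto)
  then show ?thesis by simp
qed

lemma sum_axis_mult: "(\<Sum>i\<in>UNIV. axis j (1::real) $ i * w i) = w (j::'n::finite)"
  by (simp add: axis_def if_distrib[of "\<lambda>c. c * _"] cong: if_cong)

text \<open>The gradient of the remainder \<open>r\<close> at \<open>w\<close> is the increment of
  the gradient of \<open>f\<close>, which is \<open>O(norm w)\<close> by the mean value theorem; a
  second application, to \<open>r\<close> on the ball of radius \<open>norm v\<close>, gives the
  square. Each application sums over \<open>CARD('n)\<close> coordinates, whence the factor.\<close>

lemma taylor_pdiff:
  fixes f :: "real^'n::finite \<Rightarrow> real"
  assumes f: "smooth f" and B: "\<And>i j z. \<bar>pdiff i (pdiff j f) z\<bar> \<le> B"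
  shows "\<bar>f (x + v) - f x - (\<Sum>j\<in>UNIV. v $ j * pdiff j f x)\<bar> \<le> real CARD('n) ^ 2 * B * (norm v)\<^sup>2"
proof -
  let ?N = "real CARD('n)"
  define r where "r w = f (x + w) - (\<Sum>j\<in>UNIV. w $ j * pdiff j f x)" for w
  have D: "(r has_derivative (\<lambda>v. \<Sum>j\<in>UNIV. v $ j * (pdiff j f (x + w) - pdiff j f x))) (at w)" for w
  proof -
    have 1: "((\<lambda>w. f (x + w)) has_derivative (\<lambda>v. \<Sum>j\<in>UNIV. v $ j * pdiff j f (x + w))) (at w)"
      by (rule has_derivative_compose[OF _ has_derivative_pdiff[OF smooth_differentiable[OF f]], of "\<lambda>w. x + w" "\<lambda>v. v" w UNIV])
        (auto intro!: derivative_eq_intros)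
    have 2: "((\<lambda>w. \<Sum>j\<in>UNIV. w $ j * pdiff j f x) has_derivative (\<lambda>v. \<Sum>j\<in>UNIV. v $ j * pdiff j f x)) (at w)"
      by (intro bounded_linear_imp_has_derivative bounded_linear_sum bounded_linear_mult_const bounded_linear_vec_nth)
    show ?thesis
      unfolding r_def using has_derivative_diff[OF 1 2]
      by (simp add: algebra_simps sum_subtractf)
  qed
  have L: "\<bar>pdiff j f (x + w) - pdiff j f x\<bar> \<le> ?N * B * norm w" for j w
  proof -
    have "\<bar>pdiff j f (x + w) - pdiff j f x\<bar> \<le> (\<Sum>i::'n\<in>UNIV. B) * norm ((x + w) - x)"
      by (intro mean_value_pdiff[of UNIV] sum_mono B) (auto intro: smooth_differentiable smooth_pdiff f)
    then show ?thesis by simp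
  qed
  have "\<bar>r v - r 0\<bar> \<le> (?N * (?N * B * norm v)) * norm (v - 0)"
  proof (rule mean_value_pdiff[of "cball 0 (norm v)"])
    fix z :: "real^'n" assume z: "z \<in> cball 0 (norm v)"
    show "r differentiable (at z)" using D differentiable_def by blast
    have pd: "pdiff j r z = pdiff j f (x + z) - pdiff j f x" for j
      unfolding pdiff_eqI[OF D] by (simp add: sum_axis_mult)
    have "0 \<le> B" using B[of undefined undefined undefined] by linarith
    then have "\<bar>pdiff j r z\<bar> \<le> ?N * B * norm v" for j
      unfolding pd using L[of j z] z by (meson dual_order.trans mem_cball_0 mult_left_mono mult_nonneg_nonneg of_nat_0_le_iff)
    then have "(\<Sum>j\<in>UNIV. \<bar>pdiff j r z\<bar>) \<le> (\<Sum>j::'n\<in>UNIV. ?N * B * norm v)"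
      by (intro sum_mono)
    then show "(\<Sum>j\<in>UNIV. \<bar>pdiff j r z\<bar>) \<le> ?N * (?N * B * norm v)" by simp
  qed auto
  then show ?thesis by (simp add: r_def power2_eq_square mult_ac)
qed

section \<open>Test functions\<close>

lemma test_functions_iff:
  "\<psi> \<in> test_functions \<longleftrightarrow> smooth \<psi> \<and> (\<exists>R. \<forall>x. R < norm x \<longrightarrow> \<psi> x = 0)"
proof -
  have "compact (closure {x. \<psi> x \<noteq> 0}) \<longleftrightarrow> (\<exists>R. \<forall>x. R < norm x \<longrightarrow> \<psi> x = 0)"
    unfolding compact_closure bounded_iff by (auto simp: not_less[symmetric])
  then show ?thesis by (simp add: test_functions_def)
qed

lemma test_functions_smooth: "\<psi> \<in> test_functions \<Longrightarrow> smooth \<psi>"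
  by (simp add: test_functions_def)

lemma test_functions_support:
  "\<psi> \<in> test_functions \<Longrightarrow> \<exists>R>0. \<forall>x. R < norm x \<longrightarrow> \<psi> x = 0"
proof -
  assume "\<psi> \<in> test_functions"
  then obtain R where "\<forall>x. R < norm x \<longrightarrow> \<psi> x = 0"
    unfolding test_functions_iff by blast
  then show ?thesis by (intro exI[of _ "max R 1"]) auto
qed

lemma test_functionsI:
  assumes "smooth \<psi>" "\<And>x. R < norm x \<Longrightarrow> \<psi> x = 0"
  shows "\<psi> \<in> test_functions"
  using assms test_functions_iff by blast

text \<open>The region \<open>norm x > R\<close> is open, so near each of its points the function
  coincides with zero, and hence so do its derivatives.\<close>

lemma pdiffs_support:
  fixes f :: "real^'n::finite \<Rightarrow> real"
  assumes "\<And>x. R < norm x \<Longrightarrow> f x = 0" "R < norm x"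
  shows "pdiffs js f x = 0"
  using assms(2)
proof (induction js arbitrary: x)
  case (Cons j js)
  have "open {x::real^'n. R < norm x}"
    by (intro open_Collect_less continuous_intros)
  then have "(pdiffs js f has_derivative (\<lambda>v. 0)) (at x)"
    by (rule has_derivative_transform_within_open[OF has_derivative_const[of 0]])
      (use Cons in auto)
  then show ?case by (simp add: pdiff_eqI)
qed (use assms in auto)

lemma test_functions_pdiffs: "\<psi> \<in> test_functions \<Longrightarrow> pdiffs js \<psi> \<in> test_functions"
  by (metis pdiffs_support smooth_pdiffs test_functions_iff)

lemma test_functions_pdiff: "\<psi> \<in> test_functions \<Longrightarrow> pdiff j \<psi> \<in> test_functions"
  using test_functions_pdiffs[of \<psi> "[j]"] by simp

lemma compact_support_bounded:
  fixes \<psi> :: "'a::euclidean_space \<Rightarrow> real"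
  assumes "continuous_on UNIV \<psi>" "\<And>x. R < norm x \<Longrightarrow> \<psi> x = 0"
  obtains B where "B \<ge> 0" "\<And>x. \<bar>\<psi> x\<bar> \<le> B"
proof -
  have "compact (\<psi> ` cball 0 R)"
    using assms(1) by (intro compact_continuous_image) (auto intro: continuous_on_subset)
  then have "bounded (\<psi> ` cball 0 R)" by (rule compact_imp_bounded)
  then obtain B where "\<forall>y\<in>\<psi> ` cball 0 R. norm y \<le> B"
    unfolding bounded_iff ..
  then have B: "\<And>x. x \<in> cball 0 R \<Longrightarrow> \<bar>\<psi> x\<bar> \<le> B"
    by auto
  show thesis
  proof (rule that[of "max B 0"])
    show "\<bar>\<psi> x\<bar> \<le> max B 0" for x
      using B[of x] assms(2)[of x] by (cases "norm x \<le> R") auto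
  qed simp
qed

lemma test_functions_continuous: "\<psi> \<in> test_functions \<Longrightarrow> continuous_on S \<psi>"
  by (simp add: smooth_continuous test_functions_smooth)

lemma test_functions_bounded:
  assumes "\<psi> \<in> test_functions"
  shows "\<exists>B\<ge>0. \<forall>x. \<bar>\<psi> x\<bar> \<le> B"
  using compact_support_bounded[OF test_functions_continuous[OF assms]] test_functions_support[OF assms]
  by metis

lemma test_functions_measurable [measurable_dest]:
  "\<psi> \<in> test_functions \<Longrightarrow> \<psi> \<in> borel_measurable borel"
  by (simp add: borel_measurable_continuous_onI test_functions_continuous)

lemma continuous_compact_support_integrable:
  fixes \<psi> :: "'a::euclidean_space \<Rightarrow> real"
  assumes "continuous_on UNIV \<psi>" "\<And>x. R < norm x \<Longrightarrow> \<psi> x = 0"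
  shows "integrable lborel \<psi>"
proof -
  have "integrable lborel (\<lambda>x. indicator (cball 0 R) x *\<^sub>R \<psi> x)"
    using assms(1) by (intro borel_integrable_compact) (auto intro: continuous_on_subset)
  moreover have "(\<lambda>x. indicator (cball 0 R) x *\<^sub>R \<psi> x) = \<psi>"
    using assms(2) by (auto simp: fun_eq_iff indicator_def not_le)
  ultimately show ?thesis by simp
qed

lemma test_functions_integrable: "\<psi> \<in> test_functions \<Longrightarrow> integrable lborel \<psi>"
  by (metis continuous_compact_support_integrable test_functions_continuous test_functions_support)

lemma test_functions_lincomb:
  assumes "f \<in> test_functions" "g \<in> test_functions"
  shows "(\<lambda>x. a * f x + b * g x) \<in> test_functions"
proof -
  obtain R where "R > 0" "\<forall>x. R < norm x \<longrightarrow> f x = 0"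
    using test_functions_support[OF assms(1)] by blast
  moreover obtain R' where "R' > 0" "\<forall>x. R' < norm x \<longrightarrow> g x = 0"
    using test_functions_support[OF assms(2)] by blast
  ultimately show ?thesis
    using assms by (intro test_functionsI[of "\<lambda>x. a * f x + b * g x" "max R R'"] smooth_lincomb)
      (auto intro: test_functions_smooth)
qed

lemma test_functions_diff:
  assumes "f \<in> test_functions" "g \<in> test_functions"
  shows "(\<lambda>x. f x - g x) \<in> test_functions"
  using test_functions_lincomb[OF assms, of 1 "-1"] by simp

lemma affine_support:
  fixes f :: "'a::real_normed_vector \<Rightarrow> real"
  assumes "\<And>x. R < norm x \<Longrightarrow> f x = 0" "s \<noteq> 0" "(R + norm a) / \<bar>s\<bar> < norm x"
  shows "f (a + s *\<^sub>R x) = 0"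
proof (rule assms(1))
  have "R + norm a < \<bar>s\<bar> * norm x"
    using assms by (simp add: divide_less_eq mult.commute)
  then show "R < norm (a + s *\<^sub>R x)"
    using norm_triangle_ineq2[of "s *\<^sub>R x" "- a"] by (simp add: add.commute)
qed

lemma test_functions_affine:
  assumes "f \<in> test_functions" "s \<noteq> 0"
  shows "(\<lambda>y. c * f (a + s *\<^sub>R y)) \<in> test_functions"
proof -
  obtain R where "R > 0" "\<forall>x. R < norm x \<longrightarrow> f x = 0"
    using test_functions_support[OF assms(1)] by blast
  then show ?thesis
    using assms affine_support[of R f s a]
    by (intro test_functionsI[of "\<lambda>y. c * f (a + s *\<^sub>R y)" "(R + norm a) / \<bar>s\<bar>"] smooth_affine)
      (auto intro: test_functions_smooth)
qed

lemma test_functions_reflect: "f \<in> test_functions \<Longrightarrow> (\<lambda>y. f (x - y)) \<in> test_functions"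
  using test_functions_affine[of f "-1" 1 x] by simp

lemma dilate_altdef: "dilate \<phi> t = (\<lambda>y. (1 / t ^ CARD('n)) * \<phi> (0 + inverse t *\<^sub>R (y::real^'n::finite)))"
  by (simp add: dilate_def fun_eq_iff)

lemma test_functions_dilate: "\<phi> \<in> test_functions \<Longrightarrow> t > 0 \<Longrightarrow> dilate \<phi> t \<in> test_functions"
  unfolding dilate_altdef by (intro test_functions_affine) auto

lemma dilate_support:
  fixes \<phi> :: "real^'n::finite \<Rightarrow> real"
  assumes "\<And>x. R < norm x \<Longrightarrow> \<phi> x = 0" "t > 0" "t * R < norm x"
  shows "dilate \<phi> t x = 0"
  using assms by (simp add: dilate_def field_simps)

lemma pdiffs_dilate:
  "smooth \<phi> \<Longrightarrow> pdiffs js (dilate \<phi> t) = (\<lambda>y. inverse t ^ length js * dilate (pdiffs js \<phi>) t y)"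
  unfolding dilate_altdef by (subst pdiffs_affine) (simp_all add: fun_eq_iff)

lemma dilate_dilate: "dilate (dilate \<phi> s) t = dilate \<phi> (t * s)"
  by (simp add: dilate_def fun_eq_iff power_mult_distrib mult.commute)

lemma test_functions_lipschitz:
  fixes \<psi> :: "real^'n::finite \<Rightarrow> real"
  assumes "\<psi> \<in> test_functions"
  shows "\<exists>L\<ge>0. \<forall>x y. \<bar>\<psi> x - \<psi> y\<bar> \<le> L * norm (x - y)"
proof -
  have "\<exists>B\<ge>0. \<forall>x. \<bar>pdiff j \<psi> x\<bar> \<le> B" for j
    by (rule test_functions_bounded[OF test_functions_pdiff[OF assms]])
  then obtain B where B: "\<And>j. B j \<ge> 0" "\<And>j x. \<bar>pdiff j \<psi> x\<bar> \<le> B j" by metis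
  show ?thesis
  proof (intro exI[of _ "\<Sum>j\<in>UNIV. B j"] conjI allI)
    show "\<bar>\<psi> x - \<psi> y\<bar> \<le> (\<Sum>j\<in>UNIV. B j) * norm (x - y)" for x y
      by (intro mean_value_pdiff[of UNIV] sum_mono B smooth_differentiable test_functions_smooth assms) auto
  qed (simp add: B sum_nonneg)
qed

section \<open>Distributions and convolutions\<close>

text \<open>Only values on test functions matter from here on. Continuity on the test functions
  supported in one ball is expressed as an estimate of finite order, with \<open>B\<close> any
  common bound of the derivatives in place of a supremum seminorm.\<close>

definition distribution :: "((real^'n::finite \<Rightarrow> real) \<Rightarrow> real) \<Rightarrow> bool" where
  "distribution T \<longleftrightarrow>
     (\<forall>\<psi>\<in>test_functions. \<forall>\<eta>\<in>test_functions. \<forall>a b. T (\<lambda>x. a * \<psi> x + b * \<eta> x) = a * T \<psi> + b * T \<eta>) \<and>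
     (\<forall>R. \<exists>C\<ge>0. \<exists>m. \<forall>\<psi>\<in>test_functions. \<forall>B. (\<forall>x. R < norm x \<longrightarrow> \<psi> x = 0) \<longrightarrow>
        (\<forall>js x. length js \<le> m \<longrightarrow> \<bar>pdiffs js \<psi> x\<bar> \<le> B) \<longrightarrow> \<bar>T \<psi>\<bar> \<le> C * B)"

lemma distribution_lincomb:
  assumes "distribution T" "\<psi> \<in> test_functions" "\<eta> \<in> test_functions"
  shows "T (\<lambda>x. a * \<psi> x + b * \<eta> x) = a * T \<psi> + b * T \<eta>"
  using assms unfolding distribution_def by blast

lemma distribution_diff:
  assumes "distribution T" "\<psi> \<in> test_functions" "\<eta> \<in> test_functions"
  shows "T (\<lambda>x. \<psi> x - \<eta> x) = T \<psi> - T \<eta>"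
  using distribution_lincomb[OF assms, of 1 "-1"] by simp

lemma distribution_cmult:
  assumes "distribution T" "\<psi> \<in> test_functions"
  shows "T (\<lambda>x. a * \<psi> x) = a * T \<psi>"
  using distribution_lincomb[OF assms assms(2), of a 0] by simp

lemma zero_test_function: "(\<lambda>x. 0) \<in> test_functions"
  using smooth_sum[of "{}"] by (intro test_functionsI) auto

lemma distribution_sum:
  assumes "distribution T" "finite I" "\<And>i. i \<in> I \<Longrightarrow> f i \<in> test_functions"
  shows "(\<lambda>x. \<Sum>i\<in>I. c i * f i x) \<in> test_functions \<and> T (\<lambda>x. \<Sum>i\<in>I. c i * f i x) = (\<Sum>i\<in>I. c i * T (f i))"
  using assms(2,3)
proof (induction I)
  case empty
  then show ?case using distribution_cmult[OF assms(1) zero_test_function, of 0]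
    by (simp add: zero_test_function)
next
  case (insert i I)
  then have *: "f i \<in> test_functions" "(\<lambda>x. \<Sum>i\<in>I. c i * f i x) \<in> test_functions" by simp_all
  from insert show ?case
    using test_functions_lincomb[OF *, of "c i" 1] distribution_lincomb[OF assms(1) *, of "c i" 1] by simp
qed

section \<open>From tempered distributions to estimates of locally finite order\<close>

text \<open>The triangle inequality with one term bounded pointwise. The term with
  \<open>0 - \<psi> x\<close> is kept in this form because it measures how far the centre
  \<open>\<psi>\<close> of a basic open set lies from the zero function.\<close>

lemma schwartz_seminorm_add:
  assumes "\<psi> \<in> schwartz_functions" "\<And>x. (1 + norm x) ^ k * \<bar>pdiffs js \<eta> x\<bar> \<le> e" "smooth \<eta>"
  shows "schwartz_seminorm k js (\<lambda>x. \<eta> x - \<psi> x) \<le> e + schwartz_seminorm k js (\<lambda>x. 0 - \<psi> x)"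
proof -
  have s: "smooth \<psi>" and bdd: "bdd_above (range (\<lambda>x. (1 + norm x) ^ k * \<bar>pdiffs js \<psi> x\<bar>))"
    using assms(1) by (auto simp: schwartz_functions_def)
  have 1: "pdiffs js (\<lambda>x. \<eta> x - \<psi> x) = (\<lambda>x. pdiffs js \<eta> x - pdiffs js \<psi> x)"
    using pdiffs_lincomb[OF assms(3) s, of js 1 "-1"] by simp
  have 2: "pdiffs js (\<lambda>x. 0 - \<psi> x) = (\<lambda>x. - pdiffs js \<psi> x)"
    using pdiffs_lincomb[OF assms(3) s, of js 0 "-1"] by simp
  show ?thesis
    unfolding schwartz_seminorm_def 1 2
  proof (rule cSUP_least)
    fix x
    have "(1 + norm x) ^ k * \<bar>pdiffs js \<eta> x - pdiffs js \<psi> x\<bar> \<le>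
        (1 + norm x) ^ k * \<bar>pdiffs js \<eta> x\<bar> + (1 + norm x) ^ k * \<bar>pdiffs js \<psi> x\<bar>"
      unfolding distrib_left[symmetric] by (intro mult_left_mono) auto
    also have "\<dots> \<le> e + (SUP x. (1 + norm x) ^ k * \<bar>- pdiffs js \<psi> x\<bar>)"
      using bdd by (intro add_mono assms) (auto intro: cSUP_upper)
    finally show "(1 + norm x) ^ k * \<bar>pdiffs js \<eta> x - pdiffs js \<psi> x\<bar> \<le> e + (SUP x. (1 + norm x) ^ k * \<bar>- pdiffs js \<psi> x\<bar>)" .
  qed simp
qed

lemma test_functions_schwartz:
  assumes "\<psi> \<in> test_functions"
  shows "\<psi> \<in> schwartz_functions"
proof -
  have "bdd_above (range (\<lambda>x. (1 + norm x) ^ k * \<bar>pdiffs js \<psi> x\<bar>))" for k js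
  proof -
    obtain R where R: "R > 0" "\<forall>x. R < norm x \<longrightarrow> \<psi> x = 0"
      using test_functions_support[OF assms] by blast
    obtain B where B: "B \<ge> 0" "\<And>x. \<bar>pdiffs js \<psi> x\<bar> \<le> B"
      using test_functions_bounded[OF test_functions_pdiffs[OF assms, of js]] by blast
    have "(1 + norm x) ^ k * \<bar>pdiffs js \<psi> x\<bar> \<le> (1 + R) ^ k * B" for x
    proof (cases "norm x \<le> R")
      case True
      then show ?thesis using B R by (intro mult_mono power_mono) auto
    next
      case False
      then have "pdiffs js \<psi> x = 0" using R by (intro pdiffs_support[of R]) auto
      then show ?thesis using B R by simp
    qed
    then show ?thesis by (intro bdd_aboveI2)
  qed
  then show ?thesis using test_functions_smooth[OF assms] by (simp add: schwartz_functions_def)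
qed

text \<open>The generating sets are seminorm balls around arbitrary centres
  \<open>\<psi>\<^sub>0\<close>. If such a ball contains zero, the slack between its radius and the
  distance of zero from the centre leaves room for all test functions that are small in the same
  seminorm; intersections take the larger order and the smaller bound.\<close>

lemma schwartz_topology_neighbourhood_zero:
  fixes S :: "(real^'n::finite \<Rightarrow> real) set"
  assumes "generate_topology_on {{\<psi> \<in> schwartz_functions. schwartz_seminorm k js (\<lambda>x. \<psi> x - \<psi>\<^sub>0 x) < e} | k js \<psi>\<^sub>0 e.
        \<psi>\<^sub>0 \<in> schwartz_functions \<and> e > 0} S" "(\<lambda>x. 0) \<in> S"
  shows "\<exists>m. \<exists>e>0. \<forall>\<psi>\<in>test_functions.
    (\<forall>k js x. k \<le> m \<longrightarrow> length js \<le> m \<longrightarrow> (1 + norm x) ^ k * \<bar>pdiffs js \<psi> x\<bar> \<le> e) \<longrightarrow> \<psi> \<in> S"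
  using assms
proof (induction S)
  case (Int a b)
  obtain m e where a: "e > 0" "\<And>\<psi>. \<psi>\<in>test_functions \<Longrightarrow>
    (\<forall>k js x. k \<le> m \<longrightarrow> length js \<le> m \<longrightarrow> (1 + norm x) ^ k * \<bar>pdiffs js \<psi> x\<bar> \<le> e) \<Longrightarrow> \<psi> \<in> a"
    using Int by (meson IntD1)
  obtain m' e' where b: "e' > 0" "\<And>\<psi>. \<psi>\<in>test_functions \<Longrightarrow>
    (\<forall>k js x. k \<le> m' \<longrightarrow> length js \<le> m' \<longrightarrow> (1 + norm x) ^ k * \<bar>pdiffs js \<psi> x\<bar> \<le> e') \<Longrightarrow> \<psi> \<in> b"
    using Int by (meson IntD2)
  show ?case
  proof (intro exI[of _ "max m m'"] exI[of _ "min e e'"] conjI ballI impI IntI)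
    fix \<psi> :: "real^'n \<Rightarrow> real" assume \<psi>: "\<psi> \<in> test_functions" "\<forall>k js x. k \<le> max m m' \<longrightarrow> length js \<le> max m m' \<longrightarrow>
       (1 + norm x) ^ k * \<bar>pdiffs js \<psi> x\<bar> \<le> min e e'"
    show "\<psi> \<in> a" by (rule a(2)) (use \<psi> in auto)
    show "\<psi> \<in> b" by (rule b(2)) (use \<psi> in auto)
  qed (use a b in auto)
next
  case (UN K)
  then obtain k where k: "k \<in> K" "(\<lambda>x. 0) \<in> k" by blast
  from UN.IH[OF this] show ?case using k(1) by (meson UnionI)
next
  case (Basis s)
  then obtain k js \<psi>\<^sub>0 e where s: "s = {\<psi> \<in> schwartz_functions. schwartz_seminorm k js (\<lambda>x. \<psi> x - \<psi>\<^sub>0 x) < e}"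
    "\<psi>\<^sub>0 \<in> schwartz_functions" "e > 0" by blast
  define d where "d = e - schwartz_seminorm k js (\<lambda>x. 0 - \<psi>\<^sub>0 x)"
  have d: "d > 0" using Basis(2) s by (simp add: d_def)
  show ?case
  proof (intro exI[of _ "max k (length js)"] exI[of _ "d / 2"] conjI ballI impI)
    fix \<psi> :: "real^'n \<Rightarrow> real" assume \<psi>: "\<psi> \<in> test_functions" "\<forall>k' js' x. k' \<le> max k (length js) \<longrightarrow> length js' \<le> max k (length js) \<longrightarrow>
       (1 + norm x) ^ k' * \<bar>pdiffs js' \<psi> x\<bar> \<le> d / 2"
    have "schwartz_seminorm k js (\<lambda>x. \<psi> x - \<psi>\<^sub>0 x) \<le> d / 2 + schwartz_seminorm k js (\<lambda>x. 0 - \<psi>\<^sub>0 x)"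
      using \<psi> by (intro schwartz_seminorm_add s test_functions_smooth) auto
    also have "\<dots> < e" using d unfolding d_def by (simp only: field_simps)
    finally show "\<psi> \<in> s" using \<psi> by (simp add: s test_functions_schwartz)
  qed (use d in auto)
qed simp

text \<open>The preimage of the unit ball under \<open>T\<close> is a neighbourhood of zero, so
  \<open>T\<close> is bounded by \<open>1\<close> on small test functions, and homogeneity turns
  this into an estimate of finite order. On functions supported in the ball of radius
  \<open>R\<close> the polynomial weights are bounded, so only the derivatives remain.\<close>

lemma tempered_imp_distribution:
  fixes T :: "(real^'n::finite \<Rightarrow> real) \<Rightarrow> real"
  assumes "T \<in> tempered_distributions"
  shows "distribution T"
  unfolding distribution_def
proof (intro conjI ballI allI)
  have lin: "T (\<lambda>x. a * \<psi> x + b * \<eta> x) = a * T \<psi> + b * T \<eta>" if "\<psi> \<in> test_functions" "\<eta> \<in> test_functions" for \<psi> \<eta> :: "real^'n \<Rightarrow> real" and a b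
    using assms that test_functions_schwartz unfolding tempered_distributions_def by blast
  then show "T (\<lambda>x. a * \<psi> x + b * \<eta> x) = a * T \<psi> + b * T \<eta>" if "\<psi> \<in> test_functions" "\<eta> \<in> test_functions" for \<psi> \<eta> :: "real^'n \<Rightarrow> real" and a b
    using that .
  have cmult: "T (\<lambda>x. a * \<psi> x) = a * T \<psi>" if "\<psi> \<in> test_functions" for a \<psi>
    using lin[OF that that, of a 0] by simp
  fix R :: real
  define S where "S = {\<psi> \<in> topspace schwartz_topology. T \<psi> \<in> ball 0 1}"
  have "continuous_map schwartz_topology euclidean T"
    using assms by (simp add: tempered_distributions_def)
  then have "openin schwartz_topology S"
    unfolding S_def by (rule openin_continuous_map_preimage) simp
  moreover have "(\<lambda>x. 0) \<in> S"
  proof -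
    \<comment> \<open>The underlying set of a generated topology is the union of its generators, so
      zero must be exhibited in one of them.\<close>
    have "schwartz_seminorm 0 [] (\<lambda>x. 0 - 0) < 1"
      by (simp add: schwartz_seminorm_def)
    then have "(\<lambda>x. 0) \<in> topspace schwartz_topology"
      unfolding schwartz_topology_def topology_generated_by_topspace
      using test_functions_schwartz[OF zero_test_function]
      by (intro UnionI[of "{\<psi> \<in> schwartz_functions. schwartz_seminorm 0 [] (\<lambda>x. \<psi> x - 0) < 1}"]) (auto intro!: exI[of _ "0::nat"] exI[of _ "[]"] exI[of _ "\<lambda>x. 0"] exI[of _ "1::real"])
    then show ?thesis
      using cmult[OF zero_test_function, of 0] by (simp add: S_def)
  qed
  ultimately obtain m e where e: "e > 0" "\<And>\<psi>. \<psi>\<in>test_functions \<Longrightarrow>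
    (\<forall>k js x. k \<le> m \<longrightarrow> length js \<le> m \<longrightarrow> (1 + norm x) ^ k * \<bar>pdiffs js \<psi> x\<bar> \<le> e) \<Longrightarrow> \<psi> \<in> S"
    using schwartz_topology_neighbourhood_zero[of S]
    unfolding schwartz_topology_def openin_topology_generated_by_iff by metis
  \<comment> \<open>\<open>(1 + \<bar>R\<bar>) ^ m\<close> bounds every weight that occurs on the
    support; \<open>e\<close> is the size of the neighbourhood of zero.\<close>
  define K where "K = (1 + \<bar>R\<bar>) ^ m / e"
  have K: "K > 0" using e by (simp add: K_def add_nonneg_pos)
  show "\<exists>C\<ge>0. \<exists>m. \<forall>\<psi>\<in>test_functions. \<forall>B. (\<forall>x. R < norm x \<longrightarrow> \<psi> x = 0) \<longrightarrow>
        (\<forall>js x. length js \<le> m \<longrightarrow> \<bar>pdiffs js \<psi> x\<bar> \<le> B) \<longrightarrow> \<bar>T \<psi>\<bar> \<le> C * B"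
  proof (intro exI[of _ K] exI[of _ m] conjI ballI allI impI)
    fix \<psi> :: "real^'n \<Rightarrow> real" and B assume \<psi>: "\<psi> \<in> test_functions" "\<forall>x. R < norm x \<longrightarrow> \<psi> x = 0"
      and B: "\<forall>js x. length js \<le> m \<longrightarrow> \<bar>pdiffs js \<psi> x\<bar> \<le> B"
    have B0: "B \<ge> 0" using B[rule_format, of "[]" 0] by simp
    \<comment> \<open>The rescaling divides by the bound, and \<open>B\<close> may be zero; hence a
      larger \<open>B'\<close> is used first, and \<open>B'\<close> tends to \<open>B\<close> at the
      end.\<close>
    have bound: "\<bar>T \<psi>\<bar> \<le> K * B'" if "B' > B" for B'
    proof -
      have B': "B' > 0" using that B0 by simp
      define c where "c = 1 / (K * B')"
      have c: "c > 0" using K B' by (simp add: c_def)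
      have "(\<lambda>x. c * \<psi> x) \<in> S"
      proof (rule e(2))
        show "(\<lambda>x. c * \<psi> x) \<in> test_functions"
          using test_functions_lincomb[OF \<psi>(1) \<psi>(1), of c 0] by simp
        show "\<forall>k js x. k \<le> m \<longrightarrow> length js \<le> m \<longrightarrow> (1 + norm x) ^ k * \<bar>pdiffs js (\<lambda>x. c * \<psi> x) x\<bar> \<le> e"
        proof (intro allI impI)
          fix k x and js :: "'n list" assume k: "k \<le> m" "length js \<le> m"
          have p: "pdiffs js (\<lambda>x. c * \<psi> x) x = c * pdiffs js \<psi> x"
            using pdiffs_lincomb[of \<psi> \<psi> js c 0] test_functions_smooth[OF \<psi>(1)] by (simp add: fun_eq_iff)
          show "(1 + norm x) ^ k * \<bar>pdiffs js (\<lambda>x. c * \<psi> x) x\<bar> \<le> e"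
          proof (cases "norm x \<le> R")
            case True
            have "(1 + norm x) ^ k \<le> (1 + \<bar>R\<bar>) ^ m"
              by (rule order_trans[OF power_mono[of _ "1 + \<bar>R\<bar>"] power_increasing]) (use True k in auto)
            then have "(1 + norm x) ^ k * \<bar>c * pdiffs js \<psi> x\<bar> \<le> (1 + \<bar>R\<bar>) ^ m * (c * B')"
              using B[rule_format, OF k(2), of x] c that by (intro mult_mono) (auto simp: abs_mult)
            also have "\<dots> = e" using B' K e by (simp add: c_def K_def field_simps)
            finally show ?thesis by (simp add: p)
          next
            case False
            then have "pdiffs js \<psi> x = 0" using \<psi>(2) by (intro pdiffs_support[of R]) auto
            then show ?thesis using p e by simp
          qed
        qed
      qed
      then have "\<bar>c * T \<psi>\<bar> < 1" using cmult[OF \<psi>(1)] by (simp add: S_def)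
      then show ?thesis using c K B' by (simp add: c_def abs_mult divide_simps mult_ac split: if_splits)
    qed
    show "\<bar>T \<psi>\<bar> \<le> K * B"
    proof (rule field_le_epsilon)
      fix d :: real assume "d > 0"
      then show "\<bar>T \<psi>\<bar> \<le> K * B + d"
        using bound[of "B + d / K"] K by (simp add: distrib_left)
    qed
  qed (use K in auto)
qed

text \<open>The form of continuity used throughout: a common support and uniform smallness of each
  derivative separately. Only finitely many multi-indices have length at most \<open>m\<close>, so
  the smallness holds for all of them simultaneously.\<close>

lemma distribution_tendsto_zero:
  fixes \<psi> :: "'i \<Rightarrow> real^'n::finite \<Rightarrow> real"
  assumes T: "distribution T"
    and test: "\<forall>\<^sub>F i in F. \<psi> i \<in> test_functions \<and> (\<forall>x. R < norm x \<longrightarrow> \<psi> i x = 0)"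
    and small: "\<And>js e. e > 0 \<Longrightarrow> \<forall>\<^sub>F i in F. \<forall>x. \<bar>pdiffs js (\<psi> i) x\<bar> \<le> e"
  shows "((\<lambda>i. T (\<psi> i)) \<longlongrightarrow> 0) F"
proof (rule tendstoI)
  fix e :: real assume e: "e > 0"
  obtain C m where C: "C \<ge> 0" "\<And>\<psi> B. \<psi>\<in>test_functions \<Longrightarrow> (\<forall>x. R < norm x \<longrightarrow> \<psi> x = 0) \<Longrightarrow>
        (\<forall>js x. length js \<le> m \<longrightarrow> \<bar>pdiffs js \<psi> x\<bar> \<le> B) \<Longrightarrow> \<bar>T \<psi>\<bar> \<le> C * B"
    using T unfolding distribution_def by metis
  \<comment> \<open>\<open>C + 1\<close> instead of \<open>C\<close> keeps the quotient meaningful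
    when \<open>C = 0\<close>.\<close>
  define d where "d = e / (2 * (C + 1))"
  have d: "d > 0" "C * d < e"
    using e C by (auto simp: d_def field_simps intro: add_nonneg_pos)
  have "finite {js :: 'n list. length js \<le> m}"
    using finite_lists_length_le[of "UNIV :: 'n set" m] by simp
  then have "\<forall>\<^sub>F i in F. \<forall>js\<in>{js. length js \<le> m}. \<forall>x. \<bar>pdiffs js (\<psi> i) x\<bar> \<le> d"
    by (intro eventually_ball_finite) (auto intro: small d)
  with test show "\<forall>\<^sub>F i in F. dist (T (\<psi> i)) 0 < e"
  proof eventually_elim
    case (elim i)
    then have "\<bar>T (\<psi> i)\<bar> \<le> C * d" by (intro C) auto
    with d show ?case by simp
  qed
qed

lemma distribution_pdiff:
  assumes T: "distribution T"
  shows "distribution (distr_pdiff j T)"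
  unfolding distribution_def
proof (intro conjI ballI allI)
  fix \<psi> \<eta> :: "real^'a \<Rightarrow> real" and a b :: real assume *: "\<psi> \<in> test_functions" "\<eta> \<in> test_functions"
  have "pdiff j (\<lambda>x. a * \<psi> x + b * \<eta> x) = (\<lambda>x. a * pdiff j \<psi> x + b * pdiff j \<eta> x)"
    using pdiffs_lincomb[of \<psi> \<eta> "[j]" a b] * by (simp add: test_functions_smooth)
  then show "distr_pdiff j T (\<lambda>x. a * \<psi> x + b * \<eta> x) = a * distr_pdiff j T \<psi> + b * distr_pdiff j T \<eta>"
    using * by (simp add: distr_pdiff_def distribution_lincomb[OF T] test_functions_pdiff)
next
  fix R
  obtain C m where C: "C \<ge> 0" "\<And>\<psi> B. \<psi>\<in>test_functions \<Longrightarrow> (\<forall>x. R < norm x \<longrightarrow> \<psi> x = 0) \<Longrightarrow>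
        (\<forall>js x. length js \<le> m \<longrightarrow> \<bar>pdiffs js \<psi> x\<bar> \<le> B) \<Longrightarrow> \<bar>T \<psi>\<bar> \<le> C * B"
    using T unfolding distribution_def by metis
  show "\<exists>C\<ge>0. \<exists>m. \<forall>\<psi>\<in>test_functions. \<forall>B. (\<forall>x. R < norm x \<longrightarrow> \<psi> x = 0) \<longrightarrow>
        (\<forall>js x. length js \<le> m \<longrightarrow> \<bar>pdiffs js \<psi> x\<bar> \<le> B) \<longrightarrow> \<bar>distr_pdiff j T \<psi>\<bar> \<le> C * B"
  proof (intro exI[of _ C] exI[of _ "Suc m"] conjI ballI allI impI)
    fix \<psi> :: "real^'a \<Rightarrow> real" and B
    assume \<psi>: "\<psi> \<in> test_functions" "\<forall>x. R < norm x \<longrightarrow> \<psi> x = 0"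
      and B: "\<forall>js x. length js \<le> Suc m \<longrightarrow> \<bar>pdiffs js \<psi> x\<bar> \<le> B"
    have "\<bar>T (pdiff j \<psi>)\<bar> \<le> C * B"
    proof (intro C(2) allI impI)
      fix js :: "'a list" and x assume "length js \<le> m"
      \<comment> \<open>The new derivative is the innermost one and is appended to the list, which
        raises the order from \<open>m\<close> to \<open>Suc m\<close>.\<close>
      then show "\<bar>pdiffs js (pdiff j \<psi>) x\<bar> \<le> B"
        using B[rule_format, of "js @ [j]" x] by (simp add: pdiffs_append)
    next
      fix x :: "real^'a" assume "R < norm x"
      then show "pdiff j \<psi> x = 0" using pdiffs_support[of R \<psi> x "[j]"] \<psi> by simp
    qed (use \<psi> in \<open>auto intro: test_functions_pdiff\<close>)
    then show "\<bar>distr_pdiff j T \<psi>\<bar> \<le> C * B" by (simp add: distr_pdiff_def)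
  qed (use C in auto)
qed

section \<open>Smoothness of the convolution of a distribution with a test function\<close>

text \<open>The increment of the convolution minus its linear part is \<open>T\<close> applied to
  the reflected Taylor remainder of \<open>\<psi>\<close>. That remainder and each of its
  derivatives are \<open>O((norm v)\<^sup>2)\<close> uniformly, with support in a fixed ball for
  \<open>norm v \<le> 1\<close>; so after division by \<open>norm v\<close> the continuity of
  \<open>T\<close> applies.\<close>

lemma has_derivative_distr_conv:
  fixes \<psi> :: "real^'n::finite \<Rightarrow> real"
  assumes T: "distribution T" and \<psi>: "\<psi> \<in> test_functions"
  shows "(distr_conv T \<psi> has_derivative (\<lambda>v. \<Sum>j\<in>UNIV. v $ j * distr_conv T (pdiff j \<psi>) x)) (at x)"
  unfolding has_derivative_at
proof
  show "bounded_linear (\<lambda>v. \<Sum>j\<in>UNIV. v $ j * distr_conv T (pdiff j \<psi>) x)"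
    by (intro bounded_linear_sum bounded_linear_mult_const bounded_linear_vec_nth)
  define r where "r v z = \<psi> (z + v) - \<psi> z - (\<Sum>j\<in>UNIV. v $ j * pdiff j \<psi> z)" for v z
  \<comment> \<open>At \<open>v = 0\<close> division by zero makes \<open>s v\<close> vanish, so the
    estimates below hold for every \<open>v\<close>.\<close>
  define s where "s v = (\<lambda>y. (1 / norm v) * r v (x - y))" for v
  note sm = test_functions_smooth[OF \<psi>]
  \<comment> \<open>Padding with \<open>0 * \<psi> (x - y)\<close> brings \<open>s v\<close> into
    the nested two-term form to which linearity of \<open>T\<close> can be applied.\<close>
  have s_alt: "s v = (\<lambda>y. (1 / norm v) * (1 * (1 * \<psi> (x + v - y) + (-1) * \<psi> (x - y)) + (-1) * (\<Sum>j\<in>UNIV. v $ j * pdiff j \<psi> (x - y))) +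
     0 * \<psi> (x - y))" for v
    by (simp add: s_def r_def fun_eq_iff algebra_simps)
  have t1: "(\<lambda>y. \<psi> (z - y)) \<in> test_functions" "(\<lambda>y. pdiff j \<psi> (z - y)) \<in> test_functions" for j z
    using \<psi> by (auto intro: test_functions_reflect test_functions_pdiff)
  have t2: "(\<lambda>y. \<Sum>j\<in>UNIV. v $ j * pdiff j \<psi> (x - y)) \<in> test_functions"
    "T (\<lambda>y. \<Sum>j\<in>UNIV. v $ j * pdiff j \<psi> (x - y)) = (\<Sum>j\<in>UNIV. v $ j * T (\<lambda>y. pdiff j \<psi> (x - y)))" for v
    using distribution_sum[OF T, of UNIV "\<lambda>j y. pdiff j \<psi> (x - y)" "\<lambda>j. v $ j"] t1 by auto
  note t3 = t1 t2(1) test_functions_lincomb[OF t1(1) t1(1)]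
  have s_test: "s v \<in> test_functions" for v
    unfolding s_alt by (intro test_functions_lincomb t1 t2)
  have Ts: "T (s v) = (distr_conv T \<psi> (x + v) - distr_conv T \<psi> x - (\<Sum>j\<in>UNIV. v $ j * distr_conv T (pdiff j \<psi>) x)) / norm v" for v
    unfolding s_alt
    apply (subst distribution_lincomb[OF T], (intro test_functions_lincomb t1 t2)+)+
    by (simp add: distr_conv_def t2(2))
  obtain R where R: "R > 0" "\<forall>x. R < norm x \<longrightarrow> \<psi> x = 0"
    using test_functions_support[OF \<psi>] by blast
  have supp: "s v y = 0" if "norm v \<le> 1" "R + 1 + norm x < norm y" for v y
  proof -
    have "R < norm (x - y)" "R < norm (x - y + v)"
      using that norm_triangle_ineq3[of x y] norm_triangle_ineq2[of y "x"] norm_triangle_ineq[of "x - y + v" "- v"]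
      by (auto simp: norm_minus_commute)
    moreover have "pdiff j \<psi> (x - y) = 0" for j
      using pdiffs_support[of R \<psi> "x - y" "[j]"] R calculation by simp
    ultimately show ?thesis using R by (simp add: s_def r_def)
  qed
  have small: "\<exists>K\<ge>0. \<forall>v y. \<bar>pdiffs js (s v) y\<bar> \<le> K * norm v" for js
  proof -
    have "\<exists>B. \<forall>z. \<bar>pdiff i (pdiff j (pdiffs js \<psi>)) z\<bar> \<le> B" for i j
      using test_functions_bounded[OF test_functions_pdiffs[OF \<psi>, of "i # j # js"]] by auto
    then obtain B where B: "\<And>i j z. \<bar>pdiff i (pdiff j (pdiffs js \<psi>)) z\<bar> \<le> B i j" by metis
    define B' where "B' = (\<Sum>i\<in>UNIV. \<Sum>j\<in>UNIV. B i j)"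
    have B0: "B i j \<ge> 0" for i j using B[of i j undefined] by linarith
    have "B i j \<le> B'" for i j
    proof -
      have "B i j \<le> (\<Sum>j\<in>UNIV. B i j)" using B0 by (intro member_le_sum) auto
      also have "\<dots> \<le> B'" unfolding B'_def using B0 by (intro member_le_sum[of _ _ "\<lambda>i. \<Sum>j\<in>UNIV. B i j"]) (auto intro: sum_nonneg)
      finally show ?thesis .
    qed
    then have B': "\<bar>pdiff i (pdiff j (pdiffs js \<psi>)) z\<bar> \<le> B'" for i j z
      using B order_trans by blast
    define K where "K = real CARD('n) ^ 2 * B'"
    have "B' \<ge> 0" unfolding B'_def by (intro sum_nonneg B0)
    then have K: "K \<ge> 0" by (simp add: K_def)
    have "\<bar>pdiffs js (s v) y\<bar> \<le> K * norm v" for v y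
    proof -
      have sr: "smooth (r v)"
        unfolding r_def
        using smooth_lincomb[OF smooth_lincomb[OF smooth_affine[OF sm, of 1 v 1] sm, of 1 "-1"] smooth_sum[THEN conjunct1, of UNIV "\<lambda>j. pdiff j \<psi>" "\<lambda>j. v $ j"], of 1 "-1"]
        by (simp add: sm smooth_pdiff add.commute)
      have pr: "pdiffs js (r v) = (\<lambda>z. pdiffs js \<psi> (z + v) - pdiffs js \<psi> z - (\<Sum>j\<in>UNIV. v $ j * pdiff j (pdiffs js \<psi>) z))"
        unfolding r_def
        using pdiffs_lincomb[OF smooth_lincomb[OF smooth_affine[OF sm, of 1 v 1] sm, of 1 "-1"] smooth_sum[THEN conjunct1, of UNIV "\<lambda>j. pdiff j \<psi>" "\<lambda>j. v $ j"], of js 1 "-1"]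
          pdiffs_lincomb[OF smooth_affine[OF sm, of 1 v 1] sm, of js 1 "-1"] pdiffs_affine[OF sm, of js 1 v 1]
          smooth_sum[THEN conjunct2, of UNIV "\<lambda>j. pdiff j \<psi>" js "\<lambda>j. v $ j"]
        by (simp add: sm smooth_pdiff add.commute pdiffs_pdiff_commute)
      have "pdiffs js (s v) y = (1 / norm v) * (-1) ^ length js * pdiffs js (r v) (x - y)"
        unfolding s_def using pdiffs_affine[OF sr, of js "1 / norm v" x "-1"] by simp
      then have "\<bar>pdiffs js (s v) y\<bar> = (1 / norm v) * \<bar>pdiffs js (r v) (x - y)\<bar>"
        by (simp add: abs_mult power_abs)
      also have "\<dots> \<le> (1 / norm v) * (K * (norm v)\<^sup>2)"
        unfolding pr K_def
        using taylor_pdiff[OF smooth_pdiffs[OF sm] B', of "x - y" v]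
        by (intro mult_left_mono) auto
      also have "\<dots> = K * norm v" by (simp add: power2_eq_square)
      finally show ?thesis .
    qed
    with K show ?thesis by blast
  qed
  have lim: "((\<lambda>v. T (s v)) \<longlongrightarrow> 0) (at 0)"
  proof (rule distribution_tendsto_zero[OF T, where R = "R + 1 + norm x"])
    have "\<forall>\<^sub>F v in at 0. norm v < (1::real)"
      by (metis (mono_tags, lifting) eventually_at_ball dist_0_norm eventually_mono mem_ball zero_less_one at_within_ball_bot_iff)
    then show "\<forall>\<^sub>F v in at 0. s v \<in> test_functions \<and> (\<forall>y. R + 1 + norm x < norm y \<longrightarrow> s v y = 0)"
      by eventually_elim (use s_test supp in auto)
    fix js :: "'n list" and e :: real assume e: "e > 0"
    obtain K where K: "K \<ge> 0" "\<And>v y. \<bar>pdiffs js (s v) y\<bar> \<le> K * norm v" using small by blast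
    have "((\<lambda>v::real^'n. K * norm v) \<longlongrightarrow> K * norm (0::real^'n)) (at 0)"
      by (intro tendsto_intros)
    then have "\<forall>\<^sub>F v in at (0::real^'n). K * norm v < e"
      using e by (auto intro: order_tendstoD)
    then show "\<forall>\<^sub>F v in at 0. \<forall>y. \<bar>pdiffs js (s v) y\<bar> \<le> e"
      by eventually_elim (use K(2) in \<open>meson less_imp_le order_trans\<close>)
  qed
  show "((\<lambda>v. norm (distr_conv T \<psi> (x + v) - distr_conv T \<psi> x -
      (\<Sum>j\<in>UNIV. v $ j * distr_conv T (pdiff j \<psi>) x)) / norm v) \<longlongrightarrow> 0) (at 0)"
    using tendsto_norm_zero[OF lim] by (simp add: Ts)
qed

lemma pdiff_distr_conv:
  assumes T: "distribution T" and \<psi>: "\<psi> \<in> test_functions"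
  shows "pdiff j (distr_conv T \<psi>) = distr_conv T (pdiff j \<psi>)"
  by (rule ext) (simp add: pdiff_eqI[OF has_derivative_distr_conv[OF assms]] sum_axis_mult)

lemma pdiffs_distr_conv:
  assumes T: "distribution T" and \<psi>: "\<psi> \<in> test_functions"
  shows "pdiffs js (distr_conv T \<psi>) = distr_conv T (pdiffs js \<psi>)"
  by (induction js) (simp_all add: pdiff_distr_conv[OF T] test_functions_pdiffs[OF \<psi>])

lemma smooth_distr_conv:
  assumes T: "distribution T" and \<psi>: "\<psi> \<in> test_functions"
  shows "smooth (distr_conv T \<psi>)"
  unfolding smooth_def pdiffs_distr_conv[OF assms]
  using has_derivative_distr_conv[OF T test_functions_pdiffs[OF \<psi>]] differentiable_def by blast

text \<open>Two signs cancel: one from the definition of the distributional derivative, one from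
  differentiating the reflected function.\<close>

lemma distr_conv_pdiff:
  assumes T: "distribution T" and \<psi>: "\<psi> \<in> test_functions"
  shows "distr_conv (distr_pdiff j T) \<psi> = pdiff j (distr_conv T \<psi>)"
proof
  fix x
  have "pdiff j (\<lambda>y. \<psi> (x - y)) = (\<lambda>y. (-1) * pdiff j \<psi> (x - y))"
    using pdiffs_reflect[of \<psi> "[j]" x] \<psi> by (simp add: test_functions_smooth)
  then show "distr_conv (distr_pdiff j T) \<psi> x = pdiff j (distr_conv T \<psi>) x"
    unfolding pdiff_distr_conv[OF assms]
    using distribution_cmult[OF T test_functions_reflect[OF test_functions_pdiff[OF \<psi>]], of "-1" j x]
    by (simp add: distr_conv_def distr_pdiff_def)
qed

section \<open>Integrals of dilates and reflections; convolution of functions\<close>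

lemma lborel_integral_affine:
  fixes f :: "'a::euclidean_space \<Rightarrow> real"
  assumes [measurable]: "f \<in> borel_measurable borel" and c: "c \<noteq> 0"
  shows "integrable lborel (\<lambda>x. f (t + c *\<^sub>R x)) \<longleftrightarrow> integrable lborel f"
    and "(\<integral>x. f x \<partial>lborel) = \<bar>c\<bar> ^ DIM('a) * (\<integral>x. f (t + c *\<^sub>R x) \<partial>lborel)"
proof -
  have [simp]: "\<bar>c\<bar> ^ DIM('a) \<noteq> 0" using c by simp
  show "integrable lborel (\<lambda>x. f (t + c *\<^sub>R x)) \<longleftrightarrow> integrable lborel f"
    by (subst (2) lborel_affine[OF c, of t])
      (use c in \<open>simp add: integrable_density integrable_distr_eq del: power_abs\<close>)
  show "(\<integral>x. f x \<partial>lborel) = \<bar>c\<bar> ^ DIM('a) * (\<integral>x. f (t + c *\<^sub>R x) \<partial>lborel)"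
    by (subst lborel_affine[OF c, of t])
      (simp add: integral_density integral_distr)
qed

lemma lborel_integral_reflect:
  fixes f :: "'a::euclidean_space \<Rightarrow> real"
  assumes "f \<in> borel_measurable borel"
  shows "integrable lborel (\<lambda>x. f (t - x)) \<longleftrightarrow> integrable lborel f"
    and "(\<integral>x. f (t - x) \<partial>lborel) = (\<integral>x. f x \<partial>lborel)"
  using lborel_integral_affine[OF assms, of "-1" t] by simp_all

lemma integral_dilate:
  fixes f :: "real^'n::finite \<Rightarrow> real"
  assumes "f \<in> borel_measurable borel" "t > 0"
  shows "integrable lborel (dilate f t) \<longleftrightarrow> integrable lborel f"
    and "(\<integral>x. dilate f t x \<partial>lborel) = (\<integral>x. f x \<partial>lborel)"
  using lborel_integral_affine[OF assms(1), of "inverse t" 0] assms(2)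
  by (simp_all add: dilate_def[abs_def] power_inverse divide_inverse mult.commute)

lemma integral_abs_dilate:
  fixes f :: "real^'n::finite \<Rightarrow> real"
  assumes "f \<in> borel_measurable borel" "t > 0"
  shows "(\<integral>x. \<bar>dilate f t x\<bar> \<partial>lborel) = (\<integral>x. \<bar>f x\<bar> \<partial>lborel)"
proof -
  have "(\<lambda>x. \<bar>dilate f t x\<bar>) = dilate (\<lambda>x. \<bar>f x\<bar>) t"
    using assms(2) by (simp add: dilate_def fun_eq_iff)
  then show ?thesis using integral_dilate(2)[of "\<lambda>x. \<bar>f x\<bar>" t] assms by simp
qed

text \<open>The bound on \<open>g\<close> is demanded only where \<open>f\<close> is nonzero, so
  that a kernel of small support sees merely the local behaviour of \<open>g\<close>.\<close>

lemma integral_mult_bounded: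
  fixes f g :: "'a \<Rightarrow> real"
  assumes f: "integrable M f" and [measurable]: "g \<in> borel_measurable M"
    and B: "\<And>x. f x \<noteq> 0 \<Longrightarrow> \<bar>g x\<bar> \<le> B"
  shows "integrable M (\<lambda>x. f x * g x)" and "\<bar>\<integral>x. f x * g x \<partial>M\<bar> \<le> B * (\<integral>x. \<bar>f x\<bar> \<partial>M)"
proof -
  have [measurable]: "f \<in> borel_measurable M" using f by simp
  have le: "norm (f x * g x) \<le> B * \<bar>f x\<bar>" for x
    using B[of x] by (cases "f x = 0") (simp_all add: abs_mult mult.commute mult_right_mono)
  have i: "integrable M (\<lambda>x. B * \<bar>f x\<bar>)" using f by simp
  show i2: "integrable M (\<lambda>x. f x * g x)"
    by (rule Bochner_Integration.integrable_bound[OF i]) (use le in \<open>auto intro: order_trans[OF _ abs_ge_self]\<close>)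
  have "\<bar>\<integral>x. f x * g x \<partial>M\<bar> \<le> (\<integral>x. \<bar>f x * g x\<bar> \<partial>M)"
    using integral_norm_bound[of M "\<lambda>x. f x * g x"] by simp
  also have "\<dots> \<le> (\<integral>x. B * \<bar>f x\<bar> \<partial>M)"
    using i2 i le by (intro integral_mono) auto
  finally show "\<bar>\<integral>x. f x * g x \<partial>M\<bar> \<le> B * (\<integral>x. \<bar>f x\<bar> \<partial>M)" by simp
qed

text \<open>The first factor plays the role of a distribution and the second that of the test
  function; this view (\<open>conv_eq_distr_conv\<close>) yields all derivatives of a convolution
  without differentiating under the integral.\<close>

definition conv :: "(real^'n::finite \<Rightarrow> real) \<Rightarrow> (real^'n \<Rightarrow> real) \<Rightarrow> real^'n \<Rightarrow> real" where
  "conv w \<psi> x = (\<integral>y. w y * \<psi> (x - y) \<partial>lborel)"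

lemma distribution_function:
  fixes w :: "real^'n::finite \<Rightarrow> real"
  assumes w: "integrable lborel w"
  shows "distribution (\<lambda>\<psi>. \<integral>y. w y * \<psi> y \<partial>lborel)"
  unfolding distribution_def
proof (intro conjI ballI allI)
  have int: "integrable lborel (\<lambda>y. w y * \<psi> y)" if \<psi>: "\<psi> \<in> test_functions" for \<psi>
  proof -
    obtain B where "\<forall>x. \<bar>\<psi> x\<bar> \<le> B" using test_functions_bounded[OF \<psi>] by blast
    then show ?thesis using \<psi> by (intro integral_mult_bounded(1)[OF w, of _ B]) auto
  qed
  fix \<psi> \<eta> :: "real^'n \<Rightarrow> real" and a b :: real assume *: "\<psi> \<in> test_functions" "\<eta> \<in> test_functions"
  have "(\<lambda>y. w y * (a * \<psi> y + b * \<eta> y)) = (\<lambda>y. a * (w y * \<psi> y) + b * (w y * \<eta> y))"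
    by (simp add: algebra_simps)
  then show "(\<integral>y. w y * (a * \<psi> y + b * \<eta> y) \<partial>lborel) = a * (\<integral>y. w y * \<psi> y \<partial>lborel) + b * (\<integral>y. w y * \<eta> y \<partial>lborel)"
    using int[OF *(1)] int[OF *(2)] by simp
next
  fix R :: real
  show "\<exists>C\<ge>0. \<exists>m. \<forall>\<psi>\<in>test_functions. \<forall>B. (\<forall>x. R < norm x \<longrightarrow> \<psi> x = 0) \<longrightarrow>
        (\<forall>js x. length js \<le> m \<longrightarrow> \<bar>pdiffs js \<psi> x\<bar> \<le> B) \<longrightarrow> \<bar>\<integral>y. w y * \<psi> y \<partial>lborel\<bar> \<le> C * B"
  proof (intro exI[of _ "\<integral>x. \<bar>w x\<bar> \<partial>lborel"] exI[of _ 0] conjI ballI allI impI)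
    fix \<psi> :: "real^'n \<Rightarrow> real" and B assume \<psi>: "\<psi> \<in> test_functions" and B: "\<forall>js x. length js \<le> 0 \<longrightarrow> \<bar>pdiffs js \<psi> x\<bar> \<le> B"
    have "\<bar>\<psi> x\<bar> \<le> B" for x using B by (metis le_zero_eq list.size(3) pdiffs_Nil)
    then show "\<bar>\<integral>y. w y * \<psi> y \<partial>lborel\<bar> \<le> (\<integral>x. \<bar>w x\<bar> \<partial>lborel) * B"
      using integral_mult_bounded(2)[OF w, of \<psi> B] \<psi> by (simp add: mult.commute)
  qed auto
qed

lemma conv_eq_distr_conv: "conv w \<psi> = distr_conv (\<lambda>\<eta>. \<integral>y. w y * \<eta> y \<partial>lborel) \<psi>"
  by (simp add: conv_def distr_conv_def fun_eq_iff)

lemma pdiffs_conv: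
  "integrable lborel w \<Longrightarrow> \<psi> \<in> test_functions \<Longrightarrow> pdiffs js (conv w \<psi>) = conv w (pdiffs js \<psi>)"
  unfolding conv_eq_distr_conv by (intro pdiffs_distr_conv distribution_function)

lemma conv_support:
  assumes "\<forall>x. R < norm x \<longrightarrow> w x = 0" "\<forall>x. R' < norm x \<longrightarrow> \<psi> x = 0" "R + R' < norm x"
  shows "conv w \<psi> x = 0"
proof -
  have "w y * \<psi> (x - y) = 0" for y
  proof (cases "R < norm y")
    case False
    then have "R' < norm (x - y)" using assms(3) norm_triangle_ineq2[of x y] by linarith
    then show ?thesis using assms(2) by simp
  qed (use assms(1) in simp)
  then have "(\<lambda>y. w y * \<psi> (x - y)) = (\<lambda>y. 0)" by blast
  then show ?thesis by (simp add: conv_def)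
qed

lemma conv_test_function:
  assumes "integrable lborel w" "\<forall>x. R < norm x \<longrightarrow> w x = 0" "\<psi> \<in> test_functions"
  shows "conv w \<psi> \<in> test_functions"
proof -
  obtain R' where R': "\<forall>x. R' < norm x \<longrightarrow> \<psi> x = 0"
    using test_functions_support[OF assms(3)] by blast
  show ?thesis
    using conv_support[OF assms(2) R'] smooth_distr_conv[OF distribution_function[OF assms(1)] assms(3)]
    unfolding conv_eq_distr_conv by (intro test_functionsI[of _ "R + R'"])
qed

lemma conv_test_functions:
  "f \<in> test_functions \<Longrightarrow> g \<in> test_functions \<Longrightarrow> conv f g \<in> test_functions"
  using conv_test_function[OF test_functions_integrable] test_functions_support[of f] by blast

lemma conv_bound:
  fixes w \<psi> :: "real^'n::finite \<Rightarrow> real"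
  assumes "integrable lborel w" "\<psi> \<in> borel_measurable borel" "\<And>x. \<bar>\<psi> x\<bar> \<le> B"
  shows "\<bar>conv w \<psi> x\<bar> \<le> B * (\<integral>x. \<bar>w x\<bar> \<partial>lborel)"
  unfolding conv_def by (rule integral_mult_bounded) (use assms in simp_all)

text \<open>Since \<open>w\<close> has mass one, \<open>\<psi> x\<close> may be moved under the
  integral, and only differences of \<open>\<psi>\<close> over distances at most \<open>r\<close>
  remain.\<close>

lemma conv_diff_bound:
  fixes w \<psi> :: "real^'n::finite \<Rightarrow> real"
  assumes w: "integrable lborel w" "(\<integral>x. w x \<partial>lborel) = 1" "\<forall>x. r < norm x \<longrightarrow> w x = 0"
    and \<psi>: "\<psi> \<in> borel_measurable borel" "\<And>x. \<bar>\<psi> x\<bar> \<le> B" "\<And>x y. \<bar>\<psi> x - \<psi> y\<bar> \<le> L * norm (x - y)" "L \<ge> 0"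
  shows "\<bar>\<psi> x - conv w \<psi> x\<bar> \<le> L * r * (\<integral>x. \<bar>w x\<bar> \<partial>lborel)"
proof -
  have "integrable lborel (\<lambda>y. w y * \<psi> (x - y))"
    by (rule integral_mult_bounded) (use assms in simp_all)
  then have "\<psi> x - conv w \<psi> x = (\<integral>y. w y * (\<psi> x - \<psi> (x - y)) \<partial>lborel)"
    using w(1,2) by (simp add: conv_def right_diff_distrib)
  moreover have "\<bar>\<integral>y. w y * (\<psi> x - \<psi> (x - y)) \<partial>lborel\<bar> \<le> L * r * (\<integral>x. \<bar>w x\<bar> \<partial>lborel)"
  proof (rule integral_mult_bounded(2)[OF w(1)])
    fix y assume "w y \<noteq> 0"
    then have "norm y \<le> r" using w(3) by (meson not_le)
    then show "\<bar>\<psi> x - \<psi> (x - y)\<bar> \<le> L * r"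
      using \<psi>(3)[of x "x - y"] mult_left_mono[OF _ \<psi>(4), of "norm y" r] by simp
  qed (use \<psi> in simp)
  ultimately show ?thesis by simp
qed

lemma conv_commute:
  fixes f g :: "real^'n::finite \<Rightarrow> real"
  assumes "f \<in> borel_measurable borel" "g \<in> borel_measurable borel"
  shows "conv f g = conv g f"
proof
  fix x
  show "conv f g x = conv g f x"
    using lborel_integral_reflect(2)[of "\<lambda>y. f y * g (x - y)" x] assms
    by (simp add: conv_def mult.commute)
qed

lemma dilate_conv:
  fixes f g :: "real^'n::finite \<Rightarrow> real"
  assumes "f \<in> borel_measurable borel" "g \<in> borel_measurable borel" "t > 0"
  shows "dilate (conv f g) t = conv (dilate f t) (dilate g t)"
proof
  fix x
  have [measurable]: "f \<in> borel_measurable borel" "g \<in> borel_measurable borel" by fact+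
  have [measurable]: "dilate f t \<in> borel_measurable borel" "dilate g t \<in> borel_measurable borel"
    unfolding dilate_def[abs_def] by measurable
  have "conv (dilate f t) (dilate g t) x = t ^ CARD('n) * (\<integral>y. dilate f t (t *\<^sub>R y) * dilate g t (x - t *\<^sub>R y) \<partial>lborel)"
    unfolding conv_def using lborel_integral_affine(2)[of "\<lambda>y. dilate f t y * dilate g t (x - y)" t 0] \<open>t > 0\<close>
    by simp
  also have "(\<lambda>y. dilate f t (t *\<^sub>R y) * dilate g t (x - t *\<^sub>R y)) = (\<lambda>y. (1 / t ^ CARD('n)) * (1 / t ^ CARD('n)) * (f y * g (x /\<^sub>R t - y)))"
    using \<open>t > 0\<close> by (simp add: dilate_def fun_eq_iff scaleR_diff_right)
  finally show "dilate (conv f g) t x = conv (dilate f t) (dilate g t) x"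
    using \<open>t > 0\<close> by (simp add: dilate_def conv_def)
qed

section \<open>Riemann sums, and a distribution under an integral sign\<close>

text \<open>A finite cover of the compact ball by small balls, made disjoint by removing from each
  the earlier ones. The sample points are kept in the large ball, so that translates by them have
  uniformly bounded support.\<close>

lemma fine_partition:
  assumes "d > 0"
  shows "\<exists>(n::nat) z P. (\<forall>i<n. P i \<in> sets borel \<and> z i \<in> cball 0 R \<and> P i \<subseteq> ball (z i) d) \<and>
    disjoint_family_on P {..<n} \<and> (\<Union>i<n. P i) = cball (0::'a::euclidean_space) R"
proof -
  have "cball 0 R \<subseteq> (\<Union>x\<in>cball 0 R. ball (x::'a) d)" using assms by auto
  from compactE_image[OF compact_cball _ this] obtain K
    where K: "K \<subseteq> cball 0 R" "finite K" "cball 0 R \<subseteq> (\<Union>x\<in>K. ball (x::'a) d)" by auto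
  obtain n :: nat and z where z: "K = z ` {i. i < n}"
    using finite_imp_nat_seg_image_inj_on[OF K(2)] by blast
  define P where "P i = (ball (z i) d - (\<Union>j<i. ball (z j) d)) \<inter> cball 0 R" for i
  have "disjoint_family_on P {..<n}"
  proof -
    have "P i \<inter> P j = {}" if "i < j" for i j using that by (auto simp: P_def)
    then show ?thesis unfolding disjoint_family_on_def by (metis Int_commute linorder_neqE_nat)
  qed
  moreover have "(\<Union>i<n. P i) = cball 0 R"
  proof
    show "cball 0 R \<subseteq> (\<Union>i<n. P i)"
    proof
      fix x :: 'a assume x: "x \<in> cball 0 R"
      then have "\<exists>i. i < n \<and> x \<in> ball (z i) d" using K(3) z by blast
      from exists_least_iff[THEN iffD1, OF this] obtain i
        where i: "i < n \<and> x \<in> ball (z i) d" "\<forall>j<i. \<not> (j < n \<and> x \<in> ball (z j) d)"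
        by blast
      then have "x \<in> P i" using x unfolding P_def by (auto dest: order.strict_trans)
      with i show "x \<in> (\<Union>i<n. P i)" by blast
    qed
  qed (auto simp: P_def)
  moreover have "\<forall>i<n. P i \<in> sets borel \<and> z i \<in> cball 0 R \<and> P i \<subseteq> ball (z i) d"
    using K(1) z by (auto simp: P_def)
  ultimately show ?thesis by blast
qed

text \<open>The Riemann sum is the integral of \<open>\<psi>\<close> against the step function
  \<open>s\<close> with value \<open>g (z i)\<close> on \<open>P i\<close>. The weights are
  integrals of \<open>\<psi>\<close> over the cells, so only \<open>g\<close> is sampled.\<close>

lemma riemann_sum_bound:
  fixes \<psi> g :: "'a::euclidean_space \<Rightarrow> real"
  assumes \<psi>: "integrable lborel \<psi>" "\<forall>x. R < norm x \<longrightarrow> \<psi> x = 0" and [measurable]: "g \<in> borel_measurable borel"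
    and P: "\<And>i. i < n \<Longrightarrow> P i \<in> sets borel" "disjoint_family_on P {..<n::nat}" "(\<Union>i<n. P i) = cball 0 R"
    and \<omega>: "\<And>i x. i < n \<Longrightarrow> x \<in> P i \<Longrightarrow> \<bar>g x - g (z i)\<bar> \<le> \<omega>"
  shows "integrable lborel (\<lambda>x. \<psi> x * g x)"
    and "\<bar>(\<integral>x. \<psi> x * g x \<partial>lborel) - (\<Sum>i<n. (\<integral>x. indicator (P i) x * \<psi> x \<partial>lborel) * g (z i))\<bar> \<le> \<omega> * (\<integral>x. \<bar>\<psi> x\<bar> \<partial>lborel)"
proof -
  define s where "s x = (\<Sum>i<n. indicator (P i) x * g (z i))" for x
  have [measurable]: "s \<in> borel_measurable borel" unfolding s_def using P(1) by measurable
  have ind: "integrable lborel (\<lambda>x. indicator (P i) x * \<psi> x)" if "i < n" for i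
    using integrable_mult_indicator[of "P i" lborel \<psi>] \<psi>(1) P(1)[OF that] by simp
  have \<psi>s: "(\<lambda>x. \<psi> x * s x) = (\<lambda>x. \<Sum>i<n. indicator (P i) x * \<psi> x * g (z i))"
    by (rule ext) (simp only: s_def sum_distrib_left mult_ac)
  have int_s: "integrable lborel (\<lambda>x. \<psi> x * s x)"
    unfolding \<psi>s using ind by (intro Bochner_Integration.integrable_sum) auto
  have b: "\<bar>g x - s x\<bar> \<le> \<omega>" if "\<psi> x \<noteq> 0" for x
  proof -
    have "norm x \<le> R" using that \<psi>(2) by (meson not_le)
    then obtain i where i: "i < n" "x \<in> P i" using P(3) by (metis UN_E lessThan_iff mem_cball_0)
    have "indicator (P j) x * g (z j) = (if j = i then g (z i) else 0)" if "j < n" for j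
      using P(2) i that unfolding disjoint_family_on_def by (auto simp: indicator_def)
    then have "s x = g (z i)" using i by (simp add: s_def)
    then show ?thesis using \<omega>[OF i] by simp
  qed
  have 1: "integrable lborel (\<lambda>x. \<psi> x * (g x - s x))"
    by (rule integral_mult_bounded(1)[OF \<psi>(1) _ b]) simp_all
  have 2: "\<bar>\<integral>x. \<psi> x * (g x - s x) \<partial>lborel\<bar> \<le> \<omega> * (\<integral>x. \<bar>\<psi> x\<bar> \<partial>lborel)"
    by (rule integral_mult_bounded(2)[OF \<psi>(1) _ b]) simp_all
  show i: "integrable lborel (\<lambda>x. \<psi> x * g x)"
    using Bochner_Integration.integrable_add[OF 1 int_s] by (simp add: algebra_simps)
  have "(\<integral>x. \<psi> x * s x \<partial>lborel) = (\<Sum>i<n. (\<integral>x. indicator (P i) x * \<psi> x \<partial>lborel) * g (z i))"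
    unfolding \<psi>s by (subst Bochner_Integration.integral_sum) (use ind in simp_all)
  then show "\<bar>(\<integral>x. \<psi> x * g x \<partial>lborel) - (\<Sum>i<n. (\<integral>x. indicator (P i) x * \<psi> x \<partial>lborel) * g (z i))\<bar> \<le> \<omega> * (\<integral>x. \<bar>\<psi> x\<bar> \<partial>lborel)"
    using 2 i int_s by (simp add: right_diff_distrib)
qed

lemma uminus_test_functions:
  "\<theta> \<in> test_functions \<Longrightarrow> (\<lambda>x. \<theta> (- x)) \<in> test_functions"
  using test_functions_reflect[of \<theta> 0] by simp

text \<open>Riemann sums in \<open>x\<close> are finite combinations of reflected translates of
  \<open>\<theta>\<close>, to which linearity of \<open>T\<close> applies. They converge to the
  integral with all derivatives in \<open>y\<close>, because every derivative of
  \<open>\<theta>\<close> is Lipschitz; their images under \<open>T\<close> are Riemann sums of the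
  continuous function \<open>distr_conv T \<theta>\<close>.\<close>

lemma distribution_integral:
  fixes \<psi> \<theta> :: "real^'n::finite \<Rightarrow> real"
  assumes T: "distribution T" and \<theta>: "\<theta> \<in> test_functions"
    and \<psi>: "integrable lborel \<psi>" "\<forall>x. R < norm x \<longrightarrow> \<psi> x = 0"
  shows "integrable lborel (\<lambda>x. \<psi> x * distr_conv T \<theta> x)" (is ?A)
    and "T (\<lambda>y. \<integral>x. \<psi> x * \<theta> (x - y) \<partial>lborel) = (\<integral>x. \<psi> x * distr_conv T \<theta> x \<partial>lborel)" (is ?B)
proof -
  define \<theta>' where "\<theta>' = (\<lambda>x. \<theta> (- x))"
  have \<theta>': "\<theta>' \<in> test_functions" unfolding \<theta>'_def by (rule uminus_test_functions[OF \<theta>])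
  have conv: "(\<lambda>y. \<integral>x. \<psi> x * \<theta> (x - y) \<partial>lborel) = conv \<psi> \<theta>'"
    by (rule ext) (simp add: conv_def \<theta>'_def)
  define I where "I = (\<integral>x. \<bar>\<psi> x\<bar> \<partial>lborel)"
  have I: "I \<ge> 0" by (simp add: I_def)
  have "\<forall>k. \<exists>n z P. (\<forall>i<n. P i \<in> sets borel \<and> z i \<in> cball 0 R \<and> P i \<subseteq> ball (z i) (1 / real (Suc k))) \<and>
    disjoint_family_on P {..<n} \<and> (\<Union>i<n::nat. P i) = cball (0::real^'n) R"
    by (intro allI fine_partition) simp
  then obtain n z P where P: "\<And>k. (\<forall>i<n k. P k i \<in> sets borel \<and> z k i \<in> cball 0 R \<and> P k i \<subseteq> ball (z k i) (1 / real (Suc k))) \<and>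
    disjoint_family_on (P k) {..<n k} \<and> (\<Union>i<n k::nat. P k i) = cball (0::real^'n) R"
    by metis
  define c where "c k i = (\<integral>x. indicator (P k i) x * \<psi> x \<partial>lborel)" for k i
  \<comment> \<open>The error of the \<open>k\<close>-th Riemann sum as a function of
    \<open>y\<close>, written as a two-term combination for the linearity rule.\<close>
  define Q where "Q k = (\<lambda>y. 1 * conv \<psi> \<theta>' y + (-1) * (\<Sum>i<n k. c k i * \<theta> (z k i - y)))" for k
  have ct: "conv \<psi> \<theta>' \<in> test_functions" by (rule conv_test_function[OF \<psi> \<theta>'])
  have st: "(\<lambda>y. \<Sum>i<n k. c k i * \<theta> (z k i - y)) \<in> test_functions"
    "T (\<lambda>y. \<Sum>i<n k. c k i * \<theta> (z k i - y)) = (\<Sum>i<n k. c k i * distr_conv T \<theta> (z k i))" for k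
    using distribution_sum[OF T, of "{..<n k}" "\<lambda>i y. \<theta> (z k i - y)" "c k"] test_functions_reflect[OF \<theta>]
    by (auto simp: distr_conv_def)
  have Q: "Q k \<in> test_functions" for k
    unfolding Q_def by (intro test_functions_lincomb ct st)
  have TQ: "T (Q k) = T (conv \<psi> \<theta>') - (\<Sum>i<n k. c k i * distr_conv T \<theta> (z k i))" for k
    unfolding Q_def using distribution_lincomb[OF T ct st(1), of 1 "-1" k] st(2) by simp
  obtain R' where R': "R' > 0" "\<forall>x. R' < norm x \<longrightarrow> \<theta> x = 0"
    using test_functions_support[OF \<theta>] by blast
  have supp: "Q k y = 0" if "R + R' < norm y" for k y
  proof -
    have "\<theta> (z k i - y) = 0" if i: "i < n k" for i
    proof -
      have "norm (z k i) \<le> R" using P i by simp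
      then have "R' < norm (z k i - y)"
        using \<open>R + R' < norm y\<close> norm_triangle_ineq2[of y "z k i"] by (simp add: norm_minus_commute)
      then show ?thesis using R' by simp
    qed
    moreover have "conv \<psi> \<theta>' y = 0"
      by (rule conv_support[OF \<psi>(2) _ that]) (use R' in \<open>simp add: \<theta>'_def\<close>)
    ultimately show ?thesis by (simp add: Q_def)
  qed
  have one_div: "\<forall>\<^sub>F k in sequentially. K * (1 / real (Suc k)) \<le> e" if "e > 0" for K e :: real
  proof -
    have "(\<lambda>k. K * (1 / real (Suc k))) \<longlonglongrightarrow> K * 0"
      using LIMSEQ_inverse_real_of_nat by (intro tendsto_intros) (simp add: inverse_eq_divide)
    then show ?thesis
      using that by (intro eventually_mono[OF order_tendstoD(2)]) auto
  qed
  have lim1: "(\<lambda>k. T (Q k)) \<longlonglongrightarrow> 0"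
  proof (rule distribution_tendsto_zero[OF T, where R = "R + R'"])
    show "\<forall>\<^sub>F k in sequentially. Q k \<in> test_functions \<and> (\<forall>x. R + R' < norm x \<longrightarrow> Q k x = 0)"
      using Q supp by simp
    fix js :: "'n list" and e :: real assume e: "e > 0"
    define \<theta>d where "\<theta>d = pdiffs js \<theta>"
    have \<theta>d: "\<theta>d \<in> test_functions" unfolding \<theta>d_def by (rule test_functions_pdiffs[OF \<theta>])
    obtain L where L: "L \<ge> 0" "\<forall>x y. \<bar>\<theta>d x - \<theta>d y\<bar> \<le> L * norm (x - y)"
      using test_functions_lipschitz[OF \<theta>d] by blast
    have pd: "pdiffs js (Q k) y = (-1) ^ length js * ((\<integral>x. \<psi> x * \<theta>d (x - y) \<partial>lborel) - (\<Sum>i<n k. c k i * \<theta>d (z k i - y)))" for k y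
    proof -
      have "pdiffs js \<theta>' = (\<lambda>y. (-1) ^ length js * \<theta>d (- y))"
        unfolding \<theta>'_def \<theta>d_def using pdiffs_reflect[OF test_functions_smooth[OF \<theta>], of js 0] by simp
      then have "pdiffs js (conv \<psi> \<theta>') y = (-1) ^ length js * (\<integral>x. \<psi> x * \<theta>d (x - y) \<partial>lborel)"
        unfolding pdiffs_conv[OF \<psi>(1) \<theta>'] by (simp add: conv_def mult.left_commute[of _ "(-1) ^ length js"])
      moreover have "pdiffs js (\<lambda>y. \<Sum>i<n k. c k i * \<theta> (z k i - y)) y = (-1) ^ length js * (\<Sum>i<n k. c k i * \<theta>d (z k i - y))"
        using smooth_sum[THEN conjunct2, of "{..<n k}" "\<lambda>i y. \<theta> (z k i - y)" js "c k"]
          pdiffs_reflect[OF test_functions_smooth[OF \<theta>], of js] smooth_reflect[OF test_functions_smooth[OF \<theta>]]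
        by (simp add: \<theta>d_def sum_distrib_left mult.left_commute)
      ultimately show ?thesis
        unfolding Q_def pdiffs_lincomb[OF test_functions_smooth[OF ct] test_functions_smooth[OF st(1)]]
        by (simp add: algebra_simps)
    qed
    have "\<bar>pdiffs js (Q k) y\<bar> \<le> (L * I) * (1 / real (Suc k))" for k y
    proof -
      have "\<bar>(\<integral>x. \<psi> x * \<theta>d (x - y) \<partial>lborel) - (\<Sum>i<n k. c k i * \<theta>d (z k i - y))\<bar> \<le> (L * (1 / real (Suc k))) * I"
        unfolding c_def I_def
      proof (rule riemann_sum_bound(2)[OF \<psi>])
        show "(\<lambda>x. \<theta>d (x - y)) \<in> borel_measurable borel" using test_functions_measurable[OF \<theta>d] by simp
        fix i x assume i: "i < n k" "x \<in> P k i"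
        then have "norm (x - z k i) \<le> 1 / real (Suc k)"
          using P[of k] by (force simp: dist_norm norm_minus_commute)
        then show "\<bar>\<theta>d (x - y) - \<theta>d (z k i - y)\<bar> \<le> L * (1 / real (Suc k))"
          using L(2)[rule_format, of "x - y" "z k i - y"] mult_left_mono[OF _ L(1)]
          by (intro order_trans[OF L(2)[rule_format]] mult_left_mono L(1)) simp
      qed (use P in auto)
      then show ?thesis by (simp add: pd abs_mult power_abs mult_ac)
    qed
    then show "\<forall>\<^sub>F k in sequentially. \<forall>y. \<bar>pdiffs js (Q k) y\<bar> \<le> e"
      using one_div[OF e, of "L * I"] by (auto elim!: eventually_mono intro: order_trans)
  qed
  let ?u = "distr_conv T \<theta>"
  have cu: "continuous_on S ?u" for S
    by (intro smooth_continuous smooth_distr_conv T \<theta>)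
  have [measurable]: "?u \<in> borel_measurable borel"
    by (intro borel_measurable_continuous_onI cu)
  have uc: "uniformly_continuous_on (cball 0 R) ?u"
    by (intro compact_uniformly_continuous cu compact_cball)
  have osc: "\<forall>\<^sub>F k in sequentially. \<forall>i x. i < n k \<longrightarrow> x \<in> P k i \<longrightarrow> \<bar>?u x - ?u (z k i)\<bar> \<le> e" if e: "e > 0" for e
  proof -
    obtain d where d: "d > 0" "\<And>x x'. x \<in> cball 0 R \<Longrightarrow> x' \<in> cball 0 R \<Longrightarrow> dist x' x < d \<Longrightarrow> dist (?u x') (?u x) < e"
      using uc e unfolding uniformly_continuous_on_def by metis
    from one_div[OF half_gt_zero[OF d(1)], of 1] show ?thesis
    proof eventually_elim
      case (elim k)
      show ?case
      proof (intro allI impI)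
        fix i x assume i: "i < n k" "x \<in> P k i"
        have "x \<in> cball 0 R" using i P[of k] by blast
        moreover have "z k i \<in> cball 0 R" using i P[of k] by blast
        moreover have "dist (z k i) x < 1 / real (Suc k)" using i P[of k] by (meson mem_ball subsetD)
        then have "dist x (z k i) < d" using elim d(1) by (simp add: dist_commute)
        ultimately show "\<bar>?u x - ?u (z k i)\<bar> \<le> e" using d(2)[of "z k i" x] by (simp add: dist_real_def)
      qed
    qed
  qed
  have rs: "integrable lborel (\<lambda>x. \<psi> x * ?u x) \<and>
     \<bar>(\<integral>x. \<psi> x * ?u x \<partial>lborel) - (\<Sum>i<n k. c k i * ?u (z k i))\<bar> \<le> e * I"
    if "\<forall>i x. i < n k \<longrightarrow> x \<in> P k i \<longrightarrow> \<bar>?u x - ?u (z k i)\<bar> \<le> e" for k e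
    unfolding c_def I_def
    by (intro conjI riemann_sum_bound[OF \<psi>, where n = "n k" and P = "P k" and z = "z k"]) (use P that in auto)
  show ?A
    using eventually_happens[OF osc[of 1]] rs by auto
  have lim2: "(\<lambda>k. (\<integral>x. \<psi> x * ?u x \<partial>lborel) - (\<Sum>i<n k. c k i * ?u (z k i))) \<longlonglongrightarrow> 0"
  proof (rule tendstoI)
    fix e :: real assume e: "e > 0"
    define e' where "e' = e / (2 * (I + 1))"
    have e': "e' > 0" "e' * I < e" using e I by (auto simp: e'_def field_simps intro: add_nonneg_pos)
    from osc[OF e'(1)] show "\<forall>\<^sub>F k in sequentially. dist ((\<integral>x. \<psi> x * ?u x \<partial>lborel) - (\<Sum>i<n k. c k i * ?u (z k i))) 0 < e"
    proof eventually_elim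
      case (elim k)
      with rs[OF elim] e' show ?case by simp
    qed
  qed
  have "(\<lambda>k. T (conv \<psi> \<theta>') - (\<integral>x. \<psi> x * ?u x \<partial>lborel)) \<longlonglongrightarrow> 0 - 0"
    using tendsto_diff[OF lim1 lim2] by (simp add: TQ)
  then show ?B
    unfolding conv by (simp add: LIMSEQ_const_iff)
qed

text \<open>Associativity of convolution,
  \<open>T * (\<eta> * \<psi>) = \<eta> * (T * \<psi>)\<close>; after a reflection it is the
  interchange of \<open>T\<close> with an integral.\<close>

lemma distr_conv_conv:
  fixes \<eta> \<psi> :: "real^'n::finite \<Rightarrow> real"
  assumes T: "distribution T" and \<eta>: "\<eta> \<in> test_functions" and \<psi>: "\<psi> \<in> test_functions"
  shows "distr_conv T (conv \<eta> \<psi>) x = (\<integral>z. \<eta> z * distr_conv T \<psi> (x - z) \<partial>lborel)"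
    and "integrable lborel (\<lambda>z. \<eta> z * distr_conv T \<psi> (x - z))"
proof -
  have [measurable]: "\<eta> \<in> borel_measurable borel" "\<psi> \<in> borel_measurable borel" using \<eta> \<psi> by auto
  have [measurable]: "distr_conv T \<psi> \<in> borel_measurable borel"
    by (intro borel_measurable_continuous_onI smooth_continuous smooth_distr_conv T \<psi>)
  let ?h = "\<lambda>w. \<eta> (x - w)"
  have h: "?h \<in> test_functions" by (rule test_functions_reflect[OF \<eta>])
  obtain R where R: "\<forall>x. R < norm x \<longrightarrow> ?h x = 0"
    using test_functions_support[OF h] by blast
  have "conv \<eta> \<psi> (x - y) = (\<integral>w. ?h w * \<psi> (w - y) \<partial>lborel)" for y
    unfolding conv_def using lborel_integral_reflect(2)[of "\<lambda>z. \<eta> z * \<psi> (x - y - z)" x]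
    by (simp add: algebra_simps)
  then have "distr_conv T (conv \<eta> \<psi>) x = T (\<lambda>y. \<integral>w. ?h w * \<psi> (w - y) \<partial>lborel)"
    by (simp add: distr_conv_def)
  also have "\<dots> = (\<integral>w. ?h w * distr_conv T \<psi> w \<partial>lborel)"
    by (rule distribution_integral[OF T \<psi> test_functions_integrable[OF h] R])
  also have "\<dots> = (\<integral>z. \<eta> z * distr_conv T \<psi> (x - z) \<partial>lborel)"
    using lborel_integral_reflect(2)[of "\<lambda>z. \<eta> z * distr_conv T \<psi> (x - z)" x] by simp
  finally show "distr_conv T (conv \<eta> \<psi>) x = (\<integral>z. \<eta> z * distr_conv T \<psi> (x - z) \<partial>lborel)" .
  show "integrable lborel (\<lambda>z. \<eta> z * distr_conv T \<psi> (x - z))"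
    using distribution_integral(1)[OF T \<psi> test_functions_integrable[OF h] R]
     lborel_integral_reflect(1)[of "\<lambda>z. \<eta> z * distr_conv T \<psi> (x - z)" x] by simp
qed

section \<open>Approximate identities\<close>

text \<open>Each derivative of \<open>\<psi>\<close> is Lipschitz, so mollifying at scale
  \<open>t k\<close> changes it uniformly by at most a multiple of \<open>t k\<close>; the supports
  stay in a fixed ball once \<open>t k < 1\<close>.\<close>

lemma distribution_mollify:
  fixes \<phi> \<psi> :: "real^'n::finite \<Rightarrow> real"
  assumes T: "distribution T" and \<phi>: "\<phi> \<in> test_functions" "(\<integral>x. \<phi> x \<partial>lborel) = 1" and \<psi>: "\<psi> \<in> test_functions"
    and t: "t \<longlonglongrightarrow> 0" "\<And>k. t k > 0"
  shows "(\<lambda>k. T (conv (dilate \<phi> (t k)) \<psi>)) \<longlonglongrightarrow> T \<psi>"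
proof -
  obtain R where R: "R > 0" "\<forall>x. R < norm x \<longrightarrow> \<phi> x = 0" using test_functions_support[OF \<phi>(1)] by blast
  obtain R' where R': "R' > 0" "\<forall>x. R' < norm x \<longrightarrow> \<psi> x = 0" using test_functions_support[OF \<psi>] by blast
  note d = test_functions_dilate[OF \<phi>(1) t(2)]
  note di = test_functions_integrable[OF d]
  have m[measurable]: "\<phi> \<in> borel_measurable borel" using \<phi> by auto
  have ds: "\<forall>x. t k * R < norm x \<longrightarrow> dilate \<phi> (t k) x = 0" for k
    using dilate_support[of R \<phi> "t k"] R t(2) by auto
  define Q where "Q k = (\<lambda>x. \<psi> x - conv (dilate \<phi> (t k)) \<psi> x)" for k
  have ct: "conv (dilate \<phi> (t k)) \<psi> \<in> test_functions" for k
    by (intro conv_test_functions d \<psi>)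
  have Q: "Q k \<in> test_functions" for k
    unfolding Q_def by (intro test_functions_diff ct \<psi>)
  have TQ: "T (Q k) = T \<psi> - T (conv (dilate \<phi> (t k)) \<psi>)" for k
    unfolding Q_def by (intro distribution_diff T ct \<psi>)
  have "(\<lambda>k. T (Q k)) \<longlonglongrightarrow> 0"
  proof (rule distribution_tendsto_zero[OF T, where R = "R + R'"])
    have "\<forall>\<^sub>F k in sequentially. t k < 1" using t(1) by (rule order_tendstoD) simp
    then show "\<forall>\<^sub>F k in sequentially. Q k \<in> test_functions \<and> (\<forall>x. R + R' < norm x \<longrightarrow> Q k x = 0)"
    proof eventually_elim
      case (elim k)
      have "Q k x = 0" if x: "R + R' < norm x" for x
      proof -
        have "t k * R \<le> R" using elim R by simp
        then have "conv (dilate \<phi> (t k)) \<psi> x = 0"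
          using x by (intro conv_support[OF ds R'(2)]) simp
        then show ?thesis using R R' x by (simp add: Q_def)
      qed
      with Q show ?case by blast
    qed
    fix js :: "'n list" and e :: real assume e: "e > 0"
    define \<psi>d where "\<psi>d = pdiffs js \<psi>"
    have \<psi>d: "\<psi>d \<in> test_functions" unfolding \<psi>d_def by (rule test_functions_pdiffs[OF \<psi>])
    obtain L where L: "L \<ge> 0" "\<forall>x y. \<bar>\<psi>d x - \<psi>d y\<bar> \<le> L * norm (x - y)"
      using test_functions_lipschitz[OF \<psi>d] by blast
    obtain B where B: "\<forall>x. \<bar>\<psi>d x\<bar> \<le> B"
      using test_functions_bounded[OF \<psi>d] by blast
    define I where "I = (\<integral>x. \<bar>\<phi> x\<bar> \<partial>lborel)"
    have le: "\<bar>pdiffs js (Q k) x\<bar> \<le> L * (t k * R) * I" for k x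
    proof -
      have "pdiffs js (Q k) = (\<lambda>x. \<psi>d x - conv (dilate \<phi> (t k)) \<psi>d x)"
        using pdiffs_lincomb[OF test_functions_smooth[OF \<psi>] test_functions_smooth[OF ct], of js 1 "-1"]
        by (simp add: Q_def \<psi>d_def pdiffs_conv[OF di \<psi>])
      moreover have "\<bar>\<psi>d x - conv (dilate \<phi> (t k)) \<psi>d x\<bar> \<le> L * (t k * R) * (\<integral>x. \<bar>dilate \<phi> (t k) x\<bar> \<partial>lborel)"
        by (rule conv_diff_bound[OF di]) (use \<psi>d L B \<phi> t integral_dilate[OF m t(2)] ds in auto)
      ultimately show ?thesis by (simp add: I_def integral_abs_dilate[OF m t(2)])
    qed
    have "(\<lambda>k. L * (t k * R) * I) \<longlonglongrightarrow> L * (0 * R) * I"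
      by (intro tendsto_intros t)
    then have "\<forall>\<^sub>F k in sequentially. L * (t k * R) * I < e" using e by (auto intro: order_tendstoD)
    then show "\<forall>\<^sub>F k in sequentially. \<forall>x. \<bar>pdiffs js (Q k) x\<bar> \<le> e"
      by eventually_elim (meson le less_imp_le order_trans)
  qed
  then have "(\<lambda>k. T \<psi> - T (Q k)) \<longlonglongrightarrow> T \<psi> - 0" by (intro tendsto_intros)
  then show ?thesis by (simp add: TQ)
qed

text \<open>Pairing the regularisation of \<open>T\<close> with \<open>\<psi>\<close> means applying
  \<open>T\<close> to \<open>\<psi>\<close> mollified by the reflected kernel, which is again an
  admissible mollifier.\<close>

lemma distribution_approx:
  fixes \<phi> \<psi> :: "real^'n::finite \<Rightarrow> real"
  assumes T: "distribution T" and \<phi>: "\<phi> \<in> test_functions" "(\<integral>x. \<phi> x \<partial>lborel) = 1" and \<psi>: "\<psi> \<in> test_functions"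
    and t: "t \<longlonglongrightarrow> 0" "\<And>k. t k > 0"
  shows "(\<lambda>k. \<integral>x. \<psi> x * distr_conv T (dilate \<phi> (t k)) x \<partial>lborel) \<longlonglongrightarrow> T \<psi>"
proof -
  define \<phi>' where "\<phi>' = (\<lambda>x. \<phi> (- x))"
  have m: "\<phi> \<in> borel_measurable borel" "\<psi> \<in> borel_measurable borel" using \<phi> \<psi> by auto
  have \<phi>': "\<phi>' \<in> test_functions" "(\<integral>x. \<phi>' x \<partial>lborel) = 1"
    using \<phi> lborel_integral_reflect(2)[OF m(1), of 0] uminus_test_functions by (auto simp: \<phi>'_def)
  obtain R' where R': "\<forall>x. R' < norm x \<longrightarrow> \<psi> x = 0" using test_functions_support[OF \<psi>] by blast
  have "T (conv (dilate \<phi>' (t k)) \<psi>) = (\<integral>x. \<psi> x * distr_conv T (dilate \<phi> (t k)) x \<partial>lborel)" for k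
  proof -
    have "conv (dilate \<phi>' (t k)) \<psi> = conv \<psi> (dilate \<phi>' (t k))"
      using test_functions_dilate[OF \<phi>'(1) t(2)] m by (intro conv_commute) auto
    also have "\<dots> = (\<lambda>y. \<integral>x. \<psi> x * dilate \<phi> (t k) (x - y) \<partial>lborel)"
      by (simp add: conv_def \<phi>'_def dilate_def fun_eq_iff flip: scaleR_minus_right)
    finally show ?thesis
      using distribution_integral(2)[OF T test_functions_dilate[OF \<phi>(1) t(2)] test_functions_integrable[OF \<psi>] R', of k]
      by simp
  qed
  with distribution_mollify[OF T \<phi>' \<psi> t] show ?thesis by simp
qed

section \<open>A reproducing formula\<close>

text \<open>Applied to this distribution, associativity of convolution yields the integral of a
  convolution without a separate appeal to Fubini's theorem.\<close>

lemma distribution_lebesgue_integral: "distribution (\<lambda>\<psi>. \<integral>y. \<psi> y \<partial>lborel)"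
  unfolding distribution_def
proof (intro conjI ballI allI)
  fix \<psi> \<eta> :: "real^'n::finite \<Rightarrow> real" and a b :: real assume *: "\<psi> \<in> test_functions" "\<eta> \<in> test_functions"
  show "(\<integral>y. a * \<psi> y + b * \<eta> y \<partial>lborel) = a * (\<integral>y. \<psi> y \<partial>lborel) + b * (\<integral>y. \<eta> y \<partial>lborel)"
    using *[THEN test_functions_integrable] by simp
next
  fix R :: real
  have ball: "integrable lborel (indicator (cball (0::real^'n) R) :: _ \<Rightarrow> real)"
    using lmeasurable_cball[of "0::real^'n" R] emeasure_lborel_cball_finite[of "0::real^'n" R]
    by (intro integrable_real_indicator) auto
  show "\<exists>C\<ge>0. \<exists>m. \<forall>\<psi>\<in>test_functions. \<forall>B. (\<forall>x::real^'n. R < norm x \<longrightarrow> \<psi> x = 0) \<longrightarrow>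
        (\<forall>js x. length js \<le> m \<longrightarrow> \<bar>pdiffs js \<psi> x\<bar> \<le> B) \<longrightarrow> \<bar>\<integral>y. \<psi> y \<partial>lborel\<bar> \<le> C * B"
  proof (intro exI[of _ "\<integral>x. \<bar>indicator (cball (0::real^'n) R) x\<bar> \<partial>lborel"] exI[of _ 0] conjI ballI allI impI)
    fix \<psi> :: "real^'n \<Rightarrow> real" and B assume \<psi>: "\<psi> \<in> test_functions"
      and R: "\<forall>x::real^'n. R < norm x \<longrightarrow> \<psi> x = 0"
      and B: "\<forall>js x. length js \<le> 0 \<longrightarrow> \<bar>pdiffs js \<psi> x\<bar> \<le> B"
    have "\<bar>\<psi> x\<bar> \<le> B" for x using B by (metis le_zero_eq list.size(3) pdiffs_Nil)
    moreover have "(\<lambda>x. indicator (cball 0 R) x * \<psi> x) = \<psi>"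
      using R by (auto simp: fun_eq_iff indicator_def not_le)
    ultimately show "\<bar>\<integral>y. \<psi> y \<partial>lborel\<bar> \<le> (\<integral>x. \<bar>indicator (cball (0::real^'n) R) x\<bar> \<partial>lborel) * B"
      using integral_mult_bounded(2)[OF ball, of \<psi> B] \<psi> by (simp add: mult.commute)
  qed auto
qed

lemma integral_conv:
  fixes f g :: "real^'n::finite \<Rightarrow> real"
  assumes "f \<in> test_functions" "g \<in> test_functions"
  shows "(\<integral>x. conv f g x \<partial>lborel) = (\<integral>x. f x \<partial>lborel) * (\<integral>x. g x \<partial>lborel)"
proof -
  have m: "g \<in> borel_measurable borel" "conv f g \<in> borel_measurable borel"
    using assms conv_test_functions[OF assms] by (auto intro: test_functions_measurable)
  show ?thesis
    using distr_conv_conv(1)[OF distribution_lebesgue_integral assms, of 0]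
      lborel_integral_reflect(2)[OF m(1)] lborel_integral_reflect(2)[OF m(2), of 0]
    by (simp add: distr_conv_def)
qed

section \<open>The telescoping products and their decay\<close>

text \<open>These are the functions \<open>\<eta>\<^sub>i\<close> of the overview. The index counts
  the factors already applied, starting with none, so that two consecutive remainders differ by
  \<open>A\<^sub>i \<eta>\<^sub>i\<close>.\<close>

definition remainder ::
    "(real^'n::finite \<Rightarrow> real) \<Rightarrow> (real^'n \<Rightarrow> real) \<Rightarrow> nat \<Rightarrow> real^'n \<Rightarrow> real" where
  "remainder \<phi> \<Phi> = rec_nat \<Phi> (\<lambda>i g x. g x - conv (dilate \<phi> ((1/2) ^ i)) g x)"

lemma remainder_simps [simp]:
  "remainder \<phi> \<Phi> 0 = \<Phi>"
  "remainder \<phi> \<Phi> (Suc i) = (\<lambda>x. remainder \<phi> \<Phi> i x - conv (dilate \<phi> ((1/2) ^ i)) (remainder \<phi> \<Phi> i) x)"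
  by (simp_all add: remainder_def)

context
  fixes \<phi> \<Phi> :: "real^'n::finite \<Rightarrow> real"
  assumes \<phi>: "\<phi> \<in> test_functions" "(\<integral>x. \<phi> x \<partial>lborel) = 1" and \<Phi>: "\<Phi> \<in> test_functions"
begin

lemma dilate_half_test: "dilate \<phi> ((1/2) ^ i) \<in> test_functions"
  by (intro test_functions_dilate \<phi>) simp

lemma dilate_half_integral:
  "(\<integral>x. dilate \<phi> ((1/2) ^ i) x \<partial>lborel) = 1"
  "(\<integral>x. \<bar>dilate \<phi> ((1/2) ^ i) x\<bar> \<partial>lborel) = (\<integral>x. \<bar>\<phi> x\<bar> \<partial>lborel)"
  using integral_dilate(2)[of \<phi> "(1/2) ^ i"] integral_abs_dilate[of \<phi> "(1/2) ^ i"] \<phi> by auto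

lemma remainder_test: "remainder \<phi> \<Phi> i \<in> test_functions"
  by (induction i) (auto intro!: test_functions_diff conv_test_functions dilate_half_test \<Phi>)

text \<open>\<open>\<phi>\<close> has mass one, so the averaging operators preserve integrals. The
  vanishing mean later allows a constant to be subtracted from the function integrated against the
  remainder.\<close>

lemma remainder_integral: "(\<integral>x. \<Phi> x \<partial>lborel) = 0 \<Longrightarrow> (\<integral>x. remainder \<phi> \<Phi> i x \<partial>lborel) = 0"
proof (induction i)
  case (Suc i)
  note t = remainder_test[of i] conv_test_functions[OF dilate_half_test[of i] remainder_test[of i]]
  show ?case
    using t[THEN test_functions_integrable] Suc
    by (simp add: integral_conv[OF dilate_half_test remainder_test] dilate_half_integral)
qed simp

lemma pdiffs_remainder_Suc:
  "pdiffs js (remainder \<phi> \<Phi> (Suc i)) x =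
     pdiffs js (remainder \<phi> \<Phi> i) x - conv (dilate \<phi> ((1/2) ^ i)) (pdiffs js (remainder \<phi> \<Phi> i)) x"
proof -
  note t = remainder_test[of i] conv_test_functions[OF dilate_half_test[of i] remainder_test[of i]]
  show ?thesis
    using pdiffs_lincomb[OF t[THEN test_functions_smooth], of js 1 "-1"]
      pdiffs_conv[OF test_functions_integrable[OF dilate_half_test] remainder_test]
    by simp
qed

lemma remainder_support:
  assumes R: "\<forall>x. R < norm x \<longrightarrow> \<phi> x = 0" "\<forall>x. R < norm x \<longrightarrow> \<Phi> x = 0" "R > 0" and "3 * R < norm x"
  shows "remainder \<phi> \<Phi> i x = 0"
proof -
  \<comment> \<open>Stage \<open>i\<close> enlarges the support radius by
    \<open>R * (1/2) ^ i\<close>; the radius is therefore \<open>R\<close> plus a partial geometric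
    sum and never exceeds \<open>3 * R\<close>.\<close>
  have "\<forall>x. R + 2 * R * (1 - (1/2) ^ i) < norm x \<longrightarrow> remainder \<phi> \<Phi> i x = 0"
  proof (induction i)
    case (Suc i)
    show ?case
    proof (intro allI impI)
      fix x :: "real^'n" assume x: "R + 2 * R * (1 - (1/2) ^ Suc i) < norm x"
      have p: "R * (1/2) ^ i > 0" using R by simp
      have "conv (dilate \<phi> ((1/2) ^ i)) (remainder \<phi> \<Phi> i) x = 0"
        using x R dilate_support[of R \<phi> "(1/2) ^ i"]
        by (intro conv_support[OF _ Suc, of "(1/2) ^ i * R"]) (auto simp: algebra_simps)
      moreover have "remainder \<phi> \<Phi> i x = 0"
        using x p by (intro Suc[rule_format]) (simp add: algebra_simps)
      ultimately show "remainder \<phi> \<Phi> (Suc i) x = 0" by simp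
    qed
  qed (use R in simp)
  moreover have "R + 2 * R * (1 - (1/2) ^ i) \<le> 3 * R" using R by (simp add: algebra_simps)
  ultimately show ?thesis using assms(4) by (meson le_less_trans)
qed

text \<open>Each factor \<open>I - A\<^sub>i\<close>, where \<open>A\<^sub>i\<close> is convolution with \<open>\<phi>\<close> at scale \<open>2\<^sup>-\<^sup>i\<close>, gains \<open>2\<^sup>-\<^sup>i\<close> at the expense of one
  derivative, and costs a factor \<open>1 + \<parallel>\<phi>\<parallel>\<^sub>1\<close> otherwise.\<close>

lemma remainder_bound_aux:
  "\<exists>C\<ge>0. \<forall>i x. \<bar>pdiffs js (remainder \<phi> \<Phi> i) x\<bar> \<le> C * (1 + (\<integral>x. \<bar>\<phi> x\<bar> \<partial>lborel)) ^ i * (1/2) ^ (L * i)"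
proof (induction L arbitrary: js)
  define I where "I = (\<integral>x. \<bar>\<phi> x\<bar> \<partial>lborel)"
  have I: "I \<ge> 0" by (simp add: I_def)
  note di = test_functions_integrable[OF dilate_half_test]
  note rt = test_functions_pdiffs[OF remainder_test]
  {
    case 0
    obtain C where C: "C \<ge> 0" "\<forall>x. \<bar>pdiffs js \<Phi> x\<bar> \<le> C"
      using test_functions_bounded[OF test_functions_pdiffs[OF \<Phi>, of js]] by blast
    have "\<forall>x. \<bar>pdiffs js (remainder \<phi> \<Phi> i) x\<bar> \<le> C * (1 + I) ^ i" for i
    proof (induction i)
      case (Suc i)
      show ?case
      proof
        fix x
        have "\<bar>conv (dilate \<phi> ((1/2) ^ i)) (pdiffs js (remainder \<phi> \<Phi> i)) x\<bar> \<le> (C * (1 + I) ^ i) * I"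
          unfolding I_def dilate_half_integral(2)[of i, symmetric]
          by (rule conv_bound[OF di]) (use Suc rt in \<open>auto simp: I_def dilate_half_integral(2)\<close>)
        then have "\<bar>pdiffs js (remainder \<phi> \<Phi> (Suc i)) x\<bar> \<le> (C * (1 + I) ^ i) + (C * (1 + I) ^ i) * I"
          unfolding pdiffs_remainder_Suc using Suc[rule_format, of x] by linarith
        then show "\<bar>pdiffs js (remainder \<phi> \<Phi> (Suc i)) x\<bar> \<le> C * (1 + I) ^ Suc i"
          by (simp add: algebra_simps)
      qed
    qed (use C in simp)
    then show ?case using C unfolding I_def by auto
  next
    case (Suc L)
    obtain C0 where C0: "C0 \<ge> 0" "\<forall>x. \<bar>pdiffs js \<Phi> x\<bar> \<le> C0"
      using test_functions_bounded[OF test_functions_pdiffs[OF \<Phi>, of js]] by blast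
    obtain R where R: "R > 0" "\<forall>x. R < norm x \<longrightarrow> \<phi> x = 0" using test_functions_support[OF \<phi>(1)] by blast
    \<comment> \<open>One more derivative is spent here, hence the induction hypothesis for
      arbitrary multi-indices.\<close>
    have "\<forall>j. \<exists>C\<ge>0. \<forall>i x. \<bar>pdiff j (pdiffs js (remainder \<phi> \<Phi> i)) x\<bar> \<le> C * (1 + I) ^ i * (1/2) ^ (L * i)"
      using Suc[of "j # js" for j] by (auto simp: I_def)
    then obtain C where C: "\<And>j. C j \<ge> 0"
      "\<And>j i x. \<bar>pdiff j (pdiffs js (remainder \<phi> \<Phi> i)) x\<bar> \<le> C j * (1 + I) ^ i * (1/2) ^ (L * i)"
      by metis
    define D where "D = (\<Sum>j\<in>UNIV. C j)"
    have D: "D \<ge> 0" unfolding D_def by (intro sum_nonneg C)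
    \<comment> \<open>\<open>C0\<close> serves \<open>i = 0\<close>; the factor
      \<open>2 ^ Suc L\<close> compensates for the estimate at \<open>Suc i\<close> being obtained
      with the decay belonging to \<open>i\<close>.\<close>
    define E where "E = C0 + 2 ^ Suc L * (D * R * I)"
    have E: "E \<ge> 0" using C0 D R I by (simp add: E_def)
    have step: "\<bar>pdiffs js (remainder \<phi> \<Phi> (Suc i)) x\<bar> \<le> E * (1 + I) ^ Suc i * (1/2) ^ (Suc L * Suc i)" for i x
    proof -
      define f where "f = pdiffs js (remainder \<phi> \<Phi> i)"
      have f: "f \<in> test_functions" unfolding f_def by (rule rt)
      obtain B where B: "\<forall>x. \<bar>f x\<bar> \<le> B" using test_functions_bounded[OF f] by blast
      have "\<bar>f x - f y\<bar> \<le> (\<Sum>j\<in>UNIV. C j * (1 + I) ^ i * (1/2) ^ (L * i)) * norm (x - y)" for x y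
        by (intro mean_value_pdiff[of UNIV] sum_mono) (auto simp: f_def C intro: smooth_differentiable test_functions_smooth rt)
      then have lip: "\<bar>f x - f y\<bar> \<le> (D * (1 + I) ^ i * (1/2) ^ (L * i)) * norm (x - y)" for x y
        by (simp add: D_def sum_distrib_right)
      have "\<bar>f x - conv (dilate \<phi> ((1/2) ^ i)) f x\<bar> \<le>
         (D * (1 + I) ^ i * (1/2) ^ (L * i)) * ((1/2) ^ i * R) * (\<integral>x. \<bar>dilate \<phi> ((1/2) ^ i) x\<bar> \<partial>lborel)"
        by (rule conv_diff_bound[OF di]) (use f B lip D I R dilate_half_integral dilate_support[of R \<phi> "(1/2) ^ i"] in auto)
      also have "\<dots> = (D * R * I) * ((1 + I) ^ i * (1/2) ^ (Suc L * i))"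
        by (simp add: dilate_half_integral(2) I_def power_add mult_ac)
      also have "\<dots> = (2 ^ Suc L * (D * R * I)) * ((1 + I) ^ i * (1/2) ^ (Suc L * Suc i))"
        by (simp add: power_add power_one_over field_simps)
      also have "\<dots> \<le> E * ((1 + I) ^ Suc i * (1/2) ^ (Suc L * Suc i))"
        using C0 I D R by (intro mult_mono mult_right_mono power_increasing) (auto simp: E_def)
      finally show ?thesis unfolding pdiffs_remainder_Suc f_def by (simp add: mult.assoc)
    qed
    have "\<bar>pdiffs js (remainder \<phi> \<Phi> i) x\<bar> \<le> E * (1 + I) ^ i * (1/2) ^ (Suc L * i)" for i x
    proof (cases i)
      case 0
      have "0 \<le> 2 ^ Suc L * (D * R * I)" using D R I by simp
      then show ?thesis using 0 C0(2)[rule_format, of x] unfolding E_def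
        by (simp only: remainder_simps mult_0_right power_0 mult_1_right)
    qed (use step in simp)
    with E show ?case unfolding I_def by blast
  }
qed

text \<open>The growth \<open>B ^ i\<close> is absorbed by asking the previous estimate for
  \<open>K\<close> further powers of \<open>(1/2) ^ i\<close>, where
  \<open>B < 2 ^ K\<close>.\<close>

lemma remainder_bound:
  "\<exists>C\<ge>0. \<forall>i x. \<bar>pdiffs js (remainder \<phi> \<Phi> i) x\<bar> \<le> C * (1/2) ^ (L * i)"
proof -
  define B where "B = 1 + (\<integral>x. \<bar>\<phi> x\<bar> \<partial>lborel)"
  have B: "B \<ge> 0" by (simp add: B_def)
  obtain K where K: "B < 2 ^ K" using real_arch_pow[of 2 B] by auto
  obtain C where C: "C \<ge> 0" "\<forall>i x. \<bar>pdiffs js (remainder \<phi> \<Phi> i) x\<bar> \<le> C * B ^ i * (1/2) ^ ((L + K) * i)"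
    using remainder_bound_aux[of js "L + K"] unfolding B_def by blast
  have "C * B ^ i * (1/2) ^ ((L + K) * i) \<le> C * (1/2) ^ (L * i)" for i
  proof -
    have "B * (1/2) ^ K \<le> 1" using K by (simp add: power_one_over field_simps)
    then have "(B * (1/2) ^ K) ^ i \<le> 1" using B by (intro power_le_one) auto
    then have "C * (1/2) ^ (L * i) * (B * (1/2) ^ K) ^ i \<le> C * (1/2) ^ (L * i) * 1"
      using C by (intro mult_left_mono) auto
    also have "C * (1/2) ^ (L * i) * (B * (1/2) ^ K) ^ i = C * B ^ i * (1/2) ^ ((L + K) * i)"
      unfolding add_mult_distrib power_add by (simp only: power_mult_distrib power_mult[symmetric] mult_ac)
    finally show ?thesis by simp
  qed
  then show ?thesis using C by (meson order_trans)
qed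

text \<open>With \<open>b i\<close> the convolution of \<open>f\<close> with the dilated
  \<open>i\<close>-th remainder at \<open>x\<close>, associativity gives
  \<open>a i = b i - b (Suc i)\<close>, so the series telescopes to \<open>b 0\<close>. The last
  term tends to zero, since the remainders and their derivatives decay uniformly on a fixed
  ball.\<close>

lemma remainder_sums:
  assumes f: "distribution f" and t: "t > 0"
  shows "(\<lambda>i. \<integral>z. dilate (remainder \<phi> \<Phi> i) t z * distr_conv f (dilate \<phi> (t * (1/2) ^ i)) (x - z) \<partial>lborel)
    sums distr_conv f (dilate \<Phi> t) x"
proof -
  let ?\<eta> = "remainder \<phi> \<Phi>"
  define a where "a i = (\<integral>z. dilate (?\<eta> i) t z * distr_conv f (dilate \<phi> (t * (1/2) ^ i)) (x - z) \<partial>lborel)" for i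
  define b where "b i = distr_conv f (dilate (?\<eta> i) t) x" for i
  have dt: "dilate (?\<eta> i) t \<in> test_functions" for i
    by (intro test_functions_dilate remainder_test t)
  have step: "b (Suc i) = b i - a i" for i
  proof -
    have m: "?\<eta> i \<in> borel_measurable borel" "dilate \<phi> ((1/2) ^ i) \<in> borel_measurable borel"
      using remainder_test dilate_half_test by auto
    have dt': "dilate \<phi> (t * (1/2) ^ i) \<in> test_functions"
      using t by (intro test_functions_dilate \<phi>) auto
    have m': "dilate (?\<eta> i) t \<in> borel_measurable borel" "dilate \<phi> (t * (1/2) ^ i) \<in> borel_measurable borel"
      using dt dt' by auto
    have "dilate (conv (dilate \<phi> ((1/2) ^ i)) (?\<eta> i)) t = conv (dilate \<phi> (t * (1/2) ^ i)) (dilate (?\<eta> i) t)"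
      using dilate_conv[OF m(2,1) t] by (simp add: dilate_dilate)
    also have "\<dots> = conv (dilate (?\<eta> i) t) (dilate \<phi> (t * (1/2) ^ i))"
      by (rule conv_commute[OF m'(2,1)])
    finally have "dilate (?\<eta> (Suc i)) t = (\<lambda>y. dilate (?\<eta> i) t y - conv (dilate (?\<eta> i) t) (dilate \<phi> (t * (1/2) ^ i)) y)"
      by (simp add: dilate_def fun_eq_iff diff_divide_distrib)
    then have "b (Suc i) = b i - distr_conv f (conv (dilate (?\<eta> i) t) (dilate \<phi> (t * (1/2) ^ i))) x"
      unfolding b_def distr_conv_def
      using distribution_diff[OF f test_functions_reflect[OF dt] test_functions_reflect[OF conv_test_functions[OF dt dt']]]
      by simp
    then show ?thesis by (simp add: distr_conv_conv(1)[OF f dt dt'] a_def)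
  qed
  obtain R1 where R1: "R1 > 0" "\<forall>x. R1 < norm x \<longrightarrow> \<phi> x = 0" using test_functions_support[OF \<phi>(1)] by blast
  obtain R2 where R2: "R2 > 0" "\<forall>x. R2 < norm x \<longrightarrow> \<Phi> x = 0" using test_functions_support[OF \<Phi>] by blast
  define R where "R = max R1 R2"
  have R: "\<forall>x. R < norm x \<longrightarrow> \<phi> x = 0" "\<forall>x. R < norm x \<longrightarrow> \<Phi> x = 0" "R > 0"
    using R1 R2 by (auto simp: R_def)
  have "b \<longlonglongrightarrow> 0"
    unfolding b_def distr_conv_def
  proof (rule distribution_tendsto_zero[OF f, where R = "norm x + t * (3 * R)"])
    have "dilate (?\<eta> i) t (x - y) = 0" if "norm x + t * (3 * R) < norm y" for i y
      by (rule dilate_support[of "3 * R"])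
        (use remainder_support[OF R] t that norm_triangle_ineq2[of y x] in \<open>auto simp: norm_minus_commute\<close>)
    then show "\<forall>\<^sub>F i in sequentially. (\<lambda>y. dilate (?\<eta> i) t (x - y)) \<in> test_functions \<and>
        (\<forall>y. norm x + t * (3 * R) < norm y \<longrightarrow> dilate (?\<eta> i) t (x - y) = 0)"
      using test_functions_reflect[OF dt] by (intro always_eventually) blast
    fix js :: "'n list" and e :: real assume e: "e > 0"
    obtain C where C: "C \<ge> 0" "\<forall>i x. \<bar>pdiffs js (?\<eta> i) x\<bar> \<le> C * (1/2) ^ (1 * i)"
      using remainder_bound[of js 1] by blast
    define K where "K = inverse t ^ length js / t ^ CARD('n)"
    have "pdiffs js (\<lambda>y. dilate (?\<eta> i) t (x - y)) y = (-1) ^ length js * (K * pdiffs js (?\<eta> i) ((x - y) /\<^sub>R t))" for i y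
      using pdiffs_reflect[OF test_functions_smooth[OF dt], of js] pdiffs_dilate[OF test_functions_smooth[OF remainder_test], of js]
      by (simp add: K_def dilate_def)
    moreover have K: "K \<ge> 0" using t by (simp add: K_def)
    ultimately have "\<bar>pdiffs js (\<lambda>y. dilate (?\<eta> i) t (x - y)) y\<bar> = K * \<bar>pdiffs js (?\<eta> i) ((x - y) /\<^sub>R t)\<bar>" for i y
      by (simp add: abs_mult power_abs)
    then have le: "\<bar>pdiffs js (\<lambda>y. dilate (?\<eta> i) t (x - y)) y\<bar> \<le> K * (C * (1/2) ^ i)" for i y
      using C(2) K by (simp add: mult_left_mono)
    have "\<forall>\<^sub>F i in sequentially. K * (C * (1/2) ^ i) < e"
    proof (rule order_tendstoD(2))
      show "(\<lambda>i. K * (C * (1/2) ^ i)) \<longlonglongrightarrow> K * (C * 0)"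
        by (intro tendsto_intros LIMSEQ_power_zero) simp
    qed (use e in simp)
    then show "\<forall>\<^sub>F i in sequentially. \<forall>y. \<bar>pdiffs js (\<lambda>y. dilate (?\<eta> i) t (x - y)) y\<bar> \<le> e"
    proof eventually_elim
      case (elim i)
      show ?case
      proof
        fix y show "\<bar>pdiffs js (\<lambda>y. dilate (?\<eta> i) t (x - y)) y\<bar> \<le> e"
          using le[of i y] elim by linarith
      qed
    qed
  qed
  moreover have "(\<Sum>i<n. a i) = b 0 - b n" for n
    by (induction n) (simp_all add: step)
  ultimately have "a sums (b 0 - 0)"
    unfolding sums_def by (simp only:) (intro tendsto_intros)
  then show ?thesis by (simp add: a_def[abs_def] b_def)
qed

end

text \<open>The functions \<open>\<eta>\<close>, the radius and the constant are chosen before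
  \<open>f\<close>, \<open>t\<close> and \<open>x\<close>, so that later constants are uniform over
  all distributions. The exponent \<open>L\<close> is free, for each application to beat the growth
  it meets.\<close>

lemma reproducing_formula:
  fixes \<phi> \<Phi> :: "real^'n::finite \<Rightarrow> real"
  assumes \<phi>: "\<phi> \<in> test_functions" "(\<integral>x. \<phi> x \<partial>lborel) = 1" and \<Phi>: "\<Phi> \<in> test_functions"
  shows "\<exists>R>0. \<exists>C\<ge>0. \<exists>\<eta>. (\<forall>i. \<eta> i \<in> test_functions \<and> (\<forall>x. R < norm x \<longrightarrow> \<eta> i x = 0) \<and>
      (\<forall>x. \<bar>\<eta> i x\<bar> \<le> C * (1/2) ^ (L * i)) \<and> ((\<integral>x. \<Phi> x \<partial>lborel) = 0 \<longrightarrow> (\<integral>x. \<eta> i x \<partial>lborel) = 0)) \<and>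
    (\<forall>f t x. distribution f \<longrightarrow> t > 0 \<longrightarrow>
      (\<lambda>i. \<integral>z. dilate (\<eta> i) t z * distr_conv f (dilate \<phi> (t * (1/2) ^ i)) (x - z) \<partial>lborel) sums distr_conv f (dilate \<Phi> t) x)"
proof -
  obtain R1 where R1: "R1 > 0" "\<forall>x. R1 < norm x \<longrightarrow> \<phi> x = 0" using test_functions_support[OF \<phi>(1)] by blast
  obtain R2 where R2: "R2 > 0" "\<forall>x. R2 < norm x \<longrightarrow> \<Phi> x = 0" using test_functions_support[OF \<Phi>] by blast
  define R where "R = max R1 R2"
  have R: "\<forall>x. R < norm x \<longrightarrow> \<phi> x = 0" "\<forall>x. R < norm x \<longrightarrow> \<Phi> x = 0" "R > 0"
    using R1 R2 by (auto simp: R_def)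
  obtain C where C: "C \<ge> 0" "\<forall>i x. \<bar>remainder \<phi> \<Phi> i x\<bar> \<le> C * (1/2) ^ (L * i)"
    using remainder_bound[OF assms, of "[]" L] by auto
  show ?thesis
    using R C remainder_test[OF assms] remainder_integral[OF assms] remainder_support[OF assms R] remainder_sums[OF assms]
    by (intro exI[of _ "3 * R"] exI[of _ C] exI[of _ "remainder \<phi> \<Phi>"] conjI allI impI) auto
qed

section \<open>The Hardy--Littlewood maximal function\<close>

text \<open>Normalised by the power of the radius instead of the volume of the ball, which differs
  by the constant \<open>unit_ball_vol\<close> only. Values in \<open>ennreal\<close> make it
  meaningful without integrability, and open balls make it lower semicontinuous.\<close>

definition maxfn :: "('a::euclidean_space \<Rightarrow> ennreal) \<Rightarrow> 'a \<Rightarrow> ennreal" where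
  "maxfn h x = (SUP r\<in>{0<..}. (\<integral>\<^sup>+y. h y * indicator (ball x r) y \<partial>lborel) / ennreal (r ^ DIM('a)))"

lemma ennreal_mult_less_cancel_right:
  fixes a b c :: ennreal
  assumes "0 < c" "c < top"
  shows "a * c < b * c \<longleftrightarrow> a < b"
proof
  show "a * c < b * c \<Longrightarrow> a < b"
    by (meson leI mult_right_mono not_le zero_le)
qed (rule ennreal_mult_strict_right_mono[OF _ assms])

lemma nn_integral_ball_le_maxfn:
  fixes h :: "'a::euclidean_space \<Rightarrow> ennreal"
  assumes "r > 0"
  shows "(\<integral>\<^sup>+y. h y * indicator (ball x r) y \<partial>lborel) \<le> maxfn h x * ennreal (r ^ DIM('a))"
proof -
  have "(\<integral>\<^sup>+y. h y * indicator (ball x r) y \<partial>lborel) / ennreal (r ^ DIM('a)) \<le> maxfn h x"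
    unfolding maxfn_def using assms by (intro SUP_upper) auto
  then have "(\<integral>\<^sup>+y. h y * indicator (ball x r) y \<partial>lborel) / ennreal (r ^ DIM('a)) * ennreal (r ^ DIM('a)) \<le> maxfn h x * ennreal (r ^ DIM('a))"
    by (intro mult_right_mono) auto
  moreover have "a / ennreal (r ^ DIM('a)) * ennreal (r ^ DIM('a)) = a" for a :: ennreal
    using assms by (simp add: ennreal_divide_times ennreal_divide_self)
  ultimately show ?thesis by simp
qed

lemma less_maxfn_iff:
  fixes h :: "'a::euclidean_space \<Rightarrow> ennreal"
  shows "a < maxfn h x \<longleftrightarrow> (\<exists>r>0. a * ennreal (r ^ DIM('a)) < (\<integral>\<^sup>+y. h y * indicator (ball x r) y \<partial>lborel))"
proof -
  have "a < b / ennreal (r ^ DIM('a)) \<longleftrightarrow> a * ennreal (r ^ DIM('a)) < b" if "r > 0" for r b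
  proof -
    have "b / ennreal (r ^ DIM('a)) * ennreal (r ^ DIM('a)) = b"
      using that by (simp add: ennreal_divide_times ennreal_divide_self)
    then show ?thesis
      using ennreal_mult_less_cancel_right[of "ennreal (r ^ DIM('a))" a "b / ennreal (r ^ DIM('a))"] that by simp
  qed
  then show ?thesis unfolding maxfn_def less_SUP_iff by auto
qed

text \<open>The integral over a ball is continuous from below in the radius, so the strict
  inequality survives for a slightly smaller ball, and that ball is contained in the balls of radius
  \<open>r\<close> about all nearby centres.\<close>

lemma open_less_maxfn:
  fixes h :: "'a::euclidean_space \<Rightarrow> ennreal"
  assumes [measurable]: "h \<in> borel_measurable borel"
  shows "open {x. a < maxfn h x}"
  unfolding open_contains_ball
proof
  fix x assume "x \<in> {x. a < maxfn h x}"
  then obtain r where r: "r > 0" "a * ennreal (r ^ DIM('a)) < (\<integral>\<^sup>+y. h y * indicator (ball x r) y \<partial>lborel)"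
    unfolding less_maxfn_iff by blast
  define s where "s n = r - r / real (Suc n)" for n
  have "(\<lambda>n. r / real (Suc n)) \<longlonglongrightarrow> r * 0"
    using LIMSEQ_inverse_real_of_nat unfolding divide_inverse by (intro tendsto_intros)
  then have s: "s \<longlonglongrightarrow> r" unfolding s_def by (auto intro: tendsto_eq_intros)
  have mono: "incseq s" unfolding s_def using r(1) by (intro incseq_SucI) (simp add: field_simps)
  have sr: "s n < r" for n using r(1) by (simp add: s_def)
  have "(SUP n. h y * indicator (ball x (s n)) y) = h y * indicator (ball x r) y" for y
  proof (cases "y \<in> ball x r")
    case True
    then have "dist x y < r" by simp
    then have "\<forall>\<^sub>F n in sequentially. dist x y < s n" using s order_tendstoD by blast
    then obtain n where "dist x y < s n" using eventually_happens trivial_limit_sequentially by blast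
    then have "h y * indicator (ball x r) y \<le> h y * indicator (ball x (s n)) y" using True by simp
    then have "h y * indicator (ball x r) y \<le> (SUP n. h y * indicator (ball x (s n)) y)"
      by (rule order_trans) (rule SUP_upper, simp)
    moreover have "(SUP n. h y * indicator (ball x (s n)) y) \<le> h y * indicator (ball x r) y"
      using sr True by (intro SUP_least mult_left_mono) (auto split: split_indicator)
    ultimately show ?thesis by (rule antisym[rotated])
  next
    case False
    then have "y \<notin> ball x (s n)" for n using sr[of n] by (auto simp: not_less intro: less_imp_le order_trans)
    with False show ?thesis by simp
  qed
  then have "(\<integral>\<^sup>+y. h y * indicator (ball x r) y \<partial>lborel) = (\<integral>\<^sup>+y. (SUP n. h y * indicator (ball x (s n)) y) \<partial>lborel)"
    by simp
  also have "\<dots> = (SUP n. \<integral>\<^sup>+y. h y * indicator (ball x (s n)) y \<partial>lborel)"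
  proof (rule nn_integral_monotone_convergence_SUP)
    show "incseq (\<lambda>n y. h y * indicator (ball x (s n)) y)"
      using mono unfolding incseq_def le_fun_def
      by (intro allI impI mult_left_mono) (auto split: split_indicator intro: less_le_trans)
    have "ball x (s n) \<in> sets borel" for n by simp
    then show "(\<lambda>y. h y * indicator (ball x (s n)) y) \<in> borel_measurable lborel" for n by measurable
  qed
  finally have "a * ennreal (r ^ DIM('a)) < (SUP n. \<integral>\<^sup>+y. h y * indicator (ball x (s n)) y \<partial>lborel)"
    using r(2) by simp
  then obtain n where n: "a * ennreal (r ^ DIM('a)) < (\<integral>\<^sup>+y. h y * indicator (ball x (s n)) y \<partial>lborel)"
    by (auto simp: less_SUP_iff)
  show "\<exists>e>0. ball x e \<subseteq> {x. a < maxfn h x}"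
  proof (intro exI[of _ "r - s n"] conjI subsetI CollectI)
    fix x' assume x': "x' \<in> ball x (r - s n)"
    have "ball x (s n) \<subseteq> ball x' r"
    proof
      fix y assume "y \<in> ball x (s n)"
      then show "y \<in> ball x' r" using x' dist_triangle[of x' y x] by (simp add: dist_commute)
    qed
    then have "(\<integral>\<^sup>+y. h y * indicator (ball x (s n)) y \<partial>lborel) \<le> (\<integral>\<^sup>+y. h y * indicator (ball x' r) y \<partial>lborel)"
      by (intro nn_integral_mono mult_left_mono) (auto split: split_indicator)
    then show "a < maxfn h x'"
      unfolding less_maxfn_iff using n r(1) less_le_trans by blast
  qed (use sr[of n] in simp)
qed

lemma borel_measurable_maxfn [measurable]:
  "h \<in> borel_measurable borel \<Longrightarrow> maxfn h \<in> borel_measurable borel"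
  using open_less_maxfn[of h] by (intro borel_measurableI_greater) auto

lemma emeasure_ball_power:
  fixes x :: "'a::euclidean_space"
  assumes "r > 0"
  shows "emeasure lborel (ball x r) = ennreal (unit_ball_vol DIM('a)) * ennreal (r ^ DIM('a))"
  using assms by (simp add: emeasure_ball ennreal_mult unit_ball_vol_nonneg)

text \<open>Vitali's covering argument: balls on which the mean exceeds \<open>l\<close> cover the
  level set, a disjoint subfamily still covers after enlarging five times, and the integrals over
  disjoint balls add up to at most the total.\<close>

lemma maxfn_weak_type:
  fixes h :: "'a::euclidean_space \<Rightarrow> ennreal"
  assumes [measurable]: "h \<in> borel_measurable borel" and l: "l > 0"
  shows "ennreal l * emeasure lborel {x. ennreal l < maxfn h x} \<le>
     ennreal (unit_ball_vol DIM('a) * 5 ^ DIM('a)) * (\<integral>\<^sup>+x. h x \<partial>lborel)"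
proof (cases "(\<integral>\<^sup>+x. h x \<partial>lborel) = \<infinity>")
  case True
  have "ennreal (unit_ball_vol DIM('a) * 5 ^ DIM('a)) \<noteq> 0"
    unfolding ennreal_eq_0_iff by (simp add: not_le)
  then show ?thesis using True ennreal_mult_top by simp
next
  case False
  then obtain I where I: "(\<integral>\<^sup>+x. h x \<partial>lborel) = ennreal I" "I \<ge> 0"
    by (metis ennreal_cases infinity_ennreal_def)
  define S where "S = {x. ennreal l < maxfn h x}"
  have S[measurable]: "S \<in> sets borel" unfolding S_def by (intro borel_open open_less_maxfn) measurable
  have "\<forall>x\<in>S. \<exists>r>0. ennreal l * ennreal (r ^ DIM('a)) < (\<integral>\<^sup>+y. h y * indicator (ball x r) y \<partial>lborel)"
    by (simp add: S_def less_maxfn_iff)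
  then obtain r where r: "\<And>x. x \<in> S \<Longrightarrow> r x > 0"
    "\<And>x. x \<in> S \<Longrightarrow> ennreal l * ennreal (r x ^ DIM('a)) < (\<integral>\<^sup>+y. h y * indicator (ball x (r x)) y \<partial>lborel)"
    by metis
  \<comment> \<open>Vitali's lemma requires bounded radii. A large mean forces
    \<open>r x ^ DIM('a) \<le> I / l\<close>, and a radius above one is at most its own
    power.\<close>
  have rB: "r x \<le> 1 + I / l" if x: "x \<in> S" for x
  proof -
    have "ennreal l * ennreal (r x ^ DIM('a)) \<le> ennreal I"
      unfolding I(1)[symmetric]
      by (rule order_trans[OF less_imp_le[OF r(2)[OF x]]]) (auto intro!: nn_integral_mono split: split_indicator)
    then have "l * r x ^ DIM('a) \<le> I" using l r(1)[OF x] I(2) by (simp flip: ennreal_mult)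
    then have *: "r x ^ DIM('a) \<le> I / l" using l by (simp add: field_simps)
    show ?thesis
    proof (cases "r x \<le> 1")
      case True
      then show ?thesis using I l by (simp add: add_increasing2)
    next
      case False
      then have "r x \<le> r x ^ DIM('a)" by (intro self_le_power) auto
      with * show ?thesis by simp
    qed
  qed
  obtain C where C: "countable C" "C \<subseteq> S" "pairwise (\<lambda>i j. disjnt (ball i (r i)) (ball j (r j))) C"
    "S \<subseteq> (\<Union>i\<in>C. ball i (5 * r i))"
  proof (rule Vitali_covering_lemma_balls[where S = S and K = S and a = "\<lambda>x. x" and r = r and B = "1 + I / l"])
    show "S \<subseteq> (\<Union>i\<in>S. ball i (r i))" using r(1) by force
    show "0 < r i \<and> r i \<le> 1 + I / l" if "i \<in> S" for i using r(1) rB that by blast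
  qed blast
  define K where "K = ennreal (unit_ball_vol DIM('a) * 5 ^ DIM('a))"
  \<comment> \<open>The sum over the countable family is written as an integral over
    \<open>count_space C\<close>, so that it can be exchanged with the Lebesgue integral.\<close>
  have "emeasure lborel S \<le> (\<integral>\<^sup>+y. (\<integral>\<^sup>+i. indicator (ball i (5 * r i)) y \<partial>count_space C) \<partial>lborel)"
  proof -
    have "indicator S y \<le> (\<integral>\<^sup>+i. indicator (ball i (5 * r i)) y \<partial>count_space C)" for y
    proof (cases "y \<in> S")
      case True
      then obtain i where i: "i \<in> C" "y \<in> ball i (5 * r i)" using C(4) by blast
      have "(1::ennreal) = indicator (ball i (5 * r i)) y" using i by simp
      also have "\<dots> \<le> (\<integral>\<^sup>+i. indicator (ball i (5 * r i)) y \<partial>count_space C)"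
        using i(1) by (rule nn_integral_ge_point)
      finally show ?thesis using True by simp
    qed simp
    then have "(\<integral>\<^sup>+y. indicator S y \<partial>lborel) \<le> (\<integral>\<^sup>+y. (\<integral>\<^sup>+i. indicator (ball i (5 * r i)) y \<partial>count_space C) \<partial>lborel)"
      by (intro nn_integral_mono)
    then show ?thesis by simp
  qed
  also have "\<dots> = (\<integral>\<^sup>+i. emeasure lborel (ball i (5 * r i)) \<partial>count_space C)"
    by (subst nn_integral_count_space_nn_integral) (use C in \<open>auto intro!: borel_measurable_indicator\<close>)
  finally have "ennreal l * emeasure lborel S \<le> ennreal l * (\<integral>\<^sup>+i. emeasure lborel (ball i (5 * r i)) \<partial>count_space C)"
    by (intro mult_left_mono) auto
  also have "\<dots> = (\<integral>\<^sup>+i. ennreal l * emeasure lborel (ball i (5 * r i)) \<partial>count_space C)"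
    by (simp add: nn_integral_cmult)
  also have "\<dots> \<le> (\<integral>\<^sup>+i. K * (\<integral>\<^sup>+y. h y * indicator (ball i (r i)) y \<partial>lborel) \<partial>count_space C)"
  proof (rule nn_integral_mono)
    fix i assume "i \<in> space (count_space C)"
    then have i: "i \<in> S" using C by auto
    have "ennreal l * emeasure lborel (ball i (5 * r i)) = K * (ennreal l * ennreal (r i ^ DIM('a)))"
      using r(1)[OF i] by (simp add: emeasure_ball_power K_def power_mult_distrib ennreal_mult mult_ac)
    also have "\<dots> \<le> K * (\<integral>\<^sup>+y. h y * indicator (ball i (r i)) y \<partial>lborel)"
      using less_imp_le[OF r(2)[OF i]] by (rule mult_left_mono) simp
    finally show "ennreal l * emeasure lborel (ball i (5 * r i)) \<le> K * (\<integral>\<^sup>+y. h y * indicator (ball i (r i)) y \<partial>lborel)" .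
  qed
  also have "\<dots> = K * (\<integral>\<^sup>+i. (\<integral>\<^sup>+y. h y * indicator (ball i (r i)) y \<partial>lborel) \<partial>count_space C)"
    by (simp add: nn_integral_cmult)
  also have "(\<integral>\<^sup>+i. (\<integral>\<^sup>+y. h y * indicator (ball i (r i)) y \<partial>lborel) \<partial>count_space C) =
      (\<integral>\<^sup>+y. (\<integral>\<^sup>+i. h y * indicator (ball i (r i)) y \<partial>count_space C) \<partial>lborel)"
    by (subst nn_integral_count_space_nn_integral)
      (use C in \<open>auto intro!: borel_measurable_times_ennreal borel_measurable_indicator\<close>)
  also have "\<dots> \<le> (\<integral>\<^sup>+y. h y \<partial>lborel)"
  proof (rule nn_integral_mono)
    fix y
    show "(\<integral>\<^sup>+i. h y * indicator (ball i (r i)) y \<partial>count_space C) \<le> h y"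
    proof (cases "\<exists>i\<in>C. y \<in> ball i (r i)")
      case True
      then obtain i where i: "i \<in> C" "y \<in> ball i (r i)" by blast
      have "y \<notin> ball j (r j)" if "j \<in> C" "j \<noteq> i" for j
        using C(3) i that unfolding pairwise_def disjnt_def by blast
      then have "(\<integral>\<^sup>+i. h y * indicator (ball i (r i)) y \<partial>count_space C) = (\<integral>\<^sup>+j. h y * indicator {i} j \<partial>count_space C)"
        using i by (intro nn_integral_cong) (auto split: split_indicator)
      also have "\<dots> = h y" using i by (simp add: nn_integral_cmult_indicator)
      finally show ?thesis by simp
    next
      case False
      then have "(\<integral>\<^sup>+i. h y * indicator (ball i (r i)) y \<partial>count_space C) = (\<integral>\<^sup>+i. 0 \<partial>count_space C)"
        by (intro nn_integral_cong) (auto split: split_indicator)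
      then show ?thesis by simp
    qed
  qed
  finally show ?thesis by (simp add: S_def K_def mult_left_mono)
qed

section \<open>The L2 maximal inequality\<close>

text \<open>For finite \<open>a\<close> this is the fundamental theorem of calculus for the square;
  an infinite \<open>a\<close> dominates every natural number, so the right-hand side is infinite
  too.\<close>

lemma square_layer_cake:
  fixes a :: ennreal
  shows "a * a \<le> (\<integral>\<^sup>+l. ennreal (2 * l) * indicator {0<..} l * indicator {l. ennreal l < a} l \<partial>lborel)" (is "_ \<le> ?I a")
proof -
  have real: "ennreal b * ennreal b \<le> ?I (ennreal b)" if b: "b \<ge> 0" for b
  proof -
    have "(\<integral>\<^sup>+l. ennreal (2 * l) * indicator {0..b} l \<partial>lborel) = ennreal (b\<^sup>2 - 0\<^sup>2)"
      using b by (intro nn_integral_FTC_Icc) (auto intro!: derivative_eq_intros)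
    moreover have "AE l in lborel. l \<noteq> 0 \<and> l \<noteq> b"
      using AE_lborel_singleton[of 0] AE_lborel_singleton[of b] by (auto elim: eventually_elim2)
    then have "AE l in lborel. ennreal (2 * l) * indicator {0..b} l = ennreal (2 * l) * indicator {0<..} l * indicator {l. ennreal l < ennreal b} l"
      by eventually_elim (use b in \<open>auto split: split_indicator simp: ennreal_less_iff not_less\<close>)
    then have "(\<integral>\<^sup>+l. ennreal (2 * l) * indicator {0..b} l \<partial>lborel) = ?I (ennreal b)"
      by (rule nn_integral_cong_AE)
    ultimately show ?thesis using b by (simp add: power2_eq_square ennreal_mult)
  qed
  show ?thesis
  proof (cases a)
    case (real b)
    then show ?thesis using \<open>\<And>b. b \<ge> 0 \<Longrightarrow> _\<close> by blast
  next
    case top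
    have "ennreal (real n) \<le> ?I a" for n
    proof -
      have "ennreal (real n) \<le> ennreal (real n) * ennreal (real n)"
        by (cases n) (auto simp flip: ennreal_mult intro!: ennreal_leI simp: algebra_simps)
      also have "\<dots> \<le> ?I (ennreal (real n))" by (rule real) simp
      also have "\<dots> \<le> ?I a"
        by (intro nn_integral_mono mult_left_mono) (auto split: split_indicator simp: top)
      finally show ?thesis .
    qed
    then have "?I a = top"
      by (metis ennreal_of_nat_eq_real_of_nat ennreal_Ex_less_of_nat leD top.not_eq_extremum)
    then show ?thesis by simp
  qed
qed

lemma emeasure_less_ennreal:
  "(\<integral>\<^sup>+l. indicator {0<..} l * indicator {l. ennreal l < a} l \<partial>lborel) \<le> a"
proof (cases a)
  case (real b)
  have "(\<integral>\<^sup>+l. indicator {0<..} l * indicator {l. ennreal l < a} l \<partial>lborel) \<le> (\<integral>\<^sup>+l. indicator {0..b} l \<partial>lborel)"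
    using real by (intro nn_integral_mono) (auto split: split_indicator simp: ennreal_less_iff)
  then show ?thesis using real by simp
qed simp

text \<open>Marcinkiewicz interpolation between the weak-type bound and the trivial bound for
  bounded functions: at height \<open>l\<close> the part of \<open>h\<close> below
  \<open>l / (2 * v)\<close> contributes at most \<open>l / 2\<close> to the maximal function, so
  only the truncation \<open>k l\<close> matters, and integrating over \<open>l\<close> recovers the
  square of \<open>h\<close>. The constant is \<open>4 * C\<close> from the weak-type bound at
  height \<open>l / 2\<close>, times \<open>2 * v\<close> from the truncation level.\<close>

lemma maxfn_strong_type:
  fixes h :: "'a::euclidean_space \<Rightarrow> ennreal"
  assumes h[measurable]: "h \<in> borel_measurable borel"
  shows "(\<integral>\<^sup>+x. maxfn h x * maxfn h x \<partial>lborel) \<le>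
     ennreal (8 * (unit_ball_vol DIM('a) * 5 ^ DIM('a)) * unit_ball_vol DIM('a)) * (\<integral>\<^sup>+x. h x * h x \<partial>lborel)"
proof -
  define v where "v = unit_ball_vol (real DIM('a))"
  have v: "v > 0" by (simp add: v_def)
  define C where "C = v * 5 ^ DIM('a)"
  have C: "C > 0" using v by (simp add: C_def)
  define k where "k l y = h y * indicator {y. ennreal (l / (2 * v)) < h y} y" for l y
  have split: "maxfn h x \<le> maxfn (k l) x + ennreal (l / 2)" if l: "l > 0" for l x
    unfolding maxfn_def[of h]
  proof (rule SUP_least)
    fix r :: real assume "r \<in> {0<..}"
    then have r: "r > 0" by simp
    have "(\<integral>\<^sup>+y. h y * indicator (ball x r) y \<partial>lborel) \<le>
       (\<integral>\<^sup>+y. k l y * indicator (ball x r) y + ennreal (l / (2 * v)) * indicator (ball x r) y \<partial>lborel)"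
      by (intro nn_integral_mono) (auto simp: k_def split: split_indicator)
    also have "\<dots> = (\<integral>\<^sup>+y. k l y * indicator (ball x r) y \<partial>lborel) + ennreal (l / (2 * v)) * emeasure lborel (ball x r)"
    proof -
      have [measurable]: "ball x r \<in> sets borel" by simp
      show ?thesis unfolding k_def by (subst nn_integral_add) (auto simp: nn_integral_cmult_indicator)
    qed
    also have "ennreal (l / (2 * v)) * emeasure lborel (ball x r) = ennreal (l / 2) * ennreal (r ^ DIM('a))"
      using r l v by (simp add: emeasure_ball_power[OF r] v_def[symmetric] flip: ennreal_mult)
    finally have "(\<integral>\<^sup>+y. h y * indicator (ball x r) y \<partial>lborel) \<le>
      maxfn (k l) x * ennreal (r ^ DIM('a)) + ennreal (l / 2) * ennreal (r ^ DIM('a))"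
      by (rule order_trans) (intro add_right_mono nn_integral_ball_le_maxfn r)
    then show "(\<integral>\<^sup>+y. h y * indicator (ball x r) y \<partial>lborel) / ennreal (r ^ DIM('a)) \<le> maxfn (k l) x + ennreal (l / 2)"
      using r by (intro divide_le_posI_ennreal) (auto simp: distrib_left mult.commute)
  qed
  have level: "ennreal (2 * l) * emeasure lborel {x. ennreal l < maxfn h x} \<le> ennreal (4 * C) * (\<integral>\<^sup>+y. k l y \<partial>lborel)" if l: "l > 0" for l
  proof -
    have [measurable]: "k l \<in> borel_measurable borel" unfolding k_def by measurable
    have "{x. ennreal l < maxfn h x} \<subseteq> {x. ennreal (l / 2) < maxfn (k l) x}"
    proof safe
      fix x assume *: "ennreal l < maxfn h x"
      show "ennreal (l / 2) < maxfn (k l) x"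
      proof (rule ccontr)
        assume "\<not> ennreal (l / 2) < maxfn (k l) x"
        then have "maxfn (k l) x + ennreal (l / 2) \<le> ennreal (l / 2) + ennreal (l / 2)"
          by (intro add_right_mono) simp
        also have "\<dots> = ennreal l" using l by (simp flip: ennreal_plus)
        finally show False using split[OF l, of x] * by (meson leD le_less_trans order_trans)
      qed
    qed
    then have "ennreal (2 * l) * emeasure lborel {x. ennreal l < maxfn h x} \<le> ennreal (2 * l) * emeasure lborel {x. ennreal (l / 2) < maxfn (k l) x}"
      by (intro mult_left_mono emeasure_mono) (auto intro!: borel_open open_less_maxfn)
    also have "\<dots> = ennreal 4 * ennreal (l / 2) * emeasure lborel {x. ennreal (l / 2) < maxfn (k l) x}"
      using l ennreal_mult[of 4 "l / 2"] by simp
    also have "\<dots> \<le> ennreal 4 * (ennreal C * (\<integral>\<^sup>+y. k l y \<partial>lborel))"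
      unfolding mult.assoc using maxfn_weak_type[of "k l" "l / 2"] l
      by (intro mult_left_mono) (auto simp: C_def v_def)
    also have "\<dots> = ennreal (4 * C) * (\<integral>\<^sup>+y. k l y \<partial>lborel)"
      using C by (simp add: ennreal_mult mult.assoc)
    finally show ?thesis .
  qed
  have "(\<integral>\<^sup>+x. maxfn h x * maxfn h x \<partial>lborel) \<le>
     (\<integral>\<^sup>+x. (\<integral>\<^sup>+l. ennreal (2 * l) * indicator {0<..} l * indicator {l. ennreal l < maxfn h x} l \<partial>lborel) \<partial>lborel)"
    by (intro nn_integral_mono square_layer_cake)
  also have "\<dots> = (\<integral>\<^sup>+l. (\<integral>\<^sup>+x. ennreal (2 * l) * indicator {0<..} l * indicator {l. ennreal l < maxfn h x} l \<partial>lborel) \<partial>lborel)"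
    by (rule lborel_pair.Fubini') simp
  also have "\<dots> = (\<integral>\<^sup>+l. indicator {0<..} l * (ennreal (2 * l) * emeasure lborel {x. ennreal l < maxfn h x}) \<partial>lborel)"
  proof (rule nn_integral_cong)
    fix l :: real
    have "(\<integral>\<^sup>+x. ennreal (2 * l) * indicator {0<..} l * indicator {l. ennreal l < maxfn h x} l \<partial>lborel) =
       (\<integral>\<^sup>+x. (ennreal (2 * l) * indicator {0<..} l) * indicator {x. ennreal l < maxfn h x} x \<partial>lborel)"
      by (intro nn_integral_cong) (auto split: split_indicator)
    also have "\<dots> = (ennreal (2 * l) * indicator {0<..} l) * emeasure lborel {x. ennreal l < maxfn h x}"
      by (rule nn_integral_cmult_indicator) measurable
    finally show "(\<integral>\<^sup>+x. ennreal (2 * l) * indicator {0<..} l * indicator {l. ennreal l < maxfn h x} l \<partial>lborel) =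
       indicator {0<..} l * (ennreal (2 * l) * emeasure lborel {x. ennreal l < maxfn h x})"
      by (simp add: mult_ac)
  qed
  also have "\<dots> \<le> (\<integral>\<^sup>+l. indicator {0<..} l * (ennreal (4 * C) * (\<integral>\<^sup>+y. k l y \<partial>lborel)) \<partial>lborel)"
    using level by (intro nn_integral_mono) (auto split: split_indicator)
  also have "\<dots> = (\<integral>\<^sup>+l. (\<integral>\<^sup>+y. ennreal (4 * C) * h y * (indicator {0<..} l * indicator {y. ennreal (l / (2 * v)) < h y} y) \<partial>lborel) \<partial>lborel)"
    unfolding k_def by (intro nn_integral_cong) (simp add: nn_integral_cmult[symmetric] mult_ac)
  also have "\<dots> = (\<integral>\<^sup>+y. (\<integral>\<^sup>+l. ennreal (4 * C) * h y * (indicator {0<..} l * indicator {y. ennreal (l / (2 * v)) < h y} y) \<partial>lborel) \<partial>lborel)"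
    by (rule lborel_pair.Fubini') simp
  also have "\<dots> \<le> (\<integral>\<^sup>+y. ennreal (4 * C) * h y * (ennreal (2 * v) * h y) \<partial>lborel)"
  proof (rule nn_integral_mono)
    fix y
    have "(\<integral>\<^sup>+l. indicator {0<..} l * indicator {y. ennreal (l / (2 * v)) < h y} y \<partial>lborel) =
      (\<integral>\<^sup>+l. indicator {0<..} l * indicator {l. ennreal l < ennreal (2 * v) * h y} l \<partial>lborel)"
    proof (rule nn_integral_cong)
      fix l :: real
      have "ennreal (l / (2 * v)) < h y \<longleftrightarrow> ennreal l < ennreal (2 * v) * h y" if "l > 0"
      proof -
        have e: "ennreal l = ennreal (2 * v) * ennreal (l / (2 * v))" using v that by (simp flip: ennreal_mult)
        show ?thesis
          unfolding e using ennreal_mult_less_cancel_right[of "ennreal (2 * v)" "ennreal (l / (2 * v))" "h y"] v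
          by (simp add: mult.commute)
      qed
      then show "indicator {0<..} l * indicator {y. ennreal (l / (2 * v)) < h y} y =
        (indicator {0<..} l * indicator {l. ennreal l < ennreal (2 * v) * h y} l :: ennreal)"
        by (auto split: split_indicator)
    qed
    also have "\<dots> \<le> ennreal (2 * v) * h y" by (rule emeasure_less_ennreal)
    finally show "(\<integral>\<^sup>+l. ennreal (4 * C) * h y * (indicator {0<..} l * indicator {y. ennreal (l / (2 * v)) < h y} y) \<partial>lborel) \<le>
       ennreal (4 * C) * h y * (ennreal (2 * v) * h y)"
      by (subst nn_integral_cmult) (auto intro: mult_left_mono)
  qed
  also have "\<dots> = ennreal (8 * C * v) * (\<integral>\<^sup>+x. h x * h x \<partial>lborel)"
  proof -
    have "ennreal (8 * C * v) = ennreal (4 * C) * ennreal (2 * v)" using C v by (simp flip: ennreal_mult)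
    then have "ennreal (4 * C) * h y * (ennreal (2 * v) * h y) = ennreal (8 * C * v) * (h y * h y)" for y
      by (simp add: mult_ac)
    then show ?thesis by (simp add: nn_integral_cmult)
  qed
  finally show ?thesis by (simp add: C_def v_def)
qed

section \<open>Radial, non-tangential and tangential maximal functions\<close>

definition radial_max :: "(real^'n::finite \<Rightarrow> real) \<Rightarrow> ((real^'n \<Rightarrow> real) \<Rightarrow> real) \<Rightarrow> real^'n \<Rightarrow> ennreal" where
  "radial_max \<phi> f x = (SUP t\<in>{0<..}. ennreal \<bar>distr_conv f (dilate \<phi> t) x\<bar>)"

text \<open>A supremum of real square roots rather than the root of the supremum, since the latter
  would need a square root on \<open>ennreal\<close>.\<close>

definition sqrt_radial_max :: "(real^'n::finite \<Rightarrow> real) \<Rightarrow> ((real^'n \<Rightarrow> real) \<Rightarrow> real) \<Rightarrow> real^'n \<Rightarrow> ennreal" where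
  "sqrt_radial_max \<phi> f x = (SUP t\<in>{0<..}. ennreal (sqrt \<bar>distr_conv f (dilate \<phi> t) x\<bar>))"

text \<open>The index set may be uncountable, so measurability comes from openness of the superlevel
  sets and not from countable suprema.\<close>

lemma borel_measurable_SUP_continuous:
  fixes F :: "'i \<Rightarrow> 'a::topological_space \<Rightarrow> real"
  assumes "\<And>s. s \<in> S \<Longrightarrow> continuous_on UNIV (F s)"
  shows "(\<lambda>z. SUP s\<in>S. ennreal (F s z)) \<in> borel_measurable borel"
proof (rule borel_measurableI_greater)
  fix a
  have "{x \<in> space borel. a < (SUP s\<in>S. ennreal (F s x))} = (\<Union>s\<in>S. {x. a < ennreal (F s x)})"
    by (auto simp: less_SUP_iff)
  moreover have "open {x. a < ennreal (F s x)}" if "s \<in> S" for s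
    using assms[OF that] by (intro open_Collect_less continuous_on_ennreal continuous_on_const)
  ultimately show "{x \<in> space borel. a < (SUP s\<in>S. ennreal (F s x))} \<in> sets borel"
    by (auto intro!: borel_open)
qed

lemma abs_integral_le:
  fixes g h :: "'a \<Rightarrow> real"
  assumes h: "integrable M h" and g: "g \<in> borel_measurable M" and le: "\<And>x. \<bar>g x\<bar> \<le> h x"
  shows "\<bar>\<integral>x. g x \<partial>M\<bar> \<le> (\<integral>x. h x \<partial>M)"
proof -
  have "integrable M g"
    by (rule Bochner_Integration.integrable_bound[OF h g]) (use le in \<open>auto intro: order_trans[OF _ abs_ge_self]\<close>)
  then have "(\<integral>x. \<bar>g x\<bar> \<partial>M) \<le> (\<integral>x. h x \<partial>M)"
    using h le by (intro integral_mono) auto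
  then show ?thesis using integral_abs_bound[of M g] by linarith
qed

lemma abs_sums_le_geometric:
  fixes a :: "nat \<Rightarrow> real"
  assumes "a sums A" "\<And>i. \<bar>a i\<bar> \<le> K * (1/2) ^ i"
  shows "\<bar>A\<bar> \<le> 2 * K"
proof -
  have s: "(\<lambda>i. K * (1/2) ^ i) sums (K * 2)"
    using geometric_sums[of "1/2::real"] by (intro sums_mult) simp
  have "summable (\<lambda>i. \<bar>a i\<bar>)"
    by (rule summable_comparison_test'[OF sums_summable[OF s], of 0]) (use assms in simp)
  then have "\<bar>suminf a\<bar> \<le> (\<Sum>i. \<bar>a i\<bar>)" by (rule summable_rabs)
  also have "\<dots> \<le> (\<Sum>i. K * (1/2) ^ i)"
    using assms s \<open>summable (\<lambda>i. \<bar>a i\<bar>)\<close> by (intro suminf_le) (auto simp: sums_iff)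
  finally show ?thesis using assms s by (simp add: sums_iff)
qed

context
  fixes \<phi> :: "real^'n::finite \<Rightarrow> real"
  assumes \<phi>: "\<phi> \<in> test_functions" "(\<integral>x. \<phi> x \<partial>lborel) = 1"
begin

lemma continuous_distr_conv_dilate:
  "distribution f \<Longrightarrow> t > 0 \<Longrightarrow> continuous_on S (distr_conv f (dilate \<phi> t))"
  by (intro smooth_continuous smooth_distr_conv test_functions_dilate \<phi>)

lemma measurable_distr_conv_dilate:
  "distribution f \<Longrightarrow> t > 0 \<Longrightarrow> distr_conv f (dilate \<phi> t) \<in> borel_measurable borel"
  by (intro borel_measurable_continuous_onI continuous_distr_conv_dilate)

lemma borel_measurable_radial_max: "distribution f \<Longrightarrow> radial_max \<phi> f \<in> borel_measurable borel"
  unfolding radial_max_def[abs_def]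
  by (intro borel_measurable_SUP_continuous continuous_on_rabs continuous_distr_conv_dilate) auto

lemma borel_measurable_sqrt_radial_max: "distribution f \<Longrightarrow> sqrt_radial_max \<phi> f \<in> borel_measurable borel"
  unfolding sqrt_radial_max_def[abs_def]
  by (intro borel_measurable_SUP_continuous continuous_on_real_sqrt continuous_on_rabs continuous_distr_conv_dilate) auto

text \<open>The product distributes over both suprema, and for two scales the product of the roots
  is at most the larger of the two values.\<close>

lemma sqrt_radial_max_square: "sqrt_radial_max \<phi> f x * sqrt_radial_max \<phi> f x \<le> radial_max \<phi> f x"
proof -
  have "ennreal (sqrt \<bar>a\<bar>) * ennreal (sqrt \<bar>b\<bar>) \<le> ennreal (max \<bar>a\<bar> \<bar>b\<bar>)" for a b
  proof -
    have "sqrt \<bar>a\<bar> * sqrt \<bar>b\<bar> \<le> sqrt (max \<bar>a\<bar> \<bar>b\<bar>) * sqrt (max \<bar>a\<bar> \<bar>b\<bar>)" by (intro mult_mono) auto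
    then show ?thesis by (simp add: ennreal_leI flip: ennreal_mult)
  qed
  moreover have "ennreal (max \<bar>distr_conv f (dilate \<phi> s) x\<bar> \<bar>distr_conv f (dilate \<phi> t) x\<bar>) \<le> radial_max \<phi> f x" if "s > 0" "t > 0" for s t
  proof -
    have "ennreal \<bar>distr_conv f (dilate \<phi> s) x\<bar> \<le> radial_max \<phi> f x" if "s > 0" for s
      unfolding radial_max_def using that by (intro SUP_upper) auto
    then show ?thesis using that by (auto simp: max_def)
  qed
  ultimately have le: "ennreal (sqrt \<bar>distr_conv f (dilate \<phi> s) x\<bar>) * ennreal (sqrt \<bar>distr_conv f (dilate \<phi> t) x\<bar>) \<le> radial_max \<phi> f x"
    if "s > 0" "t > 0" for s t
    using that order_trans by blast
  show ?thesis
    unfolding sqrt_radial_max_def SUP_mult_right_ennreal SUP_mult_left_ennreal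
    by (intro SUP_least) (auto intro: le)
qed

lemma distr_conv_dilate_integrable:
  assumes f: "distribution f" and fin: "(\<integral>\<^sup>+z. radial_max \<phi> f z \<partial>lborel) < \<infinity>" and t: "t > 0"
  shows "integrable lborel (distr_conv f (dilate \<phi> t))"
    and "(\<integral>z. \<bar>distr_conv f (dilate \<phi> t) z\<bar> \<partial>lborel) \<le> enn2real (\<integral>\<^sup>+z. radial_max \<phi> f z \<partial>lborel)"
proof -
  note m[measurable] = measurable_distr_conv_dilate[OF f t]
  have le: "(\<integral>\<^sup>+z. ennreal \<bar>distr_conv f (dilate \<phi> t) z\<bar> \<partial>lborel) \<le> (\<integral>\<^sup>+z. radial_max \<phi> f z \<partial>lborel)"
    unfolding radial_max_def using t by (intro nn_integral_mono SUP_upper) auto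
  show "integrable lborel (distr_conv f (dilate \<phi> t))"
    using le_less_trans[OF le fin] by (intro integrableI_bounded) auto
  show "(\<integral>z. \<bar>distr_conv f (dilate \<phi> t) z\<bar> \<partial>lborel) \<le> enn2real (\<integral>\<^sup>+z. radial_max \<phi> f z \<partial>lborel)"
    by (subst integral_eq_nn_integral) (use le fin in \<open>auto intro: enn2real_mono\<close>)
qed

section \<open>From radial to tangential bounds\<close>

text \<open>The reproducing formula integrates finer regularisations, whose \<open>L1\<close> norms
  the radial maximal function controls, against kernels of size \<open>1 / s ^ CARD('n)\<close>. The
  purpose is qualitative: it guarantees that a weighted supremum formed below is finite and may be
  cancelled.\<close>

lemma radial_max_crude_bound:
  "\<exists>C\<ge>0. \<forall>f. distribution f \<longrightarrow> (\<integral>\<^sup>+z. radial_max \<phi> f z \<partial>lborel) < \<infinity> \<longrightarrow>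
     (\<forall>s>0. \<forall>y. \<bar>distr_conv f (dilate \<phi> s) y\<bar> \<le> C / s ^ CARD('n) * enn2real (\<integral>\<^sup>+z. radial_max \<phi> f z \<partial>lborel))"
proof -
  obtain R C \<eta> where R: "R > 0" and C: "C \<ge> 0"
    and all: "\<forall>i. \<eta> i \<in> test_functions \<and> (\<forall>x. R < norm x \<longrightarrow> \<eta> i x = 0) \<and>
      (\<forall>x. \<bar>\<eta> i x\<bar> \<le> C * (1/2) ^ (1 * i)) \<and> ((\<integral>x. \<phi> x \<partial>lborel) = 0 \<longrightarrow> (\<integral>x. \<eta> i x \<partial>lborel) = 0)"
    and sums: "\<forall>f t x. distribution f \<longrightarrow> t > 0 \<longrightarrow>
      (\<lambda>i. \<integral>z. dilate (\<eta> i) t z * distr_conv f (dilate \<phi> (t * (1/2) ^ i)) (x - z) \<partial>lborel) sums distr_conv f (dilate \<phi> t) x"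
    using reproducing_formula[OF \<phi> \<phi>(1), of "1"] by blast
  have \<eta>: "\<And>i. \<eta> i \<in> test_functions" "\<And>i x. R < norm x \<Longrightarrow> \<eta> i x = 0"
    "\<And>i x. \<bar>\<eta> i x\<bar> \<le> C * (1/2) ^ (1 * i)"
    using all by blast+
  note sums = sums[rule_format]
  show ?thesis
  proof (intro exI[of _ "2 * C"] conjI allI impI)
    fix f s y assume f: "distribution f" and fin: "(\<integral>\<^sup>+z. radial_max \<phi> f z \<partial>lborel) < \<infinity>" and s: "(s::real) > 0"
    define I where "I = enn2real (\<integral>\<^sup>+z. radial_max \<phi> f z \<partial>lborel)"
    have "\<bar>\<integral>z. dilate (\<eta> i) s z * distr_conv f (dilate \<phi> (s * (1/2) ^ i)) (y - z) \<partial>lborel\<bar> \<le> (C / s ^ CARD('n) * I) * (1/2) ^ i" for i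
    proof -
      define F where "F = distr_conv f (dilate \<phi> (s * (1/2) ^ i))"
      have si: "s * (1/2) ^ i > 0" using s by simp
      have [measurable]: "F \<in> borel_measurable borel"
        unfolding F_def by (rule measurable_distr_conv_dilate[OF f si])
      have F: "integrable lborel F" "(\<integral>z. \<bar>F z\<bar> \<partial>lborel) \<le> I"
        unfolding F_def I_def by (intro distr_conv_dilate_integrable f fin si)+
      have F': "integrable lborel (\<lambda>z. F (y - z))" "(\<integral>z. \<bar>F (y - z)\<bar> \<partial>lborel) \<le> I"
        using lborel_integral_reflect(1)[of F y] lborel_integral_reflect(2)[of "\<lambda>z. \<bar>F z\<bar>" y] F by auto
      have dm: "dilate (\<eta> i) s \<in> borel_measurable borel"
        using test_functions_dilate[OF \<eta>(1) s] by auto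
      have "\<bar>\<integral>z. F (y - z) * dilate (\<eta> i) s z \<partial>lborel\<bar> \<le> (C * (1/2) ^ i / s ^ CARD('n)) * (\<integral>z. \<bar>F (y - z)\<bar> \<partial>lborel)"
      proof (rule integral_mult_bounded(2)[OF F'(1)])
        show "\<bar>dilate (\<eta> i) s x\<bar> \<le> C * (1/2) ^ i / s ^ CARD('n)" for x
          using \<eta>(3)[of i] s by (auto simp: dilate_def intro!: divide_right_mono)
      qed (use dm in simp)
      also have "\<dots> \<le> (C * (1/2) ^ i / s ^ CARD('n)) * I"
        using C s by (intro mult_left_mono F') auto
      finally show ?thesis by (simp add: F_def mult_ac)
    qed
    from abs_sums_le_geometric[OF sums[OF f s] this]
    show "\<bar>distr_conv f (dilate \<phi> s) y\<bar> \<le> 2 * C / s ^ CARD('n) * enn2real (\<integral>\<^sup>+z. radial_max \<phi> f z \<partial>lborel)"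
      by (simp add: I_def)
  qed (use C in auto)
qed

text \<open>The square root of the radial maximal function suffices: estimating one half power of \<open>f * \<phi>\<^sub>s\<close> by the
  tangential maximal function \<open>S\<close> and the other by the Hardy--Littlewood maximal function \<open>m\<close> gives \<open>S \<le> c m \<surd>S\<close>,
  hence \<open>S \<le> (c m)\<^sup>2\<close> since \<open>S\<close> is finite.\<close>

lemma nontangential_bound:
  "\<exists>C>0. \<forall>f. distribution f \<longrightarrow> (\<integral>\<^sup>+z. radial_max \<phi> f z \<partial>lborel) < \<infinity> \<longrightarrow>
     (\<forall>t>0. \<forall>i x y. ennreal \<bar>distr_conv f (dilate \<phi> (t * (1/2) ^ i)) y\<bar> \<le>
        ennreal (C * 4 ^ (CARD('n) * i) * (1 + norm (x - y) / t) ^ (2 * CARD('n))) *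
        (maxfn (sqrt_radial_max \<phi> f) x * maxfn (sqrt_radial_max \<phi> f) x))"
proof -
  define N where "N = CARD('n)"
  obtain C1 where C1: "C1 \<ge> 0" "\<forall>f. distribution f \<longrightarrow> (\<integral>\<^sup>+z. radial_max \<phi> f z \<partial>lborel) < \<infinity> \<longrightarrow>
     (\<forall>s>0. \<forall>y. \<bar>distr_conv f (dilate \<phi> s) y\<bar> \<le> C1 / s ^ N * enn2real (\<integral>\<^sup>+z. radial_max \<phi> f z \<partial>lborel))"
    using radial_max_crude_bound unfolding N_def by blast
  note C1 = C1(1) C1(2)[rule_format]
  \<comment> \<open>The decay exponent is \<open>N + 1\<close>: \<open>N\<close> powers cancel the
    growth \<open>2 ^ (N * l)\<close> of the half power at scale \<open>i + l\<close>, one more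
    makes the series converge.\<close>
  obtain R C0 \<eta> where R: "R > 0" and C0: "C0 \<ge> 0"
    and all: "\<forall>i. \<eta> i \<in> test_functions \<and> (\<forall>x. R < norm x \<longrightarrow> \<eta> i x = 0) \<and>
      (\<forall>x. \<bar>\<eta> i x\<bar> \<le> C0 * (1/2) ^ ((N + 1) * i)) \<and> ((\<integral>x. \<phi> x \<partial>lborel) = 0 \<longrightarrow> (\<integral>x. \<eta> i x \<partial>lborel) = 0)"
    and sums: "\<forall>f t x. distribution f \<longrightarrow> t > 0 \<longrightarrow>
      (\<lambda>i. \<integral>z. dilate (\<eta> i) t z * distr_conv f (dilate \<phi> (t * (1/2) ^ i)) (x - z) \<partial>lborel) sums distr_conv f (dilate \<phi> t) x"
    using reproducing_formula[OF \<phi> \<phi>(1), of "N + 1"] by blast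
  have \<eta>: "\<And>i. \<eta> i \<in> test_functions" "\<And>i x. R < norm x \<Longrightarrow> \<eta> i x = 0"
    "\<And>i x. \<bar>\<eta> i x\<bar> \<le> C0 * (1/2) ^ ((N + 1) * i)"
    using all by blast+
  note sums = sums[rule_format]
  define R1 where "R1 = R + 1"
  have R1: "R1 \<ge> 1" "R < R1" using R by (auto simp: R1_def)
  \<comment> \<open>The factor \<open>2\<close> is the geometric series. One \<open>R1 ^ N\<close>
    comes from the radius of the ball on which the maximal function is used, the other from the
    weight at points of that ball.\<close>
  define c where "c = 2 * C0 * R1 ^ (2 * N)"
  have c: "c \<ge> 0" using C0 R1 by (simp add: c_def)
  define C where "C = c\<^sup>2 + 1"
  have C: "C > 0" by (simp add: C_def add_nonneg_pos)
  have main: "ennreal \<bar>distr_conv f (dilate \<phi> (t * (1/2) ^ i)) y\<bar> \<le>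
        ennreal (C * 4 ^ (N * i) * (1 + norm (x - y) / t) ^ (2 * N)) *
        (maxfn (sqrt_radial_max \<phi> f) x * maxfn (sqrt_radial_max \<phi> f) x)"
    if f: "distribution f" and fin: "(\<integral>\<^sup>+z. radial_max \<phi> f z \<partial>lborel) < \<infinity>" and t: "t > 0" for f t i x y
  proof -
    define F where "F i = distr_conv f (dilate \<phi> (t * (1/2) ^ i))" for i
    define \<rho> where "\<rho> y = 1 + norm (x - y) / t" for y
    have \<rho>: "\<rho> y \<ge> 1" for y using t by (simp add: \<rho>_def)
    have ti: "t * (1/2) ^ i > 0" for i using t by simp
    have [measurable]: "F i \<in> borel_measurable borel" for i
      unfolding F_def by (rule measurable_distr_conv_dilate[OF f ti])
    show ?thesis
    proof (cases "maxfn (sqrt_radial_max \<phi> f) x")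
      \<comment> \<open>An infinite maximal function makes the right-hand side infinite, provided
        the constant is positive; hence the summand \<open>1\<close> in \<open>C\<close>.\<close>
      case top
      have "C * 4 ^ (N * i) * \<rho> y ^ (2 * N) > 0" using C \<rho>[of y] by simp
      then have "ennreal (C * 4 ^ (N * i) * \<rho> y ^ (2 * N)) \<noteq> 0" unfolding ennreal_eq_0_iff by (simp add: not_le)
      then show ?thesis unfolding top \<rho>_def by (simp add: ennreal_mult_top)
    next
      case (real m)
      have ball: "integrable lborel (\<lambda>w. indicator (ball x r) w * sqrt \<bar>F i w\<bar>)"
        "(\<integral>w. indicator (ball x r) w * sqrt \<bar>F i w\<bar> \<partial>lborel) \<le> m * r ^ N" if r: "r > 0" for r i
      proof -
        have [measurable]: "ball x r \<in> sets borel" by simp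
        have "(\<integral>\<^sup>+w. ennreal (indicator (ball x r) w * sqrt \<bar>F i w\<bar>) \<partial>lborel) \<le>
            (\<integral>\<^sup>+w. sqrt_radial_max \<phi> f w * indicator (ball x r) w \<partial>lborel)"
        proof (rule nn_integral_mono)
          fix w
          have "ennreal (sqrt \<bar>F i w\<bar>) \<le> sqrt_radial_max \<phi> f w"
            unfolding sqrt_radial_max_def F_def using ti by (intro SUP_upper) auto
          then show "ennreal (indicator (ball x r) w * sqrt \<bar>F i w\<bar>) \<le> sqrt_radial_max \<phi> f w * indicator (ball x r) w"
            by (auto split: split_indicator)
        qed
        also have "\<dots> \<le> maxfn (sqrt_radial_max \<phi> f) x * ennreal (r ^ DIM(real^'n))"
          by (rule nn_integral_ball_le_maxfn[OF r])
        also have "\<dots> = ennreal (m * r ^ N)"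
          using real r by (simp add: N_def ennreal_mult)
        finally have le: "(\<integral>\<^sup>+w. ennreal (indicator (ball x r) w * sqrt \<bar>F i w\<bar>) \<partial>lborel) \<le> ennreal (m * r ^ N)" .
        show "integrable lborel (\<lambda>w. indicator (ball x r) w * sqrt \<bar>F i w\<bar>)"
          using le_less_trans[OF le] by (intro integrableI_nonneg) auto
        show "(\<integral>w. indicator (ball x r) w * sqrt \<bar>F i w\<bar> \<partial>lborel) \<le> m * r ^ N"
          by (rule integral_real_bounded[OF _ le]) (use real r in auto)
      qed
      define I where "I = enn2real (\<integral>\<^sup>+z. radial_max \<phi> f z \<partial>lborel)"
      \<comment> \<open>All finer scales and all points enter, because the reproducing formula at
        scale \<open>i\<close> involves the scales \<open>i + l\<close> at shifted points. The
        weight reproduces itself: its square root, from one half power, times the factor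
        \<open>2 ^ (N * i) * \<rho> y ^ N\<close>, from the kernel and the ball, is the weight
        again.\<close>
      define a where "a p = \<bar>F (fst p) (snd p)\<bar> / (4 ^ (N * fst p) * \<rho> (snd p) ^ (2 * N))" for p
      define S where "S = (SUP p. a p)"
      have den: "4 ^ (N * i) * \<rho> y ^ (2 * N) > 0" for i y using \<rho>[of y] by simp
      have I0: "I \<ge> 0" by (simp add: I_def)
      \<comment> \<open>Finiteness of \<open>S\<close>: the crude bound grows only like
        \<open>2 ^ (N * i)\<close>, which the weight dominates.\<close>
      have bdd: "bdd_above (range a)"
      proof (rule bdd_aboveI2)
        fix p :: "nat \<times> (real^'n)"
        obtain i y where p: "p = (i, y)" by (cases p)
        have "\<bar>F i y\<bar> \<le> C1 / (t * (1/2) ^ i) ^ N * I"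
          unfolding F_def I_def by (intro C1 f fin ti)
        also have "\<dots> = (C1 / t ^ N * I) * (2 ^ (N * i) * 1)"
        proof -
          have "(t * (1/2) ^ i) ^ N = t ^ N / 2 ^ (N * i)"
            by (simp add: power_divide power_mult[symmetric] mult.commute)
          then show ?thesis by simp
        qed
        also have "\<dots> \<le> (C1 / t ^ N * I) * (4 ^ (N * i) * \<rho> y ^ (2 * N))"
          using C1 I0 t \<rho>[of y] by (intro mult_left_mono mult_mono power_mono one_le_power) auto
        finally show "a p \<le> C1 / t ^ N * I"
          unfolding a_def p fst_conv snd_conv pos_divide_le_eq[OF den] .
      qed
      have aS: "a p \<le> S" for p unfolding S_def by (rule cSUP_upper[OF _ bdd]) simp
      have S0: "S \<ge> 0" using aS[of "(0, x)"] den[of 0 x] by (intro order_trans[OF _ aS[of "(0, x)"]]) (simp add: a_def)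
      have FS: "\<bar>F i y\<bar> \<le> S * (4 ^ (N * i) * \<rho> y ^ (2 * N))" for i y
        using aS[of "(i, y)"] unfolding a_def fst_conv snd_conv pos_divide_le_eq[OF den] .
      have key: "\<bar>F i y\<bar> \<le> (c * m * sqrt S) * (4 ^ (N * i) * \<rho> y ^ (2 * N))" for i y
      proof -
        define s where "s = t * (1/2) ^ i"
        have s: "s > 0" "s \<le> t" using t by (auto simp: s_def mult_left_le power_le_one)
        have sN: "s ^ N = t ^ N * (1/2) ^ (N * i)"
          by (simp add: s_def power_mult_distrib power_mult[symmetric] mult.commute)
        define r where "r = R1 * t * \<rho> y"
        have r: "r > 0" using R1 t \<rho>[of y] by (simp add: r_def)
        define K where "K = C0 * R1 ^ (2 * N) * m * sqrt S * (4 ^ (N * i) * \<rho> y ^ (2 * N))"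
        have "\<bar>\<integral>z. dilate (\<eta> l) s z * F (i + l) (y - z) \<partial>lborel\<bar> \<le> K * (1/2) ^ l" for l
        proof -
          define Q where "Q = (C0 * (1/2) ^ ((N + 1) * l) / s ^ N) * (sqrt S * 2 ^ (N * (i + l)) * (R1 * \<rho> y) ^ N)"
          have Q0: "Q \<ge> 0" using C0 s S0 R1 \<rho>[of y] by (simp add: Q_def)
          have dm[measurable]: "dilate (\<eta> l) s \<in> borel_measurable borel"
            using test_functions_dilate[OF \<eta>(1) s(1)] by auto
          have pt: "\<bar>dilate (\<eta> l) s (y - w) * F (i + l) w\<bar> \<le> Q * (indicator (ball x r) w * sqrt \<bar>F (i + l) w\<bar>)" for w
          proof (cases "s * R < norm (y - w)")
            case True
            then have "dilate (\<eta> l) s (y - w) = 0" using \<eta>(2) s by (intro dilate_support[of R]) auto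
            then show ?thesis using Q0 by simp
          next
            case False
            then have yw: "norm (y - w) \<le> t * R" using s(2) R by (meson mult_right_mono less_imp_le not_less order_trans)
            have "norm (x - w) \<le> norm (x - y) + t * R"
              using norm_triangle_ineq[of "x - y" "y - w"] yw by simp
            moreover have "norm (x - y) = t * (\<rho> y - 1)" using t by (simp add: \<rho>_def)
            ultimately have xw: "norm (x - w) \<le> t * (\<rho> y - 1 + R)" by (simp add: distrib_left)
            have R\<rho>: "\<rho> y + R \<le> R1 * \<rho> y" using \<rho>[of y] R by (simp add: R1_def algebra_simps)
            have "norm (x - w) < t * (\<rho> y + R)" using xw t by (smt (verit) mult_strict_left_mono)
            also have "\<dots> \<le> r" using R\<rho> t by (simp add: r_def mult.assoc mult.left_commute)
            finally have in_ball: "w \<in> ball x r" by (simp add: dist_norm)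
            have "norm (x - w) / t \<le> \<rho> y - 1 + R" using xw t by (simp add: divide_le_eq mult.commute)
            then have \<rho>w: "\<rho> w \<le> R1 * \<rho> y" using R\<rho> by (simp add: \<rho>_def[of w])
            have "\<bar>F (i + l) w\<bar> \<le> S * (4 ^ (N * (i + l)) * (R1 * \<rho> y) ^ (2 * N))"
              using \<rho>w \<rho>[of w] S0 by (intro order_trans[OF FS] mult_left_mono power_mono) auto
            also have "\<dots> = (sqrt S * 2 ^ (N * (i + l)) * (R1 * \<rho> y) ^ N)\<^sup>2"
            proof -
              have "(4::real) ^ (N * (i + l)) = (2 ^ (N * (i + l)))\<^sup>2"
                by (simp add: power2_eq_square flip: power_mult_distrib)
              moreover have "(R1 * \<rho> y) ^ (2 * N) = ((R1 * \<rho> y) ^ N)\<^sup>2"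
                by (simp add: power_mult[symmetric] mult.commute)
              ultimately show ?thesis using S0 by (simp add: power_mult_distrib)
            qed
            finally have "sqrt \<bar>F (i + l) w\<bar> \<le> sqrt S * 2 ^ (N * (i + l)) * (R1 * \<rho> y) ^ N"
              using S0 R1 \<rho>[of y] by (intro real_le_lsqrt) auto
            then have "\<bar>F (i + l) w\<bar> \<le> (sqrt S * 2 ^ (N * (i + l)) * (R1 * \<rho> y) ^ N) * sqrt \<bar>F (i + l) w\<bar>"
              using mult_right_mono[of "sqrt \<bar>F (i + l) w\<bar>" _ "sqrt \<bar>F (i + l) w\<bar>"] by simp
            moreover have "\<bar>dilate (\<eta> l) s (y - w)\<bar> \<le> C0 * (1/2) ^ ((N + 1) * l) / s ^ N"
              using \<eta>(3)[of l] s by (auto simp: dilate_def N_def intro!: divide_right_mono)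
            ultimately have "\<bar>dilate (\<eta> l) s (y - w)\<bar> * \<bar>F (i + l) w\<bar> \<le>
              (C0 * (1/2) ^ ((N + 1) * l) / s ^ N) * ((sqrt S * 2 ^ (N * (i + l)) * (R1 * \<rho> y) ^ N) * sqrt \<bar>F (i + l) w\<bar>)"
              using C0 s by (intro mult_mono) auto
            then show ?thesis using in_ball by (simp add: abs_mult Q_def mult.assoc)
          qed
          have "(\<integral>z. dilate (\<eta> l) s z * F (i + l) (y - z) \<partial>lborel) = (\<integral>w. dilate (\<eta> l) s (y - w) * F (i + l) w \<partial>lborel)"
            using lborel_integral_reflect(2)[of "\<lambda>z. dilate (\<eta> l) s z * F (i + l) (y - z)" y] by simp
          also have "\<bar>\<dots>\<bar> \<le> (\<integral>w. Q * (indicator (ball x r) w * sqrt \<bar>F (i + l) w\<bar>) \<partial>lborel)"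
            by (rule abs_integral_le[OF _ _ pt]) (use ball[OF r] in simp_all)
          also have "\<dots> \<le> Q * (m * r ^ N)"
            using ball[OF r, of "i + l"] Q0 by (simp add: mult_left_mono)
          also have "\<dots> = K * (1/2) ^ l"
          proof -
            have e1: "(1/2::real) ^ ((N + 1) * l) = (1/2) ^ (N * l) * (1/2) ^ l" by (simp add: power_add algebra_simps)
            have e2: "(2::real) ^ (N * (i + l)) = 2 ^ (N * i) * 2 ^ (N * l)" by (simp add: power_add algebra_simps)
            have e3: "(4::real) ^ (N * i) = 2 ^ (N * i) * 2 ^ (N * i)" by (simp flip: power_mult_distrib)
            have e4: "(1/2::real) ^ k * 2 ^ k = 1" for k by (simp flip: power_mult_distrib)
            have e5: "b ^ (2 * N) = b ^ N * b ^ N" for b :: real by (simp add: mult_2 power_add)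
            have inv: "1 / s ^ N = 2 ^ (N * i) / t ^ N" unfolding sN by (simp add: power_one_over)
            have "Q * (m * r ^ N) = C0 * ((1/2) ^ (N * l) * 2 ^ (N * l)) * (1/2) ^ l * (1 / s ^ N) * t ^ N * sqrt S * 2 ^ (N * i) * R1 ^ N * R1 ^ N * \<rho> y ^ N * \<rho> y ^ N * m"
              unfolding Q_def r_def e1 e2 by (simp add: power_mult_distrib)
            also have "\<dots> = K * (1/2) ^ l"
              unfolding inv e4 K_def e3 e5 using t by simp
            finally show ?thesis .
          qed
          finally show ?thesis .
        qed
        moreover have "(\<lambda>l. \<integral>z. dilate (\<eta> l) s z * F (i + l) (y - z) \<partial>lborel) sums F i y"
          using sums[OF f s(1), of y] by (simp add: F_def s_def power_add mult.assoc)
        ultimately have "\<bar>F i y\<bar> \<le> 2 * K" by (intro abs_sums_le_geometric)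
        then show ?thesis by (simp add: K_def c_def mult_ac)
      qed
      have "a p \<le> c * m * sqrt S" for p
      proof -
        obtain i y where p: "p = (i, y)" by (cases p)
        show ?thesis
          unfolding a_def p fst_conv snd_conv pos_divide_le_eq[OF den] by (rule key)
      qed
      then have "(SUP p. a p) \<le> c * m * sqrt S" by (intro cSUP_least) auto
      then have "S \<le> c * m * sqrt S" unfolding S_def[symmetric] .
      then have "sqrt S * sqrt S \<le> (c * m) * sqrt S" using S0 by simp
      \<comment> \<open>Cancelling \<open>sqrt S\<close> relies on \<open>S\<close> being a real
        number bounding all \<open>a p\<close>; \<open>S = 0\<close> is trivial.\<close>
      then have "sqrt S \<le> c * m"
        using c real(1) S0 mult_right_le_imp_le[of "sqrt S" "sqrt S" "c * m"] by (cases "S = 0") auto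
      then have "S \<le> (c * m)\<^sup>2" using S0 by (metis real_sqrt_ge_zero real_sqrt_pow2 power_mono)
      also have "\<dots> \<le> C * (m * m)" by (simp add: C_def power2_eq_square algebra_simps)
      finally have "\<bar>F i y\<bar> \<le> (C * (m * m)) * (4 ^ (N * i) * \<rho> y ^ (2 * N))"
        using den[of i y] by (intro order_trans[OF FS] mult_right_mono) auto
      then have "ennreal \<bar>F i y\<bar> \<le> ennreal (C * 4 ^ (N * i) * \<rho> y ^ (2 * N) * (m * m))"
        by (intro ennreal_leI) (simp add: mult_ac)
      also have "\<dots> = ennreal (C * 4 ^ (N * i) * \<rho> y ^ (2 * N)) * (ennreal m * ennreal m)"
        using C \<rho>[of y] real(1) by (simp add: ennreal_mult)
      finally show ?thesis unfolding F_def \<rho>_def real(2) .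
    qed
  qed
  show ?thesis
    using C main unfolding N_def by blast
qed

section \<open>Oscillation of the regularised functions\<close>

text \<open>Up to a constant factor, the function \<open>G\<close> of the overview.\<close>

definition gradient_max :: "((real^'n \<Rightarrow> real) \<Rightarrow> real) \<Rightarrow> real^'n \<Rightarrow> ennreal" where
  "gradient_max T x = (\<Sum>j\<in>UNIV. maxfn (sqrt_radial_max \<phi> (distr_pdiff j T)) x * maxfn (sqrt_radial_max \<phi> (distr_pdiff j T)) x)"

text \<open>Differentiation commutes with regularisation, so the partial derivatives of the
  regularised \<open>T\<close> are regularisations of its distributional derivatives. The point
  \<open>x\<close> of the maximal function and the point \<open>y\<close> of the derivative are
  independent, which is what the mean value theorem around \<open>x\<close> needs.\<close>

lemma gradient_bound:
  "\<exists>C>0. \<forall>T. distribution T \<longrightarrow> (\<forall>j. (\<integral>\<^sup>+z. radial_max \<phi> (distr_pdiff j T) z \<partial>lborel) < \<infinity>) \<longrightarrow>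
     (\<forall>x. gradient_max T x < \<infinity> \<longrightarrow> (\<forall>t>0. \<forall>i y.
        (\<Sum>j\<in>UNIV. \<bar>pdiff j (distr_conv T (dilate \<phi> (t * (1/2) ^ i))) y\<bar>) \<le>
        C * 4 ^ (CARD('n) * i) * (1 + norm (x - y) / t) ^ (2 * CARD('n)) * enn2real (gradient_max T x)))"
proof -
  obtain C where C: "C > 0" "\<forall>f. distribution f \<longrightarrow> (\<integral>\<^sup>+z. radial_max \<phi> f z \<partial>lborel) < \<infinity> \<longrightarrow>
     (\<forall>t>0. \<forall>i x y. ennreal \<bar>distr_conv f (dilate \<phi> (t * (1/2) ^ i)) y\<bar> \<le>
        ennreal (C * 4 ^ (CARD('n) * i) * (1 + norm (x - y) / t) ^ (2 * CARD('n))) *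
        (maxfn (sqrt_radial_max \<phi> f) x * maxfn (sqrt_radial_max \<phi> f) x))"
    using nontangential_bound by blast
  show ?thesis
  proof (intro exI[of _ C] conjI allI impI)
    fix T x t i y
    assume T: "distribution T" and fin: "\<forall>j. (\<integral>\<^sup>+z. radial_max \<phi> (distr_pdiff j T) z \<partial>lborel) < \<infinity>"
      and G: "gradient_max T x < \<infinity>" and t: "t > (0::real)"
    define k where "k = C * 4 ^ (CARD('n) * i) * (1 + norm (x - y) / t) ^ (2 * CARD('n))"
    have k: "k \<ge> 0" using C t by (simp add: k_def)
    have tt: "dilate \<phi> (t * (1/2) ^ i) \<in> test_functions"
      using t by (intro test_functions_dilate \<phi>) simp
    have "ennreal (\<Sum>j\<in>UNIV. \<bar>pdiff j (distr_conv T (dilate \<phi> (t * (1/2) ^ i))) y\<bar>) =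
        (\<Sum>j\<in>UNIV. ennreal \<bar>distr_conv (distr_pdiff j T) (dilate \<phi> (t * (1/2) ^ i)) y\<bar>)"
      by (simp add: distr_conv_pdiff[OF T tt] sum_ennreal)
    also have "\<dots> \<le> (\<Sum>j\<in>UNIV. ennreal k * (maxfn (sqrt_radial_max \<phi> (distr_pdiff j T)) x * maxfn (sqrt_radial_max \<phi> (distr_pdiff j T)) x))"
      unfolding k_def using C(2) distribution_pdiff[OF T] fin t by (intro sum_mono) blast
    also have "\<dots> = ennreal k * gradient_max T x"
      by (simp add: gradient_max_def sum_distrib_left)
    also have "gradient_max T x = ennreal (enn2real (gradient_max T x))"
      using G by simp
    also have "ennreal k * ennreal (enn2real (gradient_max T x)) = ennreal (k * enn2real (gradient_max T x))"
      using k by (simp add: ennreal_mult)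
    finally show "(\<Sum>j\<in>UNIV. \<bar>pdiff j (distr_conv T (dilate \<phi> (t * (1/2) ^ i))) y\<bar>) \<le>
        C * 4 ^ (CARD('n) * i) * (1 + norm (x - y) / t) ^ (2 * CARD('n)) * enn2real (gradient_max T x)"
      using k by (simp add: k_def)
  qed (use C in auto)
qed

text \<open>At one scale the gradient bound on a ball of radius \<open>t\<close> suffices. The
  difference between the scales \<open>t / 2\<close> and \<open>t\<close> is convolution with the
  dilate of \<open>\<Phi>\<close>, whose integral vanishes; so do the integrals of the
  \<open>\<eta> i\<close>, hence \<open>u i x\<close> may be subtracted, and increments of
  \<open>u i\<close> over distances at most \<open>t * R\<close> remain.\<close>

lemma oscillation_bound:
  "\<exists>C>0. \<forall>T. distribution T \<longrightarrow> (\<forall>j. (\<integral>\<^sup>+z. radial_max \<phi> (distr_pdiff j T) z \<partial>lborel) < \<infinity>) \<longrightarrow>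
     (\<forall>x. gradient_max T x < \<infinity> \<longrightarrow> (\<forall>t>0.
        (\<forall>y. norm (x - y) \<le> t \<longrightarrow> \<bar>distr_conv T (dilate \<phi> t) x - distr_conv T (dilate \<phi> t) y\<bar> \<le>
           C * norm (x - y) * enn2real (gradient_max T x)) \<and>
        \<bar>distr_conv T (dilate \<phi> (t / 2)) x - distr_conv T (dilate \<phi> t) x\<bar> \<le> C * t * enn2real (gradient_max T x)))"
proof -
  define N where "N = CARD('n)"
  obtain C where C: "C > 0" and grad: "\<forall>T. distribution T \<longrightarrow> (\<forall>j. (\<integral>\<^sup>+z. radial_max \<phi> (distr_pdiff j T) z \<partial>lborel) < \<infinity>) \<longrightarrow>
     (\<forall>x. gradient_max T x < \<infinity> \<longrightarrow> (\<forall>t>0. \<forall>i y.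
        (\<Sum>j\<in>UNIV. \<bar>pdiff j (distr_conv T (dilate \<phi> (t * (1/2) ^ i))) y\<bar>) \<le>
        C * 4 ^ (N * i) * (1 + norm (x - y) / t) ^ (2 * N) * enn2real (gradient_max T x)))"
    using gradient_bound unfolding N_def by blast
  note grad = grad[rule_format]
  define \<Phi> where "\<Phi> = (\<lambda>x. dilate \<phi> (1/2) x - \<phi> x)"
  have d2: "dilate \<phi> (1/2) \<in> test_functions" by (intro test_functions_dilate \<phi>) simp
  have \<Phi>: "\<Phi> \<in> test_functions"
    unfolding \<Phi>_def by (intro test_functions_diff d2 \<phi>)
  have \<Phi>0: "(\<integral>x. \<Phi> x \<partial>lborel) = 0"
    unfolding \<Phi>_def using integral_dilate(2)[of \<phi> "1/2"] \<phi> test_functions_integrable[OF \<phi>(1)] test_functions_integrable[OF d2]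
    by auto
  \<comment> \<open>Exponent \<open>2 * N + 1\<close>: the gradient bound at scale
    \<open>t * (1/2) ^ i\<close> grows like \<open>4 ^ (N * i)\<close>, and one further power sums
    the series.\<close>
  obtain R C0 \<eta> where R: "R > 0" and C0: "C0 \<ge> 0"
    and all: "\<forall>i. \<eta> i \<in> test_functions \<and> (\<forall>x. R < norm x \<longrightarrow> \<eta> i x = 0) \<and>
      (\<forall>x. \<bar>\<eta> i x\<bar> \<le> C0 * (1/2) ^ ((2 * N + 1) * i)) \<and> ((\<integral>x. \<Phi> x \<partial>lborel) = 0 \<longrightarrow> (\<integral>x. \<eta> i x \<partial>lborel) = 0)"
    and sums: "\<forall>f t x. distribution f \<longrightarrow> t > 0 \<longrightarrow>
      (\<lambda>i. \<integral>z. dilate (\<eta> i) t z * distr_conv f (dilate \<phi> (t * (1/2) ^ i)) (x - z) \<partial>lborel) sums distr_conv f (dilate \<Phi> t) x"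
    using reproducing_formula[OF \<phi> \<Phi>, of "2 * N + 1"] by blast
  have \<eta>: "\<eta> i \<in> test_functions" "R < norm x \<Longrightarrow> \<eta> i x = 0"
    "\<bar>\<eta> i x\<bar> \<le> C0 * (1/2) ^ ((2 * N + 1) * i)" "(\<integral>x. \<eta> i x \<partial>lborel) = 0" for i x
    using all \<Phi>0 by blast+
  note sums = sums[rule_format]
  define V where "V = (\<integral>x. \<bar>indicator (cball (0::real^'n) R) x\<bar> \<partial>lborel :: real)"
  have V: "V \<ge> 0" by (simp add: V_def)
  have \<eta>int: "(\<integral>x. \<bar>\<eta> i x\<bar> \<partial>lborel) \<le> C0 * (1/2) ^ ((2 * N + 1) * i) * V" for i
  proof -
    have ball: "integrable lborel (indicator (cball (0::real^'n) R) :: _ \<Rightarrow> real)"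
      using lmeasurable_cball[of "0::real^'n" R] emeasure_lborel_cball_finite[of "0::real^'n" R]
      by (intro integrable_real_indicator) auto
    have "(\<lambda>x. indicator (cball 0 R) x * \<bar>\<eta> i x\<bar>) = (\<lambda>x. \<bar>\<eta> i x\<bar>)"
      using \<eta>(2)[of _ i] by (auto simp: fun_eq_iff indicator_def not_le)
    then show ?thesis
      using integral_mult_bounded(2)[OF ball, of "\<lambda>x. \<bar>\<eta> i x\<bar>" "C0 * (1/2) ^ ((2 * N + 1) * i)"] \<eta>(1,3)[of i]
      by (auto simp: V_def intro: test_functions_measurable)
  qed
  \<comment> \<open>The first summand serves a fixed scale, where
    \<open>(1 + t / t) ^ (2 * N) = 4 ^ N\<close>; the second, with the \<open>2\<close> of the
    geometric series, the comparison of two scales.\<close>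
  define C' where "C' = C * 4 ^ N + 2 * (C * (1 + R) ^ (2 * N) * R * C0 * V)"
  show ?thesis
  proof (intro exI[of _ C'] conjI allI impI)
    show "C' > 0" using C R C0 V by (simp add: C'_def add_pos_nonneg)
    fix T x t
    assume T: "distribution T" and fin: "\<forall>j. (\<integral>\<^sup>+z. radial_max \<phi> (distr_pdiff j T) z \<partial>lborel) < \<infinity>"
      and G: "gradient_max T x < \<infinity>" and t: "t > (0::real)"
    define g where "g = enn2real (gradient_max T x)"
    have g: "g \<ge> 0" by (simp add: g_def)
    define u where "u i = distr_conv T (dilate \<phi> (t * (1/2) ^ i))" for i
    have tt: "dilate \<phi> (t * (1/2) ^ i) \<in> test_functions" for i
      using t by (intro test_functions_dilate \<phi>) simp
    have us: "smooth (u i)" for i unfolding u_def by (intro smooth_distr_conv T tt)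
    have gr: "(\<Sum>j\<in>UNIV. \<bar>pdiff j (u i) y\<bar>) \<le> C * 4 ^ (N * i) * (1 + norm (x - y) / t) ^ (2 * N) * g" for i y
      unfolding u_def g_def using grad[OF T _ G t] fin by blast
    have lip: "\<bar>u i x - u i y\<bar> \<le> (C * 4 ^ (N * i) * (1 + r / t) ^ (2 * N) * g) * norm (x - y)" if y: "norm (x - y) \<le> r" for i y r
    proof (rule mean_value_pdiff[of "cball x r"])
      fix z assume "z \<in> cball x r"
      then have "C * 4 ^ (N * i) * (1 + norm (x - z) / t) ^ (2 * N) * g \<le> C * 4 ^ (N * i) * (1 + r / t) ^ (2 * N) * g"
        using C g t by (intro mult_right_mono mult_left_mono power_mono add_left_mono divide_right_mono) (auto simp: dist_norm)
      then show "(\<Sum>j\<in>UNIV. \<bar>pdiff j (u i) z\<bar>) \<le> C * 4 ^ (N * i) * (1 + r / t) ^ (2 * N) * g"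
        using gr[of i z] by linarith
    qed (use y us in \<open>auto simp: dist_norm intro: smooth_differentiable order_trans[OF norm_ge_zero]\<close>)
    {
      fix y assume y: "norm (x - y) \<le> t"
      have "\<bar>u 0 x - u 0 y\<bar> \<le> (C * 4 ^ N) * (norm (x - y) * g)"
      proof -
        have "(1 + t / t) ^ (2 * N) = 4 ^ N" using t by (simp add: power_mult)
        with lip[OF y, of 0] show ?thesis by (simp add: mult_ac)
      qed
      also have "\<dots> \<le> C' * (norm (x - y) * g)"
        using C R C0 V g by (intro mult_right_mono) (auto simp: C'_def)
      finally show "\<bar>distr_conv T (dilate \<phi> t) x - distr_conv T (dilate \<phi> t) y\<bar> \<le> C' * norm (x - y) * enn2real (gradient_max T x)"
        by (simp add: u_def g_def mult.assoc)
    }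
    define K where "K = C * (1 + R) ^ (2 * N) * R * C0 * V * t * g"
    have "\<bar>\<integral>z. dilate (\<eta> i) t z * u i (x - z) \<partial>lborel\<bar> \<le> K * (1/2) ^ i" for i
    proof -
      have m: "\<eta> i \<in> borel_measurable borel" using \<eta>(1) by auto
      have dt: "dilate (\<eta> i) t \<in> test_functions" by (intro test_functions_dilate \<eta> t)
      note di = test_functions_integrable[OF dt]
      have d0: "(\<integral>z. dilate (\<eta> i) t z \<partial>lborel) = 0" using integral_dilate(2)[OF m t] \<eta>(4) by simp
      have um: "u i \<in> borel_measurable borel" by (intro borel_measurable_continuous_onI smooth_continuous us)
      define B where "B = (C * 4 ^ (N * i) * (1 + R) ^ (2 * N) * g) * (t * R)"
      have B: "B \<ge> 0" using C R g t by (simp add: B_def)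
      have int1: "integrable lborel (\<lambda>z. dilate (\<eta> i) t z * u i (x - z))"
        unfolding u_def by (rule distr_conv_conv(2)[OF T dt tt])
      have "(\<integral>z. dilate (\<eta> i) t z * (u i (x - z) - u i x) \<partial>lborel) = (\<integral>z. dilate (\<eta> i) t z * u i (x - z) \<partial>lborel)"
        using int1 di d0 by (simp add: right_diff_distrib)
      moreover have "\<bar>\<integral>z. dilate (\<eta> i) t z * (u i (x - z) - u i x) \<partial>lborel\<bar> \<le> B * (\<integral>z. \<bar>dilate (\<eta> i) t z\<bar> \<partial>lborel)"
      proof (rule integral_mult_bounded(2)[OF di])
        fix z assume "dilate (\<eta> i) t z \<noteq> 0"
        then have z: "norm z \<le> t * R" using dilate_support[of R "\<eta> i" t z] \<eta>(2) t by (meson not_le)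
        then have "\<bar>u i x - u i (x - z)\<bar> \<le> (C * 4 ^ (N * i) * (1 + R) ^ (2 * N) * g) * norm z"
          using lip[of "x - z" "t * R" i] t by simp
        also have "\<dots> \<le> B" unfolding B_def using C R g by (intro mult_left_mono z) auto
        finally show "\<bar>u i (x - z) - u i x\<bar> \<le> B" by (simp add: abs_minus_commute)
      qed (use um in simp)
      moreover have "(\<integral>z. \<bar>dilate (\<eta> i) t z\<bar> \<partial>lborel) \<le> C0 * (1/2) ^ ((2 * N + 1) * i) * V"
        unfolding integral_abs_dilate[OF m t] by (rule \<eta>int)
      then have "B * (\<integral>z. \<bar>dilate (\<eta> i) t z\<bar> \<partial>lborel) \<le> B * (C0 * (1/2) ^ ((2 * N + 1) * i) * V)"
        by (intro mult_left_mono B)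
      moreover have "B * (C0 * (1/2) ^ ((2 * N + 1) * i) * V) = K * (1/2) ^ i"
      proof -
        have "(1/2::real) ^ ((2 * N + 1) * i) = (1/4) ^ (N * i) * (1/2) ^ i"
        proof -
          have "(2 * N + 1) * i = 2 * (N * i) + i" by (simp add: algebra_simps)
          then show ?thesis by (simp add: power_add power_mult power2_eq_square)
        qed
        moreover have "(4::real) ^ (N * i) * (1/4) ^ (N * i) = 1" by (simp flip: power_mult_distrib)
        moreover have "B * (C0 * ((1/4) ^ (N * i) * (1/2) ^ i) * V) = (4 ^ (N * i) * (1/4) ^ (N * i)) * (K * (1/2) ^ i)"
          by (simp only: B_def K_def mult_ac)
        ultimately show ?thesis by simp
      qed
      ultimately show ?thesis by linarith
    qed
    moreover have "(\<lambda>i. \<integral>z. dilate (\<eta> i) t z * u i (x - z) \<partial>lborel) sums distr_conv T (dilate \<Phi> t) x"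
      unfolding u_def by (rule sums[OF T t])
    ultimately have "\<bar>distr_conv T (dilate \<Phi> t) x\<bar> \<le> 2 * K" by (intro abs_sums_le_geometric)
    also have "distr_conv T (dilate \<Phi> t) x = distr_conv T (dilate \<phi> (t / 2)) x - distr_conv T (dilate \<phi> t) x"
    proof -
      have "dilate \<Phi> t = (\<lambda>y. dilate \<phi> (t / 2) y - dilate \<phi> t y)"
        using dilate_dilate[of \<phi> "1/2" t] by (simp add: \<Phi>_def dilate_def fun_eq_iff diff_divide_distrib)
      moreover have "dilate \<phi> (t / 2) \<in> test_functions" "dilate \<phi> t \<in> test_functions"
        using t by (auto intro: test_functions_dilate \<phi>)
      ultimately show ?thesis
        using distribution_diff[OF T test_functions_reflect test_functions_reflect, of "dilate \<phi> (t / 2)" "dilate \<phi> t" x x]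
        by (simp add: distr_conv_def)
    qed
    finally have "\<bar>distr_conv T (dilate \<phi> (t / 2)) x - distr_conv T (dilate \<phi> t) x\<bar> \<le> 2 * (C * (1 + R) ^ (2 * N) * R * C0 * V) * (t * g)"
      by (simp add: K_def mult_ac)
    also have "\<dots> \<le> C' * (t * g)"
      using C g t by (intro mult_right_mono) (auto simp: C'_def)
    finally show "\<bar>distr_conv T (dilate \<phi> (t / 2)) x - distr_conv T (dilate \<phi> t) x\<bar> \<le> C' * t * enn2real (gradient_max T x)"
      by (simp add: g_def mult.assoc)
  qed
qed

end

context
  fixes \<phi> :: "real^'n::finite \<Rightarrow> real"
  assumes \<phi>: "\<phi> \<in> test_functions" "(\<integral>x. \<phi> x \<partial>lborel) = 1"
begin

lemma borel_measurable_gradient_max: "distribution T \<Longrightarrow> gradient_max \<phi> T \<in> borel_measurable borel"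
  unfolding gradient_max_def[OF \<phi>, abs_def]
  by (intro borel_measurable_sum borel_measurable_times_ennreal borel_measurable_maxfn
    borel_measurable_sqrt_radial_max \<phi> distribution_pdiff)

lemma gradient_max_integral:
  assumes T: "distribution T"
  shows "(\<integral>\<^sup>+x. gradient_max \<phi> T x \<partial>lborel) \<le>
    ennreal (8 * (unit_ball_vol CARD('n) * 5 ^ CARD('n)) * unit_ball_vol CARD('n)) *
      (\<Sum>j\<in>UNIV. \<integral>\<^sup>+x. radial_max \<phi> (distr_pdiff j T) x \<partial>lborel)" (is "_ \<le> ?K * _")
proof -
  have m[measurable]: "sqrt_radial_max \<phi> (distr_pdiff j T) \<in> borel_measurable borel" for j
    by (intro borel_measurable_sqrt_radial_max \<phi> distribution_pdiff T)
  have "(\<integral>\<^sup>+x. gradient_max \<phi> T x \<partial>lborel) =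
     (\<Sum>j\<in>UNIV. \<integral>\<^sup>+x. maxfn (sqrt_radial_max \<phi> (distr_pdiff j T)) x * maxfn (sqrt_radial_max \<phi> (distr_pdiff j T)) x \<partial>lborel)"
    unfolding gradient_max_def[OF \<phi>] by (rule nn_integral_sum) simp
  also have "\<dots> \<le> (\<Sum>j\<in>UNIV. ?K * (\<integral>\<^sup>+x. sqrt_radial_max \<phi> (distr_pdiff j T) x * sqrt_radial_max \<phi> (distr_pdiff j T) x \<partial>lborel))"
    using maxfn_strong_type[OF m] by (intro sum_mono) simp
  also have "\<dots> \<le> (\<Sum>j\<in>UNIV. ?K * (\<integral>\<^sup>+x. radial_max \<phi> (distr_pdiff j T) x \<partial>lborel))"
    by (intro sum_mono mult_left_mono nn_integral_mono sqrt_radial_max_square \<phi>) simp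
  finally show ?thesis by (simp add: sum_distrib_left)
qed

section \<open>The pointwise limit of the regularisations and the Hajlasz inequality\<close>

text \<open>Two natural exponents replace an integer power of two: distant points need scales above
  one, close points scales below.\<close>

lemma dyadic_between:
  fixes r :: real
  assumes "r > 0"
  shows "\<exists>a b :: nat. r \<le> 2 ^ a * (1/2) ^ b \<and> 2 ^ a * (1/2) ^ b \<le> 2 * r"
proof -
  define j where "j = \<lceil>log 2 r\<rceil>"
  have e: "2 powr real_of_int j = 2 ^ nat j * (1/2) ^ nat (- j)"
  proof (cases "j \<ge> 0")
    case True
    then show ?thesis by (simp flip: powr_realpow)
  next
    case False
    have "(2::real) powr real_of_int j = 1 / 2 powr (real (nat (- j)))"
      using False by (simp add: powr_minus_divide[symmetric])
    also have "\<dots> = 2 ^ nat j * (1/2) ^ nat (- j)"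
      using False by (simp add: power_one_over flip: powr_realpow)
    finally show ?thesis .
  qed
  have r: "r = 2 powr log 2 r" using assms by simp
  have "r \<le> 2 powr j" by (subst r) (simp add: j_def)
  moreover have "2 powr j \<le> 2 powr (1 + log 2 r)" by (intro powr_mono) (simp_all add: j_def, linarith)
  then have "2 powr j \<le> 2 * r" using r by (simp add: powr_add)
  ultimately show ?thesis unfolding e by blast
qed

text \<open>Repeated halving telescopes, so \<open>U\<close> differs from the regularisation at a
  dyadic scale \<open>s\<close> by at most \<open>2 * C * s * g x\<close>. For two points, a dyadic
  scale comparable to their distance is reached from both with that error, and at this scale the
  oscillation bound compares them.\<close>

lemma pointwise_limit:
  "\<exists>C>0. \<forall>T. distribution T \<longrightarrow> (\<forall>j. (\<integral>\<^sup>+z. radial_max \<phi> (distr_pdiff j T) z \<partial>lborel) < \<infinity>) \<longrightarrow>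
     (\<exists>U\<in>borel_measurable borel.
       (\<forall>x k. gradient_max \<phi> T x < \<infinity> \<longrightarrow>
          \<bar>U x - distr_conv T (dilate \<phi> ((1/2) ^ k)) x\<bar> \<le> C * (1/2) ^ k * enn2real (gradient_max \<phi> T x)) \<and>
       (\<forall>x y. gradient_max \<phi> T x < \<infinity> \<longrightarrow> gradient_max \<phi> T y < \<infinity> \<longrightarrow>
          \<bar>U x - U y\<bar> \<le> C * norm (x - y) * (enn2real (gradient_max \<phi> T x) + enn2real (gradient_max \<phi> T y))))"
proof -
  obtain C where C: "C > 0" and osc: "\<forall>T. distribution T \<longrightarrow> (\<forall>j. (\<integral>\<^sup>+z. radial_max \<phi> (distr_pdiff j T) z \<partial>lborel) < \<infinity>) \<longrightarrow>
     (\<forall>x. gradient_max \<phi> T x < \<infinity> \<longrightarrow> (\<forall>t>0.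
        (\<forall>y. norm (x - y) \<le> t \<longrightarrow> \<bar>distr_conv T (dilate \<phi> t) x - distr_conv T (dilate \<phi> t) y\<bar> \<le>
           C * norm (x - y) * enn2real (gradient_max \<phi> T x)) \<and>
        \<bar>distr_conv T (dilate \<phi> (t / 2)) x - distr_conv T (dilate \<phi> t) x\<bar> \<le> C * t * enn2real (gradient_max \<phi> T x)))"
    using oscillation_bound[OF \<phi>] by blast
  show ?thesis
  \<comment> \<open>The coefficient of \<open>g x\<close>: \<open>2 * C\<close> from the telescoped
    limit, doubled since the chosen scale is at most twice the distance, plus \<open>C\<close> from
    the comparison at that scale.\<close>
  proof (rule exI[of _ "5 * C"], intro conjI allI impI)
    fix T :: "(real^'n \<Rightarrow> real) \<Rightarrow> real"
    assume T: "distribution T" and fin: "\<forall>j. (\<integral>\<^sup>+z. radial_max \<phi> (distr_pdiff j T) z \<partial>lborel) < \<infinity>"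
    define u where "u t = distr_conv T (dilate \<phi> t)" for t
    define g where "g x = enn2real (gradient_max \<phi> T x)" for x
    have g: "g x \<ge> 0" for x by (simp add: g_def)
    have osc1: "\<bar>u t x - u t y\<bar> \<le> C * norm (x - y) * g x"
      and osc2: "\<bar>u (t / 2) x - u t x\<bar> \<le> C * t * g x"
      if "gradient_max \<phi> T x < \<infinity>" "t > 0" "norm (x - y) \<le> t" for x t y
      using osc T fin that unfolding u_def g_def by blast+
    \<comment> \<open>\<open>lim\<close> is total, so \<open>U\<close> is defined everywhere;
      convergence is established where \<open>gradient_max\<close> is finite.\<close>
    define U where "U x = lim (\<lambda>k. u ((1/2) ^ k) x)" for x
    have tele: "\<bar>u (s * (1/2) ^ m) x - u s x\<bar> \<le> 2 * C * s * g x" if G: "gradient_max \<phi> T x < \<infinity>" and s: "s > 0" for x s m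
    proof -
      \<comment> \<open>The exact partial geometric sum makes the induction close.\<close>
      have "\<bar>u (s * (1/2) ^ m) x - u s x\<bar> \<le> C * s * g x * (2 - 2 * (1/2) ^ m)"
      proof (induction m)
        case (Suc m)
        have "\<bar>u ((s * (1/2) ^ m) / 2) x - u (s * (1/2) ^ m) x\<bar> \<le> C * (s * (1/2) ^ m) * g x"
          using s by (intro osc2[OF G, of _ x]) auto
        with Suc have "\<bar>u (s * (1/2) ^ Suc m) x - u s x\<bar> \<le> C * s * g x * (2 - 2 * (1/2) ^ m) + C * (s * (1/2) ^ m) * g x"
          by (simp add: mult.commute)
        also have "\<dots> = C * s * g x * (2 - 2 * (1/2) ^ Suc m)" by (simp add: algebra_simps)
        finally show ?case .
      qed simp
      also have "\<dots> \<le> C * s * g x * 2" using C s g by (intro mult_left_mono) auto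
      finally show ?thesis by (simp add: mult_ac)
    qed
    have lim: "(\<lambda>k. u ((1/2) ^ k) x) \<longlonglongrightarrow> U x" if G: "gradient_max \<phi> T x < \<infinity>" for x
    proof -
      have "Cauchy (\<lambda>k. u ((1/2) ^ k) x)"
      proof (rule CauchyI')
        fix e :: real assume e: "e > 0"
        have "(\<lambda>k. 2 * C * (1/2) ^ k * g x) \<longlonglongrightarrow> 2 * C * 0 * g x"
          by (intro tendsto_intros LIMSEQ_power_zero) simp
        then have "\<forall>\<^sub>F k in sequentially. 2 * C * (1/2) ^ k * g x < e"
          using e by (auto intro: order_tendstoD)
        then obtain M where M: "2 * C * (1/2) ^ M * g x < e"
          using eventually_happens trivial_limit_sequentially by blast
        show "\<exists>M. \<forall>m\<ge>M. \<forall>n>m. dist (u ((1/2) ^ m) x) (u ((1/2) ^ n) x) < e"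
        proof (intro exI allI impI)
          fix m n assume mn: "M \<le> m" "m < n"
          have "\<bar>u ((1/2) ^ m * (1/2) ^ (n - m)) x - u ((1/2) ^ m) x\<bar> \<le> 2 * C * (1/2) ^ m * g x"
            by (intro tele[OF G]) simp
          also have "\<dots> \<le> 2 * C * (1/2) ^ M * g x"
            using mn C g by (intro mult_right_mono mult_left_mono power_decreasing) auto
          finally show "dist (u ((1/2) ^ m) x) (u ((1/2) ^ n) x) < e"
            using M mn by (simp add: dist_real_def abs_minus_commute flip: power_add)
        qed
      qed
      then show ?thesis unfolding U_def using Cauchy_convergent convergent_LIMSEQ_iff by blast
    qed
    have approx: "\<bar>U x - u s x\<bar> \<le> 2 * C * s * g x"
      if G: "gradient_max \<phi> T x < \<infinity>" and s: "s = 2 ^ a * (1/2) ^ b" for x s a b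
    proof (rule LIMSEQ_le_const2)
      have "(\<lambda>k. u ((1/2) ^ (k + b)) x) \<longlonglongrightarrow> U x"
        by (rule LIMSEQ_ignore_initial_segment[OF lim[OF G]])
      then show "(\<lambda>k. \<bar>u ((1/2) ^ (k + b)) x - u s x\<bar>) \<longlonglongrightarrow> \<bar>U x - u s x\<bar>"
        by (intro tendsto_intros)
      show "\<exists>N. \<forall>k\<ge>N. \<bar>u ((1/2) ^ (k + b)) x - u s x\<bar> \<le> 2 * C * s * g x"
      proof (intro exI allI impI)
        fix k
        \<comment> \<open>After \<open>a\<close> halvings the scale \<open>2 ^ a * (1/2) ^ b\<close>
          has become \<open>(1/2) ^ b\<close>, a member of the sequence that defines
          \<open>U\<close>.\<close>
        have "s * (1/2) ^ (a + k) = (2 * (1/2)) ^ a * ((1/2) ^ k * (1/2) ^ b)"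
          unfolding power_mult_distrib s power_add by (simp only: mult_ac)
        then have "s * (1/2) ^ (a + k) = (1/2) ^ (k + b)" by (simp add: power_add)
        then show "\<bar>u ((1/2) ^ (k + b)) x - u s x\<bar> \<le> 2 * C * s * g x"
          using tele[OF G, of s "a + k"] s by simp
      qed
    qed
    have haj: "\<bar>U x - U y\<bar> \<le> 5 * C * norm (x - y) * (g x + g y)"
      if Gx: "gradient_max \<phi> T x < \<infinity>" and Gy: "gradient_max \<phi> T y < \<infinity>" for x y
    proof (cases "x = y")
      case False
      define r where "r = norm (x - y)"
      have r: "r > 0" using False by (simp add: r_def)
      obtain a b :: nat where ab: "r \<le> 2 ^ a * (1/2) ^ b" "2 ^ a * (1/2) ^ b \<le> 2 * r"
        using dyadic_between[OF r] by blast
      define s :: real where "s = 2 ^ a * (1/2) ^ b"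
      have s: "s > 0" by (simp add: s_def)
      have "\<bar>U x - u s x\<bar> \<le> 2 * C * (2 * r) * g x" "\<bar>U y - u s y\<bar> \<le> 2 * C * (2 * r) * g y"
      proof -
        have "2 * C * s * h \<le> 2 * C * (2 * r) * h" if "h \<ge> 0" for h
          using ab C that by (intro mult_right_mono mult_left_mono) (auto simp: s_def)
        from this[OF g[of x]] this[OF g[of y]]
        show "\<bar>U x - u s x\<bar> \<le> 2 * C * (2 * r) * g x" "\<bar>U y - u s y\<bar> \<le> 2 * C * (2 * r) * g y"
          using approx[OF Gx s_def] approx[OF Gy s_def] by linarith+
      qed
      moreover have "\<bar>u s x - u s y\<bar> \<le> C * r * g x"
        unfolding r_def using ab by (intro osc1[OF Gx s]) (simp add: r_def s_def)
      ultimately have "\<bar>U x - U y\<bar> \<le> 2 * C * (2 * r) * g x + 2 * C * (2 * r) * g y + C * r * g x"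
        by linarith
      also have "\<dots> \<le> 5 * C * r * (g x + g y)"
        using C r g[of y] by (simp add: algebra_simps)
      finally show ?thesis by (simp add: r_def)
    qed simp
    have "u ((1/2) ^ k) \<in> borel_measurable borel" for k
      unfolding u_def by (intro measurable_distr_conv_dilate \<phi> T) simp
    then have "U \<in> borel_measurable borel"
      unfolding U_def[abs_def] by (rule borel_measurable_lim_metric)
    moreover have "\<bar>U x - u ((1/2) ^ k) x\<bar> \<le> 5 * C * (1/2) ^ k * g x" if G: "gradient_max \<phi> T x < \<infinity>" for x k
    proof -
      have "\<bar>U x - u ((1/2) ^ k) x\<bar> \<le> 2 * C * (1/2) ^ k * g x"
        using approx[OF G, of "(1/2) ^ k" 0 k] by simp
      also have "\<dots> \<le> 5 * C * (1/2) ^ k * g x"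
        using C g[of x] by (intro mult_right_mono) auto
      finally show ?thesis .
    qed
    ultimately show "\<exists>U\<in>borel_measurable borel.
       (\<forall>x k. gradient_max \<phi> T x < \<infinity> \<longrightarrow>
          \<bar>U x - distr_conv T (dilate \<phi> ((1/2) ^ k)) x\<bar> \<le> 5 * C * (1/2) ^ k * enn2real (gradient_max \<phi> T x)) \<and>
       (\<forall>x y. gradient_max \<phi> T x < \<infinity> \<longrightarrow> gradient_max \<phi> T y < \<infinity> \<longrightarrow>
          \<bar>U x - U y\<bar> \<le> 5 * C * norm (x - y) * (enn2real (gradient_max \<phi> T x) + enn2real (gradient_max \<phi> T y)))"
      using haj unfolding u_def g_def by blast
  qed (use C in simp)
qed

text \<open>Almost everywhere the regularisations \<open>u k\<close> differ from \<open>U\<close> by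
  at most a constant times \<open>(1/2) ^ k\<close> times an integrable function. Hence
  \<open>U\<close> is locally integrable like the continuous \<open>u 0\<close>, and pairings with a
  test function pass to the limit; the same pairings tend to \<open>T \<psi>\<close> by
  mollification.\<close>

lemma distribution_eq_limit:
  assumes T: "distribution T" and fin: "(\<integral>\<^sup>+x. gradient_max \<phi> T x \<partial>lborel) < \<infinity>"
    and U[measurable]: "U \<in> borel_measurable borel"
    and lim: "\<forall>x k. gradient_max \<phi> T x < \<infinity> \<longrightarrow>
          \<bar>U x - distr_conv T (dilate \<phi> ((1/2) ^ k)) x\<bar> \<le> C * (1/2) ^ k * enn2real (gradient_max \<phi> T x)"
  shows "integrable lborel (\<lambda>x. indicator (cball 0 R) x * U x)"
    and "\<psi> \<in> test_functions \<Longrightarrow> integrable lborel (\<lambda>x. U x * \<psi> x) \<and> T \<psi> = (\<integral>x. U x * \<psi> x \<partial>lborel)"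
proof -
  define u where "u k = distr_conv T (dilate \<phi> ((1/2) ^ k))" for k
  define g where "g x = enn2real (gradient_max \<phi> T x)" for x
  have um[measurable]: "u k \<in> borel_measurable borel" for k
    unfolding u_def by (intro measurable_distr_conv_dilate \<phi> T) simp
  have uc: "continuous_on S (u k)" for S k
    unfolding u_def by (intro continuous_distr_conv_dilate \<phi> T) simp
  have Gm[measurable]: "gradient_max \<phi> T \<in> borel_measurable borel"
    by (rule borel_measurable_gradient_max[OF T])
  have gm[measurable]: "g \<in> borel_measurable borel" unfolding g_def by measurable
  have AE: "AE x in lborel. gradient_max \<phi> T x < \<infinity>"
    using nn_integral_PInf_AE[of "gradient_max \<phi> T" lborel] fin by (auto simp: less_top[symmetric])
  have gi: "integrable lborel g"
  proof (rule integrableI_nonneg)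
    have "(\<integral>\<^sup>+x. ennreal (g x) \<partial>lborel) = (\<integral>\<^sup>+x. gradient_max \<phi> T x \<partial>lborel)"
      using AE by (intro nn_integral_cong_AE) (auto simp: g_def elim: eventually_mono)
    then show "(\<integral>\<^sup>+x. ennreal (g x) \<partial>lborel) < \<infinity>" using fin by simp
  qed (auto simp: g_def)
  have bound: "AE x in lborel. \<bar>U x - u k x\<bar> \<le> C * (1/2) ^ k * g x" for k
    using AE by eventually_elim (use lim in \<open>auto simp: u_def g_def\<close>)
  have di: "integrable lborel (\<lambda>x. U x - u k x)" for k
  proof (rule Bochner_Integration.integrable_bound)
    show "integrable lborel (\<lambda>x. C * (1/2) ^ k * g x)" using gi by simp
    show "AE x in lborel. norm (U x - u k x) \<le> norm (C * (1/2) ^ k * g x)"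
      using bound[of k] by eventually_elim (auto intro: order_trans[OF _ abs_ge_self])
  qed simp
  have "integrable lborel (\<lambda>x. indicator (cball 0 R) x *\<^sub>R u 0 x)"
    by (rule borel_integrable_compact) (auto intro: uc)
  moreover have "integrable lborel (\<lambda>x. indicator (cball 0 R) x *\<^sub>R (U x - u 0 x))"
    by (rule integrable_mult_indicator[OF _ di]) simp
  ultimately have "integrable lborel (\<lambda>x. indicator (cball 0 R) x *\<^sub>R u 0 x + indicator (cball 0 R) x *\<^sub>R (U x - u 0 x))"
    by (rule Bochner_Integration.integrable_add)
  then show "integrable lborel (\<lambda>x. indicator (cball 0 R) x * U x)"
    by (simp add: algebra_simps)
  assume \<psi>: "\<psi> \<in> test_functions"
  have [measurable]: "\<psi> \<in> borel_measurable borel" using \<psi> by auto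
  obtain B where B: "B \<ge> 0" "\<forall>x. \<bar>\<psi> x\<bar> \<le> B" using test_functions_bounded[OF \<psi>] by blast
  have i1: "integrable lborel (\<lambda>x. (U x - u k x) * \<psi> x)" for k
    by (rule integral_mult_bounded(1)[OF di]) (use B in auto)
  have i2: "integrable lborel (\<lambda>x. u k x * \<psi> x)" for k
  proof -
    obtain R where R: "\<forall>x. R < norm x \<longrightarrow> \<psi> x = 0" using test_functions_support[OF \<psi>] by blast
    show ?thesis
      by (rule continuous_compact_support_integrable[where R = R])
        (use R in \<open>auto intro!: continuous_on_mult[OF uc test_functions_continuous[OF \<psi>]]\<close>)
  qed
  have i3: "integrable lborel (\<lambda>x. U x * \<psi> x)"
    using Bochner_Integration.integrable_add[OF i1[of 0] i2[of 0]] by (simp add: algebra_simps)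
  have diff: "\<bar>(\<integral>x. U x * \<psi> x \<partial>lborel) - (\<integral>x. u k x * \<psi> x \<partial>lborel)\<bar> \<le> (1/2) ^ k * (B * C * (\<integral>x. g x \<partial>lborel))" for k
  proof -
    have "(\<integral>x. U x * \<psi> x \<partial>lborel) - (\<integral>x. u k x * \<psi> x \<partial>lborel) = (\<integral>x. (U x - u k x) * \<psi> x \<partial>lborel)"
      using i2 i3 by (simp add: left_diff_distrib)
    moreover have "\<bar>\<integral>x. (U x - u k x) * \<psi> x \<partial>lborel\<bar> \<le> B * (\<integral>x. \<bar>U x - u k x\<bar> \<partial>lborel)"
      by (rule integral_mult_bounded(2)[OF di]) (use B in auto)
    moreover have "(\<integral>x. \<bar>U x - u k x\<bar> \<partial>lborel) \<le> (\<integral>x. C * (1/2) ^ k * g x \<partial>lborel)"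
      using bound[of k] di[of k] gi by (intro integral_mono_AE) auto
    then have "B * (\<integral>x. \<bar>U x - u k x\<bar> \<partial>lborel) \<le> B * (C * (1/2) ^ k * (\<integral>x. g x \<partial>lborel))"
      using B by (intro mult_left_mono) auto
    ultimately show ?thesis by (simp add: mult_ac)
  qed
  have "(\<lambda>k. (1/2) ^ k * (B * C * (\<integral>x. g x \<partial>lborel))) \<longlonglongrightarrow> 0 * (B * C * (\<integral>x. g x \<partial>lborel))"
    by (intro tendsto_intros LIMSEQ_power_zero) simp
  then have "(\<lambda>k. (1/2) ^ k * (B * C * (\<integral>x. g x \<partial>lborel))) \<longlonglongrightarrow> 0" by simp
  then have "(\<lambda>k. (\<integral>x. U x * \<psi> x \<partial>lborel) - (\<integral>x. u k x * \<psi> x \<partial>lborel)) \<longlonglongrightarrow> 0"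
    by (rule Lim_null_comparison[rotated]) (use diff in simp)
  then have "(\<lambda>k. (\<integral>x. U x * \<psi> x \<partial>lborel) - ((\<integral>x. U x * \<psi> x \<partial>lborel) - (\<integral>x. u k x * \<psi> x \<partial>lborel))) \<longlonglongrightarrow> (\<integral>x. U x * \<psi> x \<partial>lborel) - 0"
    by (intro tendsto_diff tendsto_const)
  then have "(\<lambda>k. \<integral>x. u k x * \<psi> x \<partial>lborel) \<longlonglongrightarrow> (\<integral>x. U x * \<psi> x \<partial>lborel)" by simp
  moreover have "(\<lambda>k. \<integral>x. \<psi> x * distr_conv T (dilate \<phi> ((1/2) ^ k)) x \<partial>lborel) \<longlonglongrightarrow> T \<psi>"
    by (rule distribution_approx[OF T \<phi> \<psi>]) (auto intro!: LIMSEQ_power_zero)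
  ultimately have "T \<psi> = (\<integral>x. U x * \<psi> x \<partial>lborel)"
    unfolding u_def by (intro LIMSEQ_unique[of _ "T \<psi>"]) (simp_all add: mult.commute)
  with i3 show "integrable lborel (\<lambda>x. U x * \<psi> x) \<and> T \<psi> = (\<integral>x. U x * \<psi> x \<partial>lborel)" by blast
qed

end

section \<open>Test functions determine measures and densities\<close>

text \<open>Mollifies the indicator of the box shrunk by \<open>d m\<close>, with a kernel supported
  within distance \<open>d m\<close>. The approximants therefore vanish exactly outside the box,
  which makes them dominated by a multiple of its indicator.\<close>

lemma box_approximation:
  fixes \<phi> :: "real^'n::finite \<Rightarrow> real"
  assumes \<phi>: "\<phi> \<in> test_functions" "(\<integral>x. \<phi> x \<partial>lborel) = 1"
  shows "\<exists>\<psi> :: nat \<Rightarrow> real^'n \<Rightarrow> real. \<exists>B. (\<forall>m. \<psi> m \<in> test_functions) \<and> (\<forall>m x. \<bar>\<psi> m x\<bar> \<le> B) \<and>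
     (\<forall>m x. x \<notin> box a b \<longrightarrow> \<psi> m x = 0) \<and> (\<forall>x. (\<lambda>m. \<psi> m x) \<longlonglongrightarrow> indicator (box a b) x)"
proof -
  obtain R where R: "R > 0" "\<forall>x. R < norm x \<longrightarrow> \<phi> x = 0" using test_functions_support[OF \<phi>(1)] by blast
  define d where "d m = 1 / real (Suc m)" for m
  have d: "d m > 0" for m by (simp add: d_def)
  define t where "t m = d m / (R + 1)" for m
  have t: "t m > 0" "t m * R < d m" for m
    using d[of m] R by (auto simp: t_def field_simps)
  define Q where "Q m = box (a + (\<chi> i. d m)) (b - (\<chi> i. d m))" for m
  have Q: "y \<in> Q m \<longleftrightarrow> (\<forall>i. a $ i + d m < y $ i \<and> y $ i < b $ i - d m)" for y m
    by (simp add: Q_def mem_box_cart)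
  have m: "\<phi> \<in> borel_measurable borel" using \<phi> by auto
  have Qi: "integrable lborel (indicator (Q m) :: _ \<Rightarrow> real)" for m
    unfolding Q_def using emeasure_lborel_box_finite by (intro integrable_real_indicator) auto
  obtain S where S: "\<forall>x\<in>box a b. norm x \<le> S"
    using bounded_box[of a b] bounded_iff by blast
  have Qsub: "Q m \<subseteq> box a b" for m
  proof
    fix y assume "y \<in> Q m"
    then have "a $ i < y $ i \<and> y $ i < b $ i" for i using Q[of y m] d[of m] by (smt (verit))
    then show "y \<in> box a b" by (simp add: mem_box_cart)
  qed
  define \<psi> where "\<psi> m = conv (indicator (Q m)) (dilate \<phi> (t m))" for m
  have dt: "dilate \<phi> (t m) \<in> test_functions" for m by (intro test_functions_dilate \<phi> t)
  have dm: "dilate \<phi> (t m) \<in> borel_measurable borel" for m using dt by auto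
  have ds: "dilate \<phi> (t m) z = 0" if "d m \<le> norm z" for m z
    using dilate_support[of R \<phi> "t m" z] R t[of m] that by auto
  have test: "\<psi> m \<in> test_functions" for m
    unfolding \<psi>_def
  proof (rule conv_test_function[OF Qi _ dt])
    show "\<forall>x. S < norm x \<longrightarrow> indicator (Q m) x = (0::real)"
      using S Qsub by (auto simp: indicator_def not_le[symmetric])
  qed
  have bound: "\<bar>\<psi> m x\<bar> \<le> (\<integral>x. \<bar>\<phi> x\<bar> \<partial>lborel)" for m x
  proof -
    have "\<psi> m = conv (dilate \<phi> (t m)) (indicator (Q m))"
      unfolding \<psi>_def by (rule conv_commute[OF _ dm]) (simp add: Q_def)
    moreover have "\<bar>conv (dilate \<phi> (t m)) (indicator (Q m)) x\<bar> \<le> 1 * (\<integral>x. \<bar>dilate \<phi> (t m) x\<bar> \<partial>lborel)"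
      by (rule conv_bound[OF test_functions_integrable[OF dt]]) (auto simp: Q_def indicator_def)
    ultimately show ?thesis by (simp add: integral_abs_dilate[OF m t(1)])
  qed
  have out: "\<psi> m x = 0" if x: "x \<notin> box a b" for m x
  proof -
    obtain i where i: "x $ i \<le> a $ i \<or> b $ i \<le> x $ i" using x by (auto simp: mem_box_cart not_less)
    have z: "indicator (Q m) y * dilate \<phi> (t m) (x - y) = 0" for y
    proof (cases "y \<in> Q m")
      case True
      then have "d m \<le> \<bar>(x - y) $ i\<bar>" using i Q[of y m] by (auto simp: abs_if) (smt (verit))+
      then have "d m \<le> norm (x - y)" using component_le_norm_cart[of "x - y" i] by linarith
      then show ?thesis using ds by simp
    qed simp
    show ?thesis unfolding \<psi>_def conv_def z by simp
  qed
  have lim: "(\<lambda>m. \<psi> m x) \<longlonglongrightarrow> indicator (box a b) x" for x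
  proof (cases "x \<in> box a b")
    case True
    have "d \<longlonglongrightarrow> 0" unfolding d_def using LIMSEQ_inverse_real_of_nat by (simp add: inverse_eq_divide)
    then have d0: "\<forall>\<^sub>F m in sequentially. d m < e" if "e > 0" for e
      using that by (rule order_tendstoD)
    have "\<forall>i\<in>UNIV. \<forall>\<^sub>F m in sequentially. d m < (x $ i - a $ i) / 2 \<and> d m < (b $ i - x $ i) / 2"
    proof
      fix i
      have "0 < (x $ i - a $ i) / 2" "0 < (b $ i - x $ i) / 2" using True by (auto simp: mem_box_cart)
      then show "\<forall>\<^sub>F m in sequentially. d m < (x $ i - a $ i) / 2 \<and> d m < (b $ i - x $ i) / 2"
        by (intro eventually_conj d0)
    qed
    then have "\<forall>\<^sub>F m in sequentially. \<forall>i\<in>UNIV. d m < (x $ i - a $ i) / 2 \<and> d m < (b $ i - x $ i) / 2"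
      by (rule eventually_ball_finite[OF finite])
    then have "\<forall>\<^sub>F m in sequentially. \<psi> m x = 1"
    proof eventually_elim
      case (elim m)
      have z: "indicator (Q m) y * dilate \<phi> (t m) (x - y) = dilate \<phi> (t m) (x - y)" for y
      proof (cases "d m \<le> norm (x - y)")
        case False
        have "y \<in> Q m"
          unfolding Q
        proof
          fix i
          have "\<bar>x $ i - y $ i\<bar> < d m" using False component_le_norm_cart[of "x - y" i] by simp
          then show "a $ i + d m < y $ i \<and> y $ i < b $ i - d m"
            using elim[rule_format, of i] by (auto simp: abs_less_iff field_simps)
        qed
        then show ?thesis by simp
      qed (simp add: ds)
      have "\<psi> m x = (\<integral>y. dilate \<phi> (t m) (x - y) \<partial>lborel)" unfolding \<psi>_def conv_def z by simp
      also have "\<dots> = 1"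
        using lborel_integral_reflect(2)[OF dm] integral_dilate(2)[OF m t(1)] \<phi>(2) by simp
      finally show ?case .
    qed
    then show ?thesis using True by (simp add: tendsto_eventually)
  qed (simp add: out)
  show ?thesis
    using test bound out lim by (intro exI[of _ \<psi>] exI[of _ "\<integral>x. \<bar>\<phi> x\<bar> \<partial>lborel"] conjI allI impI) auto
qed

lemma Int_stable_box: "Int_stable (range (\<lambda>(a, b). box a b :: 'a::euclidean_space set))"
  by (auto simp: Int_stable_def box_Int_box)

lemma sets_borel_box: "sets (borel :: 'a::euclidean_space measure) = sigma_sets UNIV (range (\<lambda>(a, b). box a b))"
  by (simp add: borel_eq_box)

text \<open>One sequence serves all measures finite on the box and all integrable densities: it is
  bounded, vanishes outside the box and converges at every point, so dominated convergence applies
  each time.\<close>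

lemma box_approximation_integral:
  fixes \<phi> :: "real^'n::finite \<Rightarrow> real"
  assumes \<phi>: "\<phi> \<in> test_functions" "(\<integral>x. \<phi> x \<partial>lborel) = 1"
  shows "\<exists>\<psi> :: nat \<Rightarrow> real^'n \<Rightarrow> real. (\<forall>m. \<psi> m \<in> test_functions) \<and>
    (\<forall>L. sets L = sets borel \<longrightarrow> emeasure L (box a b) < \<infinity> \<longrightarrow> (\<lambda>m. integral\<^sup>L L (\<psi> m)) \<longlonglongrightarrow> measure L (box a b)) \<and>
    (\<forall>q. integrable lborel q \<longrightarrow> (\<lambda>m. \<integral>x. \<psi> m x * q x \<partial>lborel) \<longlonglongrightarrow> (\<integral>x. indicator (box a b) x * q x \<partial>lborel))"
proof -
  obtain \<psi> B where \<psi>: "\<forall>m. \<psi> m \<in> test_functions" "\<forall>m x. \<bar>\<psi> m x\<bar> \<le> B"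
     "\<forall>m x. x \<notin> box a b \<longrightarrow> \<psi> m x = 0" "\<forall>x. (\<lambda>m::nat. \<psi> m x) \<longlonglongrightarrow> indicator (box a b) x"
    using box_approximation[OF \<phi>, of a b] by blast
  have \<psi>m: "\<psi> m \<in> borel_measurable borel" for m using \<psi>(1) test_functions_measurable by blast
  have "(\<lambda>m. integral\<^sup>L L (\<psi> m)) \<longlonglongrightarrow> measure L (box a b)"
    if L: "sets L = sets borel" "emeasure L (box a b) < \<infinity>" for L
  proof -
    have "(\<lambda>m. integral\<^sup>L L (\<psi> m)) \<longlonglongrightarrow> integral\<^sup>L L (indicator (box a b))"
    proof (rule integral_dominated_convergence[where w = "\<lambda>x. B * indicator (box a b) x"])
      show "\<psi> m \<in> borel_measurable L" for m
        using \<psi>m by (simp add: measurable_cong_sets[OF L(1) refl])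
      show "integrable L (\<lambda>x. B * indicator (box a b) x)"
        using L by (intro integrable_mult_right integrable_real_indicator) auto
      show "AE x in L. norm (\<psi> m x) \<le> B * indicator (box a b) x" for m
        using \<psi>(2,3) by (intro AE_I2) (auto split: split_indicator)
    qed (use \<psi>(4) L in \<open>auto\<close>)
    then show ?thesis using L by simp
  qed
  moreover have "(\<lambda>m. \<integral>x. \<psi> m x * q x \<partial>lborel) \<longlonglongrightarrow> (\<integral>x. indicator (box a b) x * q x \<partial>lborel)"
    if q: "integrable lborel q" for q
  proof (rule integral_dominated_convergence[where w = "\<lambda>x. B * \<bar>q x\<bar>"])
    have qm[measurable]: "q \<in> borel_measurable borel" using q by simp
    have [measurable]: "\<psi> m \<in> borel_measurable borel" for m by (rule \<psi>m)
    show "(\<lambda>x. \<psi> m x * q x) \<in> borel_measurable lborel" for m by measurable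
    have [measurable]: "box a b \<in> sets borel" by simp
    show "(\<lambda>x. indicator (box a b) x * q x) \<in> borel_measurable lborel" by measurable
    show "integrable lborel (\<lambda>x. B * \<bar>q x\<bar>)" using q by simp
    show "AE x in lborel. (\<lambda>m. \<psi> m x * q x) \<longlonglongrightarrow> indicator (box a b) x * q x"
      using \<psi>(4) by (intro AE_I2 tendsto_intros) blast
    show "AE x in lborel. norm (\<psi> m x * q x) \<le> B * \<bar>q x\<bar>" for m
      using \<psi>(2) by (intro AE_I2) (simp add: abs_mult mult_right_mono)
  qed
  ultimately show ?thesis using \<psi>(1) by blast
qed

text \<open>Boxes form an intersection-stable generator exhausting the space, and the measure of a
  box is a limit of integrals of test functions.\<close>

lemma measure_eqI_test_functions:
  fixes M N :: "(real^'n::finite) measure" and \<phi> :: "real^'n \<Rightarrow> real"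
  assumes \<phi>: "\<phi> \<in> test_functions" "(\<integral>x. \<phi> x \<partial>lborel) = 1"
    and sets: "sets M = sets borel" "sets N = sets borel"
    and fin: "\<And>a b. emeasure M (box a b) < \<infinity>" "\<And>a b. emeasure N (box a b) < \<infinity>"
    and eq: "\<And>\<psi>. \<psi> \<in> test_functions \<Longrightarrow> integral\<^sup>L M \<psi> = integral\<^sup>L N \<psi>"
  shows "M = N"
proof (rule measure_eqI_generator_eq[OF Int_stable_box])
  show "sets M = sigma_sets UNIV (range (\<lambda>(a, b). box a b))" "sets N = sigma_sets UNIV (range (\<lambda>(a, b). box a b))"
    using sets sets_borel_box by auto
  show "range (\<lambda>n. box (- (real n *\<^sub>R One)) (real n *\<^sub>R One)) \<subseteq> range (\<lambda>(a, b). box a b)" by auto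
  show "(\<Union>n. box (- (real n *\<^sub>R One)) (real n *\<^sub>R One)) = (UNIV :: (real^'n) set)"
    by (rule UN_box_eq_UNIV)
  show "emeasure M (box (- (real n *\<^sub>R One)) (real n *\<^sub>R One)) \<noteq> \<infinity>" for n
    using fin(1)[of "- (real n *\<^sub>R One)" "real n *\<^sub>R One"] by (simp add: less_top)
  fix X assume "X \<in> range (\<lambda>(a, b). box a b :: (real^'n) set)"
  then obtain a b where X: "X = box a b" by auto
  obtain \<psi> :: "nat \<Rightarrow> real^'n \<Rightarrow> real" where \<psi>: "\<forall>m. \<psi> m \<in> test_functions"
    and lim: "\<forall>L. sets L = sets borel \<longrightarrow> emeasure L (box a b) < \<infinity> \<longrightarrow> (\<lambda>m. integral\<^sup>L L (\<psi> m)) \<longlonglongrightarrow> measure L (box a b)"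
    using box_approximation_integral[OF \<phi>, of a b] by blast
  note lim = lim[rule_format]
  have "measure M (box a b) = measure N (box a b)"
  proof (rule LIMSEQ_unique[OF lim[OF sets(1) fin(1)]])
    have "(\<lambda>m. integral\<^sup>L M (\<psi> m)) = (\<lambda>m. integral\<^sup>L N (\<psi> m))" using eq \<psi> by auto
    then show "(\<lambda>m. integral\<^sup>L M (\<psi> m)) \<longlonglongrightarrow> measure N (box a b)"
      using lim[OF sets(2) fin(2)] by simp
  qed
  then show "emeasure M X = emeasure N X"
    unfolding X using fin[of a b] by (simp add: emeasure_eq_ennreal_measure less_top)
qed auto

text \<open>The fundamental lemma of the calculus of variations. The positive and negative parts are
  densities of measures with the same test integrals, hence of the same measure, and densities are
  unique almost everywhere.\<close>

lemma AE_zero_if_test_functions: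
  fixes w \<phi> :: "real^'n::finite \<Rightarrow> real"
  assumes \<phi>: "\<phi> \<in> test_functions" "(\<integral>x. \<phi> x \<partial>lborel) = 1"
    and w[measurable]: "w \<in> borel_measurable borel" and loc: "\<And>R. integrable lborel (\<lambda>x. indicator (cball 0 R) x * w x)"
    and zero: "\<And>\<psi>. \<psi> \<in> test_functions \<Longrightarrow> (\<integral>x. w x * \<psi> x \<partial>lborel) = 0"
  shows "AE x in lborel. w x = 0"
proof -
  define p n where "p x = ennreal (w x)" and "n x = ennreal (- w x)" for x
  have [measurable]: "p \<in> borel_measurable borel" "n \<in> borel_measurable borel"
    unfolding p_def[abs_def] n_def[abs_def] by measurable
  have int: "integrable lborel (\<lambda>x. max 0 (w x) * \<psi> x)" "integrable lborel (\<lambda>x. max 0 (- w x) * \<psi> x)"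
    if \<psi>: "\<psi> \<in> test_functions" for \<psi>
  proof -
    obtain B where B: "B \<ge> 0" "\<forall>x. \<bar>\<psi> x\<bar> \<le> B" using test_functions_bounded[OF \<psi>] by blast
    obtain R where R: "R > 0" "\<forall>x. R < norm x \<longrightarrow> \<psi> x = 0" using test_functions_support[OF \<psi>] by blast
    have [measurable]: "\<psi> \<in> borel_measurable borel" using \<psi> by auto
    have i: "integrable lborel (\<lambda>x. B * \<bar>indicator (cball 0 R) x * w x\<bar>)" using loc[of R] by simp
    have le: "\<bar>w x\<bar> * \<bar>\<psi> x\<bar> \<le> B * \<bar>indicator (cball 0 R) x * w x\<bar>" for x
      using B R by (cases "norm x \<le> R") (auto simp: mult.commute[of B] intro!: mult_left_mono)
    have le': "norm (c * \<psi> x) \<le> norm (B * \<bar>indicator (cball 0 R) x * w x\<bar>)" if "\<bar>c\<bar> \<le> \<bar>w x\<bar>" for c x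
    proof -
      have "norm (c * \<psi> x) \<le> \<bar>w x\<bar> * \<bar>\<psi> x\<bar>" using that by (simp add: abs_mult mult_right_mono)
      then show ?thesis using le[of x] abs_ge_self[of "B * \<bar>indicator (cball 0 R) x * w x\<bar>"] by simp
    qed
    show "integrable lborel (\<lambda>x. max 0 (w x) * \<psi> x)"
      by (rule Bochner_Integration.integrable_bound[OF i _ AE_I2[OF le']]) auto
    show "integrable lborel (\<lambda>x. max 0 (- w x) * \<psi> x)"
      by (rule Bochner_Integration.integrable_bound[OF i _ AE_I2[OF le']]) auto
  qed
  have boxfin: "emeasure (density lborel q) (box a b) < \<infinity>" if q: "q \<in> borel_measurable borel" "\<And>x. q x \<le> ennreal \<bar>w x\<bar>" for q and a b :: "real^'n"
  proof -
    obtain S where S: "\<forall>x\<in>box a b. norm x \<le> S"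
      using bounded_box[of a b] bounded_iff by blast
    have "emeasure (density lborel q) (box a b) = (\<integral>\<^sup>+x. q x * indicator (box a b) x \<partial>lborel)"
      using q by (simp add: emeasure_density)
    also have "\<dots> \<le> (\<integral>\<^sup>+x. ennreal (norm (indicator (cball 0 S) x * w x)) \<partial>lborel)"
      using S q(2) by (intro nn_integral_mono) (auto split: split_indicator)
    also have "\<dots> < \<infinity>" using loc[of S] unfolding integrable_iff_bounded by simp
    finally show ?thesis .
  qed
  have "density lborel p = density lborel n"
  proof (rule measure_eqI_test_functions[OF \<phi>])
    show "emeasure (density lborel p) (box a b) < \<infinity>" for a b
      by (rule boxfin) (auto simp: p_def intro: ennreal_leI)
    show "emeasure (density lborel n) (box a b) < \<infinity>" for a b
      by (rule boxfin) (auto simp: n_def intro: ennreal_leI)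
    fix \<psi> :: "real^'n \<Rightarrow> real" assume \<psi>: "\<psi> \<in> test_functions"
    have [measurable]: "\<psi> \<in> borel_measurable borel" using \<psi> by auto
    have "p = (\<lambda>x. ennreal (max 0 (w x)))" "n = (\<lambda>x. ennreal (max 0 (- w x)))"
      by (auto simp: p_def n_def fun_eq_iff max_def ennreal_neg)
    then have "integral\<^sup>L (density lborel p) \<psi> - integral\<^sup>L (density lborel n) \<psi> =
       (\<integral>x. max 0 (w x) * \<psi> x \<partial>lborel) - (\<integral>x. max 0 (- w x) * \<psi> x \<partial>lborel)"
      by (simp add: integral_density)
    also have "\<dots> = (\<integral>x. max 0 (w x) * \<psi> x - max 0 (- w x) * \<psi> x \<partial>lborel)"
      using int[OF \<psi>] by simp
    also have "(\<lambda>x. max 0 (w x) * \<psi> x - max 0 (- w x) * \<psi> x) = (\<lambda>x. w x * \<psi> x)"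
      by (auto simp: fun_eq_iff max_def)
    finally show "integral\<^sup>L (density lborel p) \<psi> = integral\<^sup>L (density lborel n) \<psi>"
      using zero[OF \<psi>] by simp
  qed auto
  then have "AE x in lborel. p x = n x"
    by (subst (asm) sigma_finite_measure.density_unique_iff[OF sigma_finite_lborel]) auto
  then show ?thesis
  proof eventually_elim
    \<comment> \<open>\<open>ennreal\<close> truncates at zero, so one of the two densities is zero
      at \<open>x\<close>, and then both are.\<close>
    case (elim x)
    show ?case
    proof (cases "w x \<ge> 0")
      case True
      then show ?thesis using elim by (simp add: p_def n_def ennreal_neg)
    next
      case False
      then show ?thesis using elim by (simp add: p_def n_def ennreal_neg ennreal_eq_0_iff)
    qed
  qed
qed

section \<open>Dominated sequences of functions with a distributional limit\<close>

context
  fixes F :: "nat \<Rightarrow> real^'n::finite \<Rightarrow> real" and g :: "real^'n \<Rightarrow> real"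
  assumes F[measurable]: "\<And>k. F k \<in> borel_measurable borel"
    and g: "integrable lborel g"
    and dom: "\<And>k. AE x in lborel. \<bar>F k x\<bar> \<le> g x"
begin

lemma dominated_integral:
  assumes [measurable]: "h \<in> borel_measurable borel" and K: "\<And>x. \<bar>h x\<bar> \<le> K"
  shows "integrable lborel (\<lambda>x. h x * F k x)" "integrable lborel (\<lambda>x. \<bar>h x\<bar> * g x)"
    "\<bar>\<integral>x. h x * F k x \<partial>lborel\<bar> \<le> (\<integral>x. \<bar>h x\<bar> * g x \<partial>lborel)"
proof -
  have [measurable]: "g \<in> borel_measurable borel" using g by simp
  show i2: "integrable lborel (\<lambda>x. \<bar>h x\<bar> * g x)"
    using integral_mult_bounded(1)[OF g, of "\<lambda>x. \<bar>h x\<bar>" K] K by (simp add: mult.commute)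
  have le: "AE x in lborel. \<bar>h x * F k x\<bar> \<le> \<bar>h x\<bar> * g x"
    using dom[of k] by eventually_elim (auto simp: abs_mult intro: mult_left_mono)
  show i1: "integrable lborel (\<lambda>x. h x * F k x)"
    by (rule Bochner_Integration.integrable_bound[OF i2])
      (use le in \<open>auto elim!: eventually_mono intro: order_trans[OF _ abs_ge_self]\<close>)
  have "\<bar>\<integral>x. h x * F k x \<partial>lborel\<bar> \<le> (\<integral>x. \<bar>h x * F k x\<bar> \<partial>lborel)"
    by (rule integral_abs_bound)
  also have "\<dots> \<le> (\<integral>x. \<bar>h x\<bar> * g x \<partial>lborel)"
    using i1 i2 le by (intro integral_mono_AE) auto
  finally show "\<bar>\<integral>x. h x * F k x \<partial>lborel\<bar> \<le> (\<integral>x. \<bar>h x\<bar> * g x \<partial>lborel)" .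
qed

text \<open>\<open>lim\<close> is total; the value is meaningful when \<open>weak_conv h\<close>
  holds.\<close>

definition weak_lim :: "(real^'n \<Rightarrow> real) \<Rightarrow> real" where
  "weak_lim h = lim (\<lambda>k. \<integral>x. h x * F k x \<partial>lborel)"

definition weak_conv :: "(real^'n \<Rightarrow> real) \<Rightarrow> bool" where
  "weak_conv h \<longleftrightarrow> convergent (\<lambda>k. \<integral>x. h x * F k x \<partial>lborel)"

lemma weak_lim: "weak_conv h \<Longrightarrow> (\<lambda>k. \<integral>x. h x * F k x \<partial>lborel) \<longlonglongrightarrow> weak_lim h"
  by (simp add: weak_conv_def weak_lim_def convergent_LIMSEQ_iff)

lemma weak_lim_bound:
  assumes "weak_conv h" "h \<in> borel_measurable borel" "\<And>x. \<bar>h x\<bar> \<le> K"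
  shows "\<bar>weak_lim h\<bar> \<le> (\<integral>x. \<bar>h x\<bar> * g x \<partial>lborel)"
  using tendsto_rabs[OF weak_lim[OF assms(1)]]
  by (rule LIMSEQ_le_const2) (use dominated_integral(3)[OF assms(2,3)] in blast)

lemma weak_lim_lincomb:
  assumes "weak_conv h" "h \<in> borel_measurable borel" "\<And>x. \<bar>h x\<bar> \<le> K"
    and "weak_conv h'" "h' \<in> borel_measurable borel" "\<And>x. \<bar>h' x\<bar> \<le> K'"
  shows "weak_conv (\<lambda>x. a * h x + b * h' x)" "weak_lim (\<lambda>x. a * h x + b * h' x) = a * weak_lim h + b * weak_lim h'"
proof -
  have "(\<integral>x. (a * h x + b * h' x) * F k x \<partial>lborel) = a * (\<integral>x. h x * F k x \<partial>lborel) + b * (\<integral>x. h' x * F k x \<partial>lborel)" for k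
    using dominated_integral(1)[OF assms(2,3), of k] dominated_integral(1)[OF assms(5,6), of k]
    by (simp add: distrib_right mult.assoc)
  then have "(\<lambda>k. \<integral>x. (a * h x + b * h' x) * F k x \<partial>lborel) \<longlonglongrightarrow> a * weak_lim h + b * weak_lim h'"
    by (auto intro!: tendsto_intros weak_lim assms)
  then show "weak_conv (\<lambda>x. a * h x + b * h' x)" "weak_lim (\<lambda>x. a * h x + b * h' x) = a * weak_lim h + b * weak_lim h'"
    unfolding weak_conv_def weak_lim_def by (auto simp: convergent_def limI)
qed

text \<open>Functions with convergent pairings are closed under bounded pointwise convergence: the
  error \<open>e n\<close> of replacing \<open>h'\<close> by \<open>h n\<close> tends to zero by
  dominated convergence and is uniform in \<open>k\<close>, thanks to the common majorant
  \<open>g\<close>. The third claim is the same limit for the pairing with one fixed integrable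
  function.\<close>

lemma weak_lim_bounded_limit:
  fixes h :: "nat \<Rightarrow> real^'n \<Rightarrow> real" and h' :: "real^'n \<Rightarrow> real"
  assumes hn[measurable]: "\<And>n. h n \<in> borel_measurable borel" and K: "\<And>n x. \<bar>h n x\<bar> \<le> K"
    and lim: "\<And>x. (\<lambda>n. h n x) \<longlonglongrightarrow> h' x" and conv: "\<And>n. weak_conv (h n)"
  shows "weak_conv h'" "(\<lambda>n. weak_lim (h n)) \<longlonglongrightarrow> weak_lim h'"
    "\<And>f. integrable lborel f \<Longrightarrow> (\<lambda>n. \<integral>x. h n x * f x \<partial>lborel) \<longlonglongrightarrow> (\<integral>x. h' x * f x \<partial>lborel)"
proof -
  have h'[measurable]: "h' \<in> borel_measurable borel"
    using lim by (intro borel_measurable_LIMSEQ_real[OF _ hn]) auto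
  have K': "\<bar>h' x\<bar> \<le> K" for x
    using tendsto_rabs[OF lim[of x]] by (rule LIMSEQ_le_const2) (use K in blast)
  have [measurable]: "g \<in> borel_measurable borel" using g by simp
  define e where "e n = (\<integral>x. \<bar>1 * h n x + (-1) * h' x\<bar> * g x \<partial>lborel)" for n
  have "e \<longlonglongrightarrow> (\<integral>x. 0 \<partial>(lborel :: (real^'n) measure))"
    unfolding e_def
  proof (rule integral_dominated_convergence[where w = "\<lambda>x. (2 * K) * \<bar>g x\<bar>"])
    show "integrable lborel (\<lambda>x. (2 * K) * \<bar>g x\<bar>)" using g by simp
    have "(\<lambda>n. \<bar>1 * h n x + (-1) * h' x\<bar> * g x) \<longlonglongrightarrow> \<bar>1 * h' x + (-1) * h' x\<bar> * g x" for x
      by (intro tendsto_intros lim)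
    then show "AE x in lborel. (\<lambda>n. \<bar>1 * h n x + (-1) * h' x\<bar> * g x) \<longlonglongrightarrow> 0" by simp
    show "AE x in lborel. norm (\<bar>1 * h n x + (-1) * h' x\<bar> * g x) \<le> (2 * K) * \<bar>g x\<bar>" for n
    proof (rule AE_I2)
      fix x
      have "\<bar>h n x - h' x\<bar> \<le> 2 * K" using K[of n x] K'[of x] by linarith
      then show "norm (\<bar>1 * h n x + (-1) * h' x\<bar> * g x) \<le> (2 * K) * \<bar>g x\<bar>"
        by (simp add: abs_mult mult_right_mono)
    qed
  qed measurable
  then have e0: "e \<longlonglongrightarrow> 0" by simp
  have db: "\<bar>1 * h n x + (-1) * h' x\<bar> \<le> 2 * K" for n x using K[of n x] K'[of x] by simp
  have diff: "\<bar>(\<integral>x. h n x * F k x \<partial>lborel) - (\<integral>x. h' x * F k x \<partial>lborel)\<bar> \<le> e n" for n k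
  proof -
    have "(\<integral>x. h n x * F k x \<partial>lborel) - (\<integral>x. h' x * F k x \<partial>lborel) = (\<integral>x. (1 * h n x + (-1) * h' x) * F k x \<partial>lborel)"
      using dominated_integral(1)[OF hn[of n] K[of n], of k] dominated_integral(1)[OF h' K', of k]
      by (simp add: left_diff_distrib)
    then show ?thesis unfolding e_def using dominated_integral(3)[where h = "\<lambda>x. 1 * h n x + (-1) * h' x" and k = k, OF _ db[of n]] by simp
  qed
  show wc: "weak_conv h'"
    unfolding weak_conv_def
  proof (rule Cauchy_convergent, rule CauchyI')
    fix \<epsilon> :: real assume \<epsilon>: "\<epsilon> > 0"
    have "\<forall>\<^sub>F n in sequentially. e n < \<epsilon> / 3" using e0 \<epsilon> by (intro order_tendstoD) auto
    then obtain n where n: "e n < \<epsilon> / 3" using eventually_happens trivial_limit_sequentially by blast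
    have "Cauchy (\<lambda>k. \<integral>x. h n x * F k x \<partial>lborel)"
      using conv[of n] unfolding weak_conv_def by (rule convergent_Cauchy)
    then obtain M where M: "\<forall>k\<ge>M. \<forall>l\<ge>M. dist (\<integral>x. h n x * F k x \<partial>lborel) (\<integral>x. h n x * F l x \<partial>lborel) < \<epsilon> / 3"
      using \<epsilon> unfolding Cauchy_def by (meson divide_pos_pos zero_less_numeral)
    show "\<exists>M. \<forall>k\<ge>M. \<forall>l>k. dist (\<integral>x. h' x * F k x \<partial>lborel) (\<integral>x. h' x * F l x \<partial>lborel) < \<epsilon>"
    proof (intro exI[of _ M] allI impI)
      fix k l assume "M \<le> k" "k < l"
      then have "dist (\<integral>x. h n x * F k x \<partial>lborel) (\<integral>x. h n x * F l x \<partial>lborel) < \<epsilon> / 3" using M by simp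
      then show "dist (\<integral>x. h' x * F k x \<partial>lborel) (\<integral>x. h' x * F l x \<partial>lborel) < \<epsilon>"
        using diff[of n k] diff[of n l] n unfolding dist_real_def by linarith
    qed
  qed
  have "\<bar>weak_lim (h n) - weak_lim h'\<bar> \<le> e n" for n
  proof (rule LIMSEQ_le_const2)
    show "(\<lambda>k. \<bar>(\<integral>x. h n x * F k x \<partial>lborel) - (\<integral>x. h' x * F k x \<partial>lborel)\<bar>) \<longlonglongrightarrow> \<bar>weak_lim (h n) - weak_lim h'\<bar>"
      by (intro tendsto_intros weak_lim conv wc)
  qed (use diff in blast)
  then have "(\<lambda>n. weak_lim (h n) - weak_lim h') \<longlonglongrightarrow> 0"
    by (intro Lim_null_comparison[OF _ e0]) auto
  then show "(\<lambda>n. weak_lim (h n)) \<longlonglongrightarrow> weak_lim h'" by (rule LIM_zero_cancel)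
  fix f :: "real^'n \<Rightarrow> real" assume f: "integrable lborel f"
  show "(\<lambda>n. \<integral>x. h n x * f x \<partial>lborel) \<longlonglongrightarrow> (\<integral>x. h' x * f x \<partial>lborel)"
  proof (rule integral_dominated_convergence[where w = "\<lambda>x. K * \<bar>f x\<bar>"])
    show "(\<lambda>x. h' x * f x) \<in> borel_measurable lborel" "(\<lambda>x. h n x * f x) \<in> borel_measurable lborel" for n
      using f by auto
    show "integrable lborel (\<lambda>x. K * \<bar>f x\<bar>)" using f by simp
    show "AE x in lborel. (\<lambda>n. h n x * f x) \<longlonglongrightarrow> h' x * f x" by (intro AE_I2 tendsto_intros lim)
    show "AE x in lborel. norm (h n x * f x) \<le> K * \<bar>f x\<bar>" for n
      using K by (intro AE_I2) (simp add: abs_mult mult_right_mono)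
  qed
qed

lemma indicator_Un_lessThan_Suc:
  assumes "disjoint_family A"
  shows "indicator (\<Union>i<Suc n. A i) = (\<lambda>x. 1 * indicator (\<Union>i<n. A i) x + 1 * indicator (A n) x :: real)"
proof -
  have "A i \<inter> A n = {}" if "i < n" for i
    using assms that unfolding disjoint_family_on_def by (metis UNIV_I less_irrefl)
  then have "(\<Union>i<n. A i) \<inter> A n = {}" by blast
  then show ?thesis by (auto simp: fun_eq_iff lessThan_Suc indicator_def disjoint_iff)
qed

text \<open>Finite disjoint unions follow by linearity, countable ones as bounded pointwise limits.
  The integral of a fixed \<open>f\<close> is treated in parallel, because a measure will be formed
  from the sum of both set functions.\<close>

lemma weak_conv_disjoint_union:
  assumes A: "disjoint_family A" "range A \<subseteq> sets borel" "\<And>i. weak_conv (indicator (A i))"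
  shows "weak_conv (indicator (\<Union>i. A i))" "(\<lambda>i. weak_lim (indicator (A i))) sums weak_lim (indicator (\<Union>i. A i))"
    "\<And>f :: real^'n \<Rightarrow> real. integrable lborel f \<Longrightarrow> (\<lambda>i. \<integral>x. indicator (A i) x * f x \<partial>lborel) sums (\<integral>x. indicator (\<Union>i. A i) x * f x \<partial>lborel)"
proof -
  have Am[measurable]: "A i \<in> sets borel" for i using A(2) by auto
  let ?B = "\<lambda>n. indicator (\<Union>i<n. A i) :: real^'n \<Rightarrow> real"
  have b: "\<bar>indicator S x :: real\<bar> \<le> 1" for S and x :: "real^'n" by (simp add: indicator_def)
  have Bm: "?B n \<in> borel_measurable borel" for n by measurable
  have fin: "weak_conv (?B n) \<and> weak_lim (?B n) = (\<Sum>i<n. weak_lim (indicator (A i)))" for n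
  proof (induction n)
    case 0
    have "(\<lambda>x. indicator {} x) = (\<lambda>x::real^'n. 0::real)" by auto
    then show ?case by (simp add: weak_conv_def weak_lim_def convergent_const)
  next
    case (Suc n)
    have "indicator (A n) \<in> borel_measurable borel" by measurable
    from weak_lim_lincomb[OF _ Bm b A(3) this b, of n 1 1] Suc show ?case
      unfolding indicator_Un_lessThan_Suc[OF A(1)] by simp
  qed
  have lim: "(\<lambda>n. ?B n x) \<longlonglongrightarrow> indicator (\<Union>i. A i) x" for x
    by (rule LIMSEQ_indicator_UN)
  show "weak_conv (indicator (\<Union>i. A i))"
    by (rule weak_lim_bounded_limit(1)[OF Bm b lim]) (use fin in blast)
  have "(\<lambda>n. weak_lim (?B n)) \<longlonglongrightarrow> weak_lim (indicator (\<Union>i. A i))"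
    by (rule weak_lim_bounded_limit(2)[OF Bm b lim]) (use fin in blast)
  then show "(\<lambda>i. weak_lim (indicator (A i))) sums weak_lim (indicator (\<Union>i. A i))"
    using fin by (simp add: sums_def)
  fix f :: "real^'n \<Rightarrow> real" assume f: "integrable lborel f"
  have "(\<integral>x. ?B n x * f x \<partial>lborel) = (\<Sum>i<n. \<integral>x. indicator (A i) x * f x \<partial>lborel)" for n
  proof (induction n)
    case (Suc n)
    have "integrable lborel (\<lambda>x. f x * ?B n x)" "integrable lborel (\<lambda>x. f x * indicator (A n) x)"
      by (rule integral_mult_bounded(1)[OF f _ b], measurable)+
    with Suc show ?case
      unfolding indicator_Un_lessThan_Suc[OF A(1)] by (simp add: distrib_right mult.commute[of "f _"])
  qed simp
  moreover have "(\<lambda>n. \<integral>x. ?B n x * f x \<partial>lborel) \<longlonglongrightarrow> (\<integral>x. indicator (\<Union>i. A i) x * f x \<partial>lborel)"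
    by (rule weak_lim_bounded_limit(3)[OF Bm b lim _ f]) (use fin in blast)
  ultimately show "(\<lambda>i. \<integral>x. indicator (A i) x * f x \<partial>lborel) sums (\<integral>x. indicator (\<Union>i. A i) x * f x \<partial>lborel)"
    by (simp add: sums_def)
qed

text \<open>Test functions give boxes, and an induction over Dynkin systems gives all Borel
  sets.\<close>

lemma weak_conv_indicator:
  fixes \<phi> :: "real^'n \<Rightarrow> real"
  assumes \<phi>: "\<phi> \<in> test_functions" "(\<integral>x. \<phi> x \<partial>lborel) = 1"
    and test: "\<And>\<psi>. \<psi> \<in> test_functions \<Longrightarrow> weak_conv \<psi>" and A: "A \<in> sets borel"
  shows "weak_conv (indicator A)"
proof -
  have b: "\<bar>indicator S x :: real\<bar> \<le> 1" for S and x :: "real^'n" by (simp add: indicator_def)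
  have box: "weak_conv (indicator (box a b))" for a b
  proof -
    obtain \<psi> B where \<psi>: "\<forall>m. \<psi> m \<in> test_functions" "\<forall>m x. \<bar>\<psi> m x\<bar> \<le> B"
       "\<forall>m x. x \<notin> box a b \<longrightarrow> \<psi> m x = 0" "\<forall>x. (\<lambda>m::nat. \<psi> m x) \<longlonglongrightarrow> indicator (box a b) x"
      using box_approximation[OF \<phi>, of a b] by blast
    have "\<psi> m \<in> borel_measurable borel" for m using \<psi>(1) test_functions_measurable by blast
    then show ?thesis
      by (rule weak_lim_bounded_limit(1)[of \<psi> B]) (use \<psi> test in auto)
  qed
  \<comment> \<open>Complements need the constant function, which is the limit of the indicators of
    growing boxes.\<close>
  have one: "weak_conv (\<lambda>x. 1)"
  proof (rule weak_lim_bounded_limit(1)[of "\<lambda>n. indicator (box (- (real n *\<^sub>R One)) (real n *\<^sub>R One))" 1])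
    show "(\<lambda>n. indicator (box (- (real n *\<^sub>R One)) (real n *\<^sub>R One)) x) \<longlonglongrightarrow> (1::real)" for x :: "real^'n"
    proof -
      have "x \<in> (\<Union>n::nat. box (- (real n *\<^sub>R One)) (real n *\<^sub>R One))"
        unfolding UN_box_eq_UNIV by simp
      then obtain n :: nat where n: "x \<in> box (- (real n *\<^sub>R One)) (real n *\<^sub>R One)" by blast
      have "x \<in> box (- (real m *\<^sub>R One)) (real m *\<^sub>R One)" if "m \<ge> n" for m
      proof -
        have "real n \<le> real m" using that by simp
        then show ?thesis using n unfolding mem_box by (auto simp: inner_sum_left_Basis intro: less_le_trans le_less_trans)
      qed
      then have "\<forall>\<^sub>F m in sequentially. indicator (box (- (real m *\<^sub>R One)) (real m *\<^sub>R One)) x = (1::real)"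
        unfolding eventually_sequentially by (intro exI[of _ n]) simp
      then show ?thesis by (rule tendsto_eventually)
    qed
  qed (use box b in auto)
  have sub: "range (\<lambda>(a, b). box a b :: (real^'n) set) \<subseteq> Pow UNIV" by simp
  have "A \<in> sigma_sets UNIV (range (\<lambda>(a, b). box a b))" using A by (simp add: sets_borel_box)
  from Int_stable_box sub this show ?thesis
  proof (induction A rule: sigma_sets_induct_disjoint)
    case (basic A)
    then show ?case using box by auto
  next
    case empty
    then show ?case by (simp add: weak_conv_def convergent_const)
  next
    case (compl A)
    have "A \<in> sets borel" using compl(1) unfolding sets_borel_box .
    then have m: "indicator A \<in> borel_measurable borel" by measurable
    have "indicator (UNIV - A) = (\<lambda>x. 1 * 1 + (-1) * indicator A x :: real)"
      by (auto simp: fun_eq_iff indicator_def)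
    then show ?case
      using weak_lim_lincomb(1)[OF one _ _ compl(2) m b, of 1 1 "-1"] by simp
  next
    case (union A)
    then show ?case by (intro weak_conv_disjoint_union(1)) (simp_all add: sets_borel_box)
  qed
qed

text \<open>Induction over a finite set of values; a bound on \<open>h Y\<close> is carried along
  because linearity of the limit is stated for bounded functions.\<close>

lemma weak_lim_simple_function:
  fixes f s :: "real^'n \<Rightarrow> real"
  assumes f: "integrable lborel f"
    and eq: "\<And>A. A \<in> sets borel \<Longrightarrow> weak_conv (indicator A) \<and> weak_lim (indicator A) = (\<integral>x. indicator A x * f x \<partial>lborel)"
    and s: "simple_function lborel s"
  shows "weak_conv s \<and> weak_lim s = (\<integral>x. s x * f x \<partial>lborel)"
proof -
  have b: "\<bar>indicator S x :: real\<bar> \<le> 1" for S and x :: "real^'n" by (simp add: indicator_def)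
  have "s \<in> borel_measurable lborel" using s by (rule borel_measurable_simple_function)
  then have [measurable]: "s \<in> borel_measurable borel" by simp
  have lev[measurable]: "s -` {y} \<in> sets borel" for y
    using measurable_sets[of s borel borel "{y}"] by simp
  define h where "h Y = (\<lambda>x. \<Sum>y\<in>Y. y * indicator (s -` {y}) x)" for Y
  have hm[measurable]: "h Y \<in> borel_measurable borel" for Y unfolding h_def by measurable
  have "weak_conv (h Y) \<and> weak_lim (h Y) = (\<integral>x. h Y x * f x \<partial>lborel) \<and> (\<exists>K. \<forall>x. \<bar>h Y x\<bar> \<le> K)" if "finite Y" for Y
    using that
  proof (induction Y)
    case empty
    have "h {} = (\<lambda>x. 0)" by (simp add: h_def)
    then show ?case by (auto simp: weak_conv_def weak_lim_def convergent_const)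
  next
    case (insert y Y)
    then obtain K where K: "\<forall>x. \<bar>h Y x\<bar> \<le> K" by blast
    have i: "indicator (s -` {y}) \<in> borel_measurable borel" by measurable
    have h: "h (insert y Y) = (\<lambda>x. 1 * h Y x + y * indicator (s -` {y}) x)"
      unfolding h_def sum.insert[OF insert(1,2)] by (simp only: mult_1 add.commute)
    have wc: "weak_conv (h Y)" "weak_conv (indicator (s -` {y}))"
      using insert eq[OF lev] by auto
    have int: "integrable lborel (\<lambda>x. f x * h Y x)" "integrable lborel (\<lambda>x. f x * indicator (s -` {y}) x)"
      using integral_mult_bounded(1)[OF f, of "h Y" K] K hm[of Y]
        integral_mult_bounded(1)[OF f, of "indicator (s -` {y})" 1] b i by simp_all
    have "\<bar>h (insert y Y) x\<bar> \<le> K + \<bar>y\<bar>" for x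
      unfolding h using K[rule_format, of x] by (auto simp: indicator_def)
    moreover have "(\<integral>x. h (insert y Y) x * f x \<partial>lborel) = (\<integral>x. h Y x * f x \<partial>lborel) + y * (\<integral>x. indicator (s -` {y}) x * f x \<partial>lborel)"
      unfolding h using int by (simp add: distrib_right mult.commute[of "f _"] mult.assoc)
    ultimately show ?case
      using weak_lim_lincomb[OF wc(1) hm K[rule_format] wc(2) i b, of 1 y] insert.IH[THEN conjunct2, THEN conjunct1] eq[OF lev, of y]
      unfolding h[symmetric] insert(3)[THEN conjunct2, THEN conjunct1] by auto
  qed
  moreover have fin: "finite (range s)" using s by (simp add: simple_function_def)
  moreover have "h (range s) = s"
  proof
    fix x
    have "h (range s) x = (\<Sum>y\<in>range s. if y = s x then s x else 0)"
      unfolding h_def by (intro sum.cong) (auto simp: indicator_def)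
    then show "h (range s) x = s x" using fin by simp
  qed
  ultimately show ?thesis by metis
qed

text \<open>The set function \<open>A \<mapsto> weak_lim (indicator A)\<close> is countably additive
  and dominated by the integral of \<open>g\<close>, hence absolutely continuous, but signed. Adding
  the integral of \<open>g\<close> makes it nonnegative, so that the Radon--Nikodym theorem for
  positive measures applies; \<open>g\<close> is subtracted from the density afterwards.\<close>

lemma weak_limit_density:
  fixes \<phi> :: "real^'n \<Rightarrow> real"
  assumes \<phi>: "\<phi> \<in> test_functions" "(\<integral>x. \<phi> x \<partial>lborel) = 1"
    and test: "\<And>\<psi>. \<psi> \<in> test_functions \<Longrightarrow> weak_conv \<psi>"
  shows "\<exists>f\<in>borel_measurable borel. (AE x in lborel. \<bar>f x\<bar> \<le> g x) \<and>
    (\<forall>\<psi>\<in>test_functions. weak_lim \<psi> = (\<integral>x. \<psi> x * f x \<partial>lborel))"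
proof -
  have gm[measurable]: "g \<in> borel_measurable borel" using g by simp
  have b: "\<bar>indicator S x :: real\<bar> \<le> 1" for S and x :: "real^'n" by (simp add: indicator_def)
  have wc: "weak_conv (indicator A)" if "A \<in> sets borel" for A
    by (rule weak_conv_indicator[OF \<phi> test that])
  have g0: "AE x in lborel. 0 \<le> g x" using dom[of 0] by eventually_elim auto
  have bound: "\<bar>weak_lim (indicator A)\<bar> \<le> (\<integral>x. indicator A x * g x \<partial>lborel)" if A: "A \<in> sets borel" for A
    using weak_lim_bound[OF wc[OF A] _ b] A by simp
  define \<nu> where "\<nu> A = weak_lim (indicator A) + (\<integral>x. indicator A x * g x \<partial>lborel)" for A
  have \<nu>0: "\<nu> A \<ge> 0" if "A \<in> sets borel" for A
    using bound[OF that] by (simp add: \<nu>_def abs_le_iff)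
  define N where "N = measure_of UNIV (sets borel) (\<lambda>A. ennreal (\<nu> A))"
  have sN: "sets N = sets borel"
    unfolding N_def using sets.sigma_sets_eq[of borel] by (simp add: sets_measure_of)
  have N: "emeasure N A = ennreal (\<nu> A)" if A: "A \<in> sets borel" for A
  proof (rule emeasure_measure_of[OF N_def])
    have "\<nu> {} = 0" using bound[of "{}"] by (simp add: \<nu>_def)
    then show "positive (sets N) (\<lambda>A. ennreal (\<nu> A))" by (simp add: positive_def)
    show "countably_additive (sets N) (\<lambda>A. ennreal (\<nu> A))"
    proof (rule countably_additiveI)
      fix A :: "nat \<Rightarrow> (real^'n) set" assume A: "range A \<subseteq> sets N" "disjoint_family A"
      have A': "range A \<subseteq> sets borel" using A sN by simp
      have wcA: "weak_conv (indicator (A i))" for i using A' by (intro wc) auto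
      have "(\<lambda>i. \<nu> (A i)) sums \<nu> (\<Union>i. A i)"
        unfolding \<nu>_def by (intro sums_add weak_conv_disjoint_union(2,3)[OF A(2) A' wcA] g)
      then show "(\<Sum>i. ennreal (\<nu> (A i))) = ennreal (\<nu> (\<Union>i. A i))"
        using A' by (intro suminf_ennreal_eq \<nu>0) auto
    qed
  qed (use A sN in auto)
  have ac: "absolutely_continuous lborel N"
    unfolding absolutely_continuous_def
  proof
    fix A assume A: "A \<in> null_sets (lborel :: (real^'n) measure)"
    then have Ab: "A \<in> sets borel" by (auto simp: null_sets_def)
    have "(\<integral>x. indicator A x * g x \<partial>lborel) = (\<integral>x. 0 \<partial>(lborel :: (real^'n) measure))"
      by (rule integral_cong_AE) (use A Ab AE_not_in[OF A] in \<open>auto elim!: eventually_mono\<close>)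
    then have "\<nu> A = 0" using bound[OF Ab] by (simp add: \<nu>_def)
    then show "A \<in> null_sets N" using N[OF Ab] Ab sN by (simp add: null_sets_def)
  qed
  obtain d where d[measurable]: "d \<in> borel_measurable lborel" and dN: "density lborel d = N"
    using sigma_finite_measure.Radon_Nikodym[OF sigma_finite_lborel ac] sN by auto
  have dA: "(\<integral>\<^sup>+x. d x * indicator A x \<partial>lborel) = ennreal (\<nu> A)" if A: "A \<in> sets borel" for A
    using N[OF A] A unfolding dN[symmetric] by (subst (asm) emeasure_density) auto
  have dfin: "AE x in lborel. d x < \<infinity>"
    using nn_integral_PInf_AE[of d lborel] dA[of UNIV] by (auto simp: less_top[symmetric])
  define e where "e x = enn2real (d x)" for x
  have em[measurable]: "e \<in> borel_measurable borel" unfolding e_def[abs_def] using d by simp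
  have e0: "e x \<ge> 0" for x by (simp add: e_def)
  have eA': "(\<integral>\<^sup>+x. ennreal (indicator A x * e x) \<partial>lborel) = ennreal (\<nu> A)" if A: "A \<in> sets borel" for A
    unfolding dA[OF A, symmetric] using dfin
    by (intro nn_integral_cong_AE) (auto elim!: eventually_mono simp: e_def split: split_indicator)
  have ei: "integrable lborel e"
    using eA'[of UNIV] e0 by (intro integrableI_nonneg) auto
  have eA: "(\<integral>x. indicator A x * e x \<partial>lborel) = \<nu> A" if A: "A \<in> sets borel" for A
    using eA'[OF A] \<nu>0[OF A] e0 A by (subst integral_eq_nn_integral) auto
  define f where "f x = e x - g x" for x
  have fi: "integrable lborel f" unfolding f_def using ei g by simp
  have fm[measurable]: "f \<in> borel_measurable borel" using fi by simp
  have ind_int: "integrable lborel (\<lambda>x. indicator A x * q x)" if "integrable lborel q" "A \<in> sets borel" for A and q :: "real^'n \<Rightarrow> real"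
    using integrable_mult_indicator[of A lborel q] that by simp
  have fA: "(\<integral>x. indicator A x * f x \<partial>lborel) = weak_lim (indicator A)" if A: "A \<in> sets borel" for A
    using eA[OF A] ind_int[OF ei A] ind_int[OF g A] by (simp add: f_def right_diff_distrib \<nu>_def)
  \<comment> \<open>Tested on the set where \<open>q\<close> is positive; applied to
    \<open>f - g\<close> and \<open>- f - g\<close> it yields the bound of
    \<open>\<bar>f\<bar>\<close> by \<open>g\<close>.\<close>
  have zero: "AE x in lborel. q x \<le> 0"
    if q: "integrable lborel q" and le: "\<And>A. A \<in> sets borel \<Longrightarrow> (\<integral>x. indicator A x * q x \<partial>lborel) \<le> 0" for q :: "real^'n \<Rightarrow> real"
  proof -
    have [measurable]: "q \<in> borel_measurable borel" using q by simp
    define A where "A = {x. 0 < q x}"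
    have A[measurable]: "A \<in> sets borel" unfolding A_def by measurable
    have nn: "AE x in lborel. 0 \<le> indicator A x * q x" by (simp add: A_def indicator_def)
    have "(\<integral>x. indicator A x * q x \<partial>lborel) = 0"
      using le[OF A] integral_nonneg_AE[OF nn] by simp
    then have "AE x in lborel. indicator A x * q x = 0"
      using integral_nonneg_eq_0_iff_AE[OF ind_int[OF q A] nn] by simp
    then show ?thesis by eventually_elim (auto simp: A_def indicator_def split: if_splits)
  qed
  have "AE x in lborel. f x - g x \<le> 0"
  proof (rule zero)
    fix A :: "(real^'n) set" assume A: "A \<in> sets borel"
    show "(\<integral>x. indicator A x * (f x - g x) \<partial>lborel) \<le> 0"
      using ind_int[OF fi A] ind_int[OF g A] fA[OF A] bound[OF A] by (simp add: right_diff_distrib)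
  qed (use fi g in simp)
  moreover have "AE x in lborel. - f x - g x \<le> 0"
  proof (rule zero)
    fix A :: "(real^'n) set" assume A: "A \<in> sets borel"
    show "(\<integral>x. indicator A x * (- f x - g x) \<partial>lborel) \<le> 0"
      using ind_int[OF fi A] ind_int[OF g A] fA[OF A] bound[OF A] by (simp add: right_diff_distrib)
  qed (use fi g in simp)
  ultimately have fg: "AE x in lborel. \<bar>f x\<bar> \<le> g x" by eventually_elim auto
  have "weak_lim \<psi> = (\<integral>x. \<psi> x * f x \<partial>lborel)" if \<psi>: "\<psi> \<in> test_functions" for \<psi>
  proof -
    obtain B where B: "\<forall>x. \<bar>\<psi> x\<bar> \<le> B" using test_functions_bounded[OF \<psi>] by blast
    have "\<psi> \<in> borel_measurable lborel" using test_functions_measurable[OF \<psi>] by simp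
    \<comment> \<open>Simple functions converging pointwise with the bound
      \<open>2 * \<bar>\<psi> x\<bar>\<close>, so that closure under bounded limits carries the
      formula from indicators to \<open>\<psi>\<close>.\<close>
    from borel_measurable_implies_sequence_metric[OF this, of 0] obtain s
      where s: "\<forall>i. simple_function lborel (s i)" "\<forall>x. (\<lambda>i. s i x) \<longlonglongrightarrow> \<psi> x" "\<forall>i x. \<bar>s i x\<bar> \<le> 2 * \<bar>\<psi> x\<bar>"
      by (auto simp: dist_real_def)
    have sB: "\<bar>s i x\<bar> \<le> 2 * B" for i x using s(3)[rule_format, of i x] B[rule_format, of x] by linarith
    have sm: "s i \<in> borel_measurable borel" for i
      using borel_measurable_simple_function[of lborel "s i"] s(1) by simp
    have sw: "weak_conv (s i)" "weak_lim (s i) = (\<integral>x. s i x * f x \<partial>lborel)" for i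
      using weak_lim_simple_function[OF fi, of "s i"] s(1) wc fA by auto
    have "(\<lambda>i. weak_lim (s i)) \<longlonglongrightarrow> weak_lim \<psi>"
      by (rule weak_lim_bounded_limit(2)[OF sm sB _ sw(1)]) (use s in blast)
    moreover have "(\<lambda>i. \<integral>x. s i x * f x \<partial>lborel) \<longlonglongrightarrow> (\<integral>x. \<psi> x * f x \<partial>lborel)"
      by (rule weak_lim_bounded_limit(3)[OF sm sB _ sw(1) fi]) (use s in blast)
    ultimately show ?thesis unfolding sw(2) by (rule LIMSEQ_unique)
  qed
  with fg fm show ?thesis by blast
qed

end

section \<open>The weak gradient\<close>

lemma indicator_set_integrable_lebesgue:
  "u \<in> L1_loc \<Longrightarrow> integrable lebesgue (\<lambda>x. indicator (cball 0 R) x * u x)"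
  unfolding L1_loc_def set_integrable_def by simp

text \<open>Local integrability speaks about compact sets only; measurability on the whole space
  follows by exhausting it with balls.\<close>

lemma L1_loc_measurable:
  fixes u :: "real^'n::finite \<Rightarrow> real"
  assumes "u \<in> L1_loc"
  shows "u \<in> borel_measurable lebesgue"
proof (rule borel_measurable_LIMSEQ_real)
  show "(\<lambda>x. indicator (cball 0 (real n)) x * u x) \<in> borel_measurable lebesgue" for n
    using indicator_set_integrable_lebesgue[OF assms] by (rule borel_measurable_integrable)
  fix x :: "real^'n"
  obtain n :: nat where n: "norm x \<le> real n" using real_arch_simple by blast
  have "\<forall>\<^sub>F m in sequentially. indicator (cball 0 (real m)) x * u x = u x"
    unfolding eventually_sequentially
  proof (intro exI[of _ n] allI impI)
    fix m assume "n \<le> m"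
    then have "norm x \<le> real m" using n by linarith
    then show "indicator (cball 0 (real m)) x * u x = u x" by simp
  qed
  then show "(\<lambda>n. indicator (cball 0 (real n)) x * u x) \<longlonglongrightarrow> u x" by (rule tendsto_eventually)
qed

lemma borel_L1_loc:
  fixes U :: "real^'n::finite \<Rightarrow> real"
  assumes [measurable]: "U \<in> borel_measurable borel" and int: "\<And>R. integrable lborel (\<lambda>x. indicator (cball 0 R) x * U x)"
  shows "U \<in> L1_loc"
  unfolding L1_loc_def set_integrable_def
proof safe
  fix K :: "(real^'n) set" assume K: "compact K"
  then obtain R where R: "\<forall>x\<in>K. norm x \<le> R" using compact_imp_bounded[of K] unfolding bounded_iff by blast
  have Kb: "K \<in> sets borel" using K by (simp add: borel_compact)
  have "integrable lborel (\<lambda>x. indicator K x *\<^sub>R (indicator (cball 0 R) x * U x))"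
    using integrable_mult_indicator[OF _ int] Kb by simp
  moreover have "(\<lambda>x. indicator K x *\<^sub>R (indicator (cball 0 R) x * U x)) = (\<lambda>x. indicator K x *\<^sub>R U x)"
    using R by (auto simp: fun_eq_iff indicator_def)
  ultimately show "integrable lebesgue (\<lambda>x. indicator K x *\<^sub>R U x)"
    using Kb by (subst integrable_completion) auto
qed

lemma L1_loc_mult_test_integrable:
  assumes u: "u \<in> L1_loc" and \<psi>: "\<psi> \<in> test_functions"
  shows "integrable lebesgue (\<lambda>x. u x * \<psi> x)"
proof -
  obtain B where B: "\<forall>x. \<bar>\<psi> x\<bar> \<le> B" using test_functions_bounded[OF \<psi>] by blast
  obtain R where R: "\<forall>x. R < norm x \<longrightarrow> \<psi> x = 0" using test_functions_support[OF \<psi>] by blast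
  have "\<psi> \<in> borel_measurable lebesgue"
    using test_functions_measurable[OF \<psi>] by (intro measurable_completion) simp
  then have "integrable lebesgue (\<lambda>x. (indicator (cball 0 R) x * u x) * \<psi> x)"
    using B by (intro integral_mult_bounded(1)[OF indicator_set_integrable_lebesgue[OF u]]) auto
  moreover have "(\<lambda>x. (indicator (cball 0 R) x * u x) * \<psi> x) = (\<lambda>x. u x * \<psi> x)"
    using R by (auto simp: fun_eq_iff indicator_def not_le)
  ultimately show ?thesis by simp
qed

context
  fixes \<phi> :: "real^'n::finite \<Rightarrow> real"
  assumes \<phi>: "\<phi> \<in> test_functions" "(\<integral>x. \<phi> x \<partial>lborel) = 1"
begin

text \<open>A function measurable for the completed measure is replaced by a Borel version, to which
  the uniqueness result for \<open>lborel\<close> applies.\<close>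

lemma lebesgue_AE_zero_if_test_functions:
  fixes w :: "real^'n \<Rightarrow> real"
  assumes w: "w \<in> L1_loc" and zero: "\<And>\<psi>. \<psi> \<in> test_functions \<Longrightarrow> (\<integral>x. w x * \<psi> x \<partial>lebesgue) = 0"
  shows "AE x in lebesgue. w x = 0"
proof -
  have wm: "w \<in> borel_measurable lebesgue" by (rule L1_loc_measurable[OF w])
  obtain w' where w'[measurable]: "w' \<in> borel_measurable lborel" and eq: "AE x in lborel. w x = w' x"
    using completion_ex_borel_measurable_real[OF wm] by blast
  have w'b[measurable]: "w' \<in> borel_measurable borel" using w' by simp
  have eq': "AE x in lebesgue. w x = w' x" using eq by (rule AE_completion)
  have m: "h \<in> borel_measurable borel \<Longrightarrow> h \<in> borel_measurable lebesgue" for h :: "real^'n \<Rightarrow> real"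
    by (intro measurable_completion) simp
  have "AE x in lborel. w' x = 0"
  proof (rule AE_zero_if_test_functions[OF \<phi> w'b])
    fix R
    have [measurable]: "cball (0::real^'n) R \<in> sets borel" by simp
    have "(\<lambda>x. indicator (cball 0 R) x * w' x) \<in> borel_measurable lebesgue" by (rule m) measurable
    then have "integrable lebesgue (\<lambda>x. indicator (cball 0 R) x * w' x)"
      by (subst integrable_cong_AE[of _ _ "\<lambda>x. indicator (cball 0 R) x * w x"])
        (use eq' wm indicator_set_integrable_lebesgue[OF w] in \<open>auto intro!: m elim!: eventually_mono dest: borel_measurable_integrable\<close>)
    then show "integrable lborel (\<lambda>x. indicator (cball 0 R) x * w' x)"
      by (subst (asm) integrable_completion) auto
  next
    fix \<psi> :: "real^'n \<Rightarrow> real" assume \<psi>: "\<psi> \<in> test_functions"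
    have \<psi>m[measurable]: "\<psi> \<in> borel_measurable borel" using \<psi> by auto
    have "(\<integral>x. w' x * \<psi> x \<partial>lborel) = (\<integral>x. w' x * \<psi> x \<partial>lebesgue)"
      by (rule integral_completion[symmetric]) simp
    also have "\<dots> = (\<integral>x. w x * \<psi> x \<partial>lebesgue)"
      using wm m[OF w'b] m[OF \<psi>m] eq' by (intro integral_cong_AE) (auto elim!: eventually_mono)
    finally show "(\<integral>x. w' x * \<psi> x \<partial>lborel) = 0" using zero[OF \<psi>] by simp
  qed
  then have "AE x in lebesgue. w' x = 0" by (rule AE_completion)
  with eq' show ?thesis by eventually_elim simp
qed

lemma L1_loc_eq_AE:
  fixes u v :: "real^'n \<Rightarrow> real"
  assumes u: "u \<in> L1_loc" and v: "v \<in> L1_loc"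
    and eq: "\<And>\<psi>. \<psi> \<in> test_functions \<Longrightarrow> (\<integral>x. u x * \<psi> x \<partial>lebesgue) = (\<integral>x. v x * \<psi> x \<partial>lebesgue)"
  shows "AE x in lebesgue. u x = v x"
proof -
  have "(\<lambda>x. u x - v x) \<in> L1_loc"
    using u v unfolding L1_loc_def set_integrable_def by (auto simp: right_diff_distrib)
  moreover have "(\<integral>x. (u x - v x) * \<psi> x \<partial>lebesgue) = 0" if \<psi>: "\<psi> \<in> test_functions" for \<psi>
    using eq[OF \<psi>] L1_loc_mult_test_integrable[OF u \<psi>] L1_loc_mult_test_integrable[OF v \<psi>]
    by (simp add: left_diff_distrib)
  ultimately have "AE x in lebesgue. u x - v x = 0"
    by (rule lebesgue_AE_zero_if_test_functions)
  then show ?thesis by eventually_elim simp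
qed

lemma integrable_L1_loc:
  fixes w :: "real^'n \<Rightarrow> real"
  assumes "integrable lebesgue w"
  shows "w \<in> L1_loc"
  unfolding L1_loc_def set_integrable_def
  using integrable_mult_indicator[OF _ assms] by (auto simp: borel_compact intro: sets_completionI_sets)

section \<open>Uniqueness and existence of the integrable gradient\<close>

text \<open>The norm is defined through a chosen gradient; any two gradients have the same pairings
  with test functions, so their components agree almost everywhere.\<close>

lemma grad_L1_norm_eq:
  fixes u :: "real^'n \<Rightarrow> real"
  assumes G: "has_L1_gradient u G"
  shows "grad_L1_norm u = (\<integral>\<^sup>+x. ennreal (norm (G x)) \<partial>lebesgue)"
proof -
  define G' where "G' = (SOME G. has_L1_gradient u G)"
  have G': "has_L1_gradient u G'" unfolding G'_def by (rule someI[of "has_L1_gradient u", OF G])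
  have comp: "(\<lambda>x. H x $ j) \<in> L1_loc" if "has_L1_gradient u H" for H j
    using that unfolding has_L1_gradient_def by (intro integrable_L1_loc integrable_bounded_linear[OF bounded_linear_vec_nth]) blast
  have "AE x in lebesgue. G' x $ j = G x $ j" for j
  proof (rule L1_loc_eq_AE[OF comp[OF G'] comp[OF G]])
    fix \<psi> :: "real^'n \<Rightarrow> real" assume \<psi>: "\<psi> \<in> test_functions"
    have "(\<integral>x. u x * pdiff j \<psi> x \<partial>lebesgue) = - (\<integral>x. G' x $ j * \<psi> x \<partial>lebesgue)"
      "(\<integral>x. u x * pdiff j \<psi> x \<partial>lebesgue) = - (\<integral>x. G x $ j * \<psi> x \<partial>lebesgue)"
      using G G' \<psi> unfolding has_L1_gradient_def by blast+
    then show "(\<integral>x. G' x $ j * \<psi> x \<partial>lebesgue) = (\<integral>x. G x $ j * \<psi> x \<partial>lebesgue)" by simp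
  qed
  then have "AE x in lebesgue. \<forall>j\<in>UNIV. G' x $ j = G x $ j"
    by (intro AE_finite_allI) auto
  then have "AE x in lebesgue. ennreal (norm (G' x)) = ennreal (norm (G x))"
    by eventually_elim (simp add: vec_eq_iff[symmetric])
  then show ?thesis
    unfolding grad_L1_norm_def G'_def[symmetric] by (rule nn_integral_cong_AE)
qed

text \<open>Each component is the weak limit of the regularised distributional derivative. The
  radial maximal function dominates the regularisations and hence the limit, so the
  \<open>L1\<close> norm of the gradient is bounded by the sum of the Hardy norms with constant
  one.\<close>

lemma L1_gradient_exists:
  assumes T: "distribution T"
    and fin: "\<forall>j. (\<integral>\<^sup>+x. radial_max \<phi> (distr_pdiff j T) x \<partial>lborel) < \<infinity>"
  shows "\<exists>G :: real^'n \<Rightarrow> real^'n. G \<in> borel_measurable borel \<and> integrable lborel G \<and>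
    (\<integral>\<^sup>+x. ennreal (norm (G x)) \<partial>lborel) \<le> (\<Sum>j\<in>UNIV. \<integral>\<^sup>+x. radial_max \<phi> (distr_pdiff j T) x \<partial>lborel) \<and>
    (\<forall>\<psi>\<in>test_functions. \<forall>j. T (pdiff j \<psi>) = - (\<integral>x. G x $ j * \<psi> x \<partial>lborel))"
proof -
  have "\<exists>f. f \<in> borel_measurable borel \<and> integrable lborel f \<and>
      (\<integral>\<^sup>+x. ennreal \<bar>f x\<bar> \<partial>lborel) \<le> (\<integral>\<^sup>+x. radial_max \<phi> (distr_pdiff j T) x \<partial>lborel) \<and>
      (\<forall>\<psi>\<in>test_functions. T (pdiff j \<psi>) = - (\<integral>x. \<psi> x * f x \<partial>lborel))" for j
  proof -
    define D where "D = distr_pdiff j T"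
    have D: "distribution D" unfolding D_def by (rule distribution_pdiff[OF T])
    have rm[measurable]: "radial_max \<phi> D \<in> borel_measurable borel" by (rule borel_measurable_radial_max[OF \<phi> D])
    have Dfin: "(\<integral>\<^sup>+x. radial_max \<phi> D x \<partial>lborel) < \<infinity>" using fin by (simp add: D_def)
    have AE: "AE x in lborel. radial_max \<phi> D x < \<infinity>"
      using nn_integral_PInf_AE[of "radial_max \<phi> D" lborel] Dfin by (auto simp: less_top[symmetric])
    define g where "g x = enn2real (radial_max \<phi> D x)" for x
    have gm[measurable]: "g \<in> borel_measurable borel" unfolding g_def[abs_def] by measurable
    have gnn: "(\<integral>\<^sup>+x. ennreal (g x) \<partial>lborel) = (\<integral>\<^sup>+x. radial_max \<phi> D x \<partial>lborel)"
      using AE by (intro nn_integral_cong_AE) (auto simp: g_def elim: eventually_mono)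
    have g: "integrable lborel g"
      using gnn Dfin by (intro integrableI_nonneg) (auto simp: g_def)
    define F where "F k = distr_conv D (dilate \<phi> ((1/2) ^ k))" for k
    have F: "F k \<in> borel_measurable borel" for k
      unfolding F_def by (intro measurable_distr_conv_dilate \<phi> D) simp
    have dom: "AE x in lborel. \<bar>F k x\<bar> \<le> g x" for k
      using AE
    proof eventually_elim
      case (elim x)
      have "ennreal \<bar>F k x\<bar> \<le> radial_max \<phi> D x"
        unfolding radial_max_def F_def by (intro SUP_upper) simp
      also have "\<dots> = ennreal (g x)" using elim by (simp add: g_def)
      finally show ?case by (simp add: g_def)
    qed
    have lim: "(\<lambda>k. \<integral>x. \<psi> x * F k x \<partial>lborel) \<longlonglongrightarrow> D \<psi>" if "\<psi> \<in> test_functions" for \<psi>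
      unfolding F_def by (rule distribution_approx[OF D \<phi> that]) (auto intro!: LIMSEQ_power_zero)
    have wc: "weak_conv F \<psi>" if "\<psi> \<in> test_functions" for \<psi>
      unfolding weak_conv_def[OF F g dom] using lim[OF that] by (auto simp: convergent_def)
    have wl: "weak_lim F \<psi> = D \<psi>" if "\<psi> \<in> test_functions" for \<psi>
      unfolding weak_lim_def[OF F g dom] using lim[OF that] by (rule limI)
    obtain f where f: "f \<in> borel_measurable borel" "AE x in lborel. \<bar>f x\<bar> \<le> g x"
      "\<forall>\<psi>\<in>test_functions. weak_lim F \<psi> = (\<integral>x. \<psi> x * f x \<partial>lborel)"
      using weak_limit_density[OF F g dom \<phi> wc] by blast
    have "integrable lborel f"
      by (rule Bochner_Integration.integrable_bound[OF g])
        (use f in \<open>auto elim!: eventually_mono intro: order_trans[OF _ abs_ge_self]\<close>)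
    moreover have "(\<integral>\<^sup>+x. ennreal \<bar>f x\<bar> \<partial>lborel) \<le> (\<integral>\<^sup>+x. radial_max \<phi> D x \<partial>lborel)"
      unfolding gnn[symmetric] using f(2) by (intro nn_integral_mono_AE) (auto elim!: eventually_mono intro: ennreal_leI)
    moreover have "T (pdiff j \<psi>) = - (\<integral>x. \<psi> x * f x \<partial>lborel)" if "\<psi> \<in> test_functions" for \<psi>
      using f(3) wl[OF that] that by (simp add: D_def distr_pdiff_def)
    ultimately show ?thesis using f(1) unfolding D_def by blast
  qed
  then have "\<exists>f. \<forall>j. f j \<in> borel_measurable borel \<and> integrable lborel (f j) \<and>
      (\<integral>\<^sup>+x. ennreal \<bar>f j x\<bar> \<partial>lborel) \<le> (\<integral>\<^sup>+x. radial_max \<phi> (distr_pdiff j T) x \<partial>lborel) \<and>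
      (\<forall>\<psi>\<in>test_functions. T (pdiff j \<psi>) = - (\<integral>x. \<psi> x * f j x \<partial>lborel))"
    by (intro choice allI)
  then obtain f where "\<forall>j. f j \<in> borel_measurable borel \<and> integrable lborel (f j) \<and>
      (\<integral>\<^sup>+x. ennreal \<bar>f j x\<bar> \<partial>lborel) \<le> (\<integral>\<^sup>+x. radial_max \<phi> (distr_pdiff j T) x \<partial>lborel) \<and>
      (\<forall>\<psi>\<in>test_functions. T (pdiff j \<psi>) = - (\<integral>x. \<psi> x * f j x \<partial>lborel))" ..
  then have f: "f j \<in> borel_measurable borel" "integrable lborel (f j)"
      "(\<integral>\<^sup>+x. ennreal \<bar>f j x\<bar> \<partial>lborel) \<le> (\<integral>\<^sup>+x. radial_max \<phi> (distr_pdiff j T) x \<partial>lborel)"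
      "\<forall>\<psi>\<in>test_functions. T (pdiff j \<psi>) = - (\<integral>x. \<psi> x * f j x \<partial>lborel)" for j
    by blast+
  define G :: "real^'n \<Rightarrow> real^'n" where "G x = (\<Sum>j\<in>UNIV. f j x *\<^sub>R axis j 1)" for x
  have Gj: "G x $ j = f j x" for x j
    by (simp add: G_def axis_def if_distrib[of "\<lambda>c. _ * c"] cong: if_cong)
  have Gi: "integrable lborel G"
    unfolding G_def by (intro Bochner_Integration.integrable_sum integrable_scaleR_left f)
  then have "G \<in> borel_measurable borel" using borel_measurable_integrable by auto
  moreover have "(\<integral>\<^sup>+x. ennreal (norm (G x)) \<partial>lborel) \<le> (\<Sum>j\<in>UNIV. \<integral>\<^sup>+x. radial_max \<phi> (distr_pdiff j T) x \<partial>lborel)"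
  proof -
    have "ennreal (norm (G x)) \<le> (\<Sum>j\<in>UNIV. ennreal \<bar>f j x\<bar>)" for x
      using norm_le_l1_cart[of "G x"] by (simp add: Gj sum_ennreal ennreal_leI)
    then have "(\<integral>\<^sup>+x. ennreal (norm (G x)) \<partial>lborel) \<le> (\<integral>\<^sup>+x. (\<Sum>j\<in>UNIV. ennreal \<bar>f j x\<bar>) \<partial>lborel)"
      by (intro nn_integral_mono)
    also have "\<dots> = (\<Sum>j\<in>UNIV. \<integral>\<^sup>+x. ennreal \<bar>f j x\<bar> \<partial>lborel)"
      by (rule nn_integral_sum) (use f(1) in simp)
    also have "\<dots> \<le> (\<Sum>j\<in>UNIV. \<integral>\<^sup>+x. radial_max \<phi> (distr_pdiff j T) x \<partial>lborel)"
      by (intro sum_mono f)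
    finally show ?thesis .
  qed
  ultimately show ?thesis
    using Gi f(4) by (intro exI[of _ G]) (simp add: Gj mult.commute)
qed

end

section \<open>From a Hajlasz inequality to the weak seminorm\<close>

lemma dyadic_annulus:
  fixes r z :: real
  assumes "0 < r" "r \<le> z"
  shows "\<exists>i::nat. 2 ^ i * r \<le> z \<and> z < 2 ^ Suc i * r"
proof -
  obtain n where "z / r < 2 ^ n" using real_arch_pow[of 2 "z / r"] by auto
  then have ex: "\<exists>n. z < 2 ^ n * r" using assms by (auto simp: divide_less_eq)
  define n where "n = (LEAST n. z < 2 ^ n * r)"
  have n: "z < 2 ^ n * r" unfolding n_def using ex by (rule LeastI_ex)
  then have "n \<noteq> 0" using assms by (intro notI) simp
  then obtain i where i: "n = Suc i" by (cases n) auto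
  have "\<not> z < 2 ^ i * r" using not_less_Least[of i "\<lambda>n. z < 2 ^ n * r"] i by (simp add: n_def)
  then show ?thesis using n i by (intro exI[of _ i]) auto
qed

text \<open>Since \<open>\<gamma> < 0\<close>, the condition places \<open>y \<noteq> x\<close>
  outside the ball of radius \<open>r = s powr (1 / \<gamma>)\<close> about \<open>x\<close>. The
  annulus between \<open>2 ^ i * r\<close> and \<open>2 ^ Suc i * r\<close> contributes at most a
  constant times \<open>s * (2 powr \<gamma>) ^ i\<close>, a geometric series with ratio below
  one.\<close>

lemma singular_kernel_integral:
  fixes \<gamma> :: real
  assumes \<gamma>: "\<gamma> < 0"
  shows "\<exists>K>0. \<forall>(x::real^'n::finite) s. s \<ge> 0 \<longrightarrow>
    (\<integral>\<^sup>+y. ennreal (norm (x - y) powr (\<gamma> - real CARD('n))) * indicator {y. norm (x - y) powr \<gamma> < s} y \<partial>lborel) \<le> ennreal (K * s)"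
proof -
  define N where "N = CARD('n)"
  define v where "v = unit_ball_vol (real N)"
  have v: "v > 0" by (simp add: v_def)
  have q: "0 < 2 powr \<gamma>" "2 powr \<gamma> < 1" using \<gamma> by (auto simp: powr_less_one)
  define K where "K = v * 2 ^ N * (1 / (1 - 2 powr \<gamma>))"
  have K: "K > 0" using v q by (simp add: K_def)
  have main: "(\<integral>\<^sup>+y. ennreal (norm (x - y) powr (\<gamma> - real N)) * indicator {y. norm (x - y) powr \<gamma> < s} y \<partial>lborel) \<le> ennreal (K * s)"
    if s: "s > 0" for x :: "real^'n" and s
  proof -
    define r where "r = s powr (1 / \<gamma>)"
    have r: "r > 0" using s by (simp add: r_def)
    have r\<gamma>: "r powr \<gamma> = s" using s \<gamma> by (simp add: r_def powr_powr)
    define c where "c i = (2 ^ i * r) powr (\<gamma> - real N)" for i :: nat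
    have pt: "ennreal (norm (x - y) powr (\<gamma> - real N)) * indicator {y. norm (x - y) powr \<gamma> < s} y \<le>
       (\<Sum>i. ennreal (c i) * indicator (ball x (2 ^ Suc i * r)) y)" for y
    \<comment> \<open>The point \<open>y = x\<close> satisfies the condition by the convention
      \<open>0 powr \<gamma> = 0\<close>, but the kernel vanishes there by the same
      convention.\<close>
    proof (cases "norm (x - y) powr \<gamma> < s \<and> x \<noteq> y")
      case True
      then have z: "norm (x - y) > 0" "norm (x - y) powr \<gamma> < s" by auto
      have "r \<le> norm (x - y)"
      proof (rule ccontr)
        assume "\<not> r \<le> norm (x - y)"
        then have "r powr \<gamma> \<le> norm (x - y) powr \<gamma>" using z \<gamma> by (intro powr_mono2') auto
        then show False using z r\<gamma> by simp
      qed
      then obtain i :: nat where i: "2 ^ i * r \<le> norm (x - y)" "norm (x - y) < 2 ^ Suc i * r"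
        using dyadic_annulus[OF r] by blast
      have "norm (x - y) powr (\<gamma> - real N) \<le> c i"
        unfolding c_def using i r \<gamma> by (intro powr_mono2') auto
      then have "ennreal (norm (x - y) powr (\<gamma> - real N)) \<le> ennreal (c i) * indicator (ball x (2 ^ Suc i * r)) y"
        using i by (simp add: dist_norm ennreal_leI)
      also have "\<dots> = (\<Sum>j\<in>{i}. ennreal (c j) * indicator (ball x (2 ^ Suc j * r)) y)"
        by (simp only: sum.insert[OF finite.emptyI] empty_iff not_False_eq_True sum.empty add_0_right)
      also have "\<dots> \<le> (\<Sum>i. ennreal (c i) * indicator (ball x (2 ^ Suc i * r)) y)"
        by (rule sum_le_suminf) (auto intro: summableI)
      finally show ?thesis using z by simp
    next
      case False
      then have "ennreal (norm (x - y) powr (\<gamma> - real N)) * indicator {y. norm (x - y) powr \<gamma> < s} y = 0"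
        by (auto simp: indicator_def)
      from this zero_le show ?thesis by (rule ord_eq_le_trans)
    qed
    have bm[measurable]: "ball x e \<in> sets borel" for e by simp
    have "(\<integral>\<^sup>+y. ennreal (norm (x - y) powr (\<gamma> - real N)) * indicator {y. norm (x - y) powr \<gamma> < s} y \<partial>lborel) \<le>
       (\<integral>\<^sup>+y. (\<Sum>i. ennreal (c i) * indicator (ball x (2 ^ Suc i * r)) y) \<partial>lborel)"
      by (intro nn_integral_mono pt)
    also have "\<dots> = (\<Sum>i. \<integral>\<^sup>+y. ennreal (c i) * indicator (ball x (2 ^ Suc i * r)) y \<partial>lborel)"
      by (intro nn_integral_suminf) measurable
    also have "\<dots> = (\<Sum>i. ennreal (v * 2 ^ N * s * (2 powr \<gamma>) ^ i))"
    proof (rule suminf_cong)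
      fix i
      have "(\<integral>\<^sup>+y. ennreal (c i) * indicator (ball x (2 ^ Suc i * r)) y \<partial>lborel) = ennreal (c i) * emeasure lborel (ball x (2 ^ Suc i * r))"
        by (rule nn_integral_cmult_indicator) simp
      also have "\<dots> = ennreal (c i * (v * (2 ^ Suc i * r) ^ N))"
        using r v by (simp add: emeasure_ball_power N_def v_def ennreal_mult c_def)
      also have "c i * (v * (2 ^ Suc i * r) ^ N) = v * 2 ^ N * s * (2 powr \<gamma>) ^ i"
      proof -
        have p: "2 ^ i * r > 0" using r by simp
        have "c i * (2 ^ i * r) ^ N = (2 ^ i * r) powr \<gamma>"
          using p by (simp add: c_def powr_diff powr_realpow)
        also have "\<dots> = (2 powr \<gamma>) ^ i * s"
        proof -
          have "((2::real) ^ i) powr \<gamma> = (2 powr \<gamma>) ^ i"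
            by (simp add: powr_powr mult.commute flip: powr_realpow)
          then show ?thesis using r r\<gamma> by (simp add: powr_mult)
        qed
        finally have e: "c i * (2 ^ i * r) ^ N = (2 powr \<gamma>) ^ i * s" .
        have "(2 ^ Suc i * r) ^ N = 2 ^ N * (2 ^ i * r) ^ N" by (simp add: power_mult_distrib)
        then have "c i * (v * (2 ^ Suc i * r) ^ N) = v * 2 ^ N * (c i * (2 ^ i * r) ^ N)" by simp
        then show ?thesis unfolding e by (simp only: mult_ac)
      qed
      finally show "(\<integral>\<^sup>+y. ennreal (c i) * indicator (ball x (2 ^ Suc i * r)) y \<partial>lborel) = ennreal (v * 2 ^ N * s * (2 powr \<gamma>) ^ i)" .
    qed
    also have "\<dots> = ennreal (v * 2 ^ N * s * (1 / (1 - 2 powr \<gamma>)))"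
    proof (rule suminf_ennreal_eq)
      show "0 \<le> v * 2 ^ N * s * (2 powr \<gamma>) ^ i" for i using v s by simp
      show "(\<lambda>i. v * 2 ^ N * s * (2 powr \<gamma>) ^ i) sums (v * 2 ^ N * s * (1 / (1 - 2 powr \<gamma>)))"
        using q by (intro sums_mult geometric_sums) simp
    qed
    finally show ?thesis by (simp add: K_def mult_ac)
  qed
  have "(\<integral>\<^sup>+y. ennreal (norm (x - y) powr (\<gamma> - real N)) * indicator {y. norm (x - y) powr \<gamma> < s} y \<partial>lborel) \<le> ennreal (K * s)"
    if "s \<ge> 0" for x :: "real^'n" and s
  proof (cases "s = 0")
    case True
    then have "{y. norm (x - y) powr \<gamma> < s} = {}" by (auto simp: not_less)
    then show ?thesis by simp
  qed (use main that in simp)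
  with K show ?thesis unfolding N_def by blast
qed

text \<open>The exceptional set \<open>Z\<close> is allowed because the pointwise estimate will be
  known for \<open>u\<close> only outside a null set. The factor \<open>4\<close> is
  \<open>2\<close> for the two points, either of which may carry the large value of
  \<open>g\<close>, times \<open>2\<close> from the threshold \<open>s\<close>.\<close>

lemma weak_seminorm_bound:
  fixes \<gamma> :: real
  assumes \<gamma>: "\<gamma> < 0"
  shows "\<exists>K>0. \<forall>(u :: real^'n::finite \<Rightarrow> real) g C Z. g \<in> borel_measurable borel \<longrightarrow> (\<forall>x. g x \<ge> 0) \<longrightarrow> C > 0 \<longrightarrow>
    Z \<in> null_sets lborel \<longrightarrow>
    (\<forall>x y. x \<notin> Z \<longrightarrow> y \<notin> Z \<longrightarrow> \<bar>u x - u y\<bar> \<le> C * norm (x - y) * (g x + g y)) \<longrightarrow>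
    weak_seminorm \<gamma> u \<le> ennreal (K * C) * (\<integral>\<^sup>+x. ennreal (g x) \<partial>lborel)"
proof -
  obtain K where K: "K > 0" and ker: "\<forall>(x::real^'n) s. s \<ge> 0 \<longrightarrow>
    (\<integral>\<^sup>+y. ennreal (norm (x - y) powr (\<gamma> - real CARD('n))) * indicator {y. norm (x - y) powr \<gamma> < s} y \<partial>lborel) \<le> ennreal (K * s)"
    using singular_kernel_integral[OF \<gamma>, where 'n = 'n] by blast
  show ?thesis
  proof (intro exI[of _ "4 * K"] conjI allI impI)
    fix u g :: "real^'n \<Rightarrow> real" and C Z
    assume g[measurable]: "g \<in> borel_measurable borel" and g0: "\<forall>x. g x \<ge> 0" and C: "C > 0"
      and Z: "Z \<in> null_sets lborel"
      and haj: "\<forall>x y. x \<notin> Z \<longrightarrow> y \<notin> Z \<longrightarrow> \<bar>u x - u y\<bar> \<le> C * norm (x - y) * (g x + g y)"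
    have Zb[measurable]: "Z \<in> sets borel" using Z by (auto simp: null_sets_def)
    define k where "k = (\<lambda>p :: (real^'n) \<times> (real^'n). ennreal (norm (fst p - snd p) powr (\<gamma> - real CARD('n))))"
    have km[measurable]: "k \<in> borel_measurable (borel \<Otimes>\<^sub>M borel)" unfolding k_def by measurable
    show "weak_seminorm \<gamma> u \<le> ennreal (4 * K * C) * (\<integral>\<^sup>+x. ennreal (g x) \<partial>lborel)"
      unfolding weak_seminorm_def
    proof (rule SUP_least)
      fix l :: real assume "l \<in> {0<..}"
      then have l: "l > 0" by simp
      \<comment> \<open>Chosen so that \<open>C * (g x + g y) / l\<close> is the mean of
        \<open>s x\<close> and \<open>s y\<close>: whatever lies below a mean lies below one of the
        two numbers.\<close>
      define s where "s x = 2 * C * g x / l" for x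
      have s: "s x \<ge> 0" for x using C g0 l by (simp add: s_def)
      have sm[measurable]: "s \<in> borel_measurable borel" unfolding s_def[abs_def] by measurable
      define H1 where "H1 = (\<lambda>p. k p * indicator {p. norm (fst p - snd p) powr \<gamma> < s (fst p)} p)"
      define H2 where "H2 = (\<lambda>p. k p * indicator {p. norm (fst p - snd p) powr \<gamma> < s (snd p)} p)"
      have Hm[measurable]: "H1 \<in> borel_measurable (borel \<Otimes>\<^sub>M borel)" "H2 \<in> borel_measurable (borel \<Otimes>\<^sub>M borel)"
        unfolding H1_def H2_def by measurable
      have Hm'[measurable]: "H1 \<in> borel_measurable (lborel \<Otimes>\<^sub>M lborel)" "H2 \<in> borel_measurable (lborel \<Otimes>\<^sub>M lborel)"
        using Hm by (simp_all cong: measurable_cong_sets)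
      have AEp: "AE p in (lborel \<Otimes>\<^sub>M lborel :: ((real^'n) \<times> (real^'n)) measure). fst p \<notin> Z \<and> snd p \<notin> Z"
      proof (rule lborel_pair.AE_pair_measure)
        show "{p \<in> space (lborel \<Otimes>\<^sub>M lborel). fst p \<notin> Z \<and> snd p \<notin> Z} \<in> sets (lborel \<Otimes>\<^sub>M lborel)" by measurable
        show "AE x in lborel. AE y in lborel. fst (x, y) \<notin> Z \<and> snd (x, y) \<notin> Z"
          using AE_not_in[OF Z] by (auto elim!: eventually_mono)
      qed
      then have AEp: "AE p in lebesgue. fst p \<notin> Z \<and> snd p \<notin> Z"
        unfolding lborel_prod by (rule AE_completion)
      have pt: "k (x, y) * indicator (E_set l \<gamma> u) (x, y) \<le> H1 (x, y) + H2 (x, y)" if xy: "x \<notin> Z" "y \<notin> Z" for x y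
      proof (cases "(x, y) \<in> E_set l \<gamma> u")
        case True
        then have z: "norm (x - y) > 0" and E: "\<bar>u x - u y\<bar> / norm (x - y) powr (1 + \<gamma>) > l"
          by (auto simp: E_set_def)
        have "l * norm (x - y) powr (1 + \<gamma>) < \<bar>u x - u y\<bar>" using E z by (simp add: less_divide_eq)
        also have "\<dots> \<le> C * norm (x - y) * (g x + g y)" using haj xy by blast
        finally have "norm (x - y) * (l * norm (x - y) powr \<gamma>) < norm (x - y) * (C * (g x + g y))"
          using z by (simp add: powr_add mult_ac)
        then have "l * norm (x - y) powr \<gamma> < C * (g x + g y)" using z by (simp add: mult_less_cancel_left)
        then have "norm (x - y) powr \<gamma> < C * (g x + g y) / l" using l by (simp add: less_divide_eq mult.commute)
        moreover have "C * (g x + g y) / l = (s x + s y) / 2" using l by (simp add: s_def field_simps)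
        moreover have "a < p \<or> a < q" if "a < b" "b = (p + q) / 2" for a b p q :: real using that by auto
        ultimately have "norm (x - y) powr \<gamma> < s x \<or> norm (x - y) powr \<gamma> < s y" by blast
        then show ?thesis by (auto simp: H1_def H2_def indicator_def)
      qed simp
      \<comment> \<open>Only monotonicity of the integral is used for
        \<open>E_set l \<gamma> u\<close> itself; measurability enters with the Borel majorants
        \<open>H1\<close> and \<open>H2\<close>.\<close>
      have "nu \<gamma> (E_set l \<gamma> u) = (\<integral>\<^sup>+p. k p * indicator (E_set l \<gamma> u) p \<partial>lebesgue)"
        by (simp add: nu_def k_def)
      also have "\<dots> \<le> (\<integral>\<^sup>+p. H1 p + H2 p \<partial>lebesgue)"
      proof (rule nn_integral_mono_AE)
        show "AE p in lebesgue. k p * indicator (E_set l \<gamma> u) p \<le> H1 p + H2 p"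
          using AEp
        proof eventually_elim
          case (elim p)
          then show ?case using pt[of "fst p" "snd p"] by simp
        qed
      qed
      also have "\<dots> = (\<integral>\<^sup>+p. H1 p + H2 p \<partial>(lborel \<Otimes>\<^sub>M lborel))"
        by (simp add: nn_integral_completion lborel_prod)
      also have "\<dots> = (\<integral>\<^sup>+p. H1 p \<partial>(lborel \<Otimes>\<^sub>M lborel)) + (\<integral>\<^sup>+p. H2 p \<partial>(lborel \<Otimes>\<^sub>M lborel))"
        by (rule nn_integral_add) measurable
      also have "(\<integral>\<^sup>+p. H1 p \<partial>(lborel \<Otimes>\<^sub>M lborel)) = (\<integral>\<^sup>+x. \<integral>\<^sup>+y. H1 (x, y) \<partial>lborel \<partial>lborel)"
        by (rule lborel.nn_integral_fst[symmetric]) measurable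
      also have "(\<integral>\<^sup>+p. H2 p \<partial>(lborel \<Otimes>\<^sub>M lborel)) = (\<integral>\<^sup>+y. \<integral>\<^sup>+x. H2 (x, y) \<partial>lborel \<partial>lborel)"
        by (rule lborel_pair.nn_integral_snd[symmetric]) measurable
      also have "(\<integral>\<^sup>+x. \<integral>\<^sup>+y. H1 (x, y) \<partial>lborel \<partial>lborel) \<le> (\<integral>\<^sup>+x. ennreal (K * s x) \<partial>lborel)"
      proof (rule nn_integral_mono)
        fix x
        have "(\<integral>\<^sup>+y. H1 (x, y) \<partial>lborel) =
          (\<integral>\<^sup>+y. ennreal (norm (x - y) powr (\<gamma> - real CARD('n))) * indicator {y. norm (x - y) powr \<gamma> < s x} y \<partial>lborel)"
          by (intro nn_integral_cong) (simp add: H1_def k_def indicator_def)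
        then show "(\<integral>\<^sup>+y. H1 (x, y) \<partial>lborel) \<le> ennreal (K * s x)" using ker s by simp
      qed
      also have "(\<integral>\<^sup>+y. \<integral>\<^sup>+x. H2 (x, y) \<partial>lborel \<partial>lborel) \<le> (\<integral>\<^sup>+x. ennreal (K * s x) \<partial>lborel)"
      proof (rule nn_integral_mono)
        fix y
        have "(\<integral>\<^sup>+x. H2 (x, y) \<partial>lborel) =
          (\<integral>\<^sup>+x. ennreal (norm (y - x) powr (\<gamma> - real CARD('n))) * indicator {x. norm (y - x) powr \<gamma> < s y} x \<partial>lborel)"
          by (intro nn_integral_cong) (simp add: H2_def k_def indicator_def norm_minus_commute)
        then show "(\<integral>\<^sup>+x. H2 (x, y) \<partial>lborel) \<le> ennreal (K * s y)" using ker s by simp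
      qed
      finally have "nu \<gamma> (E_set l \<gamma> u) \<le> (\<integral>\<^sup>+x. ennreal (K * s x) \<partial>lborel) + (\<integral>\<^sup>+x. ennreal (K * s x) \<partial>lborel)"
        by (simp add: add_left_mono add_right_mono)
      also have "(\<integral>\<^sup>+x. ennreal (K * s x) \<partial>lborel) = ennreal (2 * K * C / l) * (\<integral>\<^sup>+x. ennreal (g x) \<partial>lborel)"
      proof -
        have "ennreal (K * s x) = ennreal (2 * K * C / l) * ennreal (g x)" for x
          using K C l g0 by (simp add: s_def mult_ac flip: ennreal_mult)
        then show ?thesis by (simp add: nn_integral_cmult)
      qed
      also have "ennreal (2 * K * C / l) * (\<integral>\<^sup>+x. ennreal (g x) \<partial>lborel) + ennreal (2 * K * C / l) * (\<integral>\<^sup>+x. ennreal (g x) \<partial>lborel)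
         = ennreal (4 * K * C / l) * (\<integral>\<^sup>+x. ennreal (g x) \<partial>lborel)"
      proof -
        have "ennreal (2 * K * C / l) + ennreal (2 * K * C / l) = ennreal (4 * K * C / l)"
          using K C l by (subst ennreal_plus[symmetric]) auto
        then show ?thesis by (simp only: distrib_right[symmetric])
      qed
      finally have "ennreal l * nu \<gamma> (E_set l \<gamma> u) \<le> ennreal l * (ennreal (4 * K * C / l) * (\<integral>\<^sup>+x. ennreal (g x) \<partial>lborel))"
        by (rule mult_left_mono) simp
      also have "\<dots> = ennreal (4 * K * C) * (\<integral>\<^sup>+x. ennreal (g x) \<partial>lborel)"
        unfolding mult.assoc[symmetric] using K C l by (simp flip: ennreal_mult)
      finally show "ennreal l * nu \<gamma> (E_set l \<gamma> u) \<le> ennreal (4 * K * C) * (\<integral>\<^sup>+x. ennreal (g x) \<partial>lborel)" .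
    qed
  qed (use K in simp)
qed

section \<open>Signed and vector-valued Borel measures\<close>

text \<open>\<open>ennreal\<close> sends negative numbers to zero, so for arbitrary signs additivity
  survives as an inequality.\<close>

lemma ennreal_add_le: "ennreal (a + b) \<le> ennreal a + ennreal b"
proof -
  have "ennreal (a + b) \<le> ennreal (max 0 a + max 0 b)" by (intro ennreal_leI) auto
  also have "\<dots> = ennreal (max 0 a) + ennreal (max 0 b)" by (rule ennreal_plus) auto
  also have "\<dots> = ennreal a + ennreal b" by (simp add: max_def ennreal_neg)
  finally show ?thesis .
qed

lemma ennreal_sum_le: "ennreal (\<Sum>i<n. f i) \<le> (\<Sum>i<n::nat. ennreal (f i))"
proof (induction n)
  case (Suc n)
  show ?case using order_trans[OF ennreal_add_le add_right_mono[OF Suc]] by simp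
qed simp

text \<open>The set function behind \<open>pos_part_measure\<close>. That \<open>measure_of\<close>
  really assigns these values has to be proved, since it yields the zero measure for a set function
  that is not countably additive.\<close>

definition pos_variation :: "((real^'n::finite) set \<Rightarrow> real) \<Rightarrow> (real^'n) set \<Rightarrow> ennreal" where
  "pos_variation \<nu> S = (SUP B\<in>{B \<in> sets borel. B \<subseteq> S}. ennreal (\<nu> B))"

lemma pos_variation_upper: "B \<in> sets borel \<Longrightarrow> B \<subseteq> S \<Longrightarrow> ennreal (\<nu> B) \<le> pos_variation \<nu> S"
  unfolding pos_variation_def by (rule SUP_upper) simp

lemma pos_variation_mono: "S \<subseteq> T \<Longrightarrow> pos_variation \<nu> S \<le> pos_variation \<nu> T"
  unfolding pos_variation_def by (rule SUP_subset_mono) auto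

context
  fixes \<nu> :: "(real^'n::finite) set \<Rightarrow> real" and M :: real
  assumes ca: "\<And>A. range A \<subseteq> sets borel \<Longrightarrow> disjoint_family A \<Longrightarrow> (\<lambda>i::nat. \<nu> (A i)) sums \<nu> (\<Union>i. A i)"
    and bd: "\<And>B. B \<in> sets borel \<Longrightarrow> \<bar>\<nu> B\<bar> \<le> M"
begin

lemma signed_empty: "\<nu> {} = 0"
proof -
  have "(\<lambda>i::nat. \<nu> {}) sums \<nu> (\<Union>i::nat. {})" by (rule ca) (auto simp: disjoint_family_on_def)
  then have "summable (\<lambda>i::nat. \<nu> {})" by (rule sums_summable)
  then show ?thesis by (simp add: summable_const_iff)
qed

lemma signed_Un:
  assumes "A \<in> sets borel" "B \<in> sets borel" "A \<inter> B = {}"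
  shows "\<nu> (A \<union> B) = \<nu> A + \<nu> B"
proof -
  define S where "S i = (if i = 0 then A else if i = 1 then B else {})" for i :: nat
  have "(\<lambda>i. \<nu> (S i)) sums \<nu> (\<Union>i. S i)"
    using assms by (intro ca) (auto simp: S_def disjoint_family_on_def)
  moreover have "(\<Union>i. S i) = A \<union> B"
  proof
    show "A \<union> B \<subseteq> (\<Union>i. S i)"
      using UN_upper[of 0 UNIV S] UN_upper[of 1 UNIV S] by (auto simp: S_def)
  qed (auto simp: S_def split: if_splits)
  moreover have "(\<lambda>i. \<nu> (S i)) sums (\<Sum>i\<in>{0,1}. \<nu> (S i))"
    by (rule sums_finite) (auto simp: S_def signed_empty)
  ultimately have "\<nu> (A \<union> B) = (\<Sum>i\<in>{0,1}. \<nu> (S i))" using sums_unique2 by metis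
  then show ?thesis by (simp add: S_def)
qed

lemma signed_Diff:
  assumes "A \<in> sets borel" "B \<in> sets borel" "A \<subseteq> B"
  shows "\<nu> (B - A) = \<nu> B - \<nu> A"
  using signed_Un[of A "B - A"] assms by (simp add: Un_absorb1)

lemma pos_variation_finite: "pos_variation \<nu> S \<le> ennreal M"
  unfolding pos_variation_def
  by (rule SUP_least) (auto intro!: ennreal_leI order_trans[OF abs_ge_self] bd)

text \<open>Competitors for \<open>S\<close> and for \<open>T\<close> may be united. A set of
  negative value is first replaced by the empty set, so that \<open>ennreal\<close> is additive on
  the two values.\<close>

lemma pos_variation_superadditive:
  assumes "S \<inter> T = {}"
  shows "pos_variation \<nu> S + pos_variation \<nu> T \<le> pos_variation \<nu> (S \<union> T)"
proof -
  have ne: "{B \<in> sets borel. B \<subseteq> S} \<noteq> {}" for S :: "(real^'n) set" by auto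
  have nonneg: "\<exists>B'\<in>sets borel. B' \<subseteq> S \<and> \<nu> B' \<ge> 0 \<and> ennreal (\<nu> B) = ennreal (\<nu> B')" if "B \<in> sets borel" "B \<subseteq> S" for B S
  proof (cases "\<nu> B \<ge> 0")
    case False
    then show ?thesis by (intro bexI[of _ "{}"]) (auto simp: signed_empty ennreal_neg)
  qed (use that in blast)
  have "ennreal (\<nu> B) + ennreal (\<nu> C) \<le> pos_variation \<nu> (S \<union> T)"
    if B: "B \<in> sets borel" "B \<subseteq> S" and C: "C \<in> sets borel" "C \<subseteq> T" for B C
  proof -
    obtain B' where B': "B' \<in> sets borel" "B' \<subseteq> S" "\<nu> B' \<ge> 0" "ennreal (\<nu> B) = ennreal (\<nu> B')"
      using nonneg[OF B] by blast
    obtain C' where C': "C' \<in> sets borel" "C' \<subseteq> T" "\<nu> C' \<ge> 0" "ennreal (\<nu> C) = ennreal (\<nu> C')"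
      using nonneg[OF C] by blast
    have "ennreal (\<nu> B) + ennreal (\<nu> C) = ennreal (\<nu> (B' \<union> C'))"
      using B' C' assms signed_Un[of B' C'] by (subst signed_Un) auto
    also have "\<dots> \<le> pos_variation \<nu> (S \<union> T)" using B' C' by (intro pos_variation_upper) auto
    finally show ?thesis .
  qed
  then show ?thesis
    unfolding pos_variation_def[of _ S] pos_variation_def[of _ T]
    unfolding ennreal_SUP_add_left[OF ne, symmetric] ennreal_SUP_add_right[OF ne]
    by (intro SUP_least) auto
qed

text \<open>Superadditivity over finite unions gives one inequality of countable additivity. For the
  other, a competitor \<open>B\<close> for the union is cut into the pieces
  \<open>B \<inter> A i\<close>, and its value is a limit of partial sums.\<close>

lemma pos_part_emeasure:
  shows "sets (pos_part_measure \<nu>) = sets borel" "space (pos_part_measure \<nu>) = UNIV"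
    and "S \<in> sets borel \<Longrightarrow> emeasure (pos_part_measure \<nu>) S = pos_variation \<nu> S"
proof -
  have def: "pos_part_measure \<nu> = measure_of UNIV (sets borel) (pos_variation \<nu>)"
    by (simp add: pos_part_measure_def pos_variation_def[abs_def])
  show s: "sets (pos_part_measure \<nu>) = sets borel"
    unfolding def using sets.sigma_sets_eq[of borel] by (simp add: sets_measure_of)
  show "space (pos_part_measure \<nu>) = UNIV" unfolding def by (simp add: space_measure_of_conv)
  assume S: "S \<in> sets borel"
  show "emeasure (pos_part_measure \<nu>) S = pos_variation \<nu> S"
  proof (rule emeasure_measure_of[OF def])
    have "pos_variation \<nu> {} \<le> 0" unfolding pos_variation_def by (rule SUP_least) (auto simp: signed_empty)
    then show "positive (sets (pos_part_measure \<nu>)) (pos_variation \<nu>)" by (simp add: positive_def)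
    show "countably_additive (sets (pos_part_measure \<nu>)) (pos_variation \<nu>)"
    proof (rule countably_additiveI)
      fix A :: "nat \<Rightarrow> (real^'n) set" assume A: "range A \<subseteq> sets (pos_part_measure \<nu>)" "disjoint_family A"
      have Ab: "A i \<in> sets borel" for i using A s by auto
      have fin: "(\<Sum>i<n. pos_variation \<nu> (A i)) \<le> pos_variation \<nu> (\<Union>i<n. A i)" for n
      proof (induction n)
        case (Suc n)
        have "A i \<inter> A n = {}" if "i < n" for i
          using A(2) that unfolding disjoint_family_on_def by (metis UNIV_I less_irrefl)
        then have "(\<Union>i<n. A i) \<inter> A n = {}" by blast
        from pos_variation_superadditive[OF this] Suc
        have "(\<Sum>i<n. pos_variation \<nu> (A i)) + pos_variation \<nu> (A n) \<le> pos_variation \<nu> ((\<Union>i<n. A i) \<union> A n)"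
          by (meson add_right_mono order_trans)
        then show ?case by (simp add: lessThan_Suc Un_commute add.commute)
      qed simp
      have "(\<Sum>i. pos_variation \<nu> (A i)) \<le> pos_variation \<nu> (\<Union>i. A i)"
      proof (rule suminf_le_const)
        show "(\<Sum>i<n. pos_variation \<nu> (A i)) \<le> pos_variation \<nu> (\<Union>i. A i)" for n
          by (rule order_trans[OF fin pos_variation_mono]) blast
      qed (rule summableI)
      moreover have "pos_variation \<nu> (\<Union>i. A i) \<le> (\<Sum>i. pos_variation \<nu> (A i))"
        unfolding pos_variation_def[of _ "\<Union>i. A i"]
      proof (rule SUP_least)
        fix B assume "B \<in> {B \<in> sets borel. B \<subseteq> (\<Union>i. A i)}"
        then have B: "B \<in> sets borel" "B \<subseteq> (\<Union>i. A i)" by auto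
        have "(\<lambda>i. \<nu> (B \<inter> A i)) sums \<nu> (\<Union>i. B \<inter> A i)"
          using B Ab A(2) by (intro ca) (auto simp: disjoint_family_on_def disjoint_iff)
        moreover have "(\<Union>i. B \<inter> A i) = B" using B by blast
        ultimately have "(\<lambda>n. \<Sum>i<n. \<nu> (B \<inter> A i)) \<longlonglongrightarrow> \<nu> B" by (simp add: sums_def)
        then have "(\<lambda>n. ennreal (\<Sum>i<n. \<nu> (B \<inter> A i))) \<longlonglongrightarrow> ennreal (\<nu> B)" by (rule tendsto_ennrealI)
        moreover have "ennreal (\<Sum>i<n. \<nu> (B \<inter> A i)) \<le> (\<Sum>i. pos_variation \<nu> (A i))" for n
        proof -
          have "ennreal (\<Sum>i<n. \<nu> (B \<inter> A i)) \<le> (\<Sum>i<n. ennreal (\<nu> (B \<inter> A i)))" by (rule ennreal_sum_le)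
          also have "\<dots> \<le> (\<Sum>i<n. pos_variation \<nu> (A i))"
            using B Ab by (intro sum_mono pos_variation_upper) auto
          also have "\<dots> \<le> (\<Sum>i. pos_variation \<nu> (A i))" by (rule sum_le_suminf) (auto intro: summableI)
          finally show ?thesis .
        qed
        ultimately show "ennreal (\<nu> B) \<le> (\<Sum>i. pos_variation \<nu> (A i))"
          using LIMSEQ_le_const2 by blast
      qed
      ultimately show "(\<Sum>i. pos_variation \<nu> (A i)) = pos_variation \<nu> (\<Union>i. A i)" by (rule antisym)
    qed
  qed (use S s in auto)
qed

end

section \<open>The Jordan decomposition and uniqueness of signed measures\<close>

text \<open>Passing from \<open>B\<close> to \<open>S - B\<close> exchanges competitors for the
  positive and the negative part and shifts their values by \<open>\<nu> S\<close>; comparing the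
  suprema in both directions gives the decomposition without a Hahn set.\<close>

lemma jordan_decomposition:
  fixes \<nu> :: "(real^'n::finite) set \<Rightarrow> real"
  assumes ca: "\<And>A. range A \<subseteq> sets borel \<Longrightarrow> disjoint_family A \<Longrightarrow> (\<lambda>i::nat. \<nu> (A i)) sums \<nu> (\<Union>i. A i)"
    and bd: "\<And>B. B \<in> sets borel \<Longrightarrow> \<bar>\<nu> B\<bar> \<le> M"
    and S: "S \<in> sets borel"
  shows "emeasure (pos_part_measure \<nu>) S < \<infinity>" "emeasure (pos_part_measure (\<lambda>S. - \<nu> S)) S < \<infinity>"
    and "\<nu> S = measure (pos_part_measure \<nu>) S - measure (pos_part_measure (\<lambda>S. - \<nu> S)) S"
proof -
  let ?n = "\<lambda>S. - \<nu> S"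
  have can: "(\<lambda>i::nat. ?n (A i)) sums ?n (\<Union>i. A i)" if "range A \<subseteq> sets borel" "disjoint_family A" for A
    using sums_minus[OF ca[OF that]] .
  have bdn: "\<bar>?n B\<bar> \<le> M" if "B \<in> sets borel" for B using bd[OF that] by simp
  have P: "emeasure (pos_part_measure \<nu>) S = pos_variation \<nu> S"
    using ca bd S by (rule pos_part_emeasure(3))
  have Q: "emeasure (pos_part_measure ?n) S = pos_variation ?n S"
    using can bdn S by (rule pos_part_emeasure(3))
  show fP: "emeasure (pos_part_measure \<nu>) S < \<infinity>"
    by (rule le_less_trans[OF ord_eq_le_trans[OF P pos_variation_finite[OF ca bd, of S]]]) simp_all
  show fQ: "emeasure (pos_part_measure ?n) S < \<infinity>"
    by (rule le_less_trans[OF ord_eq_le_trans[OF Q pos_variation_finite[OF can bdn, of S]]]) simp_all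
  define p where "p = measure (pos_part_measure \<nu>) S"
  define q where "q = measure (pos_part_measure ?n) S"
  have pe: "pos_variation \<nu> S = ennreal p" "p \<ge> 0"
    unfolding P[symmetric] p_def using fP by (simp_all add: emeasure_eq_ennreal_measure less_top)
  have qe: "pos_variation ?n S = ennreal q" "q \<ge> 0"
    unfolding Q[symmetric] q_def using fQ by (simp_all add: emeasure_eq_ennreal_measure less_top)
  have pu: "\<nu> B \<le> p" if "B \<in> sets borel" "B \<subseteq> S" for B
    using pos_variation_upper[OF that, of \<nu>] pe by simp
  have qu: "- \<nu> B \<le> q" if "B \<in> sets borel" "B \<subseteq> S" for B
    using pos_variation_upper[OF that, of ?n] qe by simp
  have "ennreal q \<le> ennreal (p - \<nu> S)"
    unfolding qe(1)[symmetric] pos_variation_def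
  proof (rule SUP_least, rule ennreal_leI)
    fix B assume "B \<in> {B \<in> sets borel. B \<subseteq> S}"
    then show "- \<nu> B \<le> p - \<nu> S" using pu[of "S - B"] signed_Diff[OF ca bd, of B S] S by auto
  qed
  moreover have "ennreal p \<le> ennreal (q + \<nu> S)"
    unfolding pe(1)[symmetric] pos_variation_def
  proof (rule SUP_least, rule ennreal_leI)
    fix B assume "B \<in> {B \<in> sets borel. B \<subseteq> S}"
    then show "\<nu> B \<le> q + \<nu> S" using qu[of "S - B"] signed_Diff[OF ca bd, of B S] S by auto
  qed
  moreover have "p - \<nu> S \<ge> 0" using pu[OF S] by simp
  moreover have "q + \<nu> S \<ge> 0" using qu[OF S] by simp
  ultimately show "\<nu> S = measure (pos_part_measure \<nu>) S - measure (pos_part_measure ?n) S"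
    using pe(2) qe(2) unfolding p_def[symmetric] q_def[symmetric] by simp
qed

text \<open>The difference \<open>d\<close> of the two signed measures vanishes on boxes, whose
  indicators are limits of test functions, and then on all Borel sets by an induction over Dynkin
  systems.\<close>

lemma signed_eq_density_if_test_functions:
  fixes \<nu> :: "(real^'n::finite) set \<Rightarrow> real" and \<phi> q :: "real^'n \<Rightarrow> real"
  assumes \<phi>: "\<phi> \<in> test_functions" "(\<integral>x. \<phi> x \<partial>lborel) = 1"
    and ca: "\<And>A. range A \<subseteq> sets borel \<Longrightarrow> disjoint_family A \<Longrightarrow> (\<lambda>i::nat. \<nu> (A i)) sums \<nu> (\<Union>i. A i)"
    and bd: "\<And>B. B \<in> sets borel \<Longrightarrow> \<bar>\<nu> B\<bar> \<le> M"
    and q: "integrable lborel q"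
    and caq: "\<And>A. range A \<subseteq> sets borel \<Longrightarrow> disjoint_family A \<Longrightarrow>
      (\<lambda>i::nat. \<integral>x. indicator (A i) x * q x \<partial>lborel) sums (\<integral>x. indicator (\<Union>i. A i) x * q x \<partial>lborel)"
    and eq: "\<And>\<psi>. \<psi> \<in> test_functions \<Longrightarrow> signed_integral \<nu> \<psi> = (\<integral>x. \<psi> x * q x \<partial>lborel)"
    and S: "S \<in> sets borel"
  shows "\<nu> S = (\<integral>x. indicator S x * q x \<partial>lborel)"
proof -
  define d where "d A = \<nu> A - (\<integral>x. indicator A x * q x \<partial>lborel)" for A
  have cad: "(\<lambda>i::nat. d (A i)) sums d (\<Union>i. A i)" if "range A \<subseteq> sets borel" "disjoint_family A" for A
    unfolding d_def by (intro sums_diff ca caq that)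
  have bdd: "\<bar>d B\<bar> \<le> M + (\<integral>x. \<bar>q x\<bar> \<partial>lborel)" if B: "B \<in> sets borel" for B
  proof -
    have "\<bar>\<integral>x. q x * indicator B x \<partial>lborel\<bar> \<le> 1 * (\<integral>x. \<bar>q x\<bar> \<partial>lborel)"
      by (rule integral_mult_bounded(2)[OF q]) (use B in \<open>auto simp: indicator_def\<close>)
    then show ?thesis using bd[OF B] unfolding d_def by (simp add: mult.commute)
  qed
  note dfacts = signed_empty[OF cad bdd] signed_Un[OF cad bdd] signed_Diff[OF cad bdd]
  let ?n = "\<lambda>S. - \<nu> S"
  have can: "(\<lambda>i::nat. ?n (A i)) sums ?n (\<Union>i. A i)" if "range A \<subseteq> sets borel" "disjoint_family A" for A
    using sums_minus[OF ca[OF that]] .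
  have bdn: "\<bar>?n B\<bar> \<le> M" if "B \<in> sets borel" for B using bd[OF that] by simp
  have box: "d (box a b) = 0" for a b
  proof -
    have bb: "box a b \<in> sets borel" by simp
    obtain \<psi> :: "nat \<Rightarrow> real^'n \<Rightarrow> real" where \<psi>: "\<forall>m. \<psi> m \<in> test_functions"
      and lim: "\<forall>L. sets L = sets borel \<longrightarrow> emeasure L (box a b) < \<infinity> \<longrightarrow> (\<lambda>m. integral\<^sup>L L (\<psi> m)) \<longlonglongrightarrow> measure L (box a b)"
      and limq: "\<forall>q. integrable lborel q \<longrightarrow> (\<lambda>m. \<integral>x. \<psi> m x * q x \<partial>lborel) \<longlonglongrightarrow> (\<integral>x. indicator (box a b) x * q x \<partial>lborel)"
      using box_approximation_integral[OF \<phi>, of a b] by blast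
    have "(\<lambda>m. signed_integral \<nu> (\<psi> m)) \<longlonglongrightarrow> measure (pos_part_measure \<nu>) (box a b) - measure (pos_part_measure ?n) (box a b)"
      unfolding signed_integral_def
      by (intro tendsto_diff lim[rule_format] pos_part_emeasure(1)[OF ca bd] pos_part_emeasure(1)[OF can bdn]
          jordan_decomposition(1,2)[OF ca bd bb])
    also have "measure (pos_part_measure \<nu>) (box a b) - measure (pos_part_measure ?n) (box a b) = \<nu> (box a b)"
      by (rule jordan_decomposition(3)[OF ca bd bb, symmetric])
    finally have "(\<lambda>m. \<integral>x. \<psi> m x * q x \<partial>lborel) \<longlonglongrightarrow> \<nu> (box a b)"
      using eq \<psi> by simp
    moreover have "(\<lambda>m. \<integral>x. \<psi> m x * q x \<partial>lborel) \<longlonglongrightarrow> (\<integral>x. indicator (box a b) x * q x \<partial>lborel)"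
      using limq q by blast
    ultimately show ?thesis unfolding d_def using LIMSEQ_unique by fastforce
  qed
  \<comment> \<open>Complements need this case. The space is no box and additivity is available for
    disjoint families, so the growing boxes are replaced by their successive differences.\<close>
  have univ: "d UNIV = 0"
  proof -
    define B :: "nat \<Rightarrow> (real^'n) set" where "B n = box (- (real n *\<^sub>R One)) (real n *\<^sub>R One)" for n
    have Bb: "B n \<in> sets borel" for n by (simp add: B_def)
    have "B n \<subseteq> B m" if "n \<le> m" for n m
      using that unfolding B_def by (intro subset_box_imp) (auto simp: inner_sum_left_Basis)
    then have mono: "incseq B" by (simp add: incseq_def)
    have UB: "(\<Union>i<n. B i) = (if n = 0 then {} else B (n - 1))" for n
    proof (cases n)
      case (Suc k)
      have "B i \<subseteq> B k" if "i < Suc k" for i using mono that by (simp add: incseq_def)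
      then have "(\<Union>i<Suc k. B i) \<subseteq> B k" by (intro UN_least) simp
      moreover have "B k \<subseteq> (\<Union>i<Suc k. B i)" by (rule UN_upper) simp
      ultimately show ?thesis using Suc by simp
    qed simp
    have dj: "d (disjointed B n) = 0" for n
    proof -
      have dis: "disjointed B n = B n - (\<Union>i<n. B i)" by (simp add: disjointed_def atLeast0LessThan)
      have "(\<Union>i<n. B i) \<subseteq> B n" using mono by (auto simp: incseq_def) (meson less_imp_le subsetD)
      then have "d (disjointed B n) = d (B n) - d (\<Union>i<n. B i)"
        unfolding dis by (intro dfacts(3)) (auto simp: Bb)
      moreover have "d (\<Union>i<n. B i) = 0" unfolding UB using dfacts(1) box by (simp add: B_def)
      moreover have "d (B n) = 0" unfolding B_def by (rule box)
      ultimately show ?thesis by simp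
    qed
    have "(\<lambda>n. d (disjointed B n)) sums d (\<Union>n. disjointed B n)"
    proof (rule cad)
      show "range (disjointed B) \<subseteq> sets borel"
        using sets.range_disjointed_sets[of B borel] Bb by auto
    qed (rule disjoint_family_disjointed)
    moreover have "(\<Union>n. disjointed B n) = UNIV"
      unfolding UN_disjointed_eq B_def by (rule UN_box_eq_UNIV)
    ultimately show ?thesis using dj by (simp add: sums_iff)
  qed
  have sub: "range (\<lambda>(a, b). box a b :: (real^'n) set) \<subseteq> Pow UNIV" by simp
  have "S \<in> sigma_sets UNIV (range (\<lambda>(a, b). box a b))" using S unfolding sets_borel_box .
  from Int_stable_box sub this have "d S = 0"
  proof (induction S rule: sigma_sets_induct_disjoint)
    case (compl A)
    have "A \<in> sets borel" using compl(1) unfolding sets_borel_box .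
    then show ?case using dfacts(3)[of A UNIV] compl univ by simp
  next
    case (union A)
    have "range A \<subseteq> sets borel" using union(2) unfolding sets_borel_box .
    from cad[OF this union(1)] union(3) show ?case by (simp add: sums_iff)
  qed (use box dfacts(1) in auto)
  then show ?thesis by (simp add: d_def)
qed

section \<open>Measures with an integrable density, and the gradient measure\<close>

text \<open>The supremum defining the positive part is attained at
  \<open>S \<inter> {x. 0 < q x}\<close>.\<close>

lemma pos_part_density:
  fixes q :: "real^'n::finite \<Rightarrow> real"
  assumes q: "integrable lborel q" and \<nu>: "\<And>S. S \<in> sets borel \<Longrightarrow> \<nu> S = (\<integral>x. indicator S x * q x \<partial>lborel)"
  shows "pos_part_measure \<nu> = density lborel (\<lambda>x. ennreal (q x))"
proof -
  have [measurable]: "q \<in> borel_measurable borel" using q by simp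
  let ?D = "density lborel (\<lambda>x. ennreal (q x))"
  have ind_int: "integrable lborel (\<lambda>x. indicator A x * r x)" if "A \<in> sets borel" "integrable lborel r" for A and r :: "real^'n \<Rightarrow> real"
    using integrable_mult_indicator[of A lborel r] that by simp
  have eq: "(SUP B\<in>{B \<in> sets borel. B \<subseteq> S}. ennreal (\<nu> B)) = emeasure ?D S" if S: "S \<in> sets borel" for S
  proof (rule antisym)
    have D: "emeasure ?D B = (\<integral>\<^sup>+x. ennreal (indicator B x * max 0 (q x)) \<partial>lborel)" if "B \<in> sets borel" for B
      using that by (subst emeasure_density)
        (auto intro!: nn_integral_cong split: split_indicator simp: max_def ennreal_neg)
    have D': "emeasure ?D B = ennreal (\<integral>x. indicator B x * max 0 (q x) \<partial>lborel)" if B: "B \<in> sets borel" for B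
    proof -
      have "integrable lborel (\<lambda>x. max 0 (q x))" using q by (intro integrable_max) auto
      then show ?thesis unfolding D[OF B] by (intro nn_integral_eq_integral ind_int B) auto
    qed
    show "(SUP B\<in>{B \<in> sets borel. B \<subseteq> S}. ennreal (\<nu> B)) \<le> emeasure ?D S"
    proof (rule SUP_least)
      fix B assume "B \<in> {B \<in> sets borel. B \<subseteq> S}"
      then have B: "B \<in> sets borel" "B \<subseteq> S" by auto
      have "integrable lborel (\<lambda>x. max 0 (q x))" using q by (intro integrable_max) auto
      then have "\<nu> B \<le> (\<integral>x. indicator B x * max 0 (q x) \<partial>lborel)"
        unfolding \<nu>[OF B(1)] using B q by (intro integral_mono ind_int) (auto split: split_indicator)
      then have "ennreal (\<nu> B) \<le> emeasure ?D B" unfolding D'[OF B(1)] by (rule ennreal_leI)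
      also have "\<dots> \<le> emeasure ?D S" using B S by (intro emeasure_mono) auto
      finally show "ennreal (\<nu> B) \<le> emeasure ?D S" .
    qed
    define B where "B = S \<inter> {x. 0 < q x}"
    have B: "B \<in> sets borel" unfolding B_def using S by measurable
    have "(\<lambda>x. indicator S x * max 0 (q x)) = (\<lambda>x. indicator B x * q x)"
      by (auto simp: B_def fun_eq_iff max_def split: split_indicator)
    then have "emeasure ?D S = ennreal (\<nu> B)" unfolding D'[OF S] \<nu>[OF B] by simp
    also have "\<dots> \<le> (SUP B\<in>{B \<in> sets borel. B \<subseteq> S}. ennreal (\<nu> B))"
      using B by (intro SUP_upper) (auto simp: B_def)
    finally show "emeasure ?D S \<le> (SUP B\<in>{B \<in> sets borel. B \<subseteq> S}. ennreal (\<nu> B))" .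
  qed
  have "pos_part_measure \<nu> = measure_of UNIV (sets borel) (emeasure ?D)"
    unfolding pos_part_measure_def
    by (rule measure_of_eq) (use eq sets.sigma_sets_eq[of borel] in auto)
  also have "\<dots> = ?D" using measure_of_of_measure[of ?D] by simp
  finally show ?thesis .
qed

lemma signed_integral_density:
  fixes q :: "real^'n::finite \<Rightarrow> real"
  assumes q: "integrable lborel q" and \<nu>: "\<And>S. S \<in> sets borel \<Longrightarrow> \<nu> S = (\<integral>x. indicator S x * q x \<partial>lborel)"
    and \<psi>: "\<psi> \<in> test_functions"
  shows "signed_integral \<nu> \<psi> = (\<integral>x. q x * \<psi> x \<partial>lborel)"
proof -
  have [measurable]: "q \<in> borel_measurable borel" using q by simp
  have [measurable]: "\<psi> \<in> borel_measurable borel" using \<psi> by auto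
  obtain B where B: "\<forall>x. \<bar>\<psi> x\<bar> \<le> B" using test_functions_bounded[OF \<psi>] by blast
  have "pos_part_measure \<nu> = density lborel (\<lambda>x. ennreal (q x))"
    by (rule pos_part_density[OF q]) (rule \<nu>)
  also have "\<dots> = density lborel (\<lambda>x. ennreal (max 0 (q x)))"
    by (intro density_cong) (auto simp: max_def ennreal_neg)
  finally have P: "pos_part_measure \<nu> = density lborel (\<lambda>x. ennreal (max 0 (q x)))" .
  have "pos_part_measure (\<lambda>S. - \<nu> S) = density lborel (\<lambda>x. ennreal (- q x))"
    by (rule pos_part_density) (use q \<nu> in auto)
  also have "\<dots> = density lborel (\<lambda>x. ennreal (max 0 (- q x)))"
    by (intro density_cong) (auto simp: max_def ennreal_neg)
  finally have N: "pos_part_measure (\<lambda>S. - \<nu> S) = density lborel (\<lambda>x. ennreal (max 0 (- q x)))" .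
  have i: "integrable lborel (\<lambda>x. max 0 (q x) * \<psi> x)" "integrable lborel (\<lambda>x. max 0 (- q x) * \<psi> x)"
    using B q by (auto intro!: integral_mult_bounded(1)[of lborel _ \<psi> B] integrable_max)
  have "signed_integral \<nu> \<psi> = (\<integral>x. max 0 (q x) * \<psi> x \<partial>lborel) - (\<integral>x. max 0 (- q x) * \<psi> x \<partial>lborel)"
    unfolding signed_integral_def P N by (simp add: integral_density)
  also have "\<dots> = (\<integral>x. max 0 (q x) * \<psi> x - max 0 (- q x) * \<psi> x \<partial>lborel)" using i by simp
  also have "(\<lambda>x. max 0 (q x) * \<psi> x - max 0 (- q x) * \<psi> x) = (\<lambda>x. q x * \<psi> x)"
    by (auto simp: fun_eq_iff max_def)
  finally show ?thesis .
qed

lemma integral_indicator_component: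
  fixes G :: "real^'n::finite \<Rightarrow> real^'n"
  assumes "integrable lborel G" "S \<in> sets borel"
  shows "(\<integral>x. indicator S x *\<^sub>R G x \<partial>lborel) $ j = (\<integral>x. indicator S x * G x $ j \<partial>lborel)"
proof -
  have "integrable lborel (\<lambda>x. indicator S x *\<^sub>R G x)"
    using integrable_mult_indicator[of S lborel G] assms by simp
  from integral_bounded_linear[OF bounded_linear_vec_nth this, of j] show ?thesis by simp
qed

text \<open>Finite additivity of the set integral combined with its continuity along increasing
  unions.\<close>

lemma vector_borel_measure_density:
  fixes G :: "real^'n::finite \<Rightarrow> real^'n"
  assumes G: "integrable lborel G"
  shows "vector_borel_measure (\<lambda>S. \<integral>x. indicator S x *\<^sub>R G x \<partial>lborel)"
  unfolding vector_borel_measure_def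
proof (intro allI impI)
  fix A :: "nat \<Rightarrow> (real^'n) set" assume A: "range A \<subseteq> sets borel" "disjoint_family A"
  have Ab: "A i \<in> sets borel" for i using A by auto
  have si: "set_integrable lborel S G" if "S \<in> sets borel" for S
    unfolding set_integrable_def using integrable_mult_indicator[of S lborel G] G that by simp
  have fin: "(LINT x:(\<Union>i<n. A i)|lborel. G x) = (\<Sum>i<n. LINT x:A i|lborel. G x)" for n
    using A(2) Ab by (intro set_integral_finite_Union si) (auto simp: disjoint_family_on_def)
  have "(\<lambda>n. LINT x:(\<Union>i<n. A i)|lborel. G x) \<longlonglongrightarrow> (LINT x:(\<Union>n. \<Union>i<n. A i)|lborel. G x)"
  proof (rule set_integral_cont_up)
    show "(\<Union>i<n. A i) \<in> sets lborel" for n using Ab by auto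
    show "incseq (\<lambda>n. \<Union>i<n. A i)" by (intro incseq_SucI UN_mono) auto
    show "set_integrable lborel (\<Union>n. \<Union>i<n. A i) G" using Ab by (intro si) auto
  qed
  moreover have "(\<Union>n. \<Union>i<n. A i) = (\<Union>i. A i)" by auto
  ultimately show "(\<lambda>i. \<integral>x. indicator (A i) x *\<^sub>R G x \<partial>lborel) sums (\<integral>x. indicator (\<Union>i. A i) x *\<^sub>R G x \<partial>lborel)"
    unfolding sums_def fin by (simp add: set_lebesgue_integral_def)
qed

lemma total_variation_density:
  fixes G :: "real^'n::finite \<Rightarrow> real^'n"
  assumes G: "integrable lborel G" and \<mu>: "\<And>S. S \<in> sets borel \<Longrightarrow> \<mu> S = (\<integral>x. indicator S x *\<^sub>R G x \<partial>lborel)"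
  shows "total_variation \<mu> UNIV \<le> (\<integral>\<^sup>+x. ennreal (norm (G x)) \<partial>lborel)"
  unfolding total_variation_def
proof (rule SUP_least)
  have [measurable]: "G \<in> borel_measurable borel" using G borel_measurable_integrable by auto
  fix A :: "nat \<Rightarrow> (real^'n) set"
  assume "A \<in> {A. range A \<subseteq> sets borel \<and> disjoint_family A \<and> (\<Union>i. A i) = UNIV}"
  then have A: "range A \<subseteq> sets borel" "disjoint_family A" "(\<Union>i. A i) = UNIV" by auto
  define D where "D = density lborel (\<lambda>x. ennreal (norm (G x)))"
  have "ennreal (norm (\<mu> (A i))) \<le> emeasure D (A i)" for i
  proof -
    have Ai: "A i \<in> sets borel" using A by auto
    have "ennreal (norm (\<mu> (A i))) \<le> (\<integral>\<^sup>+x. ennreal (norm (indicator (A i) x *\<^sub>R G x)) \<partial>lborel)"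
      unfolding \<mu>[OF Ai] using integrable_mult_indicator[of "A i" lborel G] G Ai by (intro integral_norm_bound_ennreal) simp
    also have "\<dots> = (\<integral>\<^sup>+x. ennreal (norm (G x)) * indicator (A i) x \<partial>lborel)"
      by (intro nn_integral_cong) (auto split: split_indicator)
    also have "\<dots> = emeasure D (A i)" unfolding D_def using Ai by (subst emeasure_density) auto
    finally show ?thesis .
  qed
  then have "(\<Sum>i. ennreal (norm (\<mu> (A i)))) \<le> (\<Sum>i. emeasure D (A i))"
    by (intro suminf_le) (auto intro: summableI)
  also have "\<dots> = emeasure D UNIV"
    using suminf_emeasure[of A D] A by (simp add: D_def)
  also have "\<dots> = (\<integral>\<^sup>+x. ennreal (norm (G x)) \<partial>lborel)"
    unfolding D_def by (subst emeasure_density) auto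
  finally show "(\<Sum>i. ennreal (norm (\<mu> (A i)))) \<le> (\<integral>\<^sup>+x. ennreal (norm (G x)) \<partial>lborel)" .
qed

text \<open>The partition into \<open>B\<close>, its complement and empty sets is one competitor.
  This turns finite total variation into the bound on the components that the Jordan decomposition
  asks for.\<close>

lemma norm_le_total_variation:
  assumes B: "B \<in> sets borel"
  shows "ennreal (norm (\<mu> B)) \<le> total_variation \<mu> UNIV"
proof -
  define S where "S i = (if i = 0 then B else if i = 1 then - B else {})" for i :: nat
  have U: "(\<Union>i. S i) = UNIV"
    using UN_upper[of 0 UNIV S] UN_upper[of 1 UNIV S] by (auto simp: S_def)
  have "ennreal (norm (\<mu> B)) = (\<Sum>i\<in>{0}. ennreal (norm (\<mu> (S i))))" by (simp add: S_def)
  also have "\<dots> \<le> (\<Sum>i. ennreal (norm (\<mu> (S i))))" by (rule sum_le_suminf) (auto intro: summableI)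
  also have "\<dots> \<le> total_variation \<mu> UNIV"
  proof -
    have "range S \<subseteq> sets borel" using B by (auto simp: S_def)
    moreover have "disjoint_family S" by (auto simp: S_def disjoint_family_on_def)
    ultimately show ?thesis
      unfolding total_variation_def using U by (intro SUP_upper[of S]) simp
  qed
  finally show ?thesis .
qed

text \<open>The measure with density \<open>G\<close> is a gradient. The one chosen in the
  definition of \<open>grad_M_norm\<close> has the same integrals of test functions, hence agrees
  with it on Borel sets, so its total variation is at most the \<open>L1\<close> norm of
  \<open>G\<close>.\<close>

lemma measure_gradient_density:
  fixes u \<phi> :: "real^'n::finite \<Rightarrow> real" and G :: "real^'n \<Rightarrow> real^'n"
  assumes \<phi>: "\<phi> \<in> test_functions" "(\<integral>x. \<phi> x \<partial>lborel) = 1"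
    and G: "integrable lborel G"
    and grad: "\<And>\<psi> j. \<psi> \<in> test_functions \<Longrightarrow> (\<integral>x. u x * pdiff j \<psi> x \<partial>lebesgue) = - (\<integral>x. G x $ j * \<psi> x \<partial>lborel)"
  shows "\<exists>\<mu>. has_measure_gradient u \<mu>" "grad_M_norm u \<le> (\<integral>\<^sup>+x. ennreal (norm (G x)) \<partial>lborel)"
proof -
  define \<mu> where "\<mu> S = (\<integral>x. indicator S x *\<^sub>R G x \<partial>lborel)" for S
  have Gj: "integrable lborel (\<lambda>x. G x $ j)" for j
    using G by (rule integrable_bounded_linear[OF bounded_linear_vec_nth])
  have comp: "\<mu> S $ j = (\<integral>x. indicator S x * G x $ j \<partial>lborel)" if "S \<in> sets borel" for S j
    unfolding \<mu>_def by (rule integral_indicator_component[OF G that])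
  have fin: "(\<integral>\<^sup>+x. ennreal (norm (G x)) \<partial>lborel) < \<infinity>" using G unfolding integrable_iff_bounded by blast
  have vb: "vector_borel_measure \<mu>" unfolding \<mu>_def[abs_def] by (rule vector_borel_measure_density[OF G])
  have si: "signed_integral (\<lambda>S. \<mu> S $ j) \<psi> = (\<integral>x. G x $ j * \<psi> x \<partial>lborel)" if "\<psi> \<in> test_functions" for \<psi> j
    by (rule signed_integral_density[OF Gj _ that]) (rule comp)
  have "total_variation \<mu> UNIV \<le> (\<integral>\<^sup>+x. ennreal (norm (G x)) \<partial>lborel)"
    by (rule total_variation_density[OF G]) (simp add: \<mu>_def)
  then have hg: "has_measure_gradient u \<mu>"
    unfolding has_measure_gradient_def using vb fin grad si by (auto intro: le_less_trans)
  then show "\<exists>\<mu>. has_measure_gradient u \<mu>" by blast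
  define \<mu>' where "\<mu>' = (SOME \<mu>. has_measure_gradient u \<mu>)"
  have hg': "has_measure_gradient u \<mu>'"
    unfolding \<mu>'_def by (rule someI[of "has_measure_gradient u", OF hg])
  have csum: "(\<lambda>i. \<kappa> (A i) $ j) sums (\<kappa> (\<Union>i. A i) $ j)"
    if "vector_borel_measure \<kappa>" "range A \<subseteq> sets borel" "disjoint_family A" for \<kappa> :: "(real^'n) set \<Rightarrow> real^'n" and A :: "nat \<Rightarrow> (real^'n) set" and j
    using that unfolding vector_borel_measure_def by (intro bounded_linear.sums[OF bounded_linear_vec_nth]) blast
  have "\<mu>' S = \<mu> S" if S: "S \<in> sets borel" for S
  proof -
    have "\<mu>' S $ j = \<mu> S $ j" for j
      unfolding comp[OF S]
    proof (rule signed_eq_density_if_test_functions[OF \<phi>])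
      show "(\<lambda>i. \<mu>' (A i) $ j) sums (\<mu>' (\<Union>i. A i) $ j)" if "range A \<subseteq> sets borel" "disjoint_family A" for A
        using hg' that unfolding has_measure_gradient_def by (intro csum) auto
      show "\<bar>\<mu>' B $ j\<bar> \<le> enn2real (total_variation \<mu>' UNIV)" if B: "B \<in> sets borel" for B
      proof -
        have "total_variation \<mu>' UNIV < top" using hg' unfolding has_measure_gradient_def by simp
        then have "norm (\<mu>' B) \<le> enn2real (total_variation \<mu>' UNIV)"
          using norm_le_total_variation[OF B, of \<mu>'] by (metis enn2real_ennreal enn2real_mono norm_ge_zero)
        then show ?thesis using component_le_norm_cart[of "\<mu>' B" j] by linarith
      qed
      show "(\<lambda>i. \<integral>x. indicator (A i) x * G x $ j \<partial>lborel) sums (\<integral>x. indicator (\<Union>i. A i) x * G x $ j \<partial>lborel)"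
        if A: "range A \<subseteq> sets borel" "disjoint_family A" for A
      proof -
        have Ab: "A i \<in> sets borel" for i using A by auto
        then have "(\<Union>i. A i) \<in> sets borel" by auto
        with csum[OF vb A, of j] Ab show ?thesis by (simp add: comp)
      qed
      show "signed_integral (\<lambda>S. \<mu>' S $ j) \<psi> = (\<integral>x. \<psi> x * G x $ j \<partial>lborel)" if \<psi>: "\<psi> \<in> test_functions" for \<psi>
      proof -
        have "(\<integral>x. u x * pdiff j \<psi> x \<partial>lebesgue) = - signed_integral (\<lambda>S. \<mu>' S $ j) \<psi>"
          using hg' \<psi> unfolding has_measure_gradient_def by blast
        then show ?thesis using grad[OF \<psi>, of j] by (simp add: mult.commute)
      qed
    qed (use Gj S in auto)
    then show ?thesis by (simp add: vec_eq_iff)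
  qed
  then have "total_variation \<mu>' UNIV \<le> (\<integral>\<^sup>+x. ennreal (norm (G x)) \<partial>lborel)"
    by (intro total_variation_density[OF G]) (simp add: \<mu>_def)
  then show "grad_M_norm u \<le> (\<integral>\<^sup>+x. ennreal (norm (G x)) \<partial>lborel)"
    by (simp add: grad_M_norm_def \<mu>'_def)
qed

section \<open>The embeddings\<close>

lemma H1_norm_eq: "H1_norm \<phi> T = (\<integral>\<^sup>+x. radial_max \<phi> T x \<partial>lborel)"
  by (simp add: H1_norm_def radial_max_def nn_integral_completion)

text \<open>All constants are fixed before \<open>T\<close>. The function \<open>U\<close> built
  from \<open>T\<close> shows that \<open>T\<close> is represented by a function, and the estimates
  are then proved for an arbitrary representative.\<close>

lemma H11_embedding:
  fixes \<gamma> :: real and \<phi> :: "real^'n::finite \<Rightarrow> real"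
  assumes "\<gamma> < 0" and \<phi>: "\<phi> \<in> test_functions" "(\<integral>x. \<phi> x \<partial>lborel) = 1"
  shows "\<exists>C>0. \<forall>T \<in> H11 \<phi>.
           (\<exists>u. distr_is_function T u) \<and>
           (\<forall>u. distr_is_function T u \<longrightarrow>
              u \<in> W11_gamma \<gamma> \<and> u \<in> BV_gamma \<gamma> \<and>
              W11_gamma_norm \<gamma> u \<le> ennreal C * H11_norm \<phi> T \<and>
              BV_gamma_norm \<gamma> u \<le> ennreal C * H11_norm \<phi> T)"
proof -
  have bl: "(\<integral>x. f x \<partial>lebesgue) = (\<integral>x. f x \<partial>lborel)" if "f \<in> borel_measurable borel" for f :: "real^'n \<Rightarrow> real"
    using that by (intro integral_completion) simp
  obtain C where C: "C > 0" and plim: "\<forall>T. distribution T \<longrightarrow> (\<forall>j. (\<integral>\<^sup>+z. radial_max \<phi> (distr_pdiff j T) z \<partial>lborel) < \<infinity>) \<longrightarrow>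
     (\<exists>U\<in>borel_measurable borel.
       (\<forall>x k. gradient_max \<phi> T x < \<infinity> \<longrightarrow>
          \<bar>U x - distr_conv T (dilate \<phi> ((1/2) ^ k)) x\<bar> \<le> C * (1/2) ^ k * enn2real (gradient_max \<phi> T x)) \<and>
       (\<forall>x y. gradient_max \<phi> T x < \<infinity> \<longrightarrow> gradient_max \<phi> T y < \<infinity> \<longrightarrow>
          \<bar>U x - U y\<bar> \<le> C * norm (x - y) * (enn2real (gradient_max \<phi> T x) + enn2real (gradient_max \<phi> T y))))"
    using pointwise_limit[OF \<phi>] by blast
  obtain K where K: "K > 0" and weak: "\<forall>(u :: real^'n \<Rightarrow> real) g C Z. g \<in> borel_measurable borel \<longrightarrow> (\<forall>x. g x \<ge> 0) \<longrightarrow> C > 0 \<longrightarrow>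
    Z \<in> null_sets lborel \<longrightarrow>
    (\<forall>x y. x \<notin> Z \<longrightarrow> y \<notin> Z \<longrightarrow> \<bar>u x - u y\<bar> \<le> C * norm (x - y) * (g x + g y)) \<longrightarrow>
    weak_seminorm \<gamma> u \<le> ennreal (K * C) * (\<integral>\<^sup>+x. ennreal (g x) \<partial>lborel)"
    using weak_seminorm_bound[OF assms(1), where 'n = 'n] by blast
  define L where "L = 8 * (unit_ball_vol CARD('n) * 5 ^ CARD('n)) * unit_ball_vol CARD('n)"
  have L: "L \<ge> 0" by (simp add: L_def)
  \<comment> \<open>The \<open>1\<close> pays for the gradient norm, the product for the weak
    seminorm: \<open>L\<close> from the maximal inequality, \<open>C\<close> from the pointwise
    estimate, \<open>K\<close> from the singular kernel.\<close>
  define C' where "C' = 1 + K * C * L"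
  show ?thesis
  proof (intro exI[of _ C'] conjI ballI)
    show "C' > 0" using K C L by (simp add: C'_def add_pos_nonneg)
    fix T assume "T \<in> H11 \<phi>"
    then have T: "distribution T" and H: "H11_norm \<phi> T < \<infinity>"
      using tempered_imp_distribution by (auto simp: H11_def)
    have Heq: "H11_norm \<phi> T = (\<Sum>j\<in>UNIV. \<integral>\<^sup>+x. radial_max \<phi> (distr_pdiff j T) x \<partial>lborel)"
      by (simp add: H11_norm_def H1_norm_eq)
    have fin: "\<forall>j. (\<integral>\<^sup>+x. radial_max \<phi> (distr_pdiff j T) x \<partial>lborel) < \<infinity>"
    proof
      fix j
      have "(\<integral>\<^sup>+x. radial_max \<phi> (distr_pdiff j T) x \<partial>lborel) \<le> H11_norm \<phi> T"
        unfolding Heq by (intro member_le_sum) auto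
      then show "(\<integral>\<^sup>+x. radial_max \<phi> (distr_pdiff j T) x \<partial>lborel) < \<infinity>" using H by (rule le_less_trans)
    qed
    obtain U where Um: "U \<in> borel_measurable borel"
      and U1: "\<forall>x k. gradient_max \<phi> T x < \<infinity> \<longrightarrow>
          \<bar>U x - distr_conv T (dilate \<phi> ((1/2) ^ k)) x\<bar> \<le> C * (1/2) ^ k * enn2real (gradient_max \<phi> T x)"
      and U2: "\<forall>x y. gradient_max \<phi> T x < \<infinity> \<longrightarrow> gradient_max \<phi> T y < \<infinity> \<longrightarrow>
          \<bar>U x - U y\<bar> \<le> C * norm (x - y) * (enn2real (gradient_max \<phi> T x) + enn2real (gradient_max \<phi> T y))"
      using plim T fin by blast
    have Gint: "(\<integral>\<^sup>+x. gradient_max \<phi> T x \<partial>lborel) \<le> ennreal L * H11_norm \<phi> T"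
      unfolding Heq L_def by (rule gradient_max_integral[OF \<phi> T])
    then have Gfin: "(\<integral>\<^sup>+x. gradient_max \<phi> T x \<partial>lborel) < \<infinity>"
      using H by (auto intro!: le_less_trans[OF Gint] simp: ennreal_mult_less_top)
    have Gm[measurable]: "gradient_max \<phi> T \<in> borel_measurable borel"
      by (rule borel_measurable_gradient_max[OF \<phi> T])
    note lim = distribution_eq_limit[OF \<phi> T Gfin Um U1]
    have UL: "U \<in> L1_loc" by (rule borel_L1_loc[OF Um lim(1)])
    have TU: "T \<psi> = (\<integral>x. U x * \<psi> x \<partial>lebesgue)" if \<psi>: "\<psi> \<in> test_functions" for \<psi>
      using lim(2)[OF \<psi>] bl[of "\<lambda>x. U x * \<psi> x"] Um test_functions_measurable[OF \<psi>] by simp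
    have "distr_is_function T U"
      unfolding distr_is_function_def using UL TU by blast
    then show "\<exists>u. distr_is_function T u" by blast
    obtain G :: "real^'n \<Rightarrow> real^'n" where G: "G \<in> borel_measurable borel" "integrable lborel G"
      "(\<integral>\<^sup>+x. ennreal (norm (G x)) \<partial>lborel) \<le> H11_norm \<phi> T"
      "\<forall>\<psi>\<in>test_functions. \<forall>j. T (pdiff j \<psi>) = - (\<integral>x. G x $ j * \<psi> x \<partial>lborel)"
      using L1_gradient_exists[OF \<phi> T fin] unfolding Heq by blast
    show "\<forall>u. distr_is_function T u \<longrightarrow>
              u \<in> W11_gamma \<gamma> \<and> u \<in> BV_gamma \<gamma> \<and>
              W11_gamma_norm \<gamma> u \<le> ennreal C' * H11_norm \<phi> T \<and>
              BV_gamma_norm \<gamma> u \<le> ennreal C' * H11_norm \<phi> T"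
    proof (intro allI impI)
      fix u assume "distr_is_function T u"
      then have u: "u \<in> L1_loc" and Tu: "\<And>\<psi>. \<psi> \<in> test_functions \<Longrightarrow> T \<psi> = (\<integral>x. u x * \<psi> x \<partial>lebesgue)"
        by (auto simp: distr_is_function_def)
      have grad: "(\<integral>x. u x * pdiff j \<psi> x \<partial>lebesgue) = - (\<integral>x. G x $ j * \<psi> x \<partial>lborel)" if "\<psi> \<in> test_functions" for \<psi> j
        using G(4) that Tu[OF test_functions_pdiff[OF that], of j] by simp
      have "has_L1_gradient u G"
        unfolding has_L1_gradient_def
      proof (intro conjI ballI allI)
        show "integrable lebesgue G" using G(1,2) by (subst integrable_completion) auto
        fix \<psi> :: "real^'n \<Rightarrow> real" and j assume \<psi>: "\<psi> \<in> test_functions"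
        have "(\<lambda>x. G x $ j) \<in> borel_measurable borel"
          using integrable_bounded_linear[OF bounded_linear_vec_nth G(2), of j] by simp
        then have "(\<integral>x. G x $ j * \<psi> x \<partial>lebesgue) = (\<integral>x. G x $ j * \<psi> x \<partial>lborel)"
          using test_functions_measurable[OF \<psi>] by (intro bl) simp
        then show "(\<integral>x. u x * pdiff j \<psi> x \<partial>lebesgue) = - (\<integral>x. G x $ j * \<psi> x \<partial>lebesgue)"
          using grad[OF \<psi>] by simp
      qed
      then have W: "u \<in> W11" and gW: "grad_L1_norm u \<le> H11_norm \<phi> T"
        using u G(3) grad_L1_norm_eq[OF \<phi>] by (auto simp: W11_def nn_integral_completion)
      have B: "u \<in> BV" and gB: "grad_M_norm u \<le> H11_norm \<phi> T"
        using measure_gradient_density[OF \<phi> G(2) grad] u G(3) by (auto simp: BV_def)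
      \<comment> \<open>\<open>u\<close> and \<open>U\<close> have the same pairings with test
        functions. The set \<open>Z\<close> below collects the points where they differ and those
        where \<open>gradient_max\<close> is infinite; off \<open>Z\<close> the pointwise estimate
        for \<open>U\<close> is one for \<open>u\<close>.\<close>
      have "AE x in lebesgue. u x = U x"
        using Tu TU by (intro L1_loc_eq_AE[OF \<phi> u UL]) auto
      then have "AE x in lborel. u x = U x" by (simp add: AE_completion_iff)
      moreover have Gae: "AE x in lborel. gradient_max \<phi> T x < \<infinity>"
        using nn_integral_PInf_AE[of "gradient_max \<phi> T" lborel] Gfin by (auto simp: less_top[symmetric])
      ultimately have "AE x in lborel. u x = U x \<and> gradient_max \<phi> T x < \<infinity>" by eventually_elim blast
      then obtain Z where Z: "Z \<in> null_sets lborel" "\<forall>x. x \<notin> Z \<longrightarrow> u x = U x \<and> gradient_max \<phi> T x < \<infinity>"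
        unfolding eventually_ae_filter by auto
      define g where "g x = enn2real (gradient_max \<phi> T x)" for x
      have "weak_seminorm \<gamma> u \<le> ennreal (K * C) * (\<integral>\<^sup>+x. ennreal (g x) \<partial>lborel)"
      proof (rule weak[rule_format])
        show "g \<in> borel_measurable borel" unfolding g_def[abs_def] by measurable
        show "\<bar>u x - u y\<bar> \<le> C * norm (x - y) * (g x + g y)" if "x \<notin> Z" "y \<notin> Z" for x y
          using U2 Z(2) that unfolding g_def by simp
      qed (use C Z in \<open>auto simp: g_def\<close>)
      also have "(\<integral>\<^sup>+x. ennreal (g x) \<partial>lborel) = (\<integral>\<^sup>+x. gradient_max \<phi> T x \<partial>lborel)"
        using Gae by (intro nn_integral_cong_AE) (auto simp: g_def elim: eventually_mono)
      also have "ennreal (K * C) * \<dots> \<le> ennreal (K * C) * (ennreal L * H11_norm \<phi> T)"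
        by (intro mult_left_mono Gint) simp
      also have "\<dots> = ennreal (K * C * L) * H11_norm \<phi> T"
        using K C L by (simp add: ennreal_mult mult.assoc)
      finally have S: "weak_seminorm \<gamma> u \<le> ennreal (K * C * L) * H11_norm \<phi> T" .
      also have "\<dots> < \<infinity>" using H by (simp add: ennreal_mult_less_top)
      finally have Sfin: "weak_seminorm \<gamma> u < \<infinity>" .
      have add: "a + weak_seminorm \<gamma> u \<le> ennreal C' * H11_norm \<phi> T" if "a \<le> H11_norm \<phi> T" for a
      proof -
        have "a + weak_seminorm \<gamma> u \<le> 1 * H11_norm \<phi> T + ennreal (K * C * L) * H11_norm \<phi> T"
          using that S by (simp add: add_mono)
        also have "\<dots> = (ennreal 1 + ennreal (K * C * L)) * H11_norm \<phi> T" by (simp add: distrib_right)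
        also have "ennreal 1 + ennreal (K * C * L) = ennreal C'"
          unfolding C'_def using K C L by (intro ennreal_plus[symmetric]) auto
        finally show ?thesis .
      qed
      show "u \<in> W11_gamma \<gamma> \<and> u \<in> BV_gamma \<gamma> \<and>
              W11_gamma_norm \<gamma> u \<le> ennreal C' * H11_norm \<phi> T \<and>
              BV_gamma_norm \<gamma> u \<le> ennreal C' * H11_norm \<phi> T"
        using W B Sfin add[OF gW] add[OF gB]
        by (simp add: W11_gamma_def BV_gamma_def W11_gamma_norm_def BV_gamma_norm_def)
    qed
  qed
qed

theorem theorem2p4:
  fixes \<gamma> :: real and \<phi> :: "real^'n::finite \<Rightarrow> real"
  assumes "- 1 \<le> \<gamma>" and "\<gamma> < 0"
    and "\<phi> \<in> test_functions" and "integral\<^sup>L lebesgue \<phi> = 1"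
  shows "\<exists>C>0. \<forall>T \<in> H11 \<phi>.
           (\<exists>u. distr_is_function T u) \<and>
           (\<forall>u. distr_is_function T u \<longrightarrow>
              u \<in> W11_gamma \<gamma> \<and> u \<in> BV_gamma \<gamma> \<and>
              W11_gamma_norm \<gamma> u \<le> ennreal C * H11_norm \<phi> T \<and>
              BV_gamma_norm \<gamma> u \<le> ennreal C * H11_norm \<phi> T)"
proof -
  have "(\<integral>x. \<phi> x \<partial>lborel) = 1"
    using assms(4) integral_completion[of \<phi> lborel] test_functions_measurable[OF assms(3)] by simp
  then obtain C where "C > 0" "\<forall>T \<in> H11 \<phi>.
           (\<exists>u. distr_is_function T u) \<and>
           (\<forall>u. distr_is_function T u \<longrightarrow>
              u \<in> W11_gamma \<gamma> \<and> u \<in> BV_gamma \<gamma> \<and>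
              W11_gamma_norm \<gamma> u \<le> ennreal C * H11_norm \<phi> T \<and>
              BV_gamma_norm \<gamma> u \<le> ennreal C * H11_norm \<phi> T)"
    using H11_embedding[OF assms(2,3)] by blast
  then show ?thesis by blast
qed

end
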